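(* Let $X_1,\dots,X_n,Y$ be Banach spaces (over the same field $\mathbb R$ or $\mathbb C$), each of $X_1,\dots,X_n$ with an unconditional basis. Then each $X_i$ is isomorphic to $\ell_1^{\Gamma_i}$ for some $\Gamma_i$ and $Y$ is isomorphic to a Hilbert space if and only if $$\Pi_1^{Lip}(X_1,\dots,X_n;Y)=\mathcal L(X_1,\dots,X_n;Y).$$
   Context: $\ell_1^{\Gamma}=\ell_1(\Gamma)$ is the space of absolutely summable scalar families indexed by the set $\Gamma$. $\mathcal L(X_1,\dots,X_n;Y)$ is the space of bounded $n$-linear operators from $X_1\times\cdots\times X_n$ to $Y$, $\mathcal L(X_1,\dots,X_n)$ is the space of bounded scalar $n$-linear forms with the supremum norm over the product of unit balls, and $B_E$ is the closed unit ball of $E$. For $1\le p<\infty$, $T\in\mathcal L(X_1,\dots,X_n;Y)$ is Lipschitz $p$-summing, written $T\in\Pi_p^{Lip}(X_1,\dots,X_n;Y)$, if there is $c>0$ such that for all $k\in\mathbb N$ and all $u_1,\dots,u_k,v_1,\dots,v_k\in X_1\times\cdots\times X_n$, $$\Big(\sum_{i=1}^k\|T(u_i)-T(v_i)\|^p\Big)^{1/p}\le c\cdot\sup_{\varphi\in B_{\mathcal L(X_1,\dots,X_n)}}\Big(\sum_{i=1}^k|\varphi(u_i)-\varphi(v_i)|^p\Big)^{1/p}.$$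
   Formalization: Added: every X_i is nonzero, at least one X_i is infinite-dimensional, and Y is infinite-dimensional; otherwise the two sets of operators always coincide and the "if" part fails, e.g. for X_1 = l_2 and Y the scalar field. *)

theory Defs
  imports "HOL-Analysis.Analysis" "HOL-Library.Function_Algebras"
begin

text \<open>
  The scalar field. The class has exactly the models \<open>\<real>\<close> and \<open>\<complex>\<close> up to isometric isomorphism:
  \<open>to_complex\<close> identifies the type with the subfield \<open>\<real>\<close> of \<open>\<complex>\<close> or with the whole of \<open>\<complex>\<close>,
  and \<open>conjugate\<close> is complex conjugation under this identification.
\<close>

class real_or_complex = real_normed_field +
  fixes to_complex :: "'a \<Rightarrow> complex"
    and conjugate :: "'a \<Rightarrow> 'a"
  assumes to_complex_add: "to_complex (x + y) = to_complex x + to_complex y"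
    and to_complex_mult: "to_complex (x * y) = to_complex x * to_complex y"
    and norm_to_complex: "cmod (to_complex x) = norm x"
    and range_to_complex: "range to_complex = \<real> \<or> range to_complex = UNIV"
    and to_complex_conjugate: "to_complex (conjugate x) = cnj (to_complex x)"

instantiation real :: real_or_complex
begin

definition to_complex_real :: "real \<Rightarrow> complex" where "to_complex_real = complex_of_real"
definition conjugate_real :: "real \<Rightarrow> real" where "conjugate_real x = x"

instance
  by standard (auto simp: to_complex_real_def conjugate_real_def Reals_def)

end

instantiation complex :: real_or_complex
begin

definition to_complex_complex :: "complex \<Rightarrow> complex" where "to_complex_complex z = z"
definition conjugate_complex :: "complex \<Rightarrow> complex" where "conjugate_complex = cnj"

instance
  by standard (auto simp: to_complex_complex_def conjugate_complex_def)

end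

text \<open>
  A normed space is a linear subspace \<open>points E\<close> of an ambient vector space, with a norm that
  matters on \<open>points E\<close> only. Since spaces are values, one can speak of a family
  \<open>X\<^sub>1, \<dots>, X\<^sub>n\<close> of different spaces with variable \<open>n\<close>. A common ambient type is no restriction:
  any finitely many spaces embed into their direct sum.
\<close>

record ('k, 'a) normed_structure =
  points :: "'a set"
  scale :: "'k \<Rightarrow> 'a \<Rightarrow> 'a"
  nrm :: "'a \<Rightarrow> real"

definition normed_space :: "('k::real_or_complex, 'a::ab_group_add) normed_structure \<Rightarrow> bool" where
  "normed_space E \<longleftrightarrow>
     vector_space (scale E) \<and> module.subspace (scale E) (points E) \<and>
     (\<forall>x\<in>points E. 0 \<le> nrm E x) \<and>
     (\<forall>x\<in>points E. nrm E x = 0 \<longleftrightarrow> x = 0) \<and>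
     (\<forall>x\<in>points E. \<forall>y\<in>points E. nrm E (x + y) \<le> nrm E x + nrm E y) \<and>
     (\<forall>c. \<forall>x\<in>points E. nrm E (scale E c x) = norm c * nrm E x)"

text \<open>
  \<open>Metric_space\<close> asks for a distance that is nonnegative and symmetric on the whole type; hence the
  value 0 outside of \<open>points E\<close>.
\<close>

definition norm_dist :: "('k, 'a::ab_group_add) normed_structure \<Rightarrow> 'a \<Rightarrow> 'a \<Rightarrow> real" where
  "norm_dist E x y = (if x \<in> points E \<and> y \<in> points E then nrm E (x - y) else 0)"

lemma Metric_space_norm_dist:
  assumes "normed_space E"
  shows "Metric_space (points E) (norm_dist E)"
proof -
  interpret vector_space "scale E"
    using assms by (simp add: normed_space_def)
  have sub: "subspace (points E)"
    using assms by (simp add: normed_space_def)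
  show ?thesis
  proof
    fix x y
    show "0 \<le> norm_dist E x y"
      using assms sub by (auto simp: norm_dist_def normed_space_def subspace_diff)
    have "nrm E (y - x) = nrm E (x - y)" if "x \<in> points E" "y \<in> points E"
    proof -
      have "nrm E (scale E (- 1) (x - y)) = norm (- 1 :: 'a) * nrm E (x - y)"
        using assms sub that by (simp only: normed_space_def subspace_diff)
      then show ?thesis by simp
    qed
    then show "norm_dist E x y = norm_dist E y x"
      by (simp add: norm_dist_def)
  next
    fix x y
    assume "x \<in> points E" "y \<in> points E"
    then show "norm_dist E x y = 0 \<longleftrightarrow> x = y"
      using assms sub by (auto simp: norm_dist_def normed_space_def subspace_diff)
  next
    fix x y z
    assume *: "x \<in> points E" "y \<in> points E" "z \<in> points E"
    then have "nrm E ((x - y) + (y - z)) \<le> nrm E (x - y) + nrm E (y - z)"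
      using assms sub unfolding normed_space_def by (blast intro: subspace_diff)
    then show "norm_dist E x z \<le> norm_dist E x y + norm_dist E y z"
      using * by (simp add: norm_dist_def)
  qed
qed

definition norm_topology :: "('k, 'a::ab_group_add) normed_structure \<Rightarrow> 'a topology" where
  "norm_topology E = Metric_space.mtopology (points E) (norm_dist E)"

definition banach_space :: "('k::real_or_complex, 'a::ab_group_add) normed_structure \<Rightarrow> bool" where
  "banach_space E \<longleftrightarrow> normed_space E \<and> Metric_space.mcomplete (points E) (norm_dist E)"

definition infinite_dimensional ::
    "('k::real_or_complex, 'a::ab_group_add) normed_structure \<Rightarrow> bool" where
  "infinite_dimensional E \<longleftrightarrow> \<not> (\<exists>S. finite S \<and> points E = module.span (scale E) S)"

definition hilbert_space :: "('k::real_or_complex, 'a::ab_group_add) normed_structure \<Rightarrow> bool" where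
  "hilbert_space H \<longleftrightarrow> banach_space H \<and>
     (\<exists>ip :: 'a \<Rightarrow> 'a \<Rightarrow> 'k.
        (\<forall>x\<in>points H. \<forall>y\<in>points H. \<forall>z\<in>points H. ip (x + y) z = ip x z + ip y z) \<and>
        (\<forall>c. \<forall>x\<in>points H. \<forall>y\<in>points H. ip (scale H c x) y = c * ip x y) \<and>
        (\<forall>x\<in>points H. \<forall>y\<in>points H. ip y x = conjugate (ip x y)) \<and>
        (\<forall>x\<in>points H. ip x x = of_real ((nrm H x)\<^sup>2)))"

definition bounded_operator ::
    "('k::real_or_complex, 'a::ab_group_add) normed_structure \<Rightarrow>
     ('k, 'b::ab_group_add) normed_structure \<Rightarrow> ('a \<Rightarrow> 'b) \<Rightarrow> bool" where
  "bounded_operator E F f \<longleftrightarrow>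
     (\<forall>x\<in>points E. f x \<in> points F) \<and>
     (\<forall>x\<in>points E. \<forall>y\<in>points E. f (x + y) = f x + f y) \<and>
     (\<forall>c. \<forall>x\<in>points E. f (scale E c x) = scale F c (f x)) \<and>
     (\<exists>C. \<forall>x\<in>points E. nrm F (f x) \<le> C * nrm E x)"

definition isomorphic ::
    "('k::real_or_complex, 'a::ab_group_add) normed_structure \<Rightarrow>
     ('k, 'b::ab_group_add) normed_structure \<Rightarrow> bool" where
  "isomorphic E F \<longleftrightarrow>
     (\<exists>f g. bounded_operator E F f \<and> bounded_operator F E g \<and>
        (\<forall>x\<in>points E. g (f x) = x) \<and> (\<forall>y\<in>points F. f (g y) = y))"

text \<open>Families indexed by \<open>\<Gamma>\<close> are functions that vanish outside \<open>\<Gamma>\<close>.\<close>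

definition ell1 :: "'g set \<Rightarrow> ('k::real_or_complex, 'g \<Rightarrow> 'k) normed_structure" where
  "ell1 \<Gamma> = \<lparr>points = {a. (\<lambda>\<gamma>. norm (a \<gamma>)) summable_on \<Gamma> \<and> (\<forall>\<gamma>. \<gamma> \<notin> \<Gamma> \<longrightarrow> a \<gamma> = 0)},
     scale = (\<lambda>c a \<gamma>. c * a \<gamma>),
     nrm = (\<lambda>a. \<Sum>\<^sub>\<infinity>\<gamma>\<in>\<Gamma>. norm (a \<gamma>))\<rparr>"

text \<open>
  The basis is given as the set of its (automatically distinct and nonzero) members. It may be
  finite, countable or uncountable; unconditional convergence is convergence of the net of finite
  partial sums.
\<close>

definition unconditional_basis ::
    "('k::real_or_complex, 'a::ab_group_add) normed_structure \<Rightarrow> 'a set \<Rightarrow> bool" where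
  "unconditional_basis E B \<longleftrightarrow> B \<subseteq> points E \<and>
     (\<forall>x\<in>points E. \<exists>!a :: 'a \<Rightarrow> 'k. (\<forall>b. b \<notin> B \<longrightarrow> a b = 0) \<and>
        limitin (norm_topology E) (\<lambda>S. \<Sum>b\<in>S. scale E (a b) b) x (finite_subsets_at_top B))"

definition has_unconditional_basis ::
    "('k::real_or_complex, 'a::ab_group_add) normed_structure \<Rightarrow> bool" where
  "has_unconditional_basis E \<longleftrightarrow> (\<exists>B. unconditional_basis E B)"

text \<open>
  Elements of \<open>X\<^sub>1 \<times> \<dots> \<times> X\<^sub>n\<close> and operators on it are extensional functions (\<open>undefined\<close> off their
  domain), so that equality of sets of operators has its usual meaning.
\<close>

definition product_points ::
    "nat \<Rightarrow> (nat \<Rightarrow> ('k, 'a) normed_structure) \<Rightarrow> (nat \<Rightarrow> 'a) set" where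
  "product_points n X = (\<Pi>\<^sub>E i\<in>{1..n}. points (X i))"

definition multilinear_ops ::
    "nat \<Rightarrow> (nat \<Rightarrow> ('k::real_or_complex, 'a::ab_group_add) normed_structure) \<Rightarrow>
     ('k, 'b::ab_group_add) normed_structure \<Rightarrow> ((nat \<Rightarrow> 'a) \<Rightarrow> 'b) set" where
  "multilinear_ops n X Y = {T \<in> product_points n X \<rightarrow>\<^sub>E points Y.
     (\<forall>u\<in>product_points n X. \<forall>i\<in>{1..n}. \<forall>x\<in>points (X i). \<forall>y\<in>points (X i).
        T (u(i := x + y)) = T (u(i := x)) + T (u(i := y))) \<and>
     (\<forall>u\<in>product_points n X. \<forall>i\<in>{1..n}. \<forall>c. \<forall>x\<in>points (X i).
        T (u(i := scale (X i) c x)) = scale Y c (T (u(i := x)))) \<and>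
     (\<exists>C. \<forall>u\<in>product_points n X. nrm Y (T u) \<le> C * (\<Prod>i\<in>{1..n}. nrm (X i) (u i)))}"

definition multilinear_norm ::
    "nat \<Rightarrow> (nat \<Rightarrow> ('k, 'a) normed_structure) \<Rightarrow> ('k, 'b) normed_structure \<Rightarrow>
     ((nat \<Rightarrow> 'a) \<Rightarrow> 'b) \<Rightarrow> real" where
  "multilinear_norm n X Y T =
     (SUP u\<in>{u \<in> product_points n X. \<forall>i\<in>{1..n}. nrm (X i) (u i) \<le> 1}. nrm Y (T u))"

definition scalars :: "('k::real_or_complex, 'k) normed_structure" where
  "scalars = \<lparr>points = UNIV, scale = (*), nrm = norm\<rparr>"

definition form_ball ::
    "nat \<Rightarrow> (nat \<Rightarrow> ('k::real_or_complex, 'a::ab_group_add) normed_structure) \<Rightarrow>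
     ((nat \<Rightarrow> 'a) \<Rightarrow> 'k) set" where
  "form_ball n X = {\<phi> \<in> multilinear_ops n X scalars. multilinear_norm n X scalars \<phi> \<le> 1}"

text \<open>
  The supremum below is over a nonempty set that is bounded above: for \<open>\<phi>\<close> in the unit ball,
  \<open>norm (\<phi> w)\<close> is at most the product of the norms of the components of \<open>w\<close>.
\<close>

definition lipschitz_summing ::
    "real \<Rightarrow> nat \<Rightarrow> (nat \<Rightarrow> ('k::real_or_complex, 'a::ab_group_add) normed_structure) \<Rightarrow>
     ('k, 'b::ab_group_add) normed_structure \<Rightarrow> ((nat \<Rightarrow> 'a) \<Rightarrow> 'b) set" where
  "lipschitz_summing p n X Y = {T \<in> multilinear_ops n X Y.
     \<exists>c>0. \<forall>k. \<forall>u v :: nat \<Rightarrow> nat \<Rightarrow> 'a.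
       (\<forall>i\<in>{1..k}. u i \<in> product_points n X \<and> v i \<in> product_points n X) \<longrightarrow>
       (\<Sum>i=1..k. nrm Y (T (u i) - T (v i)) powr p) powr (1 / p)
         \<le> c * (SUP \<phi>\<in>form_ball n X. (\<Sum>i=1..k. norm (\<phi> (u i) - \<phi> (v i)) powr p) powr (1 / p))}"

end

theory Submission
  imports Defs
begin

text \<open>
For linear operators \<open>X \<rightarrow> Y\<close> the result is a theorem of Lindenstrauss and Pelczynski, and both
directions reduce to the linear situation.

Suppose that \<open>X\<^sub>i = \<ell>\<^sub>1(\<Gamma>\<^sub>i)\<close> and that \<open>Y\<close> is a Hilbert space. A multilinear \<open>T\<close> is the linear map on
\<open>\<ell>\<^sub>1(\<Gamma>\<^sub>1 \<times> \<dots> \<times> \<Gamma>\<^sub>n)\<close> that sends the unit vector at \<open>\<gamma>\<close> to \<open>T (e\<^sub>\<gamma>)\<close>, and \<open>T u - T v\<close> is its value at the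
difference of two elementary tensors. By Grothendieck's theorem a bounded operator from \<open>\<ell>\<^sub>1\<close> to a
Hilbert space is absolutely summing (\<open>grothendieck_coordinates\<close>, \<open>grothendieck_operator\<close>). The
functionals on \<open>\<ell>\<^sub>1(\<Gamma>\<^sub>1 \<times> \<dots> \<times> \<Gamma>\<^sub>n)\<close> are bounded weights, and every weight is a bounded multilinear form
(\<open>weighted_form\<close>). All sums become finite after truncating the coordinates, and the continuity of
\<open>T\<close> restores the general case (\<open>multilinear_lipschitz_summing\<close>).

Conversely, let all multilinear operators be Lipschitz 1-summing. Multiplying an operator
\<open>S : X\<^sub>i \<rightarrow> Y\<close> by functionals of the other variables gives a multilinear operator, so that \<open>S\<close> is
absolutely summing (\<open>operators_absolutely_summing\<close>). A gliding hump argument makes the constant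
uniform for operators that live on finite blocks of the basis (\<open>gliding_hump\<close>). Two choices of such
operators finish the proof.

\<^item> By Dvoretzky and Rogers, \<open>Y\<close> contains for every finite index set vectors \<open>y\<^sub>b\<close> of norm at least 1
  with \<open>\<parallel>\<Sum> t\<^sub>b y\<^sub>b\<parallel> \<le> D (\<Sum> |t\<^sub>b|\<^sup>2)\<^sup>1\<^sup>/\<^sup>2\<close>. Let \<open>s\<close> be the supremum of \<open>\<Sum> |a\<^sub>b|\<close> over the vectors \<open>\<Sum> a\<^sub>b b\<close> in
  the unit ball of a block of the normalised basis. Since the \<open>a\<^sub>b\<close> are bounded, \<open>\<Sum> |a\<^sub>b|\<^sup>2\<close> is at most a multiple of
  \<open>s\<close>, so the operator \<open>b \<mapsto> y\<^sub>b\<close> has norm \<open>O(\<surd>s)\<close>. Applied to the vectors \<open>a\<^sub>b b\<close>, the summing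
  inequality gives \<open>s = O(\<surd>s)\<close>. Hence \<open>s\<close> is bounded, and \<open>X\<^sub>i\<close> is an \<open>\<ell>\<^sub>1\<close> space (\<open>ell1_estimate\<close>,
  \<open>isomorphic_ell1\<close>).

\<^item> One of the \<open>X\<^sub>i\<close> is now an infinite-dimensional \<open>\<ell>\<^sub>1\<close> space, so the basis vectors of its
  blocks can be mapped onto arbitrary finite subsets of \<open>Y\<close>. Pietsch's domination argument, with a mean on bounded functions in place of a
  measure, dominates the norm of \<open>Y\<close> by the quotient of a Hilbertian seminorm. The quotient satisfies
  the parallelogram law and is equivalent to the norm of \<open>Y\<close>, so \<open>Y\<close> is a Hilbert space by Jordan
  and von Neumann (\<open>hilbertian_if_universal_map_summing\<close>, \<open>hilbert_space_hilbert\<close>).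
\<close>

section \<open>Linear functionals dominated by sublinear ones\<close>

definition sublinear_on :: "('w \<Rightarrow> real) set \<Rightarrow> (('w \<Rightarrow> real) \<Rightarrow> real) \<Rightarrow> bool" where
  "sublinear_on V q \<longleftrightarrow>
     (\<forall>f\<in>V. \<forall>g\<in>V. q (\<lambda>w. f w + g w) \<le> q f + q g) \<and>
     (\<forall>c>0. \<forall>f\<in>V. q (\<lambda>w. c * f w) \<le> c * q f)"

lemma sublinear_onD:
  assumes "sublinear_on V q"
  shows "f \<in> V \<Longrightarrow> g \<in> V \<Longrightarrow> q (\<lambda>w. f w + g w) \<le> q f + q g"
    and "c > 0 \<Longrightarrow> f \<in> V \<Longrightarrow> q (\<lambda>w. c * f w) \<le> c * q f"
  using assms unfolding sublinear_on_def by blast+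

definition function_space :: "('w \<Rightarrow> real) set \<Rightarrow> bool" where
  "function_space V \<longleftrightarrow>
     (\<lambda>w. 0) \<in> V \<and> (\<forall>f\<in>V. \<forall>g\<in>V. (\<lambda>w. f w + g w) \<in> V) \<and> (\<forall>c. \<forall>f\<in>V. (\<lambda>w. c * f w) \<in> V)"

lemma sublinear_lower_bound:
  assumes V: "function_space V" and q: "sublinear_on V q" and "f \<in> V"
  shows "q (\<lambda>w. 0) = 0" "- q (\<lambda>w. - f w) \<le> q f"
proof -
  have 0: "(\<lambda>w. 0) \<in> V" using V by (simp add: function_space_def)
  have "q (\<lambda>w. 0) \<le> c * q (\<lambda>w. 0)" if "c > 0" for c
  proof -
    have "q (\<lambda>w. c * 0) \<le> c * q (\<lambda>w. 0)" by (rule sublinear_onD(2)[OF q that 0])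
    then show ?thesis by simp
  qed
  from this[of 2] this[of "1 / 2"] show *: "q (\<lambda>w. 0) = 0" by simp
  have "(\<lambda>w. (-1) * f w) \<in> V" using V \<open>f \<in> V\<close> unfolding function_space_def by blast
  then have "(\<lambda>w. - f w) \<in> V" by simp
  then have "q (\<lambda>w. f w + - f w) \<le> q f + q (\<lambda>w. - f w)"
    by (rule sublinear_onD(1)[OF q \<open>f \<in> V\<close>])
  then show "- q (\<lambda>w. - f w) \<le> q f" using * by simp
qed

text \<open>For fixed \<open>g\<close> the functional \<open>a \<mapsto> inf\<^bsub>t \<ge> 0\<^esub> (q (a + t g) - t q g)\<close> is again sublinear and lies below
\<open>q\<close>. Minimality makes it equal to \<open>q\<close>, and then \<open>t = 1\<close> gives superadditivity.\<close>

lemma minimal_sublinear_additive: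
  assumes V: "function_space V" and q: "sublinear_on V q"
    and min: "\<And>q'. sublinear_on V q' \<Longrightarrow> (\<forall>f\<in>V. q' f \<le> q f) \<Longrightarrow> (\<forall>f\<in>V. q' f = q f)"
    and f: "f \<in> V" and g: "g \<in> V"
  shows "q (\<lambda>w. f w + g w) = q f + q g"
proof -
  have add: "(\<lambda>w. a w + b w) \<in> V" if "a \<in> V" "b \<in> V" for a b
    using V that by (simp add: function_space_def)
  have mul: "(\<lambda>w. c * a w) \<in> V" if "a \<in> V" for a c
    using V that by (simp add: function_space_def)
  have sub: "q (\<lambda>w. a w + b w) \<le> q a + q b" if "a \<in> V" "b \<in> V" for a b
    using q that by (simp add: sublinear_on_def)
  have hom: "q (\<lambda>w. c * a w) \<le> c * q a" if "a \<in> V" "c > 0" for a c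
    using q that by (simp add: sublinear_on_def)
  let ?F = "\<lambda>a t. q (\<lambda>w. a w + t * g w) - t * q g"
  define q' where "q' a = (INF t\<in>{0..}. ?F a t)" for a
  have lower: "- q (\<lambda>w. - a w) \<le> ?F a t" if "a \<in> V" "t \<ge> 0" for a t
  proof (cases "t = 0")
    case True
    then show ?thesis using sublinear_lower_bound(2)[OF V q that(1)] by simp
  next
    case False
    then have t: "t > 0" using that by simp
    have m: "(\<lambda>w. - a w) \<in> V" using mul[OF that(1), of "-1"] by simp
    have "t * q g \<le> q (\<lambda>w. t * g w)"
      using hom[OF mul[OF g, of t], of "1 / t"] t by (simp add: field_simps)
    also have "q (\<lambda>w. t * g w) \<le> q (\<lambda>w. a w + t * g w) + q (\<lambda>w. - a w)"
      using sub[OF add[OF that(1) mul[OF g, of t]] m] by simp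
    finally show ?thesis by simp
  qed
  have bdd: "bdd_below (?F a ` {0..})" if "a \<in> V" for a
    using lower[OF that] by (intro bdd_belowI[of _ "- q (\<lambda>w. - a w)"]) auto
  have q'_le: "q' a \<le> ?F a t" if "a \<in> V" "t \<ge> 0" for a t
    unfolding q'_def using that by (intro cINF_lower bdd) auto
  have q'_ge: "m \<le> q' a" if "\<And>t. t \<ge> 0 \<Longrightarrow> m \<le> ?F a t" for m a
    unfolding q'_def using that by (intro cINF_greatest) auto
  have "sublinear_on V q'"
    unfolding sublinear_on_def
  proof (intro conjI ballI allI impI)
    fix a b assume a: "a \<in> V" and b: "b \<in> V"
    have "q' (\<lambda>w. a w + b w) - ?F b t \<le> q' a" if t: "t \<ge> 0" for t
    proof (rule q'_ge)
      fix s :: real assume s: "s \<ge> 0"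
      have "q' (\<lambda>w. a w + b w) \<le> ?F (\<lambda>w. a w + b w) (s + t)" using q'_le[OF add[OF a b]] s t by simp
      also have "q (\<lambda>w. a w + b w + (s + t) * g w) \<le> q (\<lambda>w. a w + s * g w) + q (\<lambda>w. b w + t * g w)"
        using sub[OF add[OF a mul[OF g, of s]] add[OF b mul[OF g, of t]]] by (simp add: algebra_simps)
      finally show "q' (\<lambda>w. a w + b w) - ?F b t \<le> ?F a s" by (simp add: algebra_simps)
    qed
    then have "q' (\<lambda>w. a w + b w) - q' a \<le> q' b" by (intro q'_ge) (simp add: algebra_simps)
    then show "q' (\<lambda>w. a w + b w) \<le> q' a + q' b" by simp
  next
    fix c :: real and a assume c: "0 < c" and a: "a \<in> V"
    have "q' (\<lambda>w. c * a w) / c \<le> q' a"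
    proof (rule q'_ge)
      fix t :: real assume t: "t \<ge> 0"
      have "q' (\<lambda>w. c * a w) \<le> ?F (\<lambda>w. c * a w) (c * t)" using q'_le[OF mul[OF a]] c t by simp
      also have "q (\<lambda>w. c * a w + c * t * g w) \<le> c * q (\<lambda>w. a w + t * g w)"
        using hom[OF add[OF a mul[OF g, of t]] c] by (simp add: algebra_simps)
      finally show "q' (\<lambda>w. c * a w) / c \<le> ?F a t" using c by (simp add: field_simps)
    qed
    then show "q' (\<lambda>w. c * a w) \<le> c * q' a" using c by (simp add: field_simps)
  qed
  moreover have "\<forall>a\<in>V. q' a \<le> q a" using q'_le[of _ 0] by simp
  ultimately have "\<forall>a\<in>V. q' a = q a" by (rule min)
  then have "q f \<le> ?F f 1" using q'_le[OF f, of 1] f by simp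
  then show ?thesis using sub[OF f g] by simp
qed

text \<open>Zorn's lemma gives a minimal sublinear functional below \<open>p\<close>; such a functional is linear. Functionals
are set to 0 outside of \<open>V\<close> so that the pointwise order on \<open>V\<close> is antisymmetric.\<close>

lemma hahn_banach_sublinear:
  fixes V :: "('w \<Rightarrow> real) set"
  assumes V: "function_space V" and p: "sublinear_on V p"
  shows "\<exists>l. (\<forall>f\<in>V. l f \<le> p f) \<and> (\<forall>f\<in>V. \<forall>g\<in>V. l (\<lambda>w. f w + g w) = l f + l g) \<and>
    (\<forall>c. \<forall>f\<in>V. l (\<lambda>w. c * f w) = c * l f)"
proof -
  have add: "(\<lambda>w. a w + b w) \<in> V" if "a \<in> V" "b \<in> V" for a b
    using V that by (simp add: function_space_def)
  have mul: "(\<lambda>w. c * a w) \<in> V" if "a \<in> V" for a c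
    using V that by (simp add: function_space_def)
  define S where "S = {q. sublinear_on V q \<and> (\<forall>f\<in>V. q f \<le> p f) \<and> (\<forall>f. f \<notin> V \<longrightarrow> q f = 0)}"
  define P where "P a b \<longleftrightarrow> (\<forall>f\<in>V. b f \<le> (a f :: real))" for a b :: "('w \<Rightarrow> real) \<Rightarrow> real"
  have "\<exists>m\<in>S. \<forall>a\<in>S. P m a \<longrightarrow> a = m"
  proof (rule predicate_Zorn)
    show "partial_order_on S (relation_of P S)"
    proof (rule partial_order_on_relation_ofI)
      show "P a a" if "a \<in> S" for a by (simp add: P_def)
      show "P a c" if "P a b" "P b c" for a b c using that unfolding P_def by (meson order.trans)
      show "a = b" if "a \<in> S" "b \<in> S" "P a b" "P b a" for a b
      proof
        fix f show "a f = b f" using that by (cases "f \<in> V") (auto simp: P_def S_def intro: antisym)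
      qed
    qed
    fix C assume C: "C \<in> Chains (relation_of P S)"
    then have CS: "C \<subseteq> S" and chain: "\<And>a b. a \<in> C \<Longrightarrow> b \<in> C \<Longrightarrow> P a b \<or> P b a"
      by (auto simp: Chains_def relation_of_def)
    show "\<exists>u\<in>S. \<forall>a\<in>C. P a u"
    proof (cases "C = {}")
      case True
      have "(\<lambda>f. if f \<in> V then p f else 0) \<in> S"
        using p add mul by (auto simp: S_def sublinear_on_def)
      then show ?thesis using True by blast
    next
      case False
      define u where "u f = (if f \<in> V then INF q\<in>C. q f else 0)" for f
      have bdd: "bdd_below ((\<lambda>q. q f) ` C)" if f: "f \<in> V" for f
      proof (rule bdd_belowI2)
        fix q assume "q \<in> C"
        then have q: "q \<in> S" using CS by blast
        have m: "(\<lambda>w. - f w) \<in> V" using mul[OF f, of "-1"] by simp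
        have "- p (\<lambda>w. - f w) \<le> - q (\<lambda>w. - f w)" using q m by (simp add: S_def)
        also have "\<dots> \<le> q f" using sublinear_lower_bound(2)[OF V _ f] q by (simp add: S_def)
        finally show "- p (\<lambda>w. - f w) \<le> q f" .
      qed
      have u_le: "u f \<le> q f" if "f \<in> V" "q \<in> C" for f q
        unfolding u_def using that by (auto intro: cINF_lower bdd)
      have u_ge: "m \<le> u f" if "f \<in> V" "\<And>q. q \<in> C \<Longrightarrow> m \<le> q f" for m f
        unfolding u_def using that False by (auto intro: cINF_greatest)
      have sl: "sublinear_on V q" if "q \<in> C" for q using that CS by (auto simp: S_def)
      have "sublinear_on V u"
        unfolding sublinear_on_def
      proof (intro conjI ballI allI impI)
        fix a b assume a: "a \<in> V" and b: "b \<in> V"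
        have "u (\<lambda>w. a w + b w) \<le> q a + r b" if q: "q \<in> C" and r: "r \<in> C" for q r
        proof -
          obtain s where s: "s \<in> C" "s a \<le> q a" "s b \<le> r b"
            using chain[OF q r] q r a b by (auto simp: P_def)
          have "u (\<lambda>w. a w + b w) \<le> s (\<lambda>w. a w + b w)" using u_le[OF add[OF a b] s(1)] .
          also have "\<dots> \<le> s a + s b" using sl[OF s(1)] a b by (simp add: sublinear_on_def)
          finally show ?thesis using s by simp
        qed
        then have "u (\<lambda>w. a w + b w) - r b \<le> u a" if "r \<in> C" for r
          using that by (intro u_ge a) (simp add: algebra_simps)
        then have "u (\<lambda>w. a w + b w) - u a \<le> u b" by (intro u_ge b) (simp add: algebra_simps)
        then show "u (\<lambda>w. a w + b w) \<le> u a + u b" by simp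
      next
        fix c :: real and a assume c: "0 < c" and a: "a \<in> V"
        have "u (\<lambda>w. c * a w) / c \<le> u a"
        proof (rule u_ge[OF a])
          fix q assume q: "q \<in> C"
          have "u (\<lambda>w. c * a w) \<le> q (\<lambda>w. c * a w)" using u_le[OF mul[OF a] q] .
          also have "\<dots> \<le> c * q a" using sl[OF q] a c by (simp add: sublinear_on_def)
          finally show "u (\<lambda>w. c * a w) / c \<le> q a" using c by (simp add: field_simps)
        qed
        then show "u (\<lambda>w. c * a w) \<le> c * u a" using c by (simp add: field_simps)
      qed
      moreover have "\<forall>f\<in>V. u f \<le> p f"
      proof
        fix f assume f: "f \<in> V"
        obtain q where q: "q \<in> C" using False by blast
        then have "q f \<le> p f" using CS f by (auto simp: S_def)
        then show "u f \<le> p f" using u_le[OF f q] by simp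
      qed
      ultimately have "u \<in> S" by (simp add: S_def u_def)
      then show ?thesis using u_le by (auto simp: P_def)
    qed
  qed
  then obtain l where l: "l \<in> S" "\<And>a. a \<in> S \<Longrightarrow> P l a \<Longrightarrow> a = l" by blast
  have sl: "sublinear_on V l" and lp: "\<forall>f\<in>V. l f \<le> p f" using l(1) by (auto simp: S_def)
  have ladd: "l (\<lambda>w. f w + g w) = l f + l g" if "f \<in> V" "g \<in> V" for f g
  proof (rule minimal_sublinear_additive[OF V sl _ that])
    fix q' assume q': "sublinear_on V q'" "\<forall>f\<in>V. q' f \<le> l f"
    let ?a = "\<lambda>f. if f \<in> V then q' f else 0"
    have "?a \<in> S" using q' lp add mul by (auto simp: S_def sublinear_on_def intro: order.trans)
    moreover have "P l ?a" using q'(2) by (simp add: P_def)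
    ultimately have "?a = l" by (rule l(2))
    then show "\<forall>f\<in>V. q' f = l f" by (metis (mono_tags, lifting))
  qed
  have l0: "l (\<lambda>w. 0) = 0" using V by (intro sublinear_lower_bound(1)[OF V sl, of "\<lambda>w. 0"]) (simp add: function_space_def)
  have lpos: "l (\<lambda>w. c * f w) = c * l f" if "f \<in> V" "c > 0" for f c
  proof (rule antisym)
    show "l (\<lambda>w. c * f w) \<le> c * l f" using sl that by (simp add: sublinear_on_def)
    have "l (\<lambda>w. (1 / c) * (c * f w)) \<le> (1 / c) * l (\<lambda>w. c * f w)"
      using that(2) by (intro sublinear_onD(2)[OF sl _ mul[OF that(1)]]) simp
    then show "c * l f \<le> l (\<lambda>w. c * f w)" using that(2) by (simp add: field_simps)
  qed
  have "l (\<lambda>w. c * f w) = c * l f" if f: "f \<in> V" for f c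
  proof (cases c "0 :: real" rule: linorder_cases)
    case less
    have "l (\<lambda>w. c * f w + (- c) * f w) = l (\<lambda>w. c * f w) + l (\<lambda>w. (- c) * f w)"
      using ladd[OF mul[OF f] mul[OF f]] .
    then show ?thesis using lpos[OF f, of "- c"] less l0 by simp
  qed (use lpos f l0 in auto)
  then show ?thesis using lp ladd by blast
qed

text \<open>The separation step behind Pietsch's domination theorem. A pair \<open>(h, r)\<close> stands for a function \<open>h\<close>
whose supremum bounds \<open>r\<close>; if the pairs form a convex cone, a single mean \<open>l\<close> on the bounded functions
satisfies \<open>r \<le> l h\<close> for all of them. It is found below the sublinear functional that maps \<open>f\<close> to the
infimum of \<open>sup (f + h) - r\<close>. As \<open>l\<close> is a positive functional in place of a measure,
\<open>\<Omega>\<close> can be an arbitrary set.\<close>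

lemma dominating_mean:
  fixes \<Omega> :: "'w set" and Q :: "(('w \<Rightarrow> real) \<times> real) set"
  defines "V \<equiv> {f. \<exists>B. \<forall>w\<in>\<Omega>. \<bar>f w\<bar> \<le> B}"
  assumes zero: "((\<lambda>w. 0), 0) \<in> Q"
    and add: "\<And>g h r s. (g, r) \<in> Q \<Longrightarrow> (h, s) \<in> Q \<Longrightarrow> ((\<lambda>w. g w + h w), r + s) \<in> Q"
    and mul: "\<And>c h r. c > 0 \<Longrightarrow> (h, r) \<in> Q \<Longrightarrow> ((\<lambda>w. c * h w), c * r) \<in> Q"
    and bounded: "\<And>h r. (h, r) \<in> Q \<Longrightarrow> h \<in> V"
    and dom: "\<And>h r M. (h, r) \<in> Q \<Longrightarrow> (\<And>w. w \<in> \<Omega> \<Longrightarrow> h w \<le> M) \<Longrightarrow> r \<le> M"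
  obtains l where "\<And>f g. f \<in> V \<Longrightarrow> g \<in> V \<Longrightarrow> l (\<lambda>w. f w + g w) = l f + l g"
    and "\<And>c f. f \<in> V \<Longrightarrow> l (\<lambda>w. c * f w) = c * l f"
    and "\<And>f M. f \<in> V \<Longrightarrow> (\<And>w. w \<in> \<Omega> \<Longrightarrow> f w \<le> M) \<Longrightarrow> l f \<le> (M :: real)"
    and "\<And>h r. (h, r) \<in> Q \<Longrightarrow> r \<le> l h"
proof -
  have V: "function_space V"
    unfolding function_space_def
  proof (intro conjI ballI allI)
    show "(\<lambda>w. 0) \<in> V" by (auto simp: V_def)
    fix f assume "f \<in> V"
    then obtain A where A: "\<forall>w\<in>\<Omega>. \<bar>f w\<bar> \<le> A" unfolding V_def by blast
    then have "\<forall>w\<in>\<Omega>. \<bar>c * f w\<bar> \<le> \<bar>c\<bar> * A" for c by (auto simp: abs_mult intro: mult_left_mono)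
    then show "(\<lambda>w. c * f w) \<in> V" for c unfolding V_def by blast
    fix g assume "g \<in> V"
    then obtain B where "\<forall>w\<in>\<Omega>. \<bar>g w\<bar> \<le> B" unfolding V_def by blast
    with A have "\<forall>w\<in>\<Omega>. \<bar>f w + g w\<bar> \<le> A + B" by (meson abs_triangle_ineq add_mono order.trans)
    then show "(\<lambda>w. f w + g w) \<in> V" unfolding V_def by blast
  qed
  define D where "D f = {M - r | M h r. (h, r) \<in> Q \<and> (\<forall>w\<in>\<Omega>. f w + h w \<le> M)}" for f
  define p where "p f = Inf (D f)" for f
  have bdd: "bdd_below (D f)" if "f \<in> V" for f
  proof -
    obtain B where B: "\<forall>w\<in>\<Omega>. \<bar>f w\<bar> \<le> B" using \<open>f \<in> V\<close> by (auto simp: V_def)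
    have "- B \<le> M - r" if "(h, r) \<in> Q" "\<forall>w\<in>\<Omega>. f w + h w \<le> M" for M h r
      using dom[OF that(1), of "M + B"] that(2) B by (smt (verit))
    then show ?thesis by (intro bdd_belowI[of _ "- B"]) (auto simp: D_def)
  qed
  have ne: "D f \<noteq> {}" if f: "f \<in> V" for f
  proof -
    obtain B where "\<forall>w\<in>\<Omega>. \<bar>f w\<bar> \<le> B" using f by (auto simp: V_def)
    then have "\<forall>w\<in>\<Omega>. f w + 0 \<le> B" by (auto intro: order.trans[OF abs_ge_self])
    then show ?thesis unfolding D_def using zero by blast
  qed
  have p_le: "p f \<le> M - r" if "f \<in> V" "(h, r) \<in> Q" "\<And>w. w \<in> \<Omega> \<Longrightarrow> f w + h w \<le> M" for f M h r
    unfolding p_def by (rule cInf_lower[OF _ bdd[OF that(1)]]) (use that in \<open>auto simp: D_def\<close>)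
  have p_ge: "m \<le> p f" if "f \<in> V"
      "\<And>M h r. (h, r) \<in> Q \<Longrightarrow> (\<And>w. w \<in> \<Omega> \<Longrightarrow> f w + h w \<le> M) \<Longrightarrow> m \<le> M - r" for f m
    unfolding p_def using that by (intro cInf_greatest ne) (auto simp: D_def)
  have Vadd: "(\<lambda>w. a w + b w) \<in> V" if "a \<in> V" "b \<in> V" for a b
    using V that by (simp add: function_space_def)
  have Vmul: "(\<lambda>w. c * a w) \<in> V" if "a \<in> V" for a c
    using V that by (simp add: function_space_def)
  have "sublinear_on V p"
    unfolding sublinear_on_def
  proof (intro conjI ballI allI impI)
    fix a b assume a: "a \<in> V" and b: "b \<in> V"
    have *: "p (\<lambda>w. a w + b w) \<le> (M - r) + (M' - r')"
      if "(h, r) \<in> Q" "\<And>w. w \<in> \<Omega> \<Longrightarrow> a w + h w \<le> M"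
         "(h', r') \<in> Q" "\<And>w. w \<in> \<Omega> \<Longrightarrow> b w + h' w \<le> M'" for h r M h' r' M'
    proof -
      have "(a w + b w) + (h w + h' w) \<le> M + M'" if "w \<in> \<Omega>" for w
        using \<open>\<And>w. w \<in> \<Omega> \<Longrightarrow> a w + h w \<le> M\<close>[OF that] \<open>\<And>w. w \<in> \<Omega> \<Longrightarrow> b w + h' w \<le> M'\<close>[OF that] by linarith
      from p_le[OF Vadd[OF a b] add[OF that(1,3)] this] show ?thesis by simp
    qed
    have "p (\<lambda>w. a w + b w) - p b \<le> p a"
    proof (rule p_ge[OF a])
      fix M h r assume 1: "(h, r) \<in> Q" "\<And>w. w \<in> \<Omega> \<Longrightarrow> a w + h w \<le> M"
      have "p (\<lambda>w. a w + b w) - (M - r) \<le> p b"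
        using *[OF 1] by (intro p_ge[OF b]) (smt (verit))
      then show "p (\<lambda>w. a w + b w) - p b \<le> M - r" by simp
    qed
    then show "p (\<lambda>w. a w + b w) \<le> p a + p b" by simp
  next
    fix c :: real and a assume c: "0 < c" and a: "a \<in> V"
    have "p (\<lambda>w. c * a w) / c \<le> p a"
    proof (rule p_ge[OF a])
      fix M h r assume 1: "(h, r) \<in> Q" "\<And>w. w \<in> \<Omega> \<Longrightarrow> a w + h w \<le> M"
      have "c * a w + c * h w \<le> c * M" if "w \<in> \<Omega>" for w
        using 1(2)[OF that] c by (simp flip: distrib_left)
      from p_le[OF Vmul[OF a] mul[OF c 1(1)] this]
      show "p (\<lambda>w. c * a w) / c \<le> M - r" using c by (simp add: field_simps)
    qed
    then show "p (\<lambda>w. c * a w) \<le> c * p a" using c by (simp add: field_simps)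
  qed
  from hahn_banach_sublinear[OF V this] obtain l where l: "\<And>f. f \<in> V \<Longrightarrow> l f \<le> p f"
      "\<And>f g. f \<in> V \<Longrightarrow> g \<in> V \<Longrightarrow> l (\<lambda>w. f w + g w) = l f + l g"
      "\<And>c f. f \<in> V \<Longrightarrow> l (\<lambda>w. c * f w) = c * l f" by blast
  have "l f \<le> M" if "f \<in> V" "\<And>w. w \<in> \<Omega> \<Longrightarrow> f w \<le> M" for f M
    using l(1)[OF that(1)] p_le[OF that(1) zero, of M] that(2) by simp
  moreover have "r \<le> l h" if "(h, r) \<in> Q" for h r
  proof -
    have "p (\<lambda>w. (-1) * h w) \<le> 0 - r" by (rule p_le[OF Vmul[OF bounded[OF that]] that]) simp
    then show ?thesis using l(1)[OF Vmul[OF bounded[OF that], of "-1"]] l(3)[OF bounded[OF that], of "-1"] by simp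
  qed
  ultimately show thesis using l(2,3) that by blast
qed

text \<open>The defect \<open>g r = f r - r f 1\<close> is additive and vanishes on the integers, so \<open>n g r = g (n r)\<close> depends on
the fractional part of \<open>n r\<close> only and stays bounded as \<open>n\<close> grows.\<close>

lemma additive_bounded_imp_linear:
  fixes f :: "real \<Rightarrow> real"
  assumes add: "\<And>a b. f (a + b) = f a + f b" and bd: "\<And>r. \<bar>r\<bar> \<le> 1 \<Longrightarrow> \<bar>f r\<bar> \<le> C"
  shows "f r = r * f 1"
proof -
  define g where "g r = f r - r * f 1" for r
  have gadd: "g (a + b) = g a + g b" for a b by (simp add: g_def add algebra_simps)
  have g1: "g 1 = 0" by (simp add: g_def)
  have g0: "g 0 = 0" using gadd[of 0 0] by simp
  have gneg: "g (- a) = - g a" for a using gadd[of a "- a"] g0 by simp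
  have gn: "g (real n * a) = real n * g a" for n a
    by (induction n) (simp_all add: g0 distrib_right gadd)
  have gi: "g (of_int k) = 0" for k
  proof (cases k)
    case (nonneg n)
    then show ?thesis using gn[of n 1] g1 by simp
  next
    case (neg n)
    then show ?thesis using gn[of "Suc n" 1] g1 gneg[of "real (Suc n)"] by simp
  qed
  have "\<bar>real n * g r\<bar> \<le> C + 1 * \<bar>f 1\<bar>" for n
  proof -
    have "real n * g r = g (of_int \<lfloor>real n * r\<rfloor> + frac (real n * r))" by (simp add: gn frac_def)
    also have "\<dots> = g (frac (real n * r))" by (simp add: gadd gi)
    also have "\<bar>\<dots>\<bar> \<le> \<bar>f (frac (real n * r))\<bar> + \<bar>frac (real n * r)\<bar> * \<bar>f 1\<bar>"
      unfolding g_def using abs_triangle_ineq4[of "f (frac (real n * r))" "frac (real n * r) * f 1"]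
      by (simp add: abs_mult)
    also have "\<dots> \<le> C + 1 * \<bar>f 1\<bar>"
    proof (intro add_mono mult_right_mono)
      have f: "\<bar>frac (real n * r)\<bar> \<le> 1" using frac_lt_1[of "real n * r"] by (simp add: less_imp_le)
      then show "\<bar>f (frac (real n * r))\<bar> \<le> C" by (rule bd)
      show "\<bar>frac (real n * r)\<bar> \<le> 1" by (rule f)
    qed simp
    finally show ?thesis .
  qed
  then have *: "real n * \<bar>g r\<bar> \<le> C + 1 * \<bar>f 1\<bar>" for n by (simp add: abs_mult)
  have "g r = 0"
  proof (rule ccontr)
    assume "g r \<noteq> 0"
    then obtain n where "C + 1 * \<bar>f 1\<bar> < real n * \<bar>g r\<bar>" using ex_less_of_nat_mult[of "\<bar>g r\<bar>"] by auto
    then show False using *[of n] by simp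
  qed
  then show ?thesis by (simp add: g_def)
qed

section \<open>Scalars and normed spaces\<close>

lemma to_complex_zero [simp]: "to_complex 0 = 0"
  using norm_to_complex[of 0] by simp

lemma to_complex_minus: "to_complex (- x) = - to_complex x"
  using to_complex_add[of x "- x"] by (simp add: eq_neg_iff_add_eq_0 add.commute)

lemma to_complex_diff: "to_complex (x - y) = to_complex x - to_complex y"
  using to_complex_add[of x "- y"] by (simp add: to_complex_minus)

lemma to_complex_sum: "to_complex (\<Sum>i\<in>I. f i) = (\<Sum>i\<in>I. to_complex (f i))"
  by (induction I rule: infinite_finite_induct) (simp_all add: to_complex_add)

lemma to_complex_one [simp]: "to_complex (1 :: 'k :: real_or_complex) = 1"
proof -
  have "to_complex (1 :: 'k) * to_complex (1 :: 'k) = to_complex (1 :: 'k)"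
    by (simp flip: to_complex_mult)
  moreover have "to_complex (1 :: 'k) \<noteq> 0" using norm_to_complex[of "1 :: 'k"] by auto
  ultimately show ?thesis by simp
qed

text \<open>The class asks for an additive and multiplicative map only; real linearity comes from additivity and
boundedness.\<close>

lemma to_complex_of_real [simp]: "to_complex (of_real r :: 'k :: real_or_complex) = of_real r"
proof -
  have "Re (to_complex (of_real r :: 'k)) = r * Re (to_complex (of_real 1 :: 'k))"
  proof (rule additive_bounded_imp_linear)
    show "\<bar>Re (to_complex (of_real r :: 'k))\<bar> \<le> 1" if "\<bar>r\<bar> \<le> 1" for r
      using that abs_Re_le_cmod[of "to_complex (of_real r :: 'k)"] by (simp add: norm_to_complex)
  qed (simp add: to_complex_add)
  then have Re: "Re (to_complex (of_real r :: 'k)) = r" by simp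
  have "(cmod (to_complex (of_real r :: 'k)))\<^sup>2 = r\<^sup>2" by (simp add: norm_to_complex)
  then have "Im (to_complex (of_real r :: 'k)) = 0" using Re by (simp add: cmod_power2)
  then show ?thesis using Re by (simp add: complex_eq_iff)
qed

lemma to_complex_eq_iff: "to_complex x = to_complex y \<longleftrightarrow> x = y"
  using norm_to_complex[of "x - y"] by (auto simp: to_complex_diff)

lemma to_complex_norm_diff: "cmod (to_complex x - to_complex y) = norm (x - y)"
  by (simp add: norm_to_complex flip: to_complex_diff)

instance real_or_complex \<subseteq> complete_space
proof
  fix X :: "nat \<Rightarrow> 'a" assume "Cauchy X"
  then have "Cauchy (\<lambda>n. to_complex (X n))"
    by (simp add: Cauchy_def dist_norm to_complex_norm_diff)
  then obtain l where l: "(\<lambda>n. to_complex (X n)) \<longlonglongrightarrow> l"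
    by (auto simp: Cauchy_convergent_iff convergent_def)
  have "closed (range (to_complex :: 'a \<Rightarrow> complex))"
    using range_to_complex[where 'a='a] closed_complex_Reals by auto
  then obtain x :: 'a where "l = to_complex x"
    using closed_sequentially[OF _ _ l] by blast
  then have "(\<lambda>n. norm (to_complex (X n) - to_complex x)) \<longlonglongrightarrow> 0"
    using l by (simp add: LIM_zero tendsto_norm_zero)
  then have "X \<longlonglongrightarrow> x"
    by (simp add: to_complex_norm_diff tendsto_norm_zero_iff LIM_zero_iff)
  then show "convergent X" by (auto simp: convergent_def)
qed

text \<open>The imaginary unit if the field has one, and 0 for the real field. With this convention the
decomposition into real and imaginary part has the same form over both fields.\<close>

definition kiota :: "'k :: real_or_complex" where
  "kiota = (if \<i> \<in> range (to_complex :: 'k \<Rightarrow> complex) then SOME x. to_complex x = \<i> else 0)"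

lemma to_complex_kiota:
  "to_complex (kiota :: 'k :: real_or_complex) = (if \<i> \<in> range (to_complex :: 'k \<Rightarrow> complex) then \<i> else 0)"
proof (cases "\<i> \<in> range (to_complex :: 'k \<Rightarrow> complex)")
  case True
  then obtain x :: 'k where "to_complex x = \<i>" by (metis imageE)
  then have "to_complex (SOME x :: 'k. to_complex x = \<i>) = \<i>" by (rule someI)
  then show ?thesis using True by (simp add: kiota_def)
qed (simp add: kiota_def)

abbreviation kre :: "'k :: real_or_complex \<Rightarrow> real" where "kre c \<equiv> Re (to_complex c)"
abbreviation kim :: "'k :: real_or_complex \<Rightarrow> real" where "kim c \<equiv> Im (to_complex c)"

lemma kim_eq_0: "\<i> \<notin> range (to_complex :: 'k \<Rightarrow> complex) \<Longrightarrow> kim (c :: 'k :: real_or_complex) = 0"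
  using range_to_complex[where 'a='k] by (metis UNIV_I complex_is_Real_iff rangeI)

lemma scalar_decomposition: "(c :: 'k :: real_or_complex) = of_real (kre c) + kiota * of_real (kim c)"
proof -
  have "to_complex (of_real (kre c) + kiota * of_real (kim c) :: 'k) = to_complex c"
  proof (cases "\<i> \<in> range (to_complex :: 'k \<Rightarrow> complex)")
    case True
    then show ?thesis
      unfolding to_complex_add to_complex_mult to_complex_kiota by (simp add: complex_eq_iff)
  next
    case False
    then show ?thesis
      unfolding to_complex_add to_complex_mult to_complex_kiota
      using kim_eq_0[OF False, of c] by (simp add: complex_eq_iff)
  qed
  then show ?thesis by (simp add: to_complex_eq_iff)
qed

lemma norm_kiota_le: "norm (kiota :: 'k :: real_or_complex) \<le> 1"
  using norm_to_complex[of "kiota :: 'k"] by (simp add: to_complex_kiota split: if_splits)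

lemma abs_kre_le: "\<bar>kre c\<bar> \<le> norm c" and abs_kim_le: "\<bar>kim c\<bar> \<le> norm c"
  using abs_Re_le_cmod[of "to_complex c"] abs_Im_le_cmod[of "to_complex c"] by (simp_all add: norm_to_complex)

lemma norm_scalar_square: "(norm c)\<^sup>2 = (kre c)\<^sup>2 + (kim c)\<^sup>2"
  using cmod_power2[of "to_complex c"] by (simp only: norm_to_complex)

lemma sum_abs_le_subset_sums:
  fixes r :: "'i \<Rightarrow> real"
  assumes "finite F" "\<And>S. S \<subseteq> F \<Longrightarrow> \<bar>\<Sum>i\<in>S. r i\<bar> \<le> M"
  shows "(\<Sum>i\<in>F. \<bar>r i\<bar>) \<le> 2 * M"
proof -
  let ?P = "{i \<in> F. r i \<ge> 0}" and ?N = "{i \<in> F. r i < 0}"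
  have "(\<Sum>i\<in>F. \<bar>r i\<bar>) = (\<Sum>i\<in>?P. \<bar>r i\<bar>) + (\<Sum>i\<in>?N. \<bar>r i\<bar>)"
    using \<open>finite F\<close> by (subst sum.union_disjoint[symmetric]) (auto intro!: sum.cong)
  also have "(\<Sum>i\<in>?P. \<bar>r i\<bar>) = (\<Sum>i\<in>?P. r i)" by (intro sum.cong) auto
  also have "(\<Sum>i\<in>?N. \<bar>r i\<bar>) = - (\<Sum>i\<in>?N. r i)" by (simp add: sum_negf[symmetric])
  also have "(\<Sum>i\<in>?P. r i) + - (\<Sum>i\<in>?N. r i) \<le> M + M"
    using assms(2)[of ?P] assms(2)[of ?N] by (intro add_mono) auto
  finally show ?thesis by simp
qed

text \<open>With the uniform bound for coordinate projections, this bounds weak \<open>\<ell>\<^sub>1\<close> norms of the terms of an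
unconditional expansion. Each of the four sign patterns of real and imaginary parts selects a subset.\<close>

lemma sum_norm_le_subset_sums:
  fixes z :: "'i \<Rightarrow> 'k :: real_or_complex"
  assumes "finite F" "\<And>S. S \<subseteq> F \<Longrightarrow> norm (\<Sum>i\<in>S. z i) \<le> M"
  shows "(\<Sum>i\<in>F. norm (z i)) \<le> 4 * M"
proof -
  have "(\<Sum>i\<in>F. norm (z i)) \<le> (\<Sum>i\<in>F. \<bar>kre (z i)\<bar> + \<bar>kim (z i)\<bar>)"
    by (intro sum_mono) (metis cmod_le norm_to_complex)
  also have "\<dots> \<le> 2 * M + 2 * M"
    unfolding sum.distrib
  proof (intro add_mono sum_abs_le_subset_sums assms(1))
    fix S assume "S \<subseteq> F"
    then show "\<bar>\<Sum>i\<in>S. kre (z i)\<bar> \<le> M" "\<bar>\<Sum>i\<in>S. kim (z i)\<bar> \<le> M"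
      using abs_kre_le[of "\<Sum>i\<in>S. z i"] abs_kim_le[of "\<Sum>i\<in>S. z i"] assms(2)[of S]
      by (simp_all add: to_complex_sum)
  qed
  finally show ?thesis by simp
qed

locale nspace =
  fixes E :: "('k::real_or_complex, 'a::ab_group_add) normed_structure"
  assumes normed: "normed_space E"
begin

sublocale vs: vector_space "scale E"
  using normed by (simp add: normed_space_def)

lemma subspace: "vs.subspace (points E)"
  using normed by (simp add: normed_space_def)

lemma zero_in [simp]: "0 \<in> points E" using vs.subspace_0[OF subspace] .
lemma add_in [intro, simp]: "x \<in> points E \<Longrightarrow> y \<in> points E \<Longrightarrow> x + y \<in> points E" using vs.subspace_add[OF subspace] .
lemma diff_in [intro, simp]: "x \<in> points E \<Longrightarrow> y \<in> points E \<Longrightarrow> x - y \<in> points E" using vs.subspace_diff[OF subspace] .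
lemma scale_in [intro, simp]: "x \<in> points E \<Longrightarrow> scale E c x \<in> points E" using vs.subspace_scale[OF subspace] .
lemma minus_in [intro, simp]: "x \<in> points E \<Longrightarrow> - x \<in> points E" using vs.subspace_neg[OF subspace] .
lemma sum_in [intro]: "(\<And>i. i \<in> I \<Longrightarrow> f i \<in> points E) \<Longrightarrow> (\<Sum>i\<in>I. f i) \<in> points E"
  using vs.subspace_sum[OF subspace] .

lemma nrm_nonneg [simp]: "x \<in> points E \<Longrightarrow> 0 \<le> nrm E x"
  using normed by (simp add: normed_space_def)
lemma nrm_eq_0 [simp]: "x \<in> points E \<Longrightarrow> nrm E x = 0 \<longleftrightarrow> x = 0"
  using normed by (simp add: normed_space_def)
lemma nrm_triangle: "x \<in> points E \<Longrightarrow> y \<in> points E \<Longrightarrow> nrm E (x + y) \<le> nrm E x + nrm E y"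
  using normed by (simp add: normed_space_def)
lemma nrm_scale: "x \<in> points E \<Longrightarrow> nrm E (scale E c x) = norm c * nrm E x"
  using normed by (simp add: normed_space_def)
lemma nrm_zero [simp]: "nrm E 0 = 0" by simp
lemma nrm_minus: "x \<in> points E \<Longrightarrow> nrm E (- x) = nrm E x"
  using nrm_scale[of x "-1"] by simp
lemma nrm_diff_commute: "x \<in> points E \<Longrightarrow> y \<in> points E \<Longrightarrow> nrm E (x - y) = nrm E (y - x)"
  using nrm_minus[of "x - y"] by simp
lemma nrm_diff_triangle:
  "x \<in> points E \<Longrightarrow> y \<in> points E \<Longrightarrow> z \<in> points E \<Longrightarrow> nrm E (x - z) \<le> nrm E (x - y) + nrm E (y - z)"
  using nrm_triangle[of "x - y" "y - z"] by simp
lemma nrm_diff_le: "x \<in> points E \<Longrightarrow> y \<in> points E \<Longrightarrow> nrm E (x - y) \<le> nrm E x + nrm E y"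
  using nrm_triangle[of x "- y"] nrm_minus by simp
lemma nrm_sum_le:
  "(\<And>i. i \<in> I \<Longrightarrow> f i \<in> points E) \<Longrightarrow> nrm E (\<Sum>i\<in>I. f i) \<le> (\<Sum>i\<in>I. nrm E (f i))"
proof (induction I rule: infinite_finite_induct)
  case (insert i I)
  then have "nrm E (f i + (\<Sum>i\<in>I. f i)) \<le> nrm E (f i) + nrm E (\<Sum>i\<in>I. f i)"
    by (intro nrm_triangle sum_in) auto
  then show ?case using insert by auto
qed simp_all

lemma metric: "Metric_space (points E) (norm_dist E)"
  by (rule Metric_space_norm_dist[OF normed])

lemma limitin_iff:
  "limitin (norm_topology E) f l F \<longleftrightarrow>
     l \<in> points E \<and> (\<forall>e>0. \<forall>\<^sub>F i in F. f i \<in> points E \<and> nrm E (f i - l) < e)"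
  unfolding norm_topology_def Metric_space.limitin_metric[OF metric]
  by (auto simp: norm_dist_def cong: conj_cong)

lemma limitin_iff_tendsto:
  assumes "\<And>i. f i \<in> points E"
  shows "limitin (norm_topology E) f l F \<longleftrightarrow> l \<in> points E \<and> ((\<lambda>i. nrm E (f i - l)) \<longlongrightarrow> 0) F"
  unfolding limitin_iff tendsto_iff dist_real_def using assms by (auto cong: conj_cong)

lemma limit_unique:
  assumes "\<And>i. f i \<in> points E" "F \<noteq> bot"
    and "l \<in> points E" "((\<lambda>i. nrm E (f i - l)) \<longlongrightarrow> 0) F"
    and "m \<in> points E" "((\<lambda>i. nrm E (f i - m)) \<longlongrightarrow> 0) F"
  shows "l = m"
proof -
  have "((\<lambda>i. nrm E (f i - l) + nrm E (f i - m)) \<longlongrightarrow> 0 + 0) F" by (intro tendsto_add assms)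
  moreover have "nrm E (l - m) \<le> nrm E (f i - l) + nrm E (f i - m)" for i
    using nrm_diff_triangle[of l "f i" m] nrm_diff_commute[of l "f i"] assms by simp
  ultimately have "nrm E (l - m) \<le> 0 + 0"
    using assms(2) by (intro tendsto_lowerbound[of _ "0 + 0" F]) auto
  then have "nrm E (l - m) = 0" using nrm_nonneg[of "l - m"] assms(3,5) by fastforce
  then show ?thesis using nrm_eq_0[of "l - m"] assms(3,5) by simp
qed

end

locale bspace = nspace E for E :: "('k::real_or_complex, 'a::ab_group_add) normed_structure" +
  assumes banach: "banach_space E"
begin

lemma complete:
  assumes s: "\<And>n. s n \<in> points E" and cau: "\<And>e. 0 < e \<Longrightarrow> \<exists>N. \<forall>m\<ge>N. \<forall>n\<ge>N. nrm E (s m - s n) < e"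
  shows "\<exists>l\<in>points E. (\<lambda>n. nrm E (s n - l)) \<longlonglongrightarrow> 0"
proof -
  interpret Metric_space "points E" "norm_dist E" by (rule metric)
  have "MCauchy s"
    unfolding MCauchy_def norm_dist_def
  proof (intro conjI allI impI)
    fix e :: real assume "0 < e"
    then obtain N where "\<forall>m\<ge>N. \<forall>n\<ge>N. nrm E (s m - s n) < e" using cau by blast
    then show "\<exists>N. \<forall>n n'. N \<le> n \<longrightarrow> N \<le> n' \<longrightarrow>
        (if s n \<in> points E \<and> s n' \<in> points E then nrm E (s n - s n') else 0) < e"
      using s by auto
  qed (use s in auto)
  moreover have "mcomplete" using banach by (simp add: banach_space_def)
  ultimately obtain l where "limitin (norm_topology E) s l sequentially"
    unfolding mcomplete_def norm_topology_def by blast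
  then show ?thesis using limitin_iff_tendsto[of s, OF s] by blast
qed

lemma geometric_series:
  assumes x: "\<And>k. x k \<in> points E" and le: "\<And>k. nrm E (x k) \<le> c * (1 / 2) ^ k"
  shows "\<exists>l\<in>points E. \<forall>m. nrm E (l - (\<Sum>k<m. x k)) \<le> 2 * c * (1 / 2) ^ m"
proof -
  let ?s = "\<lambda>m. \<Sum>k<m. x k"
  have s: "?s m \<in> points E" for m using x by (intro sum_in)
  have c: "0 \<le> c" using le[of 0] nrm_nonneg[OF x[of 0]] by simp
  have tail: "nrm E (?s n - ?s m) \<le> 2 * c * (1 / 2) ^ m" if "m \<le> n" for m n
  proof -
    have "nrm E (?s (m + j) - ?s m) \<le> 2 * c * (1 / 2) ^ m - 2 * c * (1 / 2) ^ (m + j)" for j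
    proof (induction j)
      case (Suc j)
      have "nrm E (?s (m + Suc j) - ?s m) \<le> nrm E (?s (m + Suc j) - ?s (m + j)) + nrm E (?s (m + j) - ?s m)"
        by (rule nrm_diff_triangle[OF s s s])
      then show ?case using Suc le[of "m + j"] by simp
    qed simp
    from this[of "n - m"] that have "nrm E (?s n - ?s m) \<le> 2 * c * (1 / 2) ^ m - 2 * c * (1 / 2) ^ n" by simp
    moreover have "0 \<le> 2 * c * (1 / 2) ^ n" using c by simp
    ultimately show ?thesis by linarith
  qed
  have lim: "(\<lambda>m. 2 * c * (1 / 2) ^ m) \<longlonglongrightarrow> 0"
    by (intro tendsto_mult_right_zero LIMSEQ_power_zero) simp
  have "\<exists>l\<in>points E. (\<lambda>n. nrm E (?s n - l)) \<longlonglongrightarrow> 0"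
  proof (rule complete[OF s])
    fix e :: real assume "0 < e"
    then obtain N where N: "\<And>m. m \<ge> N \<Longrightarrow> 2 * c * (1 / 2) ^ m < e"
      using order_tendstoD(2)[OF lim] by (auto simp: eventually_sequentially)
    have "nrm E (?s m - ?s n) < e" if "m \<ge> N" "n \<ge> N" for m n
    proof (cases "m \<le> n")
      case True
      then show ?thesis using tail[of m n] N[OF that(1)] nrm_diff_commute[OF s[of m] s[of n]] by linarith
    next
      case False
      then show ?thesis using tail[of n m] N[OF that(2)] by linarith
    qed
    then show "\<exists>N. \<forall>m\<ge>N. \<forall>n\<ge>N. nrm E (?s m - ?s n) < e" by blast
  qed
  then obtain l where l: "l \<in> points E" "(\<lambda>n. nrm E (?s n - l)) \<longlonglongrightarrow> 0" by blast
  have "nrm E (l - ?s m) \<le> 0 + 2 * c * (1 / 2) ^ m" for m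
  proof (rule tendsto_lowerbound)
    show "(\<lambda>n. nrm E (?s n - l) + 2 * c * (1 / 2) ^ m) \<longlonglongrightarrow> 0 + 2 * c * (1 / 2) ^ m"
      by (intro tendsto_add l(2) tendsto_const)
    have "nrm E (l - ?s m) \<le> nrm E (?s n - l) + 2 * c * (1 / 2) ^ m" if "m \<le> n" for n
      using nrm_diff_triangle[OF l(1) s[of n] s[of m]] nrm_diff_commute[OF l(1) s[of n]] tail[OF that] by linarith
    then show "\<forall>\<^sub>F n in sequentially. nrm E (l - ?s m) \<le> nrm E (?s n - l) + 2 * c * (1 / 2) ^ m"
      by (rule eventually_sequentiallyI)
  qed simp
  then show ?thesis using l(1) by (auto simp del: sum.lessThan_Suc)
qed

end

lemma bspaceI: "banach_space E \<Longrightarrow> bspace E"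
  by unfold_locales (auto simp: banach_space_def)

locale bounded_op = X: nspace X + Y: nspace Y for X :: "('k::real_or_complex, 'a::ab_group_add) normed_structure"
    and Y :: "('k, 'b::ab_group_add) normed_structure" +
  fixes f :: "'a \<Rightarrow> 'b"
  assumes op: "bounded_operator X Y f"
begin

lemma maps [simp, intro]: "x \<in> points X \<Longrightarrow> f x \<in> points Y"
  using op by (simp add: bounded_operator_def)
lemma add: "x \<in> points X \<Longrightarrow> y \<in> points X \<Longrightarrow> f (x + y) = f x + f y"
  using op by (simp add: bounded_operator_def)
lemma scale: "x \<in> points X \<Longrightarrow> f (scale X c x) = scale Y c (f x)"
  using op by (simp add: bounded_operator_def)
lemma zero [simp]: "f 0 = 0" using add[of 0 0] by simp
lemma minus: "x \<in> points X \<Longrightarrow> f (- x) = - f x"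
  using add[of x "- x"] by (simp add: eq_neg_iff_add_eq_0 add.commute)
lemma diff: "x \<in> points X \<Longrightarrow> y \<in> points X \<Longrightarrow> f (x - y) = f x - f y"
  using add[of x "- y"] minus[of y] by simp
lemma sum: "(\<And>i. i \<in> I \<Longrightarrow> g i \<in> points X) \<Longrightarrow> f (\<Sum>i\<in>I. g i) = (\<Sum>i\<in>I. f (g i))"
  by (induction I rule: infinite_finite_induct) (auto simp: add X.sum_in)
lemma bound: "\<exists>C>0. \<forall>x\<in>points X. nrm Y (f x) \<le> C * nrm X x"
proof -
  obtain C where C: "\<forall>x\<in>points X. nrm Y (f x) \<le> C * nrm X x" using op by (auto simp: bounded_operator_def)
  have "nrm Y (f x) \<le> (\<bar>C\<bar> + 1) * nrm X x" if "x \<in> points X" for x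
  proof -
    have "C * nrm X x \<le> (\<bar>C\<bar> + 1) * nrm X x" using that by (intro mult_right_mono) auto
    then show ?thesis using C that by fastforce
  qed
  then show ?thesis by (intro exI[of _ "\<bar>C\<bar> + 1"]) auto
qed

end

lemma bounded_opI: "normed_space X \<Longrightarrow> normed_space Y \<Longrightarrow> bounded_operator X Y f \<Longrightarrow> bounded_op X Y f"
  by unfold_locales

lemma scalars_simps [simp]: "points scalars = UNIV" "scale scalars = (*)" "nrm scalars = norm"
  by (simp_all add: scalars_def)

lemma normed_space_scalars: "normed_space (scalars :: ('k::real_or_complex, 'k) normed_structure)"
proof -
  have v: "vector_space ((*) :: 'k \<Rightarrow> 'k \<Rightarrow> 'k)"
    by unfold_locales (simp_all add: algebra_simps)
  then have m: "module ((*) :: 'k \<Rightarrow> 'k \<Rightarrow> 'k)" by (simp add: module_iff_vector_space)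
  show ?thesis
    using v by (simp add: normed_space_def norm_mult norm_triangle_ineq module.subspace_UNIV[OF m])
qed

section \<open>Nearly orthonormal vectors in finite-dimensional normed spaces\<close>

text \<open>The Leibniz formula for a determinant whose size is a variable and not a type.\<close>

definition ldet :: "nat \<Rightarrow> (nat \<Rightarrow> nat \<Rightarrow> real) \<Rightarrow> real" where
  "ldet N A = (\<Sum>p | p permutes {..<N}. of_int (sign p) * (\<Prod>i<N. A i (p i)))"

lemma ldet_identical_rows:
  assumes "i < N" "j < N" "i \<noteq> j" "A i = A j"
  shows "ldet N A = 0"
proof -
  let ?\<tau> = "Transposition.transpose i j"
  have \<tau>: "?\<tau> permutes {..<N}"
    using assms by (simp add: permutes_swap_id)
  have A: "A (?\<tau> k) = A k" for k
    using assms by (simp add: Transposition.transpose_def)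
  have "ldet N A = (\<Sum>p | p permutes {..<N}. of_int (sign (p \<circ> ?\<tau>)) * (\<Prod>k<N. A k ((p \<circ> ?\<tau>) k)))"
    unfolding ldet_def by (rule sum_permutations_compose_right[OF \<tau>])
  also have "\<dots> = (\<Sum>p | p permutes {..<N}. - (of_int (sign p) * (\<Prod>k<N. A k (p k))))"
  proof (rule sum.cong[OF refl], clarify)
    fix p assume p: "p permutes {..<N}"
    have "sign (p \<circ> ?\<tau>) = - sign p"
      using permutes_imp_permutation[OF finite_lessThan p] permutes_imp_permutation[OF finite_lessThan \<tau>] assms
      by (simp add: sign_compose sign_swap_id)
    moreover have "(\<Prod>k<N. A k ((p \<circ> ?\<tau>) k)) = (\<Prod>k<N. (\<lambda>k. A k (p k)) (?\<tau> k))"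
      using A by simp
    moreover have "\<dots> = (\<Prod>k<N. A k (p k))"
      using prod.permute[OF \<tau>, of "\<lambda>k. A k (p k)"] by (simp add: comp_def)
    ultimately show "of_int (sign (p \<circ> ?\<tau>)) * (\<Prod>k<N. A k ((p \<circ> ?\<tau>) k))
        = - (of_int (sign p) * (\<Prod>k<N. A k (p k)))" by simp
  qed
  also have "\<dots> = - ldet N A"
    by (simp add: ldet_def sum_negf)
  finally show ?thesis by simp
qed

lemma ldet_row_combination:
  assumes "i < N"
  shows "ldet N (A(i := \<lambda>k. \<Sum>j<N. t j * A j k)) = t i * ldet N A"
proof -
  have "(\<Prod>k<N. (A(i := \<lambda>k. \<Sum>j<N. t j * A j k)) k (p k))
      = (\<Sum>j<N. t j * (\<Prod>k<N. (A(i := A j)) k (p k)))" for p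
  proof -
    have *: "(\<Prod>k<N. (A(i := r)) k (p k)) = r (p i) * (\<Prod>k\<in>{..<N}-{i}. A k (p k))" for r
    proof -
      have "(\<Prod>k<N. (A(i := r)) k (p k)) = (A(i := r)) i (p i) * (\<Prod>k\<in>{..<N}-{i}. (A(i := r)) k (p k))"
        using assms by (subst prod.remove[of _ i]) auto
      then show ?thesis by simp
    qed
    show ?thesis
      unfolding * by (simp add: sum_distrib_right mult.assoc)
  qed
  then have "ldet N (A(i := \<lambda>k. \<Sum>j<N. t j * A j k)) = (\<Sum>j<N. t j * ldet N (A(i := A j)))"
    unfolding ldet_def by (simp only: sum_distrib_left) (subst sum.swap, simp add: mult_ac)
  also have "\<dots> = (\<Sum>j\<in>{i}. t j * ldet N (A(i := A j)))"
    using assms by (intro sum.mono_neutral_right) (auto intro: ldet_identical_rows[of i N])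
  finally show ?thesis by simp
qed

lemma ldet_diagonal: "ldet N (\<lambda>i k. if k = i then d i else 0) = (\<Prod>i<N. d i)"
proof -
  have "ldet N (\<lambda>i k. if k = i then d i else 0) =
     (\<Sum>p\<in>{id}. of_int (sign p) * (\<Prod>i<N. if p i = i then d i else 0))"
    unfolding ldet_def
  proof (rule sum.mono_neutral_right)
    show "finite {p. p permutes {..<N}}" by (simp add: finite_permutations)
    show "{id} \<subseteq> {p. p permutes {..<N}}" by (simp add: permutes_id)
    show "\<forall>p\<in>{p. p permutes {..<N}} - {id}. of_int (sign p) * (\<Prod>i<N. if p i = i then d i else 0) = 0"
    proof
      fix p assume "p \<in> {p. p permutes {..<N}} - {id}"
      then have p: "p permutes {..<N}" "p \<noteq> id" by auto
      then obtain i where "p i \<noteq> i" by (auto simp: fun_eq_iff)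
      moreover have "i < N" using p calculation by (metis lessThan_iff permutes_not_in)
      ultimately show "of_int (sign p) * (\<Prod>i<N. if p i = i then d i else 0) = 0" by auto
    qed
  qed
  then show ?thesis by simp
qed

lemma ldet_bounded:
  assumes "\<And>i k. i < N \<Longrightarrow> k < N \<Longrightarrow> \<bar>A i k\<bar> \<le> M"
  shows "\<bar>ldet N A\<bar> \<le> fact N * M ^ N"
proof -
  have "\<bar>of_int (sign p) * (\<Prod>i<N. A i (p i))\<bar> \<le> M ^ N" if p: "p permutes {..<N}" for p
  proof -
    have "\<bar>of_int (sign p) * (\<Prod>i<N. A i (p i))\<bar> = (\<Prod>i<N. \<bar>A i (p i)\<bar>)"
      by (simp add: abs_mult abs_prod sign_def)
    also have "\<dots> \<le> (\<Prod>i<N. M)"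
      using permutes_in_image[OF p] assms by (intro prod_mono) auto
    finally show ?thesis by simp
  qed
  then have "\<bar>ldet N A\<bar> \<le> real (card {p. p permutes {..<N}}) * M ^ N"
    unfolding ldet_def by (intro order.trans[OF sum_abs]) (rule sum_bounded_above, simp)
  then show ?thesis by (simp add: card_permutations)
qed

text \<open>A norm on the first \<open>N\<close> coordinates of real sequences. The dimension must be a variable, since it is
chosen large in terms of the number of vectors that are wanted.\<close>

locale finite_dim_norm =
  fixes N :: nat and \<nu> :: "(nat \<Rightarrow> real) \<Rightarrow> real"
  assumes tri: "\<nu> (\<lambda>i. s i + t i) \<le> \<nu> s + \<nu> t"
    and hom: "\<nu> (\<lambda>i. c * t i) = \<bar>c\<bar> * \<nu> t"
    and cong: "(\<And>i. i < N \<Longrightarrow> s i = t i) \<Longrightarrow> \<nu> s = \<nu> t"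
    and definite: "\<nu> t = 0 \<Longrightarrow> i < N \<Longrightarrow> t i = 0"
begin

lemma zero [simp]: "\<nu> (\<lambda>i. 0) = 0"
  using hom[of 0 "\<lambda>i. 0"] by simp

lemma nonneg: "0 \<le> \<nu> t"
  using tri[of t "\<lambda>i. - t i"] hom[of "-1" t] by simp

lemma combination_le:
  "finite K \<Longrightarrow> \<nu> (\<lambda>i. \<Sum>k\<in>K. c k * f k i) \<le> (\<Sum>k\<in>K. \<bar>c k\<bar> * \<nu> (f k))"
proof (induction rule: finite_induct)
  case (insert k K)
  have "\<nu> (\<lambda>i. c k * f k i + (\<Sum>k\<in>K. c k * f k i)) \<le> \<nu> (\<lambda>i. c k * f k i) + \<nu> (\<lambda>i. \<Sum>k\<in>K. c k * f k i)"
    by (rule tri)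
  then show ?case using insert by (simp add: hom)
qed simp

lemma le_coordinates: "\<nu> t \<le> (\<Sum>k<N. \<bar>t k\<bar> * \<nu> (\<lambda>i. if i = k then 1 else 0))"
proof -
  have "\<nu> t = \<nu> (\<lambda>i. \<Sum>k<N. t k * (if i = k then 1 else 0))"
    by (intro cong) (simp add: if_distrib[where f="\<lambda>x. _ * x"] cong: if_cong)
  also have "\<dots> \<le> (\<Sum>k<N. \<bar>t k\<bar> * \<nu> (\<lambda>i. if i = k then 1 else 0))"
    by (rule combination_le) simp
  finally show ?thesis .
qed

end

text \<open>All norms on a finite-dimensional space are equivalent. In the induction step, vectors with last
coordinate 1 and norms tending to 0 are Cauchy in the other coordinates, and their limit would be a
nonzero vector of norm 0.\<close>

lemma coordinates_bounded:
  assumes "finite_dim_norm N \<nu>"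
  shows "\<exists>M>0. \<forall>t. \<forall>i<N. \<bar>t i\<bar> \<le> M * \<nu> t"
  using assms
proof (induction N arbitrary: \<nu>)
  case 0
  then show ?case by (auto intro: exI[of _ 1])
next
  case (Suc N)
  interpret finite_dim_norm "Suc N" \<nu> by fact
  let ?z = "\<lambda>t i. if i < N then t i else (0::real)"
  have "finite_dim_norm N (\<lambda>t. \<nu> (?z t))"
  proof
    fix s t :: "nat \<Rightarrow> real" and c :: real and i
    show "\<nu> (?z (\<lambda>i. s i + t i)) \<le> \<nu> (?z s) + \<nu> (?z t)"
      using tri[of "?z s" "?z t"]
      by (simp add: if_distrib cong: if_cong)
    have "\<nu> (?z (\<lambda>i. c * t i)) = \<nu> (\<lambda>i. c * ?z t i)" by (intro cong) simp
    then show "\<nu> (?z (\<lambda>i. c * t i)) = \<bar>c\<bar> * \<nu> (?z t)" by (simp add: hom)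
    show "(\<And>i. i < N \<Longrightarrow> s i = t i) \<Longrightarrow> \<nu> (?z s) = \<nu> (?z t)" by (intro cong) simp
    show "\<nu> (?z t) = 0 \<Longrightarrow> i < N \<Longrightarrow> t i = 0" using definite[of "?z t" i] by simp
  qed
  from Suc.IH[OF this] obtain M where M: "M > 0" "\<And>t i. i < N \<Longrightarrow> \<bar>t i\<bar> \<le> M * \<nu> (?z t)" by blast
  have M': "\<bar>t i\<bar> \<le> M * \<nu> t" if "i < N" "t N = 0" for t i
  proof -
    have "\<nu> (?z t) = \<nu> t" using that(2) by (intro cong) (auto simp: less_Suc_eq)
    then show ?thesis using M(2)[OF that(1), of t] by simp
  qed
  let ?e = "\<lambda>i. if i = N then 1 else (0::real)"
  have "\<exists>M'>0. \<forall>t. \<bar>t N\<bar> \<le> M' * \<nu> t"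
  proof (rule ccontr)
    assume "\<not> ?thesis"
    then have "\<forall>n. \<exists>t. \<bar>t N\<bar> > real (Suc n) * \<nu> t"
      by (metis not_le of_nat_0_less_iff zero_less_Suc)
    then obtain s where s: "\<And>n. \<bar>s n N\<bar> > real (Suc n) * \<nu> (s n)" by metis
    have s0: "s n N \<noteq> 0" for n
      using s[of n] nonneg[of "s n"] by (smt (verit) mult_nonneg_nonneg of_nat_0_le_iff)
    define t where "t n i = (1 / s n N) * s n i" for n i
    have tN: "t n N = 1" for n using s0[of n] by (simp add: t_def)
    have \<nu>t: "\<nu> (t n) \<le> 1 / real (Suc n)" for n
    proof -
      have "\<nu> (t n) = \<nu> (s n) / \<bar>s n N\<bar>" unfolding t_def hom by simp
      also have "\<dots> \<le> 1 / real (Suc n)"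
        using s[of n] s0[of n] by (simp add: field_simps)
      finally show ?thesis .
    qed
    have diff: "\<bar>t n i - t m i\<bar> \<le> M * (1 / real (Suc n) + 1 / real (Suc m))" if "i < N" for n m i
    proof -
      have "\<bar>t n i - t m i\<bar> \<le> M * \<nu> (\<lambda>i. t n i + (-1) * t m i)"
        using M'[of i "\<lambda>i. t n i + (-1) * t m i"] that by (simp add: tN)
      also have "\<nu> (\<lambda>i. t n i + (-1) * t m i) \<le> \<nu> (t n) + \<nu> (t m)"
        using tri[of "t n" "\<lambda>i. (-1) * t m i"] hom[of "-1" "t m"] by simp
      also have "\<dots> \<le> 1 / real (Suc n) + 1 / real (Suc m)" using \<nu>t by (intro add_mono)
      finally show ?thesis using M(1) by simp
    qed
    have "Cauchy (\<lambda>n. t n i)" if "i < N" for i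
    proof (rule metric_CauchyI)
      fix e :: real assume "0 < e"
      then obtain n0 where n0: "1 / real (Suc n0) < e / (2 * M)"
        using M(1) by (metis divide_pos_pos mult_pos_pos nat_approx_posE zero_less_numeral)
      have "dist (t n i) (t m i) < e" if "n \<ge> n0" "m \<ge> n0" for n m
      proof -
        have "1 / real (Suc n) \<le> 1 / real (Suc n0)" "1 / real (Suc m) \<le> 1 / real (Suc n0)"
          using that by (simp_all add: frac_le)
        moreover have "e / (2 * M) + e / (2 * M) = e / M" using M(1) by (simp add: field_simps)
        ultimately have "1 / real (Suc n) + 1 / real (Suc m) < e / M" using n0 by linarith
        then have "M * (1 / real (Suc n) + 1 / real (Suc m)) < e"
          using M(1) by (simp add: pos_less_divide_eq mult.commute)
        then show ?thesis using diff[OF \<open>i < N\<close>, of n m] by (simp add: dist_real_def)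
      qed
      then show "\<exists>M. \<forall>m\<ge>M. \<forall>n\<ge>M. dist (t m i) (t n i) < e" by blast
    qed
    then have "convergent (\<lambda>n. t n i)" if "i < Suc N" for i
      using that tN by (cases "i = N") (auto simp: convergent_const less_Suc_eq real_Cauchy_convergent)
    then have "\<forall>i. \<exists>l. i < Suc N \<longrightarrow> (\<lambda>n. t n i) \<longlonglongrightarrow> l"
      by (auto simp: convergent_def)
    then obtain l where l: "\<And>i. i < Suc N \<Longrightarrow> (\<lambda>n. t n i) \<longlonglongrightarrow> l i" by metis
    have lN: "l N = 1" using l[of N] tN by (simp add: LIMSEQ_const_iff)
    let ?g = "\<lambda>n. (\<Sum>k<Suc N. \<bar>l k - t n k\<bar> * \<nu> (\<lambda>i. if i = k then 1 else 0)) + 1 / real (Suc n)"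
    have "\<nu> l \<le> ?g n" for n
    proof -
      have "\<nu> l \<le> \<nu> (\<lambda>i. l i - t n i) + \<nu> (t n)" using tri[of "\<lambda>i. l i - t n i" "t n"] by simp
      then show ?thesis using le_coordinates[of "\<lambda>i. l i - t n i"] \<nu>t[of n] by linarith
    qed
    moreover have "?g \<longlonglongrightarrow> (\<Sum>k<Suc N. \<bar>l k - l k\<bar> * \<nu> (\<lambda>i. if i = k then 1 else 0)) + 0"
      using l by (intro tendsto_add tendsto_sum tendsto_mult tendsto_rabs tendsto_diff tendsto_const LIMSEQ_Suc[OF lim_1_over_n]) auto
    ultimately have "\<nu> l \<le> (\<Sum>k<Suc N. \<bar>l k - l k\<bar> * \<nu> (\<lambda>i. if i = k then 1 else 0)) + 0"
      by (intro LIMSEQ_le_const) auto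
    then have "\<nu> l \<le> 0" by simp
    then have "\<nu> l = 0" using nonneg[of l] by simp
    from definite[OF this, of N] lN show False by simp
  qed
  then obtain M1 where M1: "M1 > 0" "\<And>t. \<bar>t N\<bar> \<le> M1 * \<nu> t" by blast
  define M2 where "M2 = M1 + M * (1 + M1 * \<nu> ?e)"
  have "\<bar>t i\<bar> \<le> M2 * \<nu> t" if "i < Suc N" for t i
  proof (cases "i = N")
    case True
    have "0 \<le> M * (1 + M1 * \<nu> ?e) * \<nu> t" using M(1) M1(1) nonneg by simp
    then show ?thesis using M1(2)[of t] True by (simp add: M2_def distrib_right)
  next
    case False
    then have "\<bar>t i\<bar> \<le> M * \<nu> (\<lambda>i. t i + (- t N) * ?e i)"
      using M'[of i "\<lambda>i. t i + (- t N) * ?e i"] that by simp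
    also have "\<nu> (\<lambda>i. t i + (- t N) * ?e i) \<le> \<nu> t + \<bar>t N\<bar> * \<nu> ?e"
      using tri[of t "\<lambda>i. (- t N) * ?e i"] hom[of "- t N" ?e] by simp
    also have "\<dots> \<le> \<nu> t + M1 * \<nu> t * \<nu> ?e"
      using M1(2)[of t] nonneg[of ?e] by (simp add: mult_right_mono)
    finally have "\<bar>t i\<bar> \<le> M * (\<nu> t + M1 * \<nu> t * \<nu> ?e)" using M(1) by simp
    moreover have "0 \<le> M1 * \<nu> t" using M1(1) nonneg by simp
    ultimately show ?thesis by (simp add: M2_def algebra_simps)
  qed
  moreover have "M2 > 0" using M(1) M1(1) nonneg[of ?e] by (simp add: M2_def add_pos_pos add_pos_nonneg)
  ultimately show ?case by blast
qed

text \<open>An Auerbach basis up to the factor 2: the rows \<open>A i\<close> lie in the unit ball and have a determinant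
within a factor 2 of the maximum. Replacing row \<open>i\<close> by a combination of norm at most 1 multiplies the
determinant by the coefficient \<open>t i\<close>, which is therefore at most 2.\<close>

lemma (in finite_dim_norm) auerbach:
  "\<exists>A. (\<forall>i<N. \<nu> (A i) \<le> 1) \<and> (\<forall>t. \<forall>i<N. \<bar>t i\<bar> \<le> 2 * \<nu> (\<lambda>k. \<Sum>j<N. t j * A j k))"
proof -
  obtain M where M: "M > 0" "\<And>t i. i < N \<Longrightarrow> \<bar>t i\<bar> \<le> M * \<nu> t"
    using coordinates_bounded[OF finite_dim_norm_axioms] by blast
  define S where "S = {\<bar>ldet N A\<bar> | A. \<forall>i<N. \<nu> (A i) \<le> 1}"
  have bdd: "bdd_above S"
  proof (rule bdd_aboveI)
    fix x assume "x \<in> S"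
    then obtain A where A: "x = \<bar>ldet N A\<bar>" "\<forall>i<N. \<nu> (A i) \<le> 1" by (auto simp: S_def)
    have "\<bar>A i k\<bar> \<le> M" if "i < N" "k < N" for i k
      using M(2)[OF that(2), of "A i"] A(2) that M(1) by (smt (verit) mult_left_le)
    then show "x \<le> fact N * M ^ N" unfolding A(1) by (rule ldet_bounded)
  qed
  let ?e = "\<lambda>i. \<nu> (\<lambda>k. if k = i then 1 else 0)"
  have e: "?e i > 0" if "i < N" for i
    using nonneg[of "\<lambda>k. if k = i then 1 else 0"] definite[of "\<lambda>k. if k = i then 1 else 0" i] that
    by (smt (verit))
  have "\<nu> (\<lambda>k. if k = i then 1 / ?e i else 0) \<le> 1" if "i < N" for i
    using hom[of "1 / ?e i" "\<lambda>k. if k = i then 1 else 0"] e[OF that]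
    by (simp add: if_distrib[where f="\<lambda>x. x / _"] cong: if_cong)
  then have "\<bar>ldet N (\<lambda>i k. if k = i then 1 / ?e i else 0)\<bar> \<in> S" unfolding S_def by blast
  moreover have "\<bar>ldet N (\<lambda>i k. if k = i then 1 / ?e i else 0)\<bar> > 0"
    unfolding ldet_diagonal using e by (auto simp: prod_pos less_imp_neq[symmetric])
  ultimately have pos: "Sup S > 0" and ne: "S \<noteq> {}" using cSup_upper[OF _ bdd] by fastforce+
  then have "Sup S / 2 < Sup S" by simp
  then obtain A where A: "\<forall>i<N. \<nu> (A i) \<le> 1" "\<bar>ldet N A\<bar> > Sup S / 2"
    proof -
    obtain x where "x \<in> S" "Sup S / 2 < x" using \<open>Sup S / 2 < Sup S\<close> less_cSupE[OF _ ne] by blast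
    then show thesis using that by (auto simp: S_def)
  qed
  have "\<bar>t i\<bar> \<le> 2 * \<nu> (\<lambda>k. \<Sum>j<N. t j * A j k)" if "i < N" for t i
  proof -
    let ?y = "\<lambda>k. \<Sum>j<N. t j * A j k"
    have *: "\<bar>c\<bar> * \<bar>t i\<bar> \<le> 2" if "\<bar>c\<bar> * \<nu> ?y \<le> 1" for c
    proof -
      have "\<nu> (\<lambda>k. \<Sum>j<N. (c * t j) * A j k) \<le> 1"
        using that hom[of c ?y] by (simp add: sum_distrib_left mult.assoc)
      then have "\<bar>ldet N (A(i := \<lambda>k. \<Sum>j<N. (c * t j) * A j k))\<bar> \<in> S"
        unfolding S_def using A(1) by auto
      then have "\<bar>c * t i * ldet N A\<bar> \<le> Sup S"
        unfolding ldet_row_combination[OF \<open>i < N\<close>] by (rule cSup_upper[OF _ bdd])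
      then have "\<bar>c * t i\<bar> * \<bar>ldet N A\<bar> \<le> 2 * \<bar>ldet N A\<bar>" using A(2) by (simp add: abs_mult)
      moreover have "\<bar>ldet N A\<bar> > 0" using A(2) pos by linarith
      ultimately show ?thesis by (metis abs_mult mult_le_cancel_right_pos)
    qed
    show ?thesis
    proof (cases "\<nu> ?y = 0")
      case True
      have "\<bar>t i\<bar> \<le> 0"
      proof (rule ccontr)
        assume "\<not> \<bar>t i\<bar> \<le> 0"
        then show False using *[of "3 / \<bar>t i\<bar>"] True by simp
      qed
      then show ?thesis using nonneg[of ?y] by simp
    next
      case False
      then have "\<nu> ?y > 0" using nonneg[of ?y] by simp
      then show ?thesis using *[of "1 / \<nu> ?y"] by (simp add: field_simps)
    qed
  qed
  then show ?thesis using A(1) by blast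
qed

lemma underdetermined_system:
  fixes a :: "nat \<Rightarrow> 'i \<Rightarrow> real"
  assumes "finite I" "k < card I"
  shows "\<exists>t. (\<exists>i\<in>I. t i \<noteq> 0) \<and> (\<forall>j<k. (\<Sum>i\<in>I. a j i * t i) = 0)"
  using assms
proof (induction k arbitrary: a I)
  case 0
  then have "I \<noteq> {}" by auto
  then show ?case by (intro exI[of _ "\<lambda>_. 1"]) auto
next
  case (Suc k)
  show ?case
  proof (cases "\<exists>p\<in>I. a k p \<noteq> 0")
    case False
    obtain t where t: "\<exists>i\<in>I. t i \<noteq> 0" "\<forall>j<k. (\<Sum>i\<in>I. a j i * t i) = 0"
      using Suc.IH[of I a] Suc.prems by auto
    moreover have "(\<Sum>i\<in>I. a k i * t i) = 0" using False by simp
    ultimately show ?thesis by (auto simp: less_Suc_eq)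
  next
    case True
    then obtain p where p: "p \<in> I" "a k p \<noteq> 0" by blast
    define a' where "a' j i = a j i - a j p * a k i / a k p" for j i
    have "k < card (I - {p})" using Suc.prems p by simp
    then obtain s where s: "\<exists>i\<in>I - {p}. s i \<noteq> 0" "\<forall>j<k. (\<Sum>i\<in>I - {p}. a' j i * s i) = 0"
      using Suc.IH[of "I - {p}" a'] Suc.prems by auto
    define t where "t = s(p := - (\<Sum>i\<in>I - {p}. a k i * s i) / a k p)"
    have split: "(\<Sum>i\<in>I. a j i * t i) = (\<Sum>i\<in>I - {p}. a' j i * s i)" for j
    proof -
      have "(\<Sum>i\<in>I. a j i * t i) = a j p * t p + (\<Sum>i\<in>I - {p}. a j i * t i)"
        using Suc.prems p by (subst sum.remove[of _ p]) auto
      also have "\<dots> = (\<Sum>i\<in>I - {p}. a j i * s i) - a j p / a k p * (\<Sum>i\<in>I - {p}. a k i * s i)"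
        by (simp add: t_def)
      also have "\<dots> = (\<Sum>i\<in>I - {p}. a' j i * s i)"
        unfolding a'_def by (simp add: sum_distrib_left sum_subtractf[symmetric] algebra_simps)
      finally show ?thesis .
    qed
    have "(\<Sum>i\<in>I. a j i * t i) = 0" if "j < Suc k" for j
      using that s(2) p(2) unfolding split by (auto simp: less_Suc_eq a'_def)
    moreover have "\<exists>i\<in>I. t i \<noteq> 0" using s(1) by (auto simp: t_def)
    ultimately show ?thesis by blast
  qed
qed

definition dotp :: "nat \<Rightarrow> (nat \<Rightarrow> real) \<Rightarrow> (nat \<Rightarrow> real) \<Rightarrow> real" where
  "dotp N s t = (\<Sum>i<N. s i * t i)"

lemma dotp_sum_left: "dotp N (\<lambda>k. \<Sum>i\<in>I. c i * f i k) t = (\<Sum>i\<in>I. c i * dotp N (f i) t)"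
  unfolding dotp_def by (simp only: sum_distrib_left sum_distrib_right, subst sum.swap, simp add: mult_ac)

lemma dotp_commute: "dotp N s t = dotp N t s"
  by (simp add: dotp_def mult.commute)

text \<open>The Euclidean unit sphere of the orthogonal complement of \<open>w 0, \<dots>, w (k - 1)\<close>.\<close>

definition orthocompl :: "nat \<Rightarrow> (nat \<Rightarrow> nat \<Rightarrow> real) \<Rightarrow> nat \<Rightarrow> (nat \<Rightarrow> real) set" where
  "orthocompl N w k = {t. dotp N t t = 1 \<and> (\<forall>l<k. dotp N t (w l) = 0)}"

lemma orthocompl_nonempty:
  assumes "k < N"
  shows "orthocompl N w k \<noteq> {}"
proof -
  obtain t where t: "\<exists>i\<in>{..<N}. t i \<noteq> 0" "\<forall>j<k. (\<Sum>i<N. w j i * t i) = 0"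
    using underdetermined_system[of "{..<N}" k w] assms by auto
  then obtain i where i: "i < N" "t i \<noteq> 0" by auto
  have "dotp N t t > 0"
    unfolding dotp_def using i by (intro sum_pos2[of _ i]) (auto simp: zero_less_mult_iff)
  define r where "r = 1 / sqrt (dotp N t t)"
  have "dotp N (\<lambda>i. r * t i) (\<lambda>i. r * t i) = r\<^sup>2 * dotp N t t"
    unfolding dotp_def by (simp add: sum_distrib_left power2_eq_square mult_ac)
  also have "\<dots> = 1" using \<open>dotp N t t > 0\<close> by (simp add: r_def power_divide)
  finally have "dotp N (\<lambda>i. r * t i) (\<lambda>i. r * t i) = 1" .
  moreover have "dotp N (\<lambda>i. r * t i) (w l) = 0" if "l < k" for l
  proof -
    have "dotp N (\<lambda>i. r * t i) (w l) = r * (\<Sum>i<N. w l i * t i)"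
      unfolding dotp_def by (simp add: sum_distrib_left mult_ac)
    then show ?thesis using t(2) that by simp
  qed
  ultimately show ?thesis unfolding orthocompl_def by blast
qed

lemma power2_beats_square: "\<exists>r. 2 * (real (r * p + 1))^2 < 2 ^ r"
proof -
  \<comment> \<open>With \<open>r = 4 q\<close> the right-hand side is \<open>(2 ^ q) ^ 4 \<ge> (q + 1) ^ 4\<close>, and \<open>q + 1 = 6 (p + 1)\<close> beats the constants.\<close>
  define q where "q = 6 * p + 5"
  have q: "real q + 1 = 6 * (real p + 1)" by (simp add: q_def)
  have "real (4 * q * p + 1) \<le> 4 * (real p + 1) * (real q + 1)" by (simp add: algebra_simps)
  then have "(real (4 * q * p + 1))^2 \<le> (4 * (real p + 1) * (real q + 1))^2"
    by (intro power_mono) auto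
  then have "2 * (real (4 * q * p + 1))^2 \<le> 32 * (real p + 1)^2 * (real q + 1)^2"
    by (simp only: power_mult_distrib) simp
  also have "\<dots> < 36 * (real p + 1)^2 * (real q + 1)^2" by (simp add: add_pos_pos)
  also have "\<dots> = (real q + 1) ^ 4"
    unfolding q power_mult_distrib by (simp flip: power_add power_mult)
  also have "\<dots> \<le> (2 ^ q) ^ 4"
  proof (intro power_mono)
    have "Suc q \<le> 2 ^ q" using less_exp[of q] by (simp only: Suc_le_eq)
    then have "real (Suc q) \<le> real (2 ^ q)" by (rule of_nat_mono)
    then show "real q + 1 \<le> 2 ^ q" by simp
  qed simp
  also have "\<dots> = 2 ^ (4 * q)" by (simp add: power_mult[symmetric] mult.commute)
  finally show ?thesis by blast
qed

text \<open>A greedy substitute for a singular value decomposition: each vector nearly maximises \<open>\<nu>\<close> among the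
unit vectors that are orthogonal to the earlier ones.\<close>

lemma (in finite_dim_norm) near_maximal_orthonormal_system:
  assumes lower: "\<And>t i. i < N \<Longrightarrow> \<bar>t i\<bar> \<le> 2 * \<nu> t"
    and unit: "\<And>k. k < N \<Longrightarrow> \<nu> (\<lambda>i. if i = k then 1 else 0) \<le> 1"
    and "k \<le> N"
  shows "\<exists>w. \<forall>j<k. w j \<in> orthocompl N w j \<and> (\<forall>t\<in>orthocompl N w j. \<nu> t \<le> 2 * \<nu> (w j))"
  using \<open>k \<le> N\<close>
proof (induction k)
  case (Suc k)
  then obtain w where w: "\<forall>j<k. w j \<in> orthocompl N w j \<and> (\<forall>t\<in>orthocompl N w j. \<nu> t \<le> 2 * \<nu> (w j))"
    by auto
  let ?U = "orthocompl N w k"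
  have ne: "?U \<noteq> {}" using orthocompl_nonempty Suc.prems by simp
  have "\<nu> t \<le> real N" if "t \<in> ?U" for t
  proof -
    have "\<bar>t i\<bar> \<le> 1" if "i < N" for i
    proof -
      have "(t i)^2 \<le> dotp N t t"
        unfolding dotp_def using that by (auto simp: power2_eq_square intro: member_le_sum[of _ _ "\<lambda>i. _ i * _ i"])
      then show ?thesis using \<open>t \<in> ?U\<close> by (simp add: orthocompl_def abs_square_le_1)
    qed
    then have "(\<Sum>k<N. \<bar>t k\<bar> * \<nu> (\<lambda>i. if i = k then 1 else 0)) \<le> (\<Sum>k<N. 1)"
      using unit nonneg by (intro sum_mono mult_le_one) auto
    then show ?thesis using le_coordinates[of t] by simp
  qed
  then have bdd: "bdd_above (\<nu> ` ?U)" by (intro bdd_aboveI[of _ "real N"]) auto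
  obtain t where t: "t \<in> ?U" using ne by blast
  have "\<nu> t > 0"
  proof (rule ccontr)
    assume "\<not> \<nu> t > 0"
    then have "t i = 0" if "i < N" for i using lower[OF that, of t] by simp
    then have "dotp N t t = 0" by (simp add: dotp_def)
    then show False using t by (simp add: orthocompl_def)
  qed
  then have "Sup (\<nu> ` ?U) > 0" using cSup_upper[OF _ bdd, of "\<nu> t"] t by fastforce
  then have "Sup (\<nu> ` ?U) / 2 < Sup (\<nu> ` ?U)" by simp
  then obtain x where "x \<in> \<nu> ` ?U" "Sup (\<nu> ` ?U) / 2 < x"
    using less_cSupE[of _ "\<nu> ` ?U"] ne by (metis (no_types) image_is_empty)
  then obtain v where v: "v \<in> ?U" "\<nu> v > Sup (\<nu> ` ?U) / 2" by blast
  have vmax: "\<nu> t \<le> 2 * \<nu> v" if "t \<in> ?U" for t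
    using cSup_upper[OF _ bdd, of "\<nu> t"] that v(2) by fastforce
  have same: "orthocompl N (w(k := v)) j = orthocompl N w j" if "j \<le> k" for j
    using that by (auto simp: orthocompl_def)
  have "\<forall>j<Suc k. (w(k := v)) j \<in> orthocompl N (w(k := v)) j \<and>
      (\<forall>t\<in>orthocompl N (w(k := v)) j. \<nu> t \<le> 2 * \<nu> ((w(k := v)) j))"
    using w v(1) vmax by (auto simp: less_Suc_eq same)
  then show ?case by blast
qed simp

text \<open>In an Auerbach basis of a large dimension \<open>N\<close> take the greedy orthonormal system \<open>w\<close>. The numbers
\<open>\<mu> (w j)\<close> lie between \<open>1 / (2 N)\<close> and \<open>N\<close>. If they dropped by a factor 2 over every \<open>m - 1\<close> consecutive
steps, the decay would be exponential in \<open>N\<close> for fixed \<open>m\<close>, which is impossible. So there are \<open>m\<close>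
consecutive vectors on which \<open>\<mu>\<close> is nearly constant, and by the greedy choice \<open>\<mu>\<close> is at most a multiple of the Euclidean norm on
their span.\<close>

lemma dvoretzky_rogers:
  fixes m :: nat
  shows "\<exists>N. \<forall>\<nu>. finite_dim_norm N \<nu> \<longrightarrow>
     (\<exists>u. (\<forall>i<m. 1 \<le> \<nu> (u i)) \<and>
          (\<forall>t. \<nu> (\<lambda>k. \<Sum>i<m. t i * u i k) \<le> 8 * sqrt (\<Sum>i<m. (t i)^2)))"
proof (cases "m = 0")
  case True
  then show ?thesis by (auto simp: finite_dim_norm.zero)
next
  case False
  define p where "p = m - 1"
  obtain r where r: "2 * (real (r * p + 1))^2 < 2 ^ r" using power2_beats_square by blast
  define N where "N = r * p + 1"
  have "\<exists>u. (\<forall>i<m. 1 \<le> \<nu> (u i)) \<and>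
          (\<forall>t. \<nu> (\<lambda>k. \<Sum>i<m. t i * u i k) \<le> 8 * sqrt (\<Sum>i<m. (t i)^2))"
    if "finite_dim_norm N \<nu>" for \<nu>
  proof -
    interpret \<nu>: finite_dim_norm N \<nu> by fact
    obtain A where A: "\<And>i. i < N \<Longrightarrow> \<nu> (A i) \<le> 1"
        "\<And>t i. i < N \<Longrightarrow> \<bar>t i\<bar> \<le> 2 * \<nu> (\<lambda>k. \<Sum>j<N. t j * A j k)"
      using \<nu>.auerbach by blast
    define \<mu> where "\<mu> t = \<nu> (\<lambda>k. \<Sum>j<N. t j * A j k)" for t
    interpret \<mu>: finite_dim_norm N \<mu>
    proof
      fix s t :: "nat \<Rightarrow> real" and c :: real and i
      show "\<mu> (\<lambda>i. s i + t i) \<le> \<mu> s + \<mu> t"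
        unfolding \<mu>_def distrib_right sum.distrib by (rule \<nu>.tri)
      show "\<mu> (\<lambda>i. c * t i) = \<bar>c\<bar> * \<mu> t"
        unfolding \<mu>_def mult.assoc sum_distrib_left[symmetric] by (rule \<nu>.hom)
      show "(\<And>i. i < N \<Longrightarrow> s i = t i) \<Longrightarrow> \<mu> s = \<mu> t" by (simp add: \<mu>_def)
      show "\<mu> t = 0 \<Longrightarrow> i < N \<Longrightarrow> t i = 0" using A(2)[of i t] by (simp add: \<mu>_def)
    qed
    have lower: "\<bar>t i\<bar> \<le> 2 * \<mu> t" if "i < N" for t i using A(2)[OF that] by (simp add: \<mu>_def)
    have unit: "\<mu> (\<lambda>i. if i = k then 1 else 0) \<le> 1" if "k < N" for k
    proof -
      have "(\<lambda>l. \<Sum>j<N. (if j = k then 1 else 0) * A j l) = A k"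
        using that by (simp add: if_distrib[where f="\<lambda>x. x * _"] cong: if_cong)
      then show ?thesis using A(1)[OF that] by (simp add: \<mu>_def)
    qed
    obtain w where w: "\<And>j. j < N \<Longrightarrow> w j \<in> orthocompl N w j"
        "\<And>j t. j < N \<Longrightarrow> t \<in> orthocompl N w j \<Longrightarrow> \<mu> t \<le> 2 * \<mu> (w j)"
      using \<mu>.near_maximal_orthonormal_system[OF lower unit order_refl] by blast
    have w_in: "w i \<in> orthocompl N w j" if "j \<le> i" "i < N" for i j
      using w(1)[OF that(2)] that by (auto simp: orthocompl_def)
    have orth: "dotp N (w i) (w j) = (if i = j then 1 else 0)" if "i < N" "j < N" for i j
      using w(1)[OF that(1)] w(1)[OF that(2)] dotp_commute[of N "w i" "w j"]
      by (cases i j rule: linorder_cases) (auto simp: orthocompl_def)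
    have big: "1 / (2 * real N) \<le> \<mu> (w j)" if "j < N" for j
    proof -
      have "1 = (\<Sum>i<N. (w j i)^2)" using orth[OF that that] by (simp add: dotp_def power2_eq_square)
      also have "\<dots> \<le> (\<Sum>i<N. (2 * \<mu> (w j))^2)"
        using lower \<mu>.nonneg by (intro sum_mono power2_le_iff_abs_le[THEN iffD2]) auto
      also have "\<dots> \<le> (2 * real N * \<mu> (w j))^2"
      proof -
        have "real N \<le> (real N)^2" using self_le_power[of "real N" 2] by (cases N) auto
        then show ?thesis by (simp add: power_mult_distrib mult_right_mono)
      qed
      finally have sq: "1^2 \<le> (2 * real N * \<mu> (w j))^2" by simp
      have "0 \<le> 2 * real N * \<mu> (w j)" using \<mu>.nonneg[of "w j"] by simp
      with sq have "1 \<le> 2 * real N * \<mu> (w j)" by (rule power2_le_imp_le)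
      then show ?thesis using that by (simp add: field_simps)
    qed
    have pos: "\<mu> (w j) > 0" if "j < N" for j
      using big[OF that] that by (smt (verit) divide_pos_pos mult_pos_pos of_nat_0_less_iff less_nat_zero_code not_gr_zero)
    have "\<mu> (w 0) \<le> real N"
    proof -
      have N: "0 < N" by (simp add: N_def)
      have "\<bar>w 0 i\<bar> \<le> 1" if "i < N" for i
      proof -
        have "(w 0 i)^2 \<le> dotp N (w 0) (w 0)"
          unfolding dotp_def using that by (auto simp: power2_eq_square intro: member_le_sum[of _ _ "\<lambda>i. _ i * _ i"])
        then show ?thesis using orth[OF N N] by (simp add: abs_square_le_1)
      qed
      then have "(\<Sum>k<N. \<bar>w 0 k\<bar> * \<mu> (\<lambda>i. if i = k then 1 else 0)) \<le> (\<Sum>k<N. 1)"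
        using unit \<mu>.nonneg by (intro sum_mono mult_le_one) auto
      then show ?thesis using \<mu>.le_coordinates[of "w 0"] by simp
    qed
    have "\<exists>j. j + p < N \<and> \<mu> (w j) \<le> 2 * \<mu> (w (j + p))"
    proof (rule ccontr)
      assume *: "\<not> ?thesis"
      have "2 ^ l * \<mu> (w (l * p)) \<le> \<mu> (w 0)" if "l \<le> r" for l
        using that
      proof (induction l)
        case (Suc l)
        have "l * p + p \<le> r * p" using Suc.prems mult_le_mono1[of "Suc l" r p] by simp
        then have "l * p + p < N" by (simp add: N_def)
        then have "\<not> \<mu> (w (l * p)) \<le> 2 * \<mu> (w (l * p + p))" using * by blast
        then have "2 * \<mu> (w (l * p + p)) \<le> \<mu> (w (l * p))" by simp
        then have "2 ^ l * (2 * \<mu> (w (l * p + p))) \<le> 2 ^ l * \<mu> (w (l * p))" by (rule mult_left_mono) simp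
        also have "\<dots> \<le> \<mu> (w 0)" using Suc by simp
        finally show ?case by (simp add: add.commute mult_ac)
      qed simp
      then have "2 ^ r * \<mu> (w (r * p)) \<le> real N" using \<open>\<mu> (w 0) \<le> real N\<close> by fastforce
      moreover have "2 ^ r * (1 / (2 * real N)) \<le> 2 ^ r * \<mu> (w (r * p))"
        by (intro mult_left_mono big) (auto simp: N_def)
      ultimately have "2 ^ r * (1 / (2 * real N)) \<le> real N" by linarith
      moreover have "0 < N" by (simp add: N_def)
      then have "0 < 2 * real N" by simp
      ultimately have "2 ^ r \<le> real N * (2 * real N)" by (simp only: pos_divide_le_eq mult_1_right times_divide_eq_right)
      then have "2 ^ r \<le> 2 * (real N)^2" by (simp add: power2_eq_square)
      then show False using r by (simp add: N_def)
    qed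
    then obtain j where j: "j + p < N" "\<mu> (w j) \<le> 2 * \<mu> (w (j + p))" by blast
    let ?c = "2 / \<mu> (w (j + p))"
    \<comment> \<open>The factor \<open>?c\<close> makes the smallest of the norms at least 1: the last vector is at most twice as long as any other.\<close>
    define u where "u i = (\<lambda>k. \<Sum>l<N. (?c * w (j + i) l) * A l k)" for i
    have c: "?c > 0" using pos[OF j(1)] by simp
    have "1 \<le> \<nu> (u i)" if "i < m" for i
    proof -
      have i: "j + i \<le> j + p" using that by (auto simp: p_def)
      have "\<nu> (u i) = \<mu> (\<lambda>l. ?c * w (j + i) l)" by (simp add: u_def \<mu>_def)
      also have "\<dots> = \<bar>?c\<bar> * \<mu> (w (j + i))" by (rule \<mu>.hom)
      also have "\<dots> = ?c * \<mu> (w (j + i))" using c by (simp only: abs_of_pos)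
      finally have "\<nu> (u i) = 2 * \<mu> (w (j + i)) / \<mu> (w (j + p))" by simp
      moreover have "\<mu> (w (j + p)) \<le> 2 * \<mu> (w (j + i))"
        using w(2)[OF _ w_in[OF i j(1)]] i j(1) by simp
      ultimately show ?thesis using pos[OF j(1)] by (simp add: pos_le_divide_eq)
    qed
    moreover have "\<nu> (\<lambda>k. \<Sum>i<m. t i * u i k) \<le> 8 * sqrt (\<Sum>i<m. (t i)^2)" for t
    proof -
      define s where "s l = (\<Sum>i<m. t i * w (j + i) l)" for l
      have *: "j + i < N" if "i < m" for i using j(1) that by (auto simp: p_def)
      have s_dot: "dotp N s (w l) = (\<Sum>i<m. t i * (if j + i = l then 1 else 0))" if "l < N" for l
        unfolding s_def[abs_def] dotp_sum_left using orth[OF * that] by (intro sum.cong) auto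
      have "dotp N s s = (\<Sum>i<m. t i * dotp N s (w (j + i)))"
        by (subst (1) s_def[abs_def]) (simp add: dotp_sum_left dotp_commute)
      also have "\<dots> = (\<Sum>i<m. (t i)^2)"
        using s_dot * by (intro sum.cong) (auto simp: power2_eq_square if_distrib[where f="\<lambda>x. _ * x"] cong: if_cong)
      finally have ss: "dotp N s s = (\<Sum>i<m. (t i)^2)" .
      have "\<mu> s \<le> 2 * \<mu> (w j) * sqrt (dotp N s s)"
      proof (cases "dotp N s s = 0")
        case True
        then have "(\<Sum>i<N. (s i)^2) = 0" by (simp add: dotp_def power2_eq_square)
        then have "\<mu> s = \<mu> (\<lambda>i. 0)" by (intro \<mu>.cong) (simp add: sum_nonneg_eq_0_iff)
        then show ?thesis using True by simp
      next
        case False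
        have nn: "dotp N s s \<ge> 0" unfolding ss by (simp add: sum_nonneg)
        define q where "q = sqrt (dotp N s s)"
        have q: "q > 0" "q^2 = dotp N s s" using False nn by (auto simp: q_def)
        let ?s = "\<lambda>i. (1 / q) * s i"
        have "dotp N ?s ?s = (1 / q)^2 * dotp N s s"
          unfolding dotp_def by (simp add: sum_distrib_left power2_eq_square mult_ac)
        also have "\<dots> = 1" unfolding q(2)[symmetric] using q(1) by (simp add: power_divide)
        finally have "dotp N ?s ?s = 1" .
        moreover have "dotp N ?s (w l) = 0" if "l < j" for l
        proof -
          have "dotp N ?s (w l) = (1 / q) * dotp N s (w l)"
            unfolding dotp_def by (simp add: sum_distrib_left mult_ac)
          then show ?thesis using s_dot[of l] that j(1) by simp
        qed
        ultimately have "\<mu> ?s \<le> 2 * \<mu> (w j)"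
          using j(1) by (intro w(2)) (auto simp: orthocompl_def)
        then have "\<mu> s / q \<le> 2 * \<mu> (w j)" using \<mu>.hom[of "1 / q" s] q(1) by simp
        then show ?thesis using q(1) by (simp add: q_def[symmetric] pos_divide_le_eq)
      qed
      also have "\<dots> \<le> 4 * \<mu> (w (j + p)) * sqrt (dotp N s s)"
        using j(2) ss by (intro mult_right_mono) (auto simp: sum_nonneg)
      finally have "?c * \<mu> s \<le> 8 * sqrt (dotp N s s)" using pos[OF j(1)] by (simp add: field_simps)
      moreover have "\<nu> (\<lambda>k. \<Sum>i<m. t i * u i k) = \<mu> (\<lambda>l. ?c * s l)"
      proof -
        have "(\<Sum>i<m. t i * u i k) = (\<Sum>l<N. (?c * s l) * A l k)" for k
          unfolding u_def s_def sum_distrib_left sum_distrib_right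
          by (subst sum.swap) (simp add: mult_ac)
        then show ?thesis by (simp add: \<mu>_def)
      qed
      moreover have "\<mu> (\<lambda>l. ?c * s l) = ?c * \<mu> s" unfolding \<mu>.hom using c by (simp only: abs_of_pos)
      ultimately show ?thesis using ss by simp
    qed
    ultimately show ?thesis by blast
  qed
  then show ?thesis by blast
qed

section \<open>Unconditional bases\<close>

instance real_or_complex \<subseteq> banach ..

lemma tendsto_zero_le:
  fixes f g :: "'i \<Rightarrow> real"
  assumes "(g \<longlongrightarrow> 0) F" "\<And>i. 0 \<le> f i" "\<And>i. f i \<le> g i"
  shows "(f \<longlongrightarrow> 0) F"
  by (rule tendsto_sandwich[of "\<lambda>_. 0" f F g]) (use assms in auto)

text \<open>The coordinates \<open>coord x\<close> of a vector are only known to exist and to be unique; their continuity is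
the content of \<open>projections_bounded\<close>.\<close>

locale unconditional = bspace E for E :: "('k::real_or_complex, 'a::ab_group_add) normed_structure" +
  fixes B :: "'a set"
  assumes basis: "unconditional_basis E B"
begin

definition coord :: "'a \<Rightarrow> 'a \<Rightarrow> 'k" where
  "coord x = (THE a. (\<forall>b. b \<notin> B \<longrightarrow> a b = 0) \<and>
     limitin (norm_topology E) (\<lambda>S. \<Sum>b\<in>S. scale E (a b) b) x (finite_subsets_at_top B))"

definition lincomb :: "('a \<Rightarrow> 'k) \<Rightarrow> 'a set \<Rightarrow> 'a" where
  "lincomb a F = (\<Sum>b\<in>F. scale E (a b) b)"

abbreviation proj :: "'a set \<Rightarrow> 'a \<Rightarrow> 'a" where
  "proj F x \<equiv> lincomb (coord x) F"

lemma basis_in: "b \<in> B \<Longrightarrow> b \<in> points E"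
  using basis by (auto simp: unconditional_basis_def)

lemma lincomb_in: "(\<And>b. b \<notin> B \<Longrightarrow> a b = 0) \<Longrightarrow> lincomb a F \<in> points E"
  unfolding lincomb_def by (rule sum_in) (metis basis_in scale_in vs.scale_zero_left zero_in)

lemma coord_props:
  assumes "x \<in> points E"
  shows coord_outside: "b \<notin> B \<Longrightarrow> coord x b = 0"
    and proj_tendsto: "((\<lambda>F. nrm E (proj F x - x)) \<longlongrightarrow> 0) (finite_subsets_at_top B)"
proof -
  let ?P = "\<lambda>a. (\<forall>b. b \<notin> B \<longrightarrow> a b = 0) \<and>
     limitin (norm_topology E) (\<lambda>S. \<Sum>b\<in>S. scale E (a b) b) x (finite_subsets_at_top B)"
  have "\<exists>!a. ?P a" using basis assms by (simp add: unconditional_basis_def)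
  then have P: "?P (coord x)" unfolding coord_def by (rule theI')
  then show *: "b \<notin> B \<Longrightarrow> coord x b = 0" for b by blast
  have "limitin (norm_topology E) (\<lambda>F. proj F x) x (finite_subsets_at_top B)"
    using P by (simp add: lincomb_def)
  moreover have "proj F x \<in> points E" for F using * by (rule lincomb_in)
  ultimately show "((\<lambda>F. nrm E (proj F x - x)) \<longlongrightarrow> 0) (finite_subsets_at_top B)"
    using limitin_iff_tendsto[of "\<lambda>F. proj F x"] by blast
qed

lemma proj_in [simp]: "x \<in> points E \<Longrightarrow> proj F x \<in> points E"
  by (rule lincomb_in) (rule coord_outside)

lemma coord_unique:
  assumes x: "x \<in> points E" and a: "\<And>b. b \<notin> B \<Longrightarrow> a b = 0"
    and lim: "((\<lambda>F. nrm E (lincomb a F - x)) \<longlongrightarrow> 0) (finite_subsets_at_top B)"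
  shows "coord x = a"
proof -
  let ?P = "\<lambda>a. (\<forall>b. b \<notin> B \<longrightarrow> a b = 0) \<and>
     limitin (norm_topology E) (\<lambda>S. \<Sum>b\<in>S. scale E (a b) b) x (finite_subsets_at_top B)"
  have ex1: "\<exists>!a. ?P a" using basis x by (simp add: unconditional_basis_def)
  have "limitin (norm_topology E) (lincomb a) x (finite_subsets_at_top B)"
    using limitin_iff_tendsto[of "lincomb a"] lincomb_in[of a, OF a] x lim by blast
  then have "?P a" using a by (simp add: lincomb_def[abs_def])
  then show ?thesis unfolding coord_def using ex1 by (rule the1_equality[rotated])
qed

lemma lincomb_add: "lincomb (\<lambda>b. a b + c b) F = lincomb a F + lincomb c F"
  by (simp add: lincomb_def vs.scale_left_distrib sum.distrib)

lemma lincomb_diff: "lincomb (\<lambda>b. a b - c b) F = lincomb a F - lincomb c F"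
  by (simp add: lincomb_def vs.scale_left_diff_distrib sum_subtractf)

lemma lincomb_scale: "lincomb (\<lambda>b. r * a b) F = scale E r (lincomb a F)"
  by (simp add: lincomb_def vs.scale_sum_right)

lemma lincomb_Int: "finite F \<Longrightarrow> (\<And>b. b \<notin> B \<Longrightarrow> a b = 0) \<Longrightarrow> lincomb a F = lincomb a (F \<inter> B)"
  unfolding lincomb_def by (rule sum.mono_neutral_right) auto

lemma coord_add:
  assumes x: "x \<in> points E" and y: "y \<in> points E"
  shows "coord (x + y) = (\<lambda>b. coord x b + coord y b)"
proof (rule coord_unique)
  have "((\<lambda>F. nrm E (proj F x - x) + nrm E (proj F y - y)) \<longlongrightarrow> 0 + 0) (finite_subsets_at_top B)"
    by (intro tendsto_add proj_tendsto x y)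
  then have lim: "((\<lambda>F. nrm E (proj F x - x) + nrm E (proj F y - y)) \<longlongrightarrow> 0) (finite_subsets_at_top B)" by simp
  have le: "nrm E (lincomb (\<lambda>b. coord x b + coord y b) F - (x + y)) \<le> nrm E (proj F x - x) + nrm E (proj F y - y)" for F
    proof -
    have "lincomb (\<lambda>b. coord x b + coord y b) F - (x + y) = (proj F x - x) + (proj F y - y)"
      unfolding lincomb_add by simp
    then show ?thesis using nrm_triangle[of "proj F x - x" "proj F y - y"] x y by (simp only: diff_in proj_in)
  qed
  have ge: "0 \<le> nrm E (lincomb (\<lambda>b. coord x b + coord y b) F - (x + y))" for F
    using x y by (intro nrm_nonneg diff_in) (simp_all only: lincomb_add add_in proj_in)
  show "((\<lambda>F. nrm E (lincomb (\<lambda>b. coord x b + coord y b) F - (x + y))) \<longlongrightarrow> 0) (finite_subsets_at_top B)"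
    by (rule tendsto_zero_le[OF lim ge le])
qed (use x y in \<open>auto simp: coord_outside\<close>)

lemma coord_scale:
  assumes x: "x \<in> points E"
  shows "coord (scale E r x) = (\<lambda>b. r * coord x b)"
proof (rule coord_unique)
  have "((\<lambda>F. norm r * nrm E (proj F x - x)) \<longlongrightarrow> norm r * 0) (finite_subsets_at_top B)"
    by (intro tendsto_mult_left proj_tendsto x)
  moreover have "nrm E (lincomb (\<lambda>b. r * coord x b) F - scale E r x) = norm r * nrm E (proj F x - x)" for F
    using nrm_scale[of "proj F x - x" r] x by (simp add: lincomb_scale vs.scale_right_diff_distrib)
  ultimately show "((\<lambda>F. nrm E (lincomb (\<lambda>b. r * coord x b) F - scale E r x)) \<longlongrightarrow> 0) (finite_subsets_at_top B)"
    by simp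
qed (use x in \<open>auto simp: coord_outside\<close>)

lemma coord_zero [simp]: "coord 0 b = 0"
  using coord_scale[of 0 0] by simp

lemma coord_diff: "x \<in> points E \<Longrightarrow> y \<in> points E \<Longrightarrow> coord (x - y) = (\<lambda>b. coord x b - coord y b)"
  using coord_add[of x "scale E (-1) y"] coord_scale[of y "-1"] by simp

lemma coord_sum: "(\<And>i. i \<in> I \<Longrightarrow> f i \<in> points E) \<Longrightarrow> coord (\<Sum>i\<in>I. f i) b = (\<Sum>i\<in>I. coord (f i) b)"
proof (induction I rule: infinite_finite_induct)
  case (insert i I)
  then have "coord (f i + (\<Sum>i\<in>I. f i)) = (\<lambda>b. coord (f i) b + coord (\<Sum>i\<in>I. f i) b)"
    by (intro coord_add sum_in) auto
  then show ?case using insert by simp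
qed simp_all

lemma coord_lincomb:
  assumes "finite F" "F \<subseteq> B"
  shows "coord (lincomb a F) = (\<lambda>b. if b \<in> F then a b else 0)"
proof (rule coord_unique)
  show "lincomb a F \<in> points E"
    unfolding lincomb_def using assms basis_in by (intro sum_in scale_in) auto
  then have "\<forall>\<^sub>F G in finite_subsets_at_top B. nrm E (lincomb (\<lambda>b. if b \<in> F then a b else 0) G - lincomb a F) = 0"
    unfolding eventually_finite_subsets_at_top
  proof (intro exI[of _ F] conjI allI impI assms)
    fix G assume G: "finite G \<and> F \<subseteq> G \<and> G \<subseteq> B"
    then have "lincomb (\<lambda>b. if b \<in> F then a b else 0) G = lincomb a F"
      unfolding lincomb_def by (intro sum.mono_neutral_cong_right) auto
    then show "nrm E (lincomb (\<lambda>b. if b \<in> F then a b else 0) G - lincomb a F) = 0" by simp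
  qed
  then show "((\<lambda>G. nrm E (lincomb (\<lambda>b. if b \<in> F then a b else 0) G - lincomb a F)) \<longlongrightarrow> 0) (finite_subsets_at_top B)"
    by (simp add: tendsto_eventually)
qed (use assms in auto)

lemma coord_basis: "b \<in> B \<Longrightarrow> coord b = (\<lambda>c. if c = b then 1 else 0)"
  using coord_lincomb[of "{b}" "\<lambda>_. 1"] by (simp add: lincomb_def)

lemma basis_nonzero: "b \<in> B \<Longrightarrow> 0 < nrm E b"
proof -
  assume b: "b \<in> B"
  have "b \<noteq> 0" using fun_cong[OF coord_basis[OF b], of b] coord_zero[of b] by auto
  then show ?thesis using nrm_nonneg[OF basis_in[OF b]] nrm_eq_0[OF basis_in[OF b]] by linarith
qed

lemma proj_zero [simp]: "proj F 0 = 0"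
  by (simp add: lincomb_def)

lemma proj_add: "x \<in> points E \<Longrightarrow> y \<in> points E \<Longrightarrow> proj F (x + y) = proj F x + proj F y"
  by (simp add: coord_add lincomb_add)

lemma proj_diff: "x \<in> points E \<Longrightarrow> y \<in> points E \<Longrightarrow> proj F (x - y) = proj F x - proj F y"
  by (simp add: coord_diff lincomb_diff)

lemma proj_scale: "x \<in> points E \<Longrightarrow> proj F (scale E c x) = scale E c (proj F x)"
  by (simp add: coord_scale lincomb_scale)

lemma proj_sum: "finite F \<Longrightarrow> (\<And>i. i \<in> I \<Longrightarrow> f i \<in> points E) \<Longrightarrow> proj F (\<Sum>i\<in>I. f i) = (\<Sum>i\<in>I. proj F (f i))"
proof (induction I rule: infinite_finite_induct)
  case (insert i I)
  then have "proj F (f i + (\<Sum>i\<in>I. f i)) = proj F (f i) + proj F (\<Sum>i\<in>I. f i)"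
    by (intro proj_add sum_in) auto
  then show ?case using insert by simp
qed simp_all

text \<open>Beyond some finite set \<open>G\<close> the partial sums are close to \<open>x\<close>; an arbitrary finite set differs from one
that contains \<open>G\<close> by a subset of \<open>G\<close>.\<close>

lemma proj_pointwise_bounded:
  assumes x: "x \<in> points E"
  shows "\<exists>M. \<forall>F. finite F \<longrightarrow> nrm E (proj F x) \<le> M"
proof -
  have "\<forall>\<^sub>F F in finite_subsets_at_top B. nrm E (proj F x - x) < 1"
    using order_tendstoD(2)[OF proj_tendsto[OF x], of 1] by simp
  then have "\<exists>G. finite G \<and> G \<subseteq> B \<and> (\<forall>F. finite F \<and> G \<subseteq> F \<and> F \<subseteq> B \<longrightarrow> nrm E (proj F x - x) < 1)"
    by (simp only: eventually_finite_subsets_at_top)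
  then obtain G where G: "finite G" "G \<subseteq> B"
      and near: "\<forall>F. finite F \<and> G \<subseteq> F \<and> F \<subseteq> B \<longrightarrow> nrm E (proj F x - x) < 1"
    by (elim exE conjE)
  let ?M = "nrm E x + 1 + (\<Sum>b\<in>G. nrm E (scale E (coord x b) b))"
  have "nrm E (proj F x) \<le> ?M" if F: "finite F" for F
  proof -
    let ?F = "F \<inter> B"
    have in_G: "scale E (coord x b) b \<in> points E" if "b \<in> G" for b using that G(2) basis_in by auto
    have "proj F x = proj ?F x" using F x coord_outside by (intro lincomb_Int) auto
    also have "\<dots> = proj (?F \<union> G) x - proj (G - ?F) x"
    proof -
      have "proj (?F \<union> (G - ?F)) x = proj ?F x + proj (G - ?F) x"
        unfolding lincomb_def using F G(1) by (intro sum.union_disjoint) auto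
      moreover have "?F \<union> (G - ?F) = ?F \<union> G" by auto
      ultimately show ?thesis by simp
    qed
    also have "nrm E \<dots> \<le> nrm E (proj (?F \<union> G) x) + nrm E (proj (G - ?F) x)"
      using x by (intro nrm_diff_le) auto
    also have "nrm E (proj (?F \<union> G) x) \<le> nrm E x + 1"
    proof -
      have "nrm E (proj (?F \<union> G) x - x) < 1" using F G by (intro near[rule_format]) auto
      then show ?thesis using nrm_triangle[of "proj (?F \<union> G) x - x" x] x by simp
    qed
    also have "nrm E (proj (G - ?F) x) \<le> (\<Sum>b\<in>G - ?F. nrm E (scale E (coord x b) b))"
      unfolding lincomb_def using in_G by (intro nrm_sum_le) auto
    also have "\<dots> \<le> (\<Sum>b\<in>G. nrm E (scale E (coord x b) b))"
      using in_G G(1) by (intro sum_mono2) auto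
    finally show ?thesis by simp
  qed
  then show ?thesis by blast
qed

definition level :: "nat \<Rightarrow> 'a set" where
  "level m = {x \<in> points E. \<forall>F. finite F \<longrightarrow> nrm E (proj F x) \<le> real m}"

text \<open>By Baire's theorem the closure of some \<open>level m\<close> contains a ball. Differences of two elements of
\<open>level m\<close> then approximate every small vector, and scaling gives the claim for all vectors.\<close>

lemma approximation:
  "\<exists>K>0. \<forall>x\<in>points E. \<forall>e>0. \<exists>z\<in>points E. nrm E (x - z) < e \<and>
     (\<forall>F. finite F \<longrightarrow> nrm E (proj F z) \<le> K * nrm E x)"
proof -
  interpret M: Metric_space "points E" "norm_dist E" by (rule metric)
  let ?T = "M.mtopology"
  have "\<exists>m. ?T interior_of (?T closure_of (level m)) \<noteq> {}"
  proof (rule ccontr)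
    assume "\<not> ?thesis"
    then have "?T interior_of \<Union>(range (\<lambda>m. ?T closure_of (level m))) = {}"
      using banach by (intro M.metric_Baire_category_alt) (auto simp: banach_space_def)
    moreover have "points E \<subseteq> \<Union>(range (\<lambda>m. ?T closure_of (level m)))"
    proof
      fix x assume x: "x \<in> points E"
      obtain C where "\<forall>F. finite F \<longrightarrow> nrm E (proj F x) \<le> C" using proj_pointwise_bounded[OF x] by blast
      moreover obtain m where "C \<le> real m" using real_arch_simple by blast
      ultimately have "x \<in> level m" using x by (fastforce simp: level_def)
      moreover have "level m \<subseteq> ?T closure_of (level m)"
        by (rule closure_of_subset) (auto simp: level_def)
      ultimately show "x \<in> \<Union>(range (\<lambda>m. ?T closure_of (level m)))" by blast
    qed
    then have "\<Union>(range (\<lambda>m. ?T closure_of (level m))) = topspace ?T"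
      using closure_of_subset_topspace[of ?T] by fastforce
    ultimately have "topspace ?T = {}" by (metis interior_of_topspace)
    then show False using zero_in by simp
  qed
  then obtain m x0 where "x0 \<in> ?T interior_of (?T closure_of (level m))" by blast
  then obtain U where U: "openin ?T U" "x0 \<in> U" "U \<subseteq> ?T closure_of (level m)"
    by (auto simp: interior_of_def)
  then obtain r where r: "r > 0" "M.mball x0 r \<subseteq> ?T closure_of (level m)"
    by (meson M.openin_mtopology order.trans)
  have x0: "x0 \<in> points E" using U openin_subset by fastforce
  have near: "\<exists>a\<in>level m. nrm E (y - a) < e" if "y \<in> points E" "nrm E (y - x0) < r" "e > 0" for y e
  proof -
    have "y \<in> M.mball x0 r" using that x0 nrm_diff_commute[of y x0] by (simp add: norm_dist_def)
    then have "y \<in> ?T closure_of (level m)" using r by blast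
    then obtain a where "a \<in> level m" "a \<in> M.mball y e" using \<open>e > 0\<close> by (auto simp: M.metric_closure_of)
    then show ?thesis by (auto simp: norm_dist_def split: if_splits)
  qed
  define K where "K = 4 * real m / r + 1"
  have "\<exists>z\<in>points E. nrm E (x - z) < e \<and> (\<forall>F. finite F \<longrightarrow> nrm E (proj F z) \<le> K * nrm E x)"
    if x: "x \<in> points E" and e: "e > 0" for x e
  proof (cases "x = 0")
    case True
    then show ?thesis using e by (intro bexI[of _ 0]) (auto simp: lincomb_def)
  next
    case False
    then have nx: "nrm E x > 0" using nrm_nonneg[OF x] nrm_eq_0[OF x] by linarith
    \<comment> \<open>\<open>x\<close> is shrunk to length \<open>r / 2\<close> and moved into the ball around \<open>x0\<close>.\<close>
    define t where "t = r / (2 * nrm E x)"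
    have t: "t > 0" using r nx by (simp add: t_def)
    let ?y = "x0 + scale E (of_real t) x"
    have y: "?y \<in> points E" using x x0 by simp
    have "nrm E (?y - x0) = t * nrm E x" using nrm_scale[OF x, of "of_real t"] t by simp
    also have "\<dots> < r" using r nx by (simp add: t_def)
    finally obtain a1 where a1: "a1 \<in> level m" "nrm E (?y - a1) < e * t / 2"
      using near[OF y, of "e * t / 2"] e t by auto
    obtain a0 where a0: "a0 \<in> level m" "nrm E (x0 - a0) < e * t / 2"
      using near[OF x0, of "e * t / 2"] e t r by auto
    have ain: "a1 \<in> points E" "a0 \<in> points E" using a1 a0 by (auto simp: level_def)
    let ?z = "scale E (of_real (1 / t)) (a1 - a0)"
    have z: "?z \<in> points E" using ain by simp
    have "x - ?z = scale E (of_real (1 / t)) ((?y - a1) - (x0 - a0))"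
    proof -
      have "scale E (of_real (1 / t)) (scale E (of_real t) x) = x"
        using t by (simp flip: of_real_mult)
      moreover have "(?y - a1) - (x0 - a0) = scale E (of_real t) x - (a1 - a0)" by simp
      ultimately show ?thesis by (simp only: vs.scale_right_diff_distrib)
    qed
    moreover have "(?y - a1) - (x0 - a0) \<in> points E" using y x0 ain by (intro diff_in)
    ultimately have "nrm E (x - ?z) = norm (of_real (1 / t) :: 'k) * nrm E ((?y - a1) - (x0 - a0))"
      by (simp only: nrm_scale)
    also have "norm (of_real (1 / t) :: 'k) = 1 / t" using t by (simp only: norm_of_real) simp
    also have "nrm E ((?y - a1) - (x0 - a0)) < e * t"
      using nrm_diff_le[of "?y - a1" "x0 - a0"] y x0 ain a0(2) a1(2) by simp
    finally have "nrm E (x - ?z) < e" using t by (simp add: field_simps)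
    moreover have "nrm E (proj F ?z) \<le> K * nrm E x" if F: "finite F" for F
    proof -
      have "proj F ?z = scale E (of_real (1 / t)) (proj F a1 - proj F a0)"
        using ain by (simp only: proj_scale proj_diff diff_in)
      then have "nrm E (proj F ?z) = norm (of_real (1 / t) :: 'k) * nrm E (proj F a1 - proj F a0)"
        using ain by (simp only: nrm_scale diff_in proj_in)
      also have "norm (of_real (1 / t) :: 'k) = 1 / t" using t by (simp only: norm_of_real) simp
      finally have "nrm E (proj F ?z) = 1 / t * nrm E (proj F a1 - proj F a0)" .
      also have "nrm E (proj F a1 - proj F a0) \<le> nrm E (proj F a1) + nrm E (proj F a0)"
        using ain by (intro nrm_diff_le) auto
      also have "nrm E (proj F a1) + nrm E (proj F a0) \<le> real m + real m"
        using a1(1) a0(1) F by (intro add_mono) (auto simp: level_def)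
      also have "1 / t * (real m + real m) = 4 * real m / r * nrm E x" using r nx by (simp add: t_def field_simps)
      also have "\<dots> \<le> K * nrm E x" using nx by (intro mult_right_mono) (auto simp: K_def)
      finally show ?thesis using t by (simp only: zero_less_divide_1_iff less_imp_le mult_left_mono)
    qed
    ultimately show ?thesis using z by blast
  qed
  moreover have "K > 0" using r by (simp add: K_def add_nonneg_pos)
  ultimately show ?thesis by blast
qed

text \<open>The completeness argument of the open mapping theorem. Iterating \<open>approximation\<close> writes \<open>x\<close> as a
series of vectors \<open>z k\<close> whose partial sum projections decay geometrically. The coordinates of the
\<open>z k\<close> then add up to an expansion of \<open>x\<close>, which is the only one.\<close>

lemma projections_bounded: "\<exists>U>0. \<forall>x\<in>points E. \<forall>F. finite F \<longrightarrow> nrm E (proj F x) \<le> U * nrm E x"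
proof -
  obtain K where K: "K > 0" "\<And>x e. x \<in> points E \<Longrightarrow> e > 0 \<Longrightarrow> \<exists>z\<in>points E. nrm E (x - z) < e \<and>
     (\<forall>F. finite F \<longrightarrow> nrm E (proj F z) \<le> K * nrm E x)"
    using approximation by blast
  have "nrm E (proj F x) \<le> 2 * K * nrm E x" if x: "x \<in> points E" and F: "finite F" for x F
  proof (cases "x = 0")
    case True
    then show ?thesis by (simp add: lincomb_def)
  next
    case False
    then have nx: "nrm E x > 0" using nrm_nonneg[OF x] nrm_eq_0[OF x] by linarith
    obtain Z where Z: "\<And>x e. x \<in> points E \<Longrightarrow> e > 0 \<Longrightarrow> Z x e \<in> points E"
        "\<And>x e. x \<in> points E \<Longrightarrow> e > 0 \<Longrightarrow> nrm E (x - Z x e) < e"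
        "\<And>x e F. x \<in> points E \<Longrightarrow> e > 0 \<Longrightarrow> finite F \<Longrightarrow> nrm E (proj F (Z x e)) \<le> K * nrm E x"
      using K(2) by metis
    define X where "X = rec_nat x (\<lambda>k y. y - Z y (nrm E x * (1 / 2) ^ Suc k))"
    define z where "z k = Z (X k) (nrm E x * (1 / 2) ^ Suc k)" for k
    have e: "nrm E x * (1 / 2) ^ k > 0" for k using nx by simp
    have X0: "X 0 = x" and XS: "X (Suc k) = X k - z k" for k by (simp_all add: X_def z_def)
    have Xin: "X k \<in> points E" for k
    proof (induction k)
      case (Suc k)
      then show ?case unfolding XS z_def by (intro diff_in Z(1) e)
    qed (simp add: X0 x)
    have zin: "z k \<in> points E" for k unfolding z_def by (rule Z(1)[OF Xin e])
    have Xle: "nrm E (X k) \<le> nrm E x * (1 / 2) ^ k" for k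
    proof (cases k)
      case (Suc j)
      then show ?thesis using Z(2)[OF Xin[of j] e[of "Suc j"]] XS[of j] by (simp add: z_def)
    qed (simp add: X0)
    have zle: "nrm E (proj F (z k)) \<le> K * nrm E x * (1 / 2) ^ k" if "finite F" for F k
    proof -
      have "nrm E (proj F (z k)) \<le> K * nrm E (X k)" unfolding z_def by (rule Z(3)[OF Xin e that])
      also have "\<dots> \<le> K * (nrm E x * (1 / 2) ^ k)" using Xle K(1) by simp
      finally show ?thesis by simp
    qed
    have tele: "(\<Sum>k<n. z k) = x - X n" for n by (induction n) (simp_all add: X0 XS)
    define s where "s n = (\<Sum>k<n. z k)" for n
    have sin: "s n \<in> points E" for n unfolding s_def using zin by (intro sum_in)
    have coord_summable: "summable (\<lambda>k. coord (z k) b)" for b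
    proof (cases "b \<in> B")
      case True
      have le: "norm (coord (z k) b) \<le> K * nrm E x / nrm E b * (1 / 2) ^ k" for k
      proof -
        have "norm (coord (z k) b) * nrm E b = nrm E (proj {b} (z k))"
          using nrm_scale[OF basis_in[OF True]] by (simp add: lincomb_def)
        then have "norm (coord (z k) b) * nrm E b \<le> K * nrm E x * (1 / 2) ^ k" using zle[of "{b}" k] by simp
        then show ?thesis using basis_nonzero[OF True] by (simp add: field_simps)
      qed
      have "summable (\<lambda>k. K * nrm E x / nrm E b * (1 / 2 :: real) ^ k)"
        by (intro summable_mult summable_geometric) simp
      then show ?thesis by (rule summable_comparison_test'[of _ 0]) (rule le)
    next
      case False
      then show ?thesis using coord_outside[OF zin] by simp
    qed
    define a where "a b = (\<Sum>k. coord (z k) b)" for b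
    have a_out: "a b = 0" if "b \<notin> B" for b using coord_outside[OF zin that] by (simp add: a_def)
    have la: "lincomb a F \<in> points E" for F using a_out by (rule lincomb_in)
    have approx: "nrm E (lincomb a F - proj F (s n)) \<le> 2 * (K * nrm E x) * (1 / 2) ^ n" if F: "finite F" for F n
    proof -
      have ps: "proj F (s n) = (\<Sum>k<n. proj F (z k))" for n
        unfolding s_def using F zin by (intro proj_sum) auto
      obtain l where l: "l \<in> points E" "\<And>m. nrm E (l - proj F (s m)) \<le> 2 * (K * nrm E x) * (1 / 2) ^ m"
      proof -
        have "\<exists>l\<in>points E. \<forall>m. nrm E (l - (\<Sum>k<m. proj F (z k))) \<le> 2 * (K * nrm E x) * (1 / 2) ^ m"
          by (rule geometric_series) (rule proj_in[OF zin], rule zle[OF F])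
        then show thesis using that by (auto simp only: ps)
      qed
      have "lincomb a F = l"
      proof (rule limit_unique[of "\<lambda>n. proj F (s n)" sequentially])
        show "(\<lambda>i. nrm E (proj F (s i) - l)) \<longlonglongrightarrow> 0"
        proof (rule tendsto_zero_le)
          show "nrm E (proj F (s i) - l) \<le> 2 * (K * nrm E x) * (1 / 2) ^ i" for i
            using l(2)[of i] nrm_diff_commute[OF l(1) proj_in[OF sin]] by simp
          show "(\<lambda>i. 2 * (K * nrm E x) * (1 / 2) ^ i) \<longlonglongrightarrow> 0"
            by (intro tendsto_mult_right_zero LIMSEQ_power_zero) simp
          show "0 \<le> nrm E (proj F (s i) - l)" for i
            by (intro nrm_nonneg diff_in proj_in sin l(1))
        qed
        show "(\<lambda>i. nrm E (proj F (s i) - lincomb a F)) \<longlonglongrightarrow> 0"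
        proof (rule tendsto_zero_le)
          show "nrm E (proj F (s i) - lincomb a F) \<le> (\<Sum>b\<in>F \<inter> B. norm (coord (s i) b - a b) * nrm E b)" for i
          proof -
            have "proj F (s i) - lincomb a F = lincomb (\<lambda>b. coord (s i) b - a b) (F \<inter> B)"
              unfolding lincomb_diff[symmetric] using F a_out coord_outside[OF sin] by (intro lincomb_Int) auto
            then have "nrm E (proj F (s i) - lincomb a F) \<le> (\<Sum>b\<in>F \<inter> B. nrm E (scale E (coord (s i) b - a b) b))"
              unfolding lincomb_def using basis_in by (simp only:) (intro nrm_sum_le scale_in, auto)
            also have "\<dots> = (\<Sum>b\<in>F \<inter> B. norm (coord (s i) b - a b) * nrm E b)"
              using basis_in by (intro sum.cong) (auto simp: nrm_scale)
            finally show ?thesis .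
          qed
          have "(\<lambda>i. coord (s i) b) \<longlonglongrightarrow> a b" for b
            using summable_LIMSEQ[OF coord_summable[of b]] coord_sum[of _ z b] zin by (simp add: a_def s_def)
          then have "(\<lambda>i. \<Sum>b\<in>F \<inter> B. norm (coord (s i) b - a b) * nrm E b) \<longlonglongrightarrow> (\<Sum>b\<in>F \<inter> B. norm (a b - a b) * nrm E b)"
            by (intro tendsto_intros)
          then show "(\<lambda>i. \<Sum>b\<in>F \<inter> B. norm (coord (s i) b - a b) * nrm E b) \<longlonglongrightarrow> 0" by simp
          show "0 \<le> nrm E (proj F (s i) - lincomb a F)" for i
            by (intro nrm_nonneg diff_in proj_in sin la)
        qed
      qed (use l la sin in auto)
      then show ?thesis using l(2) by simp
    qed
    have "coord x = a"
    proof (rule coord_unique[OF x a_out])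
      show "((\<lambda>F. nrm E (lincomb a F - x)) \<longlongrightarrow> 0) (finite_subsets_at_top B)"
      proof (rule tendstoI)
        fix e :: real assume "0 < e"
        have "(\<lambda>n. (2 * (K * nrm E x) + nrm E x) * (1 / 2) ^ n) \<longlonglongrightarrow> 0"
          by (intro tendsto_mult_right_zero LIMSEQ_power_zero) simp
        then obtain n where n: "(2 * (K * nrm E x) + nrm E x) * (1 / 2) ^ n < e / 2"
          using order_tendstoD(2)[of _ 0 sequentially "e / 2"] \<open>0 < e\<close> by (auto simp: eventually_sequentially)
        have "\<forall>\<^sub>F F in finite_subsets_at_top B. nrm E (proj F (s n) - s n) < e / 2"
          using order_tendstoD(2)[OF proj_tendsto[OF sin], of "e / 2"] \<open>0 < e\<close> by simp
        moreover have "\<forall>\<^sub>F F in finite_subsets_at_top B. finite F"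
          by (rule eventually_finite_subsets_at_top_weakI)
        ultimately show "\<forall>\<^sub>F F in finite_subsets_at_top B. dist (nrm E (lincomb a F - x)) 0 < e"
        proof eventually_elim
          case (elim F)
          have "nrm E (lincomb a F - x) \<le> nrm E (lincomb a F - proj F (s n)) + nrm E (proj F (s n) - x)"
            using la sin x by (intro nrm_diff_triangle) auto
          also have "nrm E (proj F (s n) - x) \<le> nrm E (proj F (s n) - s n) + nrm E (s n - x)"
            using sin x by (intro nrm_diff_triangle) auto
          also have "nrm E (s n - x) \<le> nrm E x * (1 / 2) ^ n"
            using Xle[of n] nrm_minus[OF Xin[of n]] by (simp add: s_def tele)
          finally have "nrm E (lincomb a F - x) < e"
            using approx[OF elim(2), of n] elim(1) n by (simp add: distrib_right)
          then show ?case using la x by simp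
        qed
      qed
    qed
    then show ?thesis using approx[OF F, of 0] by (simp add: s_def lincomb_def)
  qed
  then show ?thesis using K(1) by (intro exI[of _ "2 * K"]) auto
qed

end

section \<open>Absolutely summing operators and the gliding hump\<close>

text \<open>The weak \<open>\<ell>\<^sub>1\<close> norm of the family \<open>x\<close> is at most \<open>W\<close>.\<close>

definition weakly_bounded ::
    "('k::real_or_complex, 'a::ab_group_add) normed_structure \<Rightarrow> 'i set \<Rightarrow> ('i \<Rightarrow> 'a) \<Rightarrow> real \<Rightarrow> bool" where
  "weakly_bounded X J x W \<longleftrightarrow> (\<forall>\<psi>. bounded_operator X scalars \<psi> \<longrightarrow> (\<forall>z\<in>points X. norm (\<psi> z :: 'k) \<le> nrm X z) \<longrightarrow>
     (\<Sum>j\<in>J. norm (\<psi> (x j))) \<le> W)"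

definition absolutely_summing ::
    "('k::real_or_complex, 'a::ab_group_add) normed_structure \<Rightarrow> ('k, 'b::ab_group_add) normed_structure \<Rightarrow> ('a \<Rightarrow> 'b) \<Rightarrow> bool" where
  "absolutely_summing X Y S \<longleftrightarrow> (\<exists>c. \<forall>k. \<forall>x :: nat \<Rightarrow> 'a. \<forall>W. (\<forall>j<k. x j \<in> points X) \<longrightarrow> weakly_bounded X {..<k} x W \<longrightarrow>
     (\<Sum>j<k. nrm Y (S (x j))) \<le> c * W)"

lemma operator_series:
  assumes X: "normed_space X" and Y: "banach_space Y"
    and T: "\<And>m. bounded_operator X Y (T m)"
    and le: "\<And>m x. x \<in> points X \<Longrightarrow> nrm Y (T m x) \<le> nrm X x * (1 / 2) ^ m"
  obtains S where "bounded_operator X Y S"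
    and "\<And>x m. x \<in> points X \<Longrightarrow> nrm Y (S x - (\<Sum>k<m. T k x)) \<le> 2 * nrm X x * (1 / 2) ^ m"
proof -
  interpret X: nspace X by (rule nspace.intro[OF X])
  interpret Y: bspace Y by (rule bspaceI[OF Y])
  have T_in: "T m x \<in> points Y" if "x \<in> points X" for m x
    using T[of m] that by (simp add: bounded_operator_def)
  have "\<forall>x. \<exists>l. x \<in> points X \<longrightarrow> l \<in> points Y \<and> (\<forall>m. nrm Y (l - (\<Sum>k<m. T k x)) \<le> 2 * nrm X x * (1 / 2) ^ m)"
  proof
    fix x
    show "\<exists>l. x \<in> points X \<longrightarrow> l \<in> points Y \<and> (\<forall>m. nrm Y (l - (\<Sum>k<m. T k x)) \<le> 2 * nrm X x * (1 / 2) ^ m)"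
    proof (cases "x \<in> points X")
      case True
      have "\<exists>l\<in>points Y. \<forall>m. nrm Y (l - (\<Sum>k<m. T k x)) \<le> 2 * nrm X x * (1 / 2) ^ m"
        by (rule Y.geometric_series) (rule T_in[OF True], rule le[OF True])
      then show ?thesis by blast
    qed simp
  qed
  then obtain S where S: "\<And>x. x \<in> points X \<Longrightarrow> S x \<in> points Y"
      "\<And>x m. x \<in> points X \<Longrightarrow> nrm Y (S x - (\<Sum>k<m. T k x)) \<le> 2 * nrm X x * (1 / 2) ^ m"
    by metis
  let ?s = "\<lambda>m x. \<Sum>k<m. T k x"
  have s_in: "?s m x \<in> points Y" if "x \<in> points X" for m x using T_in[OF that] by (rule Y.sum_in)
  have lim: "(\<lambda>m. nrm Y (?s m x - S x)) \<longlonglongrightarrow> 0" if x: "x \<in> points X" for x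
  proof (rule tendsto_zero_le)
    show "(\<lambda>m. 2 * nrm X x * (1 / 2) ^ m) \<longlonglongrightarrow> 0"
      by (intro tendsto_mult_right_zero LIMSEQ_power_zero) simp
    show "nrm Y (?s m x - S x) \<le> 2 * nrm X x * (1 / 2) ^ m" for m
      using S(2)[OF x, of m] Y.nrm_diff_commute[OF s_in[OF x, of m] S(1)[OF x]] by simp
    show "0 \<le> nrm Y (?s m x - S x)" for m
      by (intro Y.nrm_nonneg Y.diff_in s_in S x)
  qed
  have add: "S (x + y) = S x + S y" if x: "x \<in> points X" and y: "y \<in> points X" for x y
  proof (rule Y.limit_unique[of "\<lambda>m. ?s m (x + y)" sequentially])
    have seq: "?s m (x + y) = ?s m x + ?s m y" for m
      using T x y by (simp add: bounded_operator_def sum.distrib)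
    show "(\<lambda>m. nrm Y (?s m (x + y) - (S x + S y))) \<longlonglongrightarrow> 0"
    proof (rule tendsto_zero_le)
      show "(\<lambda>m. nrm Y (?s m x - S x) + nrm Y (?s m y - S y)) \<longlonglongrightarrow> 0"
        using tendsto_add[OF lim[OF x] lim[OF y]] by simp
      show "nrm Y (?s m (x + y) - (S x + S y)) \<le> nrm Y (?s m x - S x) + nrm Y (?s m y - S y)" for m
      proof -
        have "?s m (x + y) - (S x + S y) = (?s m x - S x) + (?s m y - S y)" by (simp add: seq)
        then show ?thesis using Y.nrm_triangle[OF Y.diff_in[OF s_in[OF x] S(1)[OF x]] Y.diff_in[OF s_in[OF y] S(1)[OF y]]] by (simp only:)
      qed
      show "0 \<le> nrm Y (?s m (x + y) - (S x + S y))" for m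
        using x y by (intro Y.nrm_nonneg Y.diff_in Y.add_in s_in S X.add_in)
    qed
  qed (use x y s_in S lim in auto)
  have scale: "S (scale X c x) = scale Y c (S x)" if x: "x \<in> points X" for x c
  proof (rule Y.limit_unique[of "\<lambda>m. ?s m (scale X c x)" sequentially])
    have seq: "?s m (scale X c x) = scale Y c (?s m x)" for m
      using T x by (simp add: bounded_operator_def Y.vs.scale_sum_right)
    have "nrm Y (?s m (scale X c x) - scale Y c (S x)) = norm c * nrm Y (?s m x - S x)" for m
      unfolding seq Y.vs.scale_right_diff_distrib[symmetric] using s_in S x by (intro Y.nrm_scale Y.diff_in)
    then show "(\<lambda>m. nrm Y (?s m (scale X c x) - scale Y c (S x))) \<longlonglongrightarrow> 0"
      using tendsto_mult_left[OF lim[OF x], of "norm c"] by simp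
  qed (use x s_in S lim in auto)
  have "bounded_operator X Y S"
    unfolding bounded_operator_def
  proof (intro conjI ballI allI)
    show "\<exists>C. \<forall>x\<in>points X. nrm Y (S x) \<le> C * nrm X x"
      using S(2)[of _ 0] by (intro exI[of _ 2]) simp
  qed (use S add scale in auto)
  then show thesis using S(2) that by blast
qed

text \<open>The linear situation to which the converse direction reduces.\<close>

locale operators = X: unconditional X B + Y: bspace Y
  for X :: "('k::real_or_complex, 'a::ab_group_add) normed_structure" and B
    and Y :: "('k, 'b::ab_group_add) normed_structure" +
  assumes all_summing: "\<And>S. bounded_operator X Y S \<Longrightarrow> absolutely_summing X Y S"
begin

definition block_op :: "'a set \<Rightarrow> ('a \<Rightarrow> 'b) \<Rightarrow> 'a \<Rightarrow> 'b" where
  "block_op F y x = (\<Sum>b\<in>F. scale Y (X.coord x b) (y b))"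

lemma block_op_in: "(\<And>b. b \<in> F \<Longrightarrow> y b \<in> points Y) \<Longrightarrow> block_op F y x \<in> points Y"
  unfolding block_op_def by (intro Y.sum_in) auto

lemma block_op_add:
  "x \<in> points X \<Longrightarrow> z \<in> points X \<Longrightarrow> block_op F y (x + z) = block_op F y x + block_op F y z"
  by (simp add: block_op_def X.coord_add Y.vs.scale_left_distrib sum.distrib)

lemma block_op_scale:
  "x \<in> points X \<Longrightarrow> block_op F y (scale X c x) = scale Y c (block_op F y x)"
  by (simp add: block_op_def X.coord_scale Y.vs.scale_sum_right)

text \<open>Data on which the summing inequality is to hold uniformly: an operator of norm at most 1 that factors
through the block \<open>F\<close> of the basis, and a family in the span of \<open>F\<close> of weak \<open>\<ell>\<^sub>1\<close> norm at most 1.\<close>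

definition admissible :: "'a set \<Rightarrow> ('a \<Rightarrow> 'b) \<Rightarrow> 'i set \<Rightarrow> ('i \<Rightarrow> 'a) \<Rightarrow> bool" where
  "admissible F y J x \<longleftrightarrow> finite J \<and> finite F \<and> F \<subseteq> B \<and> (\<forall>b\<in>F. y b \<in> points Y) \<and>
     (\<forall>z\<in>points X. nrm Y (block_op F y z) \<le> nrm X z) \<and>
     (\<forall>j\<in>J. x j \<in> points X \<and> (\<forall>b. b \<notin> F \<longrightarrow> X.coord (x j) b = 0)) \<and> weakly_bounded X J x 1"

text \<open>Otherwise there are pairwise disjoint blocks on which the summing inequality fails with constants
\<open>4 ^ m\<close>. Weighted by \<open>2 ^ (- m)\<close>, these block operators add up to a bounded operator. On the vectors of
block \<open>m\<close> it agrees with the term \<open>m\<close>, so it is not absolutely summing.\<close>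

lemma gliding_hump:
  "\<exists>K F0. finite F0 \<and> (\<forall>F y k x. admissible F y {..<k::nat} x \<longrightarrow> F \<inter> F0 = {} \<longrightarrow>
     (\<Sum>j<k. nrm Y (block_op F y (x j))) \<le> K)"
proof -
  define bad where "bad F0 K q \<longleftrightarrow> (case q of (F, y, k, x) \<Rightarrow> admissible F y {..<k::nat} x \<and> F \<inter> F0 = {} \<and>
     (\<Sum>j<k. nrm Y (block_op F y (x j))) > K)" for F0 K q
  have "\<exists>K F0. finite F0 \<and> (\<forall>q. \<not> bad F0 K q)"
  proof (rule ccontr)
    assume contra: "\<not> (\<exists>K F0. finite F0 \<and> (\<forall>q. \<not> bad F0 K q))"
    have p: "bad F0 K (SOME q. bad F0 K q)" if "finite F0" for F0 K
      by (rule someI_ex) (use that contra in blast)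
    define p where "p F0 K = (SOME q. bad F0 K q)" for F0 K
    have p: "case p F0 K of (F, y, k, x) \<Rightarrow> admissible F y {..<k::nat} x \<and> F \<inter> F0 = {} \<and>
       (\<Sum>j<k. nrm Y (block_op F y (x j))) > K" if "finite F0" for F0 K
      using p[OF that] unfolding p_def bad_def .
    define G where "G = rec_nat {} (\<lambda>m G. G \<union> fst (p G (4 ^ m)))"
    have G0: "G 0 = {}" and GS: "G (Suc m) = G m \<union> fst (p (G m) (4 ^ m))" for m
      by (simp_all add: G_def)
    define F where "F m = fst (p (G m) (4 ^ m))" for m
    define y where "y m = fst (snd (p (G m) (4 ^ m)))" for m
    define k where "k m = fst (snd (snd (p (G m) (4 ^ m))))" for m
    define x where "x m = snd (snd (snd (p (G m) (4 ^ m))))" for m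
    have finG: "finite (G m)" for m
    proof (induction m)
      case (Suc m)
      then show ?case using p[OF Suc, of "4 ^ m"] unfolding GS by (auto simp: admissible_def split: prod.splits)
    qed (simp add: G0)
    have adm: "admissible (F m) (y m) {..<k m} (x m)" and disj: "F m \<inter> G m = {}"
      and large: "(\<Sum>j<k m. nrm Y (block_op (F m) (y m) (x m j))) > 4 ^ m" for m
      using p[OF finG, of m "4 ^ m"] by (auto simp: F_def y_def k_def x_def split: prod.splits)
    have sub: "F l \<subseteq> G m" if "l < m" for l m
      using that by (induction m) (auto simp: less_Suc_eq GS F_def)
    have disjF: "F l \<inter> F m = {}" if "l \<noteq> m" for l m
      using that sub[of l m] sub[of m l] disj[of l] disj[of m] by (cases l m rule: linorder_cases) auto
    define T where "T m z = scale Y (of_real ((1 / 2) ^ m)) (block_op (F m) (y m) z)" for m z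
    have blk_in: "block_op (F m) (y m) z \<in> points Y" for m z
      using adm[of m] by (intro block_op_in) (auto simp: admissible_def)
    have T_nrm: "nrm Y (T m z) = (1 / 2) ^ m * nrm Y (block_op (F m) (y m) z)" for m z
      unfolding T_def using Y.nrm_scale[OF blk_in, of "of_real ((1 / 2) ^ m)"] by (simp add: norm_power)
    have T_le: "nrm Y (T m z) \<le> nrm X z * (1 / 2) ^ m" if "z \<in> points X" for m z
      unfolding T_nrm using adm[of m] that by (simp add: admissible_def mult.commute)
    have T_op: "bounded_operator X Y (T m)" for m
      unfolding bounded_operator_def
    proof (intro conjI ballI allI)
      show "\<exists>C. \<forall>z\<in>points X. nrm Y (T m z) \<le> C * nrm X z"
        using T_le by (intro exI[of _ "(1 / 2) ^ m"]) (simp add: mult.commute)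
    qed (simp_all add: T_def blk_in block_op_add block_op_scale Y.vs.scale_right_distrib mult.commute)
    obtain S where S: "bounded_operator X Y S"
        and S_le: "\<And>z m. z \<in> points X \<Longrightarrow> nrm Y (S z - (\<Sum>l<m. T l z)) \<le> 2 * nrm X z * (1 / 2) ^ m"
      using operator_series[OF X.normed Y.banach T_op T_le] by blast
    have S_eq: "S z = T m z" if z: "z \<in> points X" "\<And>b. b \<notin> F m \<Longrightarrow> X.coord z b = 0" for z m
    proof -
      have T0: "T l z = 0" if "l \<noteq> m" for l
      proof -
        have "X.coord z b = 0" if "b \<in> F l" for b using z(2)[of b] disjF[OF \<open>l \<noteq> m\<close>] that by blast
        then show ?thesis by (simp add: T_def block_op_def)
      qed
      have Sz: "S z \<in> points Y" "T m z \<in> points Y"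
        using S T_op[of m] z(1) by (auto simp: bounded_operator_def)
      have "nrm Y (S z - T m z) \<le> 2 * nrm X z * (1 / 2) ^ (n + Suc m)" for n
      proof -
        have "(\<Sum>l<n + Suc m. T l z) = (\<Sum>l\<in>{m}. T l z)"
          using T0 by (intro sum.mono_neutral_right) auto
        then show ?thesis using S_le[OF z(1), of "n + Suc m"] by simp
      qed
      moreover have "(\<lambda>n. 2 * nrm X z * (1 / 2) ^ (n + Suc m)) \<longlonglongrightarrow> 0"
        by (rule LIMSEQ_ignore_initial_segment[of "\<lambda>n. 2 * nrm X z * (1 / 2) ^ n"])
          (intro tendsto_mult_right_zero LIMSEQ_power_zero, simp)
      ultimately have "nrm Y (S z - T m z) \<le> 0"
        by (intro LIMSEQ_le_const) auto
      moreover have Sz': "S z - T m z \<in> points Y" using Sz by (rule Y.diff_in)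
      ultimately have "nrm Y (S z - T m z) = 0" using Y.nrm_nonneg[OF Sz'] by simp
      then have "S z - T m z = 0" using Y.nrm_eq_0[OF Sz'] by simp
      then show ?thesis by simp
    qed
    obtain c where c: "\<forall>k. \<forall>x :: nat \<Rightarrow> 'a. \<forall>W. (\<forall>j<k. x j \<in> points X) \<longrightarrow> weakly_bounded X {..<k} x W \<longrightarrow>
       (\<Sum>j<k. nrm Y (S (x j))) \<le> c * W"
      using all_summing[OF S] unfolding absolutely_summing_def by (elim exE)
    have "2 ^ m \<le> c" for m
    proof -
      have "(\<Sum>j<k m. nrm Y (S (x m j))) \<le> c * 1"
        using adm[of m] by (intro c[rule_format]) (auto simp: admissible_def)
      moreover have "(\<Sum>j<k m. nrm Y (S (x m j))) = (1 / 2) ^ m * (\<Sum>j<k m. nrm Y (block_op (F m) (y m) (x m j)))"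
        unfolding sum_distrib_left T_nrm[symmetric] using adm[of m]
        by (intro sum.cong refl arg_cong[of _ _ "nrm Y"] S_eq) (auto simp: admissible_def)
      moreover have "(1 / 2) ^ m * 4 ^ m \<le> (1 / 2) ^ m * (\<Sum>j<k m. nrm Y (block_op (F m) (y m) (x m j)))"
        using large[of m] by (intro mult_left_mono) auto
      moreover have "(1 / 2 :: real) ^ m * 4 ^ m = 2 ^ m" by (simp flip: power_mult_distrib)
      ultimately show ?thesis by linarith
    qed
    moreover obtain m where "c < 2 ^ m" using real_arch_pow[of 2 c] by auto
    ultimately show False by (meson not_le)
  qed
  then obtain K F0 where "finite F0" and K: "\<forall>q. \<not> bad F0 K q" by blast
  moreover have "(\<Sum>j<k. nrm Y (block_op F y (x j))) \<le> K" if "admissible F y {..<k::nat} x" "F \<inter> F0 = {}" for F y k x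
    using K[rule_format, of "(F, y, k, x)"] that by (simp add: bad_def)
  ultimately show ?thesis by blast
qed

end

lemma weakly_bounded_reindex:
  assumes "bij_betw h I J"
  shows "weakly_bounded X I (\<lambda>i. x (h i)) W \<longleftrightarrow> weakly_bounded X J x W"
  unfolding weakly_bounded_def using sum.reindex_bij_betw[OF assms] by (metis (no_types, lifting) sum.cong)

lemma (in nspace) independent_sequence:
  assumes inf: "infinite_dimensional E"
  obtains z :: "nat \<Rightarrow> 'a" where "\<And>n. z n \<in> points E"
    and "\<And>N c. (\<Sum>i<N. scale E (c i) (z i)) = 0 \<Longrightarrow> \<forall>i<N. c i = 0"
proof -
  have "\<exists>z. z \<in> points E \<and> z \<notin> vs.span S" if "finite S" "S \<subseteq> points E" for S
  proof -
    have "vs.span S \<subseteq> points E" using vs.span_minimal[OF that(2) subspace] .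
    moreover have "points E \<noteq> vs.span S" using inf that(1) by (auto simp: infinite_dimensional_def)
    ultimately show ?thesis by blast
  qed
  then obtain w where w: "\<And>S. finite S \<Longrightarrow> S \<subseteq> points E \<Longrightarrow> w S \<in> points E \<and> w S \<notin> vs.span S" by metis
  define S where "S = rec_nat {} (\<lambda>_ S. insert (w S) S)"
  have S0: "S 0 = {}" and SS: "S (Suc n) = insert (w (S n)) (S n)" for n by (simp_all add: S_def)
  have S: "finite (S n) \<and> S n \<subseteq> points E" for n
    by (induction n) (use w in \<open>auto simp: S0 SS\<close>)
  define z where "z n = w (S n)" for n
  have z: "z n \<in> points E" "z n \<notin> vs.span (S n)" for n using w S by (auto simp: z_def)
  have z_S: "z i \<in> S N" if "i < N" for i N
    using that by (induction N) (auto simp: SS z_def less_Suc_eq)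
  have "(\<Sum>i<N. scale E (c i) (z i)) = 0 \<Longrightarrow> \<forall>i<N. c i = 0" for N c
  proof (induction N)
    case (Suc N)
    have "c N = 0"
    proof (rule ccontr)
      assume c: "c N \<noteq> 0"
      have "scale E (c N) (z N) = - (\<Sum>i<N. scale E (c i) (z i))" using Suc.prems by (simp add: eq_neg_iff_add_eq_0 add.commute)
      moreover have "- (\<Sum>i<N. scale E (c i) (z i)) \<in> vs.span (S N)"
        using z_S by (intro vs.span_neg vs.span_sum vs.span_scale vs.span_base) auto
      ultimately have "scale E (inverse (c N)) (scale E (c N) (z N)) \<in> vs.span (S N)"
        by (metis vs.span_scale)
      then show False using z(2)[of N] c by simp
    qed
    then show ?case using Suc by (auto simp: less_Suc_eq)
  qed simp
  then show thesis using z(1) that by blast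
qed

text \<open>The real version is applied to the real span of a linearly independent sequence; splitting the
coefficients into real and imaginary parts doubles the constant 8.\<close>

lemma (in nspace) dvoretzky_rogers_vectors:
  assumes inf: "infinite_dimensional E" and "finite I"
  shows "\<exists>y :: 'i \<Rightarrow> 'a. (\<forall>i\<in>I. y i \<in> points E \<and> 1 \<le> nrm E (y i)) \<and>
     (\<forall>t. nrm E (\<Sum>i\<in>I. scale E (t i) (y i)) \<le> 16 * sqrt (\<Sum>i\<in>I. (norm (t i))\<^sup>2))"
proof -
  obtain z :: "nat \<Rightarrow> 'a" where z: "\<And>n. z n \<in> points E"
    and indep: "\<And>N c. (\<Sum>i<N. scale E (c i) (z i)) = 0 \<Longrightarrow> \<forall>i<N. c i = 0"
    using independent_sequence[OF inf] by blast
  obtain N where N: "\<And>\<nu>. finite_dim_norm N \<nu> \<Longrightarrow>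
     (\<exists>u. (\<forall>i<card I. 1 \<le> \<nu> (u i)) \<and>
          (\<forall>t. \<nu> (\<lambda>k. \<Sum>i<card I. t i * u i k) \<le> 8 * sqrt (\<Sum>i<card I. (t i)^2)))"
    using dvoretzky_rogers by blast
  define v where "v t = (\<Sum>i<N. scale E (of_real (t i)) (z i))" for t
  have v_in: "v t \<in> points E" for t unfolding v_def using z by (intro sum_in) auto
  have v_add: "v (\<lambda>i. s i + t i) = v s + v t" for s t
    by (simp add: v_def vs.scale_left_distrib sum.distrib)
  have v_scale: "v (\<lambda>i. c * t i) = scale E (of_real c) (v t)" for c t
    by (simp add: v_def vs.scale_sum_right)
  have v_zero: "v (\<lambda>_. 0) = 0" by (simp add: v_def)
  have v_sum: "v (\<lambda>k. \<Sum>i\<in>J. t i * u i k) = (\<Sum>i\<in>J. scale E (of_real (t i)) (v (u i)))" if "finite J" for t u and J :: "nat set"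
    using that by (induction J rule: finite_induct) (simp_all add: v_zero v_add v_scale)
  have "finite_dim_norm N (\<lambda>t. nrm E (v t))"
  proof
    fix s t :: "nat \<Rightarrow> real" and c i
    show "nrm E (v (\<lambda>i. s i + t i)) \<le> nrm E (v s) + nrm E (v t)"
      unfolding v_add by (intro nrm_triangle v_in)
    show "nrm E (v (\<lambda>i. c * t i)) = \<bar>c\<bar> * nrm E (v t)"
      unfolding v_scale using nrm_scale[OF v_in, of "of_real c"] by simp
    show "(\<And>i. i < N \<Longrightarrow> s i = t i) \<Longrightarrow> nrm E (v s) = nrm E (v t)" by (simp add: v_def)
    show "nrm E (v t) = 0 \<Longrightarrow> i < N \<Longrightarrow> t i = 0"
      using indep[where N=N and c="\<lambda>i. of_real (t i)"] nrm_eq_0[OF v_in, of t] by (simp add: v_def)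
  qed
  from N[OF this] obtain u where u: "\<And>i. i < card I \<Longrightarrow> 1 \<le> nrm E (v (u i))"
      "\<And>t. nrm E (v (\<lambda>k. \<Sum>i<card I. t i * u i k)) \<le> 8 * sqrt (\<Sum>i<card I. (t i)^2)" by blast
  obtain h where h: "bij_betw h I {..<card I}"
    using ex_bij_betw_finite_nat[OF \<open>finite I\<close>] by (auto simp: atLeast0LessThan)
  define y where "y i = v (u (h i))" for i
  have y_in: "y i \<in> points E" for i by (simp add: y_def v_in)
  have real: "nrm E (\<Sum>i\<in>I. scale E (of_real (t i)) (y i)) \<le> 8 * sqrt (\<Sum>i\<in>I. (t i)\<^sup>2)" for t
  proof -
    define s where "s j = t (inv_into I h j)" for j
    have st: "s (h i) = t i" if "i \<in> I" for i
      using h that by (simp add: s_def bij_betw_def)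
    have "(\<Sum>i\<in>I. scale E (of_real (t i)) (y i)) = (\<Sum>j<card I. scale E (of_real (s j)) (v (u j)))"
      unfolding sum.reindex_bij_betw[OF h, symmetric] by (intro sum.cong) (simp_all add: st y_def)
    moreover have "(\<Sum>i\<in>I. (t i)\<^sup>2) = (\<Sum>j<card I. (s j)\<^sup>2)"
      unfolding sum.reindex_bij_betw[OF h, symmetric] by (intro sum.cong) (simp_all add: st)
    ultimately show ?thesis using u(2)[of s] by (simp add: v_sum)
  qed
  have "nrm E (\<Sum>i\<in>I. scale E (t i) (y i)) \<le> 16 * sqrt (\<Sum>i\<in>I. (norm (t i))\<^sup>2)" for t
  proof -
    let ?r = "\<Sum>i\<in>I. scale E (of_real (kre (t i))) (y i)" and ?m = "\<Sum>i\<in>I. scale E (of_real (kim (t i))) (y i)"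
    have in': "?r \<in> points E" "?m \<in> points E" using y_in by (auto intro!: sum_in)
    have "(\<Sum>i\<in>I. scale E (t i) (y i)) = (\<Sum>i\<in>I. scale E (of_real (kre (t i)) + kiota * of_real (kim (t i))) (y i))"
      by (simp only: scalar_decomposition[symmetric])
    also have "\<dots> = ?r + scale E kiota ?m"
      by (simp add: vs.scale_left_distrib sum.distrib vs.scale_sum_right)
    finally have "nrm E (\<Sum>i\<in>I. scale E (t i) (y i)) \<le> nrm E ?r + norm (kiota :: 'k) * nrm E ?m"
      using nrm_triangle[of ?r "scale E kiota ?m"] in' by (simp add: nrm_scale)
    also have "\<dots> \<le> nrm E ?r + 1 * nrm E ?m"
      using norm_kiota_le in' by (intro add_left_mono mult_right_mono) auto
    also have "nrm E ?r \<le> 8 * sqrt (\<Sum>i\<in>I. (kre (t i))\<^sup>2)" by (rule real)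
    also have "nrm E ?m \<le> 8 * sqrt (\<Sum>i\<in>I. (kim (t i))\<^sup>2)" by (rule real)
    also have "sqrt (\<Sum>i\<in>I. (kre (t i))\<^sup>2) \<le> sqrt (\<Sum>i\<in>I. (norm (t i))\<^sup>2)"
      using abs_kre_le by (intro real_sqrt_le_mono sum_mono) (simp add: norm_scalar_square)
    also have "sqrt (\<Sum>i\<in>I. (kim (t i))\<^sup>2) \<le> sqrt (\<Sum>i\<in>I. (norm (t i))\<^sup>2)"
      using abs_kim_le by (intro real_sqrt_le_mono sum_mono) (simp add: norm_scalar_square)
    finally show ?thesis by simp
  qed
  moreover have "1 \<le> nrm E (y i)" if "i \<in> I" for i
    using u(1)[of "h i"] h that by (auto simp: y_def bij_betw_def)
  ultimately show ?thesis using y_in by blast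
qed

section \<open>Unconditional bases equivalent to the basis of \<open>\<ell>\<^sub>1\<close>\<close>

context operators
begin

lemma block_summing:
  "\<exists>K>0. \<exists>F0. finite F0 \<and> (\<forall>F y (J :: 'i set) x. admissible F y J x \<longrightarrow> F \<inter> F0 = {} \<longrightarrow>
     (\<Sum>j\<in>J. nrm Y (block_op F y (x j))) \<le> K)"
proof -
  obtain K F0 where F0: "finite F0"
    and K: "\<forall>F y k x. admissible F y {..<k::nat} x \<longrightarrow> F \<inter> F0 = {} \<longrightarrow> (\<Sum>j<k. nrm Y (block_op F y (x j))) \<le> K"
    using gliding_hump by (elim exE conjE)
  have "(\<Sum>j\<in>J. nrm Y (block_op F y (x j))) \<le> \<bar>K\<bar> + 1"
    if adm: "admissible F y J x" and disj: "F \<inter> F0 = {}" for F y x and J :: "'i set"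
  proof -
    have "finite J" using adm by (simp add: admissible_def)
    then obtain h where h: "bij_betw h {..<card J} J"
      using ex_bij_betw_nat_finite by (auto simp: atLeast0LessThan)
    then have hJ: "h j \<in> J" if "j < card J" for j using that by (auto simp: bij_betw_def)
    have "admissible F y {..<card J} (\<lambda>j. x (h j))"
      using adm hJ weakly_bounded_reindex[OF h, of X x 1] by (simp add: admissible_def)
    then have "(\<Sum>j<card J. nrm Y (block_op F y (x (h j)))) \<le> K" using K disj by simp
    also have "(\<Sum>j<card J. nrm Y (block_op F y (x (h j)))) = (\<Sum>j\<in>J. nrm Y (block_op F y (x j)))"
      by (rule sum.reindex_bij_betw[OF h])
    finally show ?thesis by simp
  qed
  then show ?thesis using F0 by (intro exI[of _ "\<bar>K\<bar> + 1"] conjI exI[of _ F0]) auto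
qed

text \<open>Away from the exceptional block \<open>F0\<close> of the gliding hump, the best constant \<open>s\<close> for a block satisfies
\<open>s \<le> 64 U K \<surd>(U s)\<close>, where \<open>U\<close> bounds the projections and \<open>K\<close> is the uniform summing constant. The finitely many
coordinates in \<open>F0\<close> are bounded one by one.\<close>

lemma ell1_estimate:
  assumes inf: "infinite_dimensional Y"
  shows "\<exists>C>0. \<forall>x\<in>points X. \<forall>F. finite F \<longrightarrow> F \<subseteq> B \<longrightarrow>
    (\<Sum>b\<in>F. norm (X.coord x b) * nrm X b) \<le> C * nrm X x"
proof -
  obtain U where U: "U > 0" "\<And>x F. x \<in> points X \<Longrightarrow> finite F \<Longrightarrow> nrm X (X.proj F x) \<le> U * nrm X x"
    using X.projections_bounded by blast
  have single: "norm (X.coord x b) * nrm X b \<le> U * nrm X x" if "x \<in> points X" "b \<in> B" for x b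
    using U(2)[OF that(1), of "{b}"] X.nrm_scale[OF X.basis_in[OF that(2)]] by (simp add: X.lincomb_def)
  obtain K F0 where K: "0 < K" and F0: "finite F0"
    and summing: "\<forall>F y (J :: 'a set) x. admissible F y J x \<longrightarrow> F \<inter> F0 = {} \<longrightarrow>
      (\<Sum>j\<in>J. nrm Y (block_op F y (x j))) \<le> K"
    using block_summing by (elim exE conjE)
  let ?\<sigma> = "\<lambda>F x. \<Sum>b\<in>F. norm (X.coord x b) * nrm X b"
  define C where "C = (64 * U * K)\<^sup>2 * U"
  have away: "?\<sigma> F x \<le> C * nrm X x" if F: "finite F" "F \<subseteq> B" "F \<inter> F0 = {}" and x: "x \<in> points X" for F x
  proof -
    have nb: "0 < nrm X b" "b \<in> points X" if "b \<in> F" for b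
      using that F X.basis_in X.basis_nonzero by auto
    have \<sigma>_nonneg: "0 \<le> ?\<sigma> F x" for x using nb by (intro sum_nonneg mult_nonneg_nonneg) (auto intro: less_imp_le)
    have \<sigma>_scale: "?\<sigma> F (scale X (of_real r) x) = \<bar>r\<bar> * ?\<sigma> F x" if "x \<in> points X" for r x
      using that by (simp add: X.coord_scale norm_mult sum_distrib_left mult.assoc)
    let ?S = "?\<sigma> F ` {x \<in> points X. nrm X x \<le> 1}"
    define s where "s = Sup ?S"
    have bdd: "bdd_above ?S"
    proof (rule bdd_aboveI2)
      fix x assume "x \<in> {x \<in> points X. nrm X x \<le> 1}"
      then have x: "x \<in> points X" "nrm X x \<le> 1" by auto
      have "?\<sigma> F x \<le> (\<Sum>b\<in>F. U)"
      proof (rule sum_mono)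
        fix b assume "b \<in> F"
        then have "norm (X.coord x b) * nrm X b \<le> U * nrm X x" using F by (intro single x) auto
        also have "\<dots> \<le> U" using x(2) U(1) by (simp add: mult_left_le)
        finally show "norm (X.coord x b) * nrm X b \<le> U" .
      qed
      then show "?\<sigma> F x \<le> real (card F) * U" by simp
    qed
    have s_upper: "?\<sigma> F x \<le> s" if "x \<in> points X" "nrm X x \<le> 1" for x
      unfolding s_def by (rule cSup_upper[OF _ bdd]) (use that in auto)
    have s_nonneg: "0 \<le> s" using s_upper[of 0] by simp
    have \<sigma>_le: "?\<sigma> F x \<le> s * nrm X x" if x: "x \<in> points X" for x
    proof (cases "x = 0")
      case False
      then have n: "0 < nrm X x" using X.nrm_nonneg[OF x] X.nrm_eq_0[OF x] by linarith
      have "nrm X (scale X (of_real (1 / nrm X x)) x) = norm (of_real (1 / nrm X x) :: 'k) * nrm X x"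
        by (rule X.nrm_scale[OF x])
      also have "\<dots> = 1" using n by (simp only: norm_of_real) simp
      finally have "?\<sigma> F (scale X (of_real (1 / nrm X x)) x) \<le> s" using x by (intro s_upper) auto
      then have "\<bar>1 / nrm X x\<bar> * ?\<sigma> F x \<le> s" unfolding \<sigma>_scale[OF x] .
      then show ?thesis using n by (simp add: field_simps)
    qed simp
    have "s \<le> C"
    proof (cases "s = 0")
      case True
      then show ?thesis using U(1) by (simp add: C_def)
    next
      case False
      then have s: "0 < s" using s_nonneg by simp
      obtain y where y: "\<And>b. b \<in> F \<Longrightarrow> y b \<in> points Y" "\<And>b. b \<in> F \<Longrightarrow> 1 \<le> nrm Y (y b)"
        "\<And>t. nrm Y (\<Sum>b\<in>F. scale Y (t b) (y b)) \<le> 16 * sqrt (\<Sum>b\<in>F. (norm (t b))\<^sup>2)"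
        using Y.dvoretzky_rogers_vectors[OF inf F(1)] by blast
      \<comment> \<open>\<open>q\<close> is a bound for the norm of the operator that sends the normalised basis to \<open>y\<close>.\<close>
      define q where "q = 16 * sqrt (U * s)"
      have q: "0 < q" using U(1) s by (simp add: q_def)
      define y' where "y' b = scale Y (of_real (nrm X b / q)) (y b)" for b
      have op_le: "nrm Y (block_op F y' z) \<le> nrm X z" if z: "z \<in> points X" for z
      proof -
        have "block_op F y' z = (\<Sum>b\<in>F. scale Y (X.coord z b * of_real (nrm X b / q)) (y b))"
          by (simp add: block_op_def y'_def)
        also have "nrm Y \<dots> \<le> 16 * sqrt (\<Sum>b\<in>F. (norm (X.coord z b * of_real (nrm X b / q)))\<^sup>2)" by (rule y(3))
        also have "(\<Sum>b\<in>F. (norm (X.coord z b * of_real (nrm X b / q)))\<^sup>2) = (\<Sum>b\<in>F. (norm (X.coord z b) * nrm X b)\<^sup>2) / q\<^sup>2"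
          unfolding sum_divide_distrib using nb q
          by (intro sum.cong refl) (simp add: norm_mult power_mult_distrib power_divide abs_of_pos del: of_real_divide)
        also have "(\<Sum>b\<in>F. (norm (X.coord z b) * nrm X b)\<^sup>2) \<le> (\<Sum>b\<in>F. (U * nrm X z) * (norm (X.coord z b) * nrm X b))"
          unfolding power2_eq_square using nb F z
          by (intro sum_mono mult_right_mono single mult_nonneg_nonneg) (auto intro: less_imp_le)
        also have "\<dots> \<le> (U * nrm X z) * (s * nrm X z)"
          unfolding sum_distrib_left[symmetric] using \<sigma>_le[OF z] U(1) z by (intro mult_left_mono) auto
        also have "16 * sqrt ((U * nrm X z) * (s * nrm X z) / q\<^sup>2) = nrm X z"
        proof -
          have "(U * nrm X z) * (s * nrm X z) / q\<^sup>2 = (nrm X z / 16)\<^sup>2"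
            using U(1) s by (simp add: q_def power2_eq_square field_simps)
          then show ?thesis using z by simp
        qed
        finally show ?thesis using q by (simp add: divide_right_mono)
      qed
      have "?\<sigma> F x \<le> 4 * U * q * K" if x: "x \<in> points X" "nrm X x \<le> 1" for x
      proof -
        \<comment> \<open>This factor brings the weak norm of the vectors \<open>coord x b \<cdot> b\<close> down to 1.\<close>
        define r where "r = 1 / (4 * U)"
        have r: "0 < r" using U(1) by (simp add: r_def)
        define w where "w b = scale X (of_real r * X.coord x b) b" for b
        have "weakly_bounded X F w 1"
          unfolding weakly_bounded_def
        proof (intro allI impI)
          fix \<psi> :: "'a \<Rightarrow> 'k"
          assume \<psi>: "bounded_operator X scalars \<psi>" "\<forall>z\<in>points X. norm (\<psi> z) \<le> nrm X z"
          interpret \<psi>: bounded_op X scalars \<psi>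
            by (rule bounded_opI[OF X.normed normed_space_scalars \<psi>(1)])
          have "\<psi> (w b) = of_real r * \<psi> (scale X (X.coord x b) b)" if "b \<in> F" for b
            using nb[OF that] by (simp add: w_def \<psi>.scale mult.assoc)
          then have "(\<Sum>b\<in>F. norm (\<psi> (w b))) = r * (\<Sum>b\<in>F. norm (\<psi> (scale X (X.coord x b) b)))"
            using r by (simp add: norm_mult sum_distrib_left)
          also have "(\<Sum>b\<in>F. norm (\<psi> (scale X (X.coord x b) b))) \<le> 4 * U"
          proof (rule sum_norm_le_subset_sums[OF F(1)])
            fix G assume G: "G \<subseteq> F"
            have "(\<Sum>b\<in>G. \<psi> (scale X (X.coord x b) b)) = \<psi> (X.proj G x)"
              unfolding X.lincomb_def using nb G by (intro \<psi>.sum[symmetric]) auto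
            also have "norm \<dots> \<le> nrm X (X.proj G x)" using \<psi>(2) x by simp
            also have "\<dots> \<le> U * nrm X x" using G F(1) by (intro U(2) x) (auto intro: finite_subset)
            also have "\<dots> \<le> U" using x(2) U(1) by (simp add: mult_left_le)
            finally show "norm (\<Sum>b\<in>G. \<psi> (scale X (X.coord x b) b)) \<le> U" .
          qed
          finally show "(\<Sum>b\<in>F. norm (\<psi> (w b))) \<le> 1" using r U(1) by (simp add: r_def divide_right_mono)
        qed
        moreover have w_coord: "X.coord (w b) = (\<lambda>c. of_real r * X.coord x b * (if c = b then 1 else 0))" if "b \<in> F" for b
        proof -
          have "b \<in> B" using that F(2) by blast
          then show ?thesis unfolding w_def X.coord_scale[OF nb(2)[OF that]] by (simp add: X.coord_basis)
        qed
        ultimately have "admissible F y' F w"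
          unfolding admissible_def using F y nb op_le by (auto simp: y'_def w_def)
        then have "(\<Sum>b\<in>F. nrm Y (block_op F y' (w b))) \<le> K" using summing F(3) by simp
        moreover have "r / q * (norm (X.coord x b) * nrm X b) \<le> nrm Y (block_op F y' (w b))" if b: "b \<in> F" for b
        proof -
          have "block_op F y' (w b) = (\<Sum>c\<in>F. if c = b then scale Y (of_real r * X.coord x b) (y' b) else 0)"
            unfolding block_op_def w_coord[OF b] by (intro sum.cong) auto
          also have "\<dots> = scale Y (of_real r * X.coord x b * of_real (nrm X b / q)) (y b)"
            using b F(1) by (simp add: y'_def)
          finally have "nrm Y (block_op F y' (w b)) = norm (of_real r * X.coord x b * of_real (nrm X b / q)) * nrm Y (y b)"
            using y(1)[OF b] by (simp add: Y.nrm_scale del: of_real_divide)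
          also have "norm (of_real r * X.coord x b * of_real (nrm X b / q)) = r / q * (norm (X.coord x b) * nrm X b)"
            using r q nb[OF b] by (simp add: norm_mult abs_of_pos del: of_real_divide)
          finally show ?thesis
            using y(2)[OF b] r q nb[OF b] mult_left_mono[OF y(2)[OF b], of "r / q * (norm (X.coord x b) * nrm X b)"] by simp
        qed
        ultimately have "r / q * ?\<sigma> F x \<le> K"
          unfolding sum_distrib_left by (meson order.trans sum_mono)
        then show ?thesis using r q U(1) by (simp add: r_def field_simps)
      qed
      then have "s \<le> 4 * U * q * K"
        unfolding s_def by (intro cSup_least) (auto intro: exI[of _ 0] simp: image_iff)
      then have "s \<le> 64 * U * K * sqrt U * sqrt s" by (simp add: q_def real_sqrt_mult mult_ac)
      then have "sqrt s * sqrt s \<le> (64 * U * K * sqrt U) * sqrt s" using s by simp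
      then have "sqrt s \<le> 64 * U * K * sqrt U" using s by (simp only: mult_le_cancel_right real_sqrt_gt_0_iff)
      then have "(sqrt s)\<^sup>2 \<le> (64 * U * K * sqrt U)\<^sup>2" using s by (intro power_mono) auto
      then show ?thesis using s U(1) by (simp add: C_def power_mult_distrib)
    qed
    then have "s * nrm X x \<le> C * nrm X x" using x by (intro mult_right_mono) auto
    then show ?thesis using \<sigma>_le[OF x] by linarith
  qed
  have "?\<sigma> F x \<le> (C + real (card F0) * U + 1) * nrm X x" if F: "finite F" "F \<subseteq> B" and x: "x \<in> points X" for F x
  proof -
    have "?\<sigma> F x = ?\<sigma> (F - F0) x + ?\<sigma> (F \<inter> F0) x"
      using F(1) by (subst sum.union_disjoint[symmetric]) (auto intro!: sum.cong)
    also have "?\<sigma> (F - F0) x \<le> C * nrm X x" using F x by (intro away) auto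
    also have "?\<sigma> (F \<inter> F0) x \<le> (\<Sum>b\<in>F \<inter> F0. U * nrm X x)" using F x by (intro sum_mono single) auto
    also have "\<dots> = real (card (F \<inter> F0)) * (U * nrm X x)" by simp
    also have "\<dots> \<le> real (card F0) * (U * nrm X x)"
      using F0 U(1) x by (intro mult_right_mono) (auto intro: card_mono)
    finally show ?thesis using X.nrm_nonneg[OF x] by (simp add: algebra_simps)
  qed
  moreover have "0 < C + real (card F0) * U + 1" using U(1) by (simp add: C_def add_nonneg_pos)
  ultimately show ?thesis by blast
qed

end

lemma isomorphicI:
  assumes E: "normed_space E" and F: "normed_space F" and f: "bounded_operator E F f"
    and surj: "\<And>y. y \<in> points F \<Longrightarrow> \<exists>x\<in>points E. f x = y"
    and le: "\<And>x. x \<in> points E \<Longrightarrow> nrm E x \<le> D * nrm F (f x)"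
  shows "isomorphic E F"
proof -
  interpret f: bounded_op E F f by (rule bounded_opI[OF E F f])
  have inj: "x = x'" if x: "x \<in> points E" and x': "x' \<in> points E" and eq: "f x = f x'" for x x'
  proof -
    have in': "x - x' \<in> points E" using x x' by (rule f.X.diff_in)
    have "nrm E (x - x') \<le> 0" using le[OF in'] f.diff[OF x x'] eq by simp
    then show ?thesis using f.X.nrm_nonneg[OF in'] f.X.nrm_eq_0[OF in'] by simp
  qed
  define g where "g y = (SOME x. x \<in> points E \<and> f x = y)" for y
  have g: "g y \<in> points E \<and> f (g y) = y" if "y \<in> points F" for y
    unfolding g_def by (rule someI_ex) (use surj[OF that] in blast)
  have "bounded_operator F E g"
    unfolding bounded_operator_def
  proof (intro conjI ballI allI)
    show "g y \<in> points E" if "y \<in> points F" for y using g[OF that] by blast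
    show "g (y + z) = g y + g z" if "y \<in> points F" "z \<in> points F" for y z
      using g[OF that(1)] g[OF that(2)] g[OF f.Y.add_in[OF that]] by (intro inj) (auto simp: f.add)
    show "g (scale F c y) = scale E c (g y)" if "y \<in> points F" for c y
      using g[OF that] g[OF f.Y.scale_in[OF that]] by (intro inj) (auto simp: f.scale)
    show "\<exists>C. \<forall>y\<in>points F. nrm E (g y) \<le> C * nrm F y" using le g by metis
  qed
  then show ?thesis
    unfolding isomorphic_def using f g inj f.maps by blast
qed

lemma ell1_simps:
  "a \<in> points (ell1 \<Gamma>) \<longleftrightarrow> (\<lambda>\<gamma>. norm (a \<gamma>)) summable_on \<Gamma> \<and> (\<forall>\<gamma>. \<gamma> \<notin> \<Gamma> \<longrightarrow> a \<gamma> = 0)"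
  "scale (ell1 \<Gamma>) c a = (\<lambda>\<gamma>. c * a \<gamma>)"
  "nrm (ell1 \<Gamma>) a = (\<Sum>\<^sub>\<infinity>\<gamma>\<in>\<Gamma>. norm (a \<gamma>))"
  by (simp_all add: ell1_def)

lemma ell1_pointsI:
  assumes "\<And>\<gamma>. \<gamma> \<notin> \<Gamma> \<Longrightarrow> a \<gamma> = 0" "\<And>F. finite F \<Longrightarrow> F \<subseteq> \<Gamma> \<Longrightarrow> (\<Sum>\<gamma>\<in>F. norm (a \<gamma>)) \<le> C"
  shows "a \<in> points (ell1 \<Gamma>)" "nrm (ell1 \<Gamma>) a \<le> C"
proof -
  have s: "(\<lambda>\<gamma>. norm (a \<gamma>)) summable_on \<Gamma>"
    by (rule nonneg_bdd_above_summable_on) (use assms in \<open>auto intro!: bdd_aboveI2[where M=C]\<close>)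
  then show "a \<in> points (ell1 \<Gamma>)" using assms by (simp add: ell1_simps)
  show "nrm (ell1 \<Gamma>) a \<le> C"
    unfolding ell1_simps by (rule infsum_le_finite_sums[OF s]) (use assms in auto)
qed

lemma ell1_finite_sum_le:
  assumes "a \<in> points (ell1 \<Gamma>)" "finite F" "F \<subseteq> \<Gamma>"
  shows "(\<Sum>\<gamma>\<in>F. norm (a \<gamma>)) \<le> nrm (ell1 \<Gamma>) a"
  using assms unfolding ell1_simps by (intro finite_sum_le_infsum) auto

lemma normed_space_ell1: "normed_space (ell1 \<Gamma> :: ('k::real_or_complex, 'g \<Rightarrow> 'k) normed_structure)"
proof -
  let ?E = "ell1 \<Gamma> :: ('k, 'g \<Rightarrow> 'k) normed_structure"
  have vs: "vector_space (scale ?E)"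
    by unfold_locales (auto simp: ell1_simps fun_eq_iff algebra_simps)
  then have m: "module (scale ?E)" by (simp add: module_iff_vector_space)
  have zero: "0 \<in> points ?E" by (simp add: ell1_simps)
  have add: "a + b \<in> points ?E \<and> nrm ?E (a + b) \<le> nrm ?E a + nrm ?E b"
    if a: "a \<in> points ?E" and b: "b \<in> points ?E" for a b
  proof -
    have "(\<Sum>\<gamma>\<in>F. norm ((a + b) \<gamma>)) \<le> nrm ?E a + nrm ?E b" if F: "finite F" "F \<subseteq> \<Gamma>" for F
    proof -
      have "(\<Sum>\<gamma>\<in>F. norm ((a + b) \<gamma>)) \<le> (\<Sum>\<gamma>\<in>F. norm (a \<gamma>)) + (\<Sum>\<gamma>\<in>F. norm (b \<gamma>))"
        unfolding sum.distrib[symmetric] by (intro sum_mono) (simp add: norm_triangle_ineq)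
      then show ?thesis using ell1_finite_sum_le[OF a F] ell1_finite_sum_le[OF b F] by linarith
    qed
    moreover have "(a + b) \<gamma> = 0" if "\<gamma> \<notin> \<Gamma>" for \<gamma> using a b that by (simp add: ell1_simps)
    ultimately show ?thesis using ell1_pointsI[of \<Gamma> "a + b"] by blast
  qed
  have scale_nrm: "scale ?E c a \<in> points ?E \<and> nrm ?E (scale ?E c a) = norm c * nrm ?E a" if "a \<in> points ?E" for c a
    using that by (auto simp: ell1_simps norm_mult infsum_cmult_right' intro: summable_on_cmult_right)
  have zero_iff: "nrm ?E a = 0 \<longleftrightarrow> a = 0" if a: "a \<in> points ?E" for a
  proof
    assume n: "nrm ?E a = 0"
    show "a = 0"
    proof
      fix \<gamma>
      show "a \<gamma> = 0 \<gamma>"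
        using ell1_finite_sum_le[OF a, of "{\<gamma>}"] n a by (cases "\<gamma> \<in> \<Gamma>") (auto simp: ell1_simps)
    qed
  qed (simp add: ell1_simps)
  have "module.subspace (scale ?E) (points ?E)"
    unfolding module.subspace_def[OF m] using zero add scale_nrm by blast
  moreover have "0 \<le> nrm ?E a" for a by (simp add: ell1_simps infsum_nonneg)
  ultimately show ?thesis unfolding normed_space_def using vs add scale_nrm zero_iff by blast
qed

text \<open>The isomorphism maps \<open>x\<close> to its coordinates with respect to the normalised basis. It is onto because
for an absolutely summable family the partial sums over suitable finite sets form a Cauchy sequence.\<close>

lemma (in unconditional) isomorphic_ell1:
  assumes C: "\<And>x F. x \<in> points E \<Longrightarrow> finite F \<Longrightarrow> F \<subseteq> B \<Longrightarrow> (\<Sum>b\<in>F. norm (coord x b) * nrm E b) \<le> C * nrm E x"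
  shows "isomorphic E (ell1 B :: ('k, 'a \<Rightarrow> 'k) normed_structure)"
proof (rule isomorphicI[where D = 1])
  let ?L = "ell1 B :: ('k, 'a \<Rightarrow> 'k) normed_structure"
  define f where "f x b = coord x b * of_real (nrm E b)" for x b
  have norm_f: "norm (f x b) = norm (coord x b) * nrm E b" if "b \<in> B" for x b
    using basis_nonzero[OF that] by (simp add: f_def norm_mult abs_of_pos)
  have f_points: "f x \<in> points ?L" "nrm ?L (f x) \<le> C * nrm E x" if x: "x \<in> points E" for x
  proof -
    have "(\<Sum>b\<in>F. norm (f x b)) \<le> C * nrm E x" if "finite F" "F \<subseteq> B" for F
    proof -
      have "(\<Sum>b\<in>F. norm (f x b)) = (\<Sum>b\<in>F. norm (coord x b) * nrm E b)"
        using that by (intro sum.cong) (auto simp: norm_f)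
      then show ?thesis using C[OF x that] by simp
    qed
    moreover have "f x b = 0" if "b \<notin> B" for b using coord_outside[OF x that] by (simp add: f_def)
    ultimately show "f x \<in> points ?L" "nrm ?L (f x) \<le> C * nrm E x" using ell1_pointsI[of B "f x"] by auto
  qed
  show "bounded_operator E ?L f"
    unfolding bounded_operator_def
  proof (intro conjI ballI allI)
    show "\<exists>C. \<forall>x\<in>points E. nrm ?L (f x) \<le> C * nrm E x" using f_points(2) by blast
    show "f x \<in> points ?L" if "x \<in> points E" for x using f_points(1)[OF that] .
  qed (simp_all add: f_def[abs_def] coord_add coord_scale ell1_simps fun_eq_iff algebra_simps)
  have lincomb_le: "nrm E (lincomb c F) \<le> (\<Sum>b\<in>F. norm (c b) * nrm E b)" if "F \<subseteq> B" for c F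
  proof -
    have "nrm E (lincomb c F) \<le> (\<Sum>b\<in>F. nrm E (scale E (c b) b))"
      unfolding lincomb_def using that basis_in by (intro nrm_sum_le) auto
    also have "\<dots> = (\<Sum>b\<in>F. norm (c b) * nrm E b)"
      using that basis_in by (intro sum.cong) (auto simp: nrm_scale)
    finally show ?thesis .
  qed
  show "nrm E x \<le> 1 * nrm ?L (f x)" if x: "x \<in> points E" for x
  proof -
    have "nrm E x \<le> nrm E (proj F x - x) + nrm ?L (f x)" if F: "finite F" "F \<subseteq> B" for F
    proof -
      have "nrm E x \<le> nrm E (x - proj F x) + nrm E (proj F x)"
        using nrm_triangle[of "x - proj F x" "proj F x"] x by simp
      also have "nrm E (proj F x) \<le> (\<Sum>b\<in>F. norm (f x b))"
        using lincomb_le[OF F(2), of "coord x"] F(2) norm_f by (simp add: subset_iff)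
      also have "\<dots> \<le> nrm ?L (f x)" by (rule ell1_finite_sum_le[OF f_points(1)[OF x] F])
      finally show ?thesis using nrm_diff_commute[of x "proj F x"] x by simp
    qed
    then have "\<forall>\<^sub>F F in finite_subsets_at_top B. nrm E x \<le> nrm E (proj F x - x) + nrm ?L (f x)"
      by (intro eventually_finite_subsets_at_top_weakI)
    moreover have "((\<lambda>F. nrm E (proj F x - x) + nrm ?L (f x)) \<longlongrightarrow> 0 + nrm ?L (f x)) (finite_subsets_at_top B)"
      by (intro tendsto_add proj_tendsto x tendsto_const)
    ultimately have "nrm E x \<le> 0 + nrm ?L (f x)"
      by (intro tendsto_lowerbound[of _ "0 + nrm ?L (f x)" "finite_subsets_at_top B"]) auto
    then show ?thesis by simp
  qed
  show "\<exists>x\<in>points E. f x = a" if a: "a \<in> points ?L" for a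
  proof -
    define c where "c b = a b * of_real (inverse (nrm E b))" for b
    have norm_c: "norm (c b) * nrm E b = norm (a b)" if "b \<in> B" for b
      using basis_nonzero[OF that] by (simp add: c_def norm_mult abs_of_pos del: of_real_inverse)
    have c_out: "c b = 0" if "b \<notin> B" for b using a that by (simp add: c_def ell1_simps)
    have "((\<lambda>F. \<Sum>b\<in>F. norm (a b)) \<longlongrightarrow> nrm ?L a) (finite_subsets_at_top B)"
      using a unfolding ell1_simps by (auto dest: has_sum_infsum simp: has_sum_def)
    then have "\<forall>\<^sub>F F in finite_subsets_at_top B. nrm ?L a - (1 / 2) ^ k < (\<Sum>b\<in>F. norm (a b))" for k :: nat
      by (rule order_tendstoD) simp
    then have "\<exists>F. finite F \<and> F \<subseteq> B \<and> nrm ?L a - (1 / 2) ^ k < (\<Sum>b\<in>F. norm (a b))" for k :: nat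
      unfolding eventually_finite_subsets_at_top by (meson order_refl)
    then obtain H where H: "\<And>k::nat. finite (H k)" "\<And>k. H k \<subseteq> B" "\<And>k. nrm ?L a - (1 / 2) ^ k < (\<Sum>b\<in>H k. norm (a b))"
      by metis
    define G where "G k = (\<Union>i\<le>k. H i)" for k
    have G: "finite (G k)" "G k \<subseteq> B" "H k \<subseteq> G k" "G k \<subseteq> G (Suc k)" for k
      using H by (auto simp: G_def intro: le_SucI)
    have tail: "nrm E (lincomb c F) \<le> (1 / 2) ^ k" if F: "finite F" "F \<subseteq> B" "F \<inter> G k = {}" for F k
    proof -
      have "(\<Sum>b\<in>F. norm (a b)) + (\<Sum>b\<in>H k. norm (a b)) = (\<Sum>b\<in>F \<union> H k. norm (a b))"
        using F H G(3)[of k] by (intro sum.union_disjoint[symmetric]) auto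
      also have "\<dots> \<le> nrm ?L a" using F H by (intro ell1_finite_sum_le[OF a]) auto
      finally have "(\<Sum>b\<in>F. norm (a b)) \<le> (1 / 2) ^ k" using H(3)[of k] by linarith
      moreover have "(\<Sum>b\<in>F. norm (c b) * nrm E b) = (\<Sum>b\<in>F. norm (a b))"
        using F norm_c by (intro sum.cong) auto
      ultimately show ?thesis using lincomb_le[OF F(2), of c] by linarith
    qed
    have diff: "lincomb c G' - lincomb c G = lincomb c (G' - G)" if "finite G'" "G \<subseteq> G'" for G G'
      unfolding lincomb_def using that by (simp add: sum_diff)
    have "\<exists>l\<in>points E. \<forall>m. nrm E (l - (\<Sum>k<m. lincomb c (G (Suc k) - G k))) \<le> 2 * 1 * (1 / 2) ^ m"
    proof (rule geometric_series)
      show "lincomb c (G (Suc k) - G k) \<in> points E" for k using c_out by (rule lincomb_in)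
      show "nrm E (lincomb c (G (Suc k) - G k)) \<le> 1 * (1 / 2) ^ k" for k
        using tail[of "G (Suc k) - G k" k] G by fastforce
    qed
    then obtain l where l: "l \<in> points E"
        "\<And>m. nrm E (l - (\<Sum>k<m. lincomb c (G (Suc k) - G k))) \<le> 2 * (1 / 2) ^ m" by auto
    have tele: "(\<Sum>k<m. lincomb c (G (Suc k) - G k)) = lincomb c (G m) - lincomb c (G 0)" for m
      by (induction m) (simp_all add: diff[OF G(1,4), symmetric])
    define x where "x = l + lincomb c (G 0)"
    have lin: "lincomb c F \<in> points E" for F using c_out by (rule lincomb_in)
    have x: "x \<in> points E" unfolding x_def using l(1) lin by simp
    have x_near: "nrm E (x - lincomb c (G m)) \<le> 2 * (1 / 2) ^ m" for m
      using l(2)[of m] unfolding tele x_def by (simp add: algebra_simps)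
    have "((\<lambda>F. nrm E (lincomb c F - x)) \<longlongrightarrow> 0) (finite_subsets_at_top B)"
    proof (rule tendstoI)
      fix e :: real assume "0 < e"
      have "(\<lambda>m. 3 * (1 / 2) ^ m) \<longlonglongrightarrow> (0::real)"
        by (intro tendsto_mult_right_zero LIMSEQ_power_zero) simp
      then have "\<forall>\<^sub>F m in sequentially. 3 * (1 / 2) ^ m < e"
        using \<open>0 < e\<close> by (rule order_tendstoD(2))
      then obtain m where m: "3 * (1 / 2) ^ m < e"
        using eventually_happens'[OF sequentially_bot] by blast
      have "dist (nrm E (lincomb c F - x)) 0 < e" if F: "finite F" "G m \<subseteq> F" "F \<subseteq> B" for F
      proof -
        have "nrm E (lincomb c F - x) \<le> nrm E (lincomb c F - lincomb c (G m)) + nrm E (lincomb c (G m) - x)"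
          by (rule nrm_diff_triangle[OF lin lin x])
        also have "nrm E (lincomb c F - lincomb c (G m)) \<le> (1 / 2) ^ m"
          unfolding diff[OF F(1,2)] using F by (intro tail) auto
        also have "nrm E (lincomb c (G m) - x) \<le> 2 * (1 / 2) ^ m"
          using x_near[of m] nrm_diff_commute[OF x lin] by simp
        finally show ?thesis using m x lin by simp
      qed
      then show "\<forall>\<^sub>F F in finite_subsets_at_top B. dist (nrm E (lincomb c F - x)) 0 < e"
        unfolding eventually_finite_subsets_at_top using G(1,2)[of m] by (intro exI[of _ "G m"]) simp
    qed
    then have "coord x = c" using x c_out by (intro coord_unique)
    moreover have "f x b = a b" for b
    proof (cases "b \<in> B")
      case True
      then show ?thesis using basis_nonzero[OF True] \<open>coord x = c\<close>
        by (simp add: f_def c_def mult.assoc)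
    next
      case False
      then show ?thesis using a coord_outside[OF x False] by (simp add: f_def ell1_simps)
    qed
    ultimately show ?thesis using x by blast
  qed
qed (rule normed normed_space_ell1)+

section \<open>The parallelogram law\<close>

lemma kiota_square: "kiota * kiota = (-1 :: 'k :: real_or_complex) \<or> (kiota :: 'k) = 0"
proof (cases "\<i> \<in> range (to_complex :: 'k \<Rightarrow> complex)")
  case True
  have "to_complex (kiota * kiota :: 'k) = to_complex (-1 :: 'k)"
    unfolding to_complex_mult to_complex_kiota to_complex_minus using True by simp
  then show ?thesis by (simp add: to_complex_eq_iff)
qed (simp add: kiota_def)

lemma conjugate_decomposition:
  "conjugate (of_real a + kiota * of_real b) = (of_real a - kiota * of_real b :: 'k :: real_or_complex)"
proof -
  have "to_complex (conjugate (of_real a + kiota * of_real b :: 'k)) = to_complex (of_real a - kiota * of_real b :: 'k)"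
    unfolding to_complex_conjugate to_complex_add to_complex_diff to_complex_mult to_complex_kiota by simp
  then show ?thesis by (simp add: to_complex_eq_iff)
qed

text \<open>A functional \<open>q\<close> that behaves like the square of a Hilbertian norm equivalent to the norm of \<open>Y\<close>.
The inner product is recovered by polarization.\<close>

locale hilbertian = Y: bspace Y for Y :: "('k::real_or_complex, 'b::ab_group_add) normed_structure" +
  fixes q :: "'b \<Rightarrow> real" and L M :: real
  assumes q_upper: "y \<in> points Y \<Longrightarrow> q y \<le> M * (nrm Y y)\<^sup>2"
    and q_lower: "y \<in> points Y \<Longrightarrow> (nrm Y y)\<^sup>2 \<le> L * q y"
    and q_nonneg: "y \<in> points Y \<Longrightarrow> 0 \<le> q y"
    and q_scale: "y \<in> points Y \<Longrightarrow> q (scale Y c y) = (norm c)\<^sup>2 * q y"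
    and parallelogram: "x \<in> points Y \<Longrightarrow> y \<in> points Y \<Longrightarrow> q (x + y) + q (x - y) = 2 * q x + 2 * q y"
begin

lemma q_zero [simp]: "q 0 = 0"
  using q_scale[of 0 0] by simp

lemma q_minus: "y \<in> points Y \<Longrightarrow> q (- y) = q y"
  using q_scale[of y "-1"] by simp

lemma q_eq_0: "y \<in> points Y \<Longrightarrow> q y = 0 \<Longrightarrow> y = 0"
  using q_lower[of y] Y.nrm_eq_0[of y] by simp

definition form :: "'b \<Rightarrow> 'b \<Rightarrow> real" where
  "form x y = (q (x + y) - q (x - y)) / 4"

lemma form_commute: "x \<in> points Y \<Longrightarrow> y \<in> points Y \<Longrightarrow> form x y = form y x"
  using q_minus[of "x - y"] by (simp add: form_def add.commute)

lemma q_add: "x \<in> points Y \<Longrightarrow> y \<in> points Y \<Longrightarrow> q (x + y) = q x + 2 * form x y + q y"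
  using parallelogram[of x y] by (simp add: form_def field_simps)

lemma form_self: "x \<in> points Y \<Longrightarrow> form x x = q x"
  using parallelogram[of x x] by (simp add: form_def)

text \<open>The argument of Jordan and von Neumann: four instances of the parallelogram law.\<close>

lemma form_add_left:
  assumes x: "x \<in> points Y" and y: "y \<in> points Y" and z: "z \<in> points Y"
  shows "form (x + y) z = form x z + form y z"
proof -
  have 1: "q (x + z + y) + q (x + z - y) = 2 * q (x + z) + 2 * q y"
    and 2: "q (x - z + y) + q (x - z - y) = 2 * q (x - z) + 2 * q y"
    and 3: "q (y + z + x) + q (y + z - x) = 2 * q (y + z) + 2 * q x"
    and 4: "q (y - z + x) + q (y - z - x) = 2 * q (y - z) + 2 * q x"
    using x y z by (auto intro!: parallelogram)
  have 5: "q (x + z - y) = q (y - z - x)" "q (x - z - y) = q (y + z - x)"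
    using q_minus[of "x + z - y"] q_minus[of "x - z - y"] x y z by (simp_all add: algebra_simps)
  have 6: "x + z + y = x + y + z" "y + z + x = x + y + z" "x - z + y = x + y - z" "y - z + x = x + y - z"
    by (simp_all add: algebra_simps)
  show ?thesis using 1 2 3 4 unfolding 5 6 by (simp add: form_def field_simps)
qed

lemma form_bound: "x \<in> points Y \<Longrightarrow> y \<in> points Y \<Longrightarrow> \<bar>form x y\<bar> \<le> (q x + q y) / 2"
  using parallelogram[of x y] q_nonneg[of "x + y"] q_nonneg[of "x - y"] by (simp add: form_def)

lemma form_real_scale_left:
  assumes x: "x \<in> points Y" and y: "y \<in> points Y"
  shows "form (scale Y (of_real r) x) y = r * form x y"
proof -
  have "form (scale Y (of_real r) x) y = r * form (scale Y (of_real 1) x) y"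
  proof (rule additive_bounded_imp_linear[where f = "\<lambda>r. form (scale Y (of_real r) x) y"])
    show "form (scale Y (of_real (a + b)) x) y = form (scale Y (of_real a) x) y + form (scale Y (of_real b) x) y" for a b
      using x y by (simp add: Y.vs.scale_left_distrib form_add_left)
    show "\<bar>form (scale Y (of_real r) x) y\<bar> \<le> (q x + q y) / 2" if "\<bar>r\<bar> \<le> 1" for r
    proof -
      have "\<bar>form (scale Y (of_real r) x) y\<bar> \<le> (q (scale Y (of_real r) x) + q y) / 2"
        using x y by (intro form_bound) auto
      also have "q (scale Y (of_real r) x) = r\<^sup>2 * q x" using q_scale[OF x] by simp
      also have "r\<^sup>2 * q x \<le> q x" using that q_nonneg[OF x] by (simp add: mult_left_le_one_le abs_square_le_1)
      finally show ?thesis by simp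
    qed
  qed
  then show ?thesis by simp
qed

lemma form_minus_right: "x \<in> points Y \<Longrightarrow> y \<in> points Y \<Longrightarrow> form x (- y) = - form x y"
  by (simp add: form_def minus_divide_left)

lemma form_scale_both:
  assumes x: "x \<in> points Y" and y: "y \<in> points Y"
  shows "form (scale Y c x) (scale Y c y) = (norm c)\<^sup>2 * form x y"
  using q_scale[OF Y.add_in[OF x y], of c] q_scale[OF Y.diff_in[OF x y], of c]
  by (simp add: form_def Y.vs.scale_right_distrib Y.vs.scale_right_diff_distrib right_diff_distrib)

text \<open>The real form is invariant under multiplication of both arguments by the imaginary unit, so that
multiplication by it is skew-adjoint.\<close>

lemma form_kiota_left:
  assumes "(kiota :: 'k) \<noteq> 0" and x: "x \<in> points Y" and y: "y \<in> points Y"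
  shows "form (scale Y kiota x) y = - form x (scale Y kiota y)"
proof -
  have i: "kiota * kiota = (-1 :: 'k)" using kiota_square assms(1) by blast
  then have "(norm (kiota :: 'k))\<^sup>2 = 1" by (metis norm_minus_cancel norm_mult norm_one power2_eq_square)
  then have "form (scale Y kiota x) (scale Y kiota (scale Y kiota y)) = form x (scale Y kiota y)"
    using form_scale_both[OF x Y.scale_in[OF y, of kiota], of kiota] by (simp only: mult_1)
  moreover have "scale Y kiota (scale Y kiota y) = - y" by (simp add: i)
  ultimately show ?thesis using x y by (simp add: form_minus_right)
qed

text \<open>The sesquilinear form with real part \<open>form\<close>. Over the real field \<open>kiota\<close> is 0 and the second summand
vanishes.\<close>

definition ip :: "'b \<Rightarrow> 'b \<Rightarrow> 'k" where
  "ip x y = of_real (form x y) + kiota * of_real (form x (scale Y kiota y))"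

lemma ip_add_left:
  "x \<in> points Y \<Longrightarrow> y \<in> points Y \<Longrightarrow> z \<in> points Y \<Longrightarrow> ip (x + y) z = ip x z + ip y z"
  by (simp add: ip_def form_add_left algebra_simps)

lemma ip_scale_left:
  assumes x: "x \<in> points Y" and y: "y \<in> points Y"
  shows "ip (scale Y c x) y = c * ip x y"
proof -
  have real: "ip (scale Y (of_real r) x) y = of_real r * ip x y" if "x \<in> points Y" for r x
    using that y by (simp add: ip_def form_real_scale_left algebra_simps)
  have iota: "ip (scale Y kiota x) y = kiota * ip x y" if "x \<in> points Y" for x
  proof (cases "(kiota :: 'k) = 0")
    case True
    then show ?thesis using y by (simp add: ip_def form_def q_minus)
  next
    case False
    then have i: "kiota * kiota = (-1 :: 'k)" using kiota_square by blast
    have "ip (scale Y kiota x) y = - of_real (form x (scale Y kiota y)) + kiota * of_real (form x y)"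
    proof -
      have "form (scale Y kiota x) (scale Y kiota y) = (norm (kiota :: 'k))\<^sup>2 * form x y"
        by (rule form_scale_both[OF that y])
      moreover have "(norm (kiota :: 'k))\<^sup>2 = 1" using i by (metis norm_minus_cancel norm_mult norm_one power2_eq_square)
      ultimately show ?thesis using form_kiota_left[OF False that y] by (simp add: ip_def)
    qed
    also have "\<dots> = kiota * ip x y"
      unfolding ip_def distrib_left mult.assoc[symmetric] i by simp
    finally show ?thesis .
  qed
  have "scale Y c x = scale Y (of_real (kre c)) x + scale Y kiota (scale Y (of_real (kim c)) x)"
    using scalar_decomposition[of c] by (metis Y.vs.scale_left_distrib Y.vs.scale_scale)
  then have "ip (scale Y c x) y = of_real (kre c) * ip x y + kiota * (of_real (kim c) * ip x y)"
    using x y by (simp only: ip_add_left real iota Y.scale_in)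
  also have "\<dots> = (of_real (kre c) + kiota * of_real (kim c)) * ip x y"
    by (simp add: algebra_simps)
  finally show ?thesis by (simp only: scalar_decomposition[symmetric])
qed

lemma ip_conjugate:
  assumes x: "x \<in> points Y" and y: "y \<in> points Y"
  shows "ip y x = conjugate (ip x y)"
proof (cases "(kiota :: 'k) = 0")
  case True
  then show ?thesis
    using form_commute[OF x y] conjugate_decomposition[of "form x y" 0, where 'k='k] by (simp add: ip_def)
next
  case False
  have "form y (scale Y kiota x) = - form x (scale Y kiota y)"
    using form_commute[of y "scale Y kiota x"] form_kiota_left[OF False x y] x y by simp
  then show ?thesis
    unfolding ip_def conjugate_decomposition using form_commute[OF x y] by simp
qed

lemma ip_self:
  assumes x: "x \<in> points Y"
  shows "ip x x = of_real (q x)"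
proof -
  have "kiota * of_real (form x (scale Y kiota x)) = (0 :: 'k)"
  proof (cases "(kiota :: 'k) = 0")
    case False
    have "form x (scale Y kiota x) = - form x (scale Y kiota x)"
      using form_commute[of x "scale Y kiota x"] form_kiota_left[OF False x x] x by simp
    then show ?thesis by simp
  qed simp
  then show ?thesis using form_self[OF x] by (simp add: ip_def)
qed

lemma cauchy_schwarz:
  assumes x: "x \<in> points Y" and y: "y \<in> points Y"
  shows "form x y \<le> sqrt (q x) * sqrt (q y)"
proof (cases "x = 0 \<or> y = 0")
  case True
  then show ?thesis using x y by (auto simp: form_def q_minus)
next
  case False
  define a b where "a = sqrt (q x)" and "b = sqrt (q y)"
  have a: "0 < a" "a\<^sup>2 = q x" and b: "0 < b" "b\<^sup>2 = q y"
    using False q_eq_0 q_nonneg x y by (auto simp: a_def b_def order_less_le)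
  let ?u = "scale Y (of_real b) x" and ?v = "scale Y (of_real (- a)) y"
  have u: "?u \<in> points Y" "?v \<in> points Y" using x y by auto
  have "form ?u ?v = b * (- a) * form x y"
    using form_real_scale_left[OF x u(2), of b] form_real_scale_left[OF y x, of "- a"] form_commute[OF x u(2)] form_commute[OF x y]
    by simp
  moreover have "q ?u = b\<^sup>2 * q x" "q ?v = a\<^sup>2 * q y"
    using q_scale[OF x, of "of_real b"] q_scale[OF y, of "of_real (- a)"] by simp_all
  ultimately have "0 \<le> b\<^sup>2 * a\<^sup>2 + 2 * (b * (- a) * form x y) + a\<^sup>2 * b\<^sup>2"
    using q_nonneg[OF Y.add_in[OF u]] q_add[OF u] a b by simp
  then have "(a * b) * form x y \<le> (a * b) * (a * b)" by (simp add: power2_eq_square algebra_simps)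
  then have "form x y \<le> a * b" using a(1) b(1) by (simp add: mult_le_cancel_left_pos)
  then show ?thesis by (simp add: a_def b_def)
qed

definition hilbert :: "('k, 'b) normed_structure" where
  "hilbert = \<lparr>points = points Y, scale = scale Y, nrm = (\<lambda>y. sqrt (q y))\<rparr>"

lemma hilbert_simps [simp]:
  "points hilbert = points Y" "scale hilbert = scale Y" "nrm hilbert y = sqrt (q y)"
  by (simp_all add: hilbert_def)

lemma normed_space_hilbert: "normed_space hilbert"
  unfolding normed_space_def hilbert_simps
proof (intro conjI ballI allI)
  show "vector_space (scale Y)" by (rule Y.vs.vector_space_axioms)
  show "Y.vs.subspace (points Y)" by (rule Y.subspace)
  show "0 \<le> sqrt (q x)" if "x \<in> points Y" for x using q_nonneg[OF that] by simp
  show "sqrt (q x) = 0 \<longleftrightarrow> x = 0" if "x \<in> points Y" for x using q_eq_0[OF that] by auto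
  show "sqrt (q (x + y)) \<le> sqrt (q x) + sqrt (q y)" if x: "x \<in> points Y" and y: "y \<in> points Y" for x y
  proof (rule real_le_lsqrt)
    show "q (x + y) \<le> (sqrt (q x) + sqrt (q y))\<^sup>2"
      using cauchy_schwarz[OF x y] q_nonneg[OF x] q_nonneg[OF y] by (simp add: q_add[OF x y] power2_sum)
  qed (use x y q_nonneg in auto)
  show "sqrt (q (scale Y c x)) = norm c * sqrt (q x)" if "x \<in> points Y" for c x
    by (simp add: q_scale[OF that] real_sqrt_mult)
qed

lemma nrm_equivalent:
  "\<exists>C>0. \<forall>y\<in>points Y. nrm Y y \<le> C * nrm hilbert y \<and> nrm hilbert y \<le> C * nrm Y y"
proof -
  have "nrm Y y \<le> (sqrt \<bar>L\<bar> + sqrt \<bar>M\<bar> + 1) * sqrt (q y) \<and> sqrt (q y) \<le> (sqrt \<bar>L\<bar> + sqrt \<bar>M\<bar> + 1) * nrm Y y"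
    if y: "y \<in> points Y" for y
  proof
    have "nrm Y y = sqrt ((nrm Y y)\<^sup>2)" using y by simp
    also have "\<dots> \<le> sqrt (\<bar>L\<bar> * q y)"
      using q_lower[OF y] q_nonneg[OF y] by (intro real_sqrt_le_mono) (meson abs_ge_self mult_right_mono order.trans)
    also have "\<dots> \<le> (sqrt \<bar>L\<bar> + sqrt \<bar>M\<bar> + 1) * sqrt (q y)"
      unfolding real_sqrt_mult using q_nonneg[OF y] by (intro mult_right_mono) auto
    finally show "nrm Y y \<le> (sqrt \<bar>L\<bar> + sqrt \<bar>M\<bar> + 1) * sqrt (q y)" .
    have "sqrt (q y) \<le> sqrt (\<bar>M\<bar> * (nrm Y y)\<^sup>2)"
      using q_upper[OF y] by (intro real_sqrt_le_mono) (meson abs_ge_self mult_right_mono order.trans zero_le_power2)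
    also have "\<dots> = sqrt \<bar>M\<bar> * nrm Y y" using y by (simp add: real_sqrt_mult)
    also have "\<dots> \<le> (sqrt \<bar>L\<bar> + sqrt \<bar>M\<bar> + 1) * nrm Y y"
      using y by (intro mult_right_mono) auto
    finally show "sqrt (q y) \<le> (sqrt \<bar>L\<bar> + sqrt \<bar>M\<bar> + 1) * nrm Y y" .
  qed
  then show ?thesis by (intro exI[of _ "sqrt \<bar>L\<bar> + sqrt \<bar>M\<bar> + 1"]) (auto simp: add_nonneg_pos)
qed

lemma hilbert_space_hilbert: "hilbert_space hilbert" and isomorphic_hilbert: "isomorphic Y hilbert"
proof -
  obtain C where C: "0 < C" "\<And>y. y \<in> points Y \<Longrightarrow> nrm Y y \<le> C * nrm hilbert y"
      "\<And>y. y \<in> points Y \<Longrightarrow> nrm hilbert y \<le> C * nrm Y y"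
    using nrm_equivalent by blast
  interpret H: nspace hilbert by (rule nspace.intro[OF normed_space_hilbert])
  interpret HM: Metric_space "points hilbert" "norm_dist hilbert" by (rule H.metric)
  have "HM.mcomplete"
    unfolding HM.mcomplete_def
  proof (intro allI impI)
    fix s assume "HM.MCauchy s"
    then have s: "\<And>n. s n \<in> points Y"
      and cau: "\<And>e. e > 0 \<Longrightarrow> \<exists>N. \<forall>n n'. N \<le> n \<longrightarrow> N \<le> n' \<longrightarrow> norm_dist hilbert (s n) (s n') < e"
      unfolding HM.MCauchy_def by auto
    have "\<exists>l\<in>points Y. (\<lambda>n. nrm Y (s n - l)) \<longlonglongrightarrow> 0"
    proof (rule Y.complete[OF s])
      fix e :: real assume "0 < e"
      then obtain N where N: "\<forall>n n'. N \<le> n \<longrightarrow> N \<le> n' \<longrightarrow> norm_dist hilbert (s n) (s n') < e / C"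
        using cau[of "e / C"] C(1) by auto
      have "nrm Y (s m - s n) < e" if "m \<ge> N" "n \<ge> N" for m n
      proof -
        have "nrm hilbert (s m - s n) < e / C" using N that s by (simp add: norm_dist_def)
        then have "C * nrm hilbert (s m - s n) < e" using C(1) by (simp add: pos_less_divide_eq mult.commute)
        then show ?thesis using C(2)[OF Y.diff_in[OF s s], of m n] by linarith
      qed
      then show "\<exists>N. \<forall>m\<ge>N. \<forall>n\<ge>N. nrm Y (s m - s n) < e" by blast
    qed
    then obtain l where l: "l \<in> points Y" "(\<lambda>n. nrm Y (s n - l)) \<longlonglongrightarrow> 0" by blast
    have "(\<lambda>n. nrm hilbert (s n - l)) \<longlonglongrightarrow> 0"
    proof (rule tendsto_zero_le)
      show "(\<lambda>n. C * nrm Y (s n - l)) \<longlonglongrightarrow> 0" using tendsto_mult_left[OF l(2), of C] by simp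
      show "nrm hilbert (s n - l) \<le> C * nrm Y (s n - l)" for n using C(3)[OF Y.diff_in[OF s l(1)]] .
      show "0 \<le> nrm hilbert (s n - l)" for n using s l(1) by (intro H.nrm_nonneg) simp
    qed
    then have "limitin (norm_topology hilbert) s l sequentially"
      using H.limitin_iff_tendsto[of s] s l(1) by simp
    then show "\<exists>x. limitin HM.mtopology s x sequentially" unfolding norm_topology_def by blast
  qed
  then have "banach_space hilbert" using normed_space_hilbert by (simp add: banach_space_def)
  moreover have "ip x x = of_real ((sqrt (q x))\<^sup>2)" if "x \<in> points Y" for x
    using ip_self[OF that] q_nonneg[OF that] by simp
  ultimately show "hilbert_space hilbert"
    unfolding hilbert_space_def hilbert_simps
    by (intro conjI exI[of _ ip] ballI allI ip_add_left ip_scale_left ip_conjugate) auto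
  show "isomorphic Y hilbert"
  proof (rule isomorphicI[OF Y.normed normed_space_hilbert, where f = "\<lambda>x. x" and D = C])
    show "bounded_operator Y hilbert (\<lambda>x. x)"
      unfolding bounded_operator_def using C(3) by auto
  qed (use C(2) in auto)
qed

end

section \<open>Pietsch domination\<close>

context bspace
begin

text \<open>Finitely supported families of coefficients on the points of the space: the finitely supported part of
\<open>\<ell>\<^sub>1\<close> indexed by all points. The map \<open>total\<close> is the canonical map onto the space, and \<open>weights\<close> is the
dual unit ball for the norm in which the unit vector at \<open>y\<close> has the norm of \<open>y\<close>.\<close>

definition testfuns :: "('a \<Rightarrow> 'k) set" where
  "testfuns = {x. finite {y. x y \<noteq> 0} \<and> {y. x y \<noteq> 0} \<subseteq> points E}"

definition total :: "('a \<Rightarrow> 'k) \<Rightarrow> 'a" where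
  "total x = (\<Sum>y | x y \<noteq> 0. scale E (x y) y)"

definition pairing :: "('a \<Rightarrow> 'k) \<Rightarrow> ('a \<Rightarrow> 'k) \<Rightarrow> 'k" where
  "pairing w x = (\<Sum>y | x y \<noteq> 0. x y * w y)"

definition weights :: "('a \<Rightarrow> 'k) set" where
  "weights = {w. \<forall>y\<in>points E. norm (w y) \<le> nrm E y}"

lemma total_eq: "finite A \<Longrightarrow> {y. x y \<noteq> 0} \<subseteq> A \<Longrightarrow> total x = (\<Sum>y\<in>A. scale E (x y) y)"
  unfolding total_def by (rule sum.mono_neutral_left) auto

lemma pairing_eq: "finite A \<Longrightarrow> {y. x y \<noteq> 0} \<subseteq> A \<Longrightarrow> pairing w x = (\<Sum>y\<in>A. x y * w y)"
  unfolding pairing_def by (rule sum.mono_neutral_left) auto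

lemma testfuns_supportD: "x \<in> testfuns \<Longrightarrow> finite {y. x y \<noteq> 0}" "x \<in> testfuns \<Longrightarrow> x y \<noteq> 0 \<Longrightarrow> y \<in> points E"
  by (auto simp: testfuns_def)

lemma testfuns_combination:
  assumes x: "x \<in> testfuns" and z: "z \<in> testfuns"
  shows "(\<lambda>y. a * x y + b * z y) \<in> testfuns"
    and "total (\<lambda>y. a * x y + b * z y) = scale E a (total x) + scale E b (total z)"
    and "pairing w (\<lambda>y. a * x y + b * z y) = a * pairing w x + b * pairing w z"
proof -
  let ?A = "{y. x y \<noteq> 0} \<union> {y. z y \<noteq> 0}"
  have A: "finite ?A" "?A \<subseteq> points E" using x z by (auto simp: testfuns_def)
  have sub: "{y. a * x y + b * z y \<noteq> 0} \<subseteq> ?A" by auto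
  then show "(\<lambda>y. a * x y + b * z y) \<in> testfuns"
    using A by (auto simp: testfuns_def intro: finite_subset)
  have "total x = (\<Sum>y\<in>?A. scale E (x y) y)" "total z = (\<Sum>y\<in>?A. scale E (z y) y)"
    using A by (auto intro!: total_eq)
  then show "total (\<lambda>y. a * x y + b * z y) = scale E a (total x) + scale E b (total z)"
    unfolding total_eq[OF A(1) sub] by (simp add: vs.scale_left_distrib sum.distrib vs.scale_sum_right)
  have "pairing w x = (\<Sum>y\<in>?A. x y * w y)" "pairing w z = (\<Sum>y\<in>?A. z y * w y)"
    using A by (auto intro!: pairing_eq)
  then show "pairing w (\<lambda>y. a * x y + b * z y) = a * pairing w x + b * pairing w z"
    unfolding pairing_eq[OF A(1) sub] by (simp add: distrib_right sum.distrib sum_distrib_left mult.assoc)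
qed

lemma testfuns_scale:
  assumes x: "x \<in> testfuns"
  shows "(\<lambda>y. a * x y) \<in> testfuns" "total (\<lambda>y. a * x y) = scale E a (total x)"
    "pairing w (\<lambda>y. a * x y) = a * pairing w x"
  using testfuns_combination[OF x x, where a = a and b = 0] by simp_all

lemma testfuns_delta:
  assumes "y \<in> points E"
  shows "(\<lambda>z. if z = y then 1 else 0) \<in> testfuns" "total (\<lambda>z. if z = y then 1 else 0) = y"
    "pairing w (\<lambda>z. if z = y then 1 else 0) = w y"
  using assms by (auto simp: testfuns_def total_def pairing_def)

lemma total_in: "x \<in> testfuns \<Longrightarrow> total x \<in> points E"
  unfolding total_def by (auto intro!: sum_in dest: testfuns_supportD)

lemma pairing_bounded:
  assumes "x \<in> testfuns"
  shows "\<exists>C. \<forall>w\<in>weights. norm (pairing w x) \<le> C"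
proof -
  have "norm (pairing w x) \<le> (\<Sum>y | x y \<noteq> 0. norm (x y) * nrm E y)" if "w \<in> weights" for w
  proof -
    have "norm (pairing w x) \<le> (\<Sum>y | x y \<noteq> 0. norm (x y * w y))"
      unfolding pairing_def by (rule norm_sum)
    also have "\<dots> \<le> (\<Sum>y | x y \<noteq> 0. norm (x y) * nrm E y)"
      unfolding norm_mult using that testfuns_supportD(2)[OF assms]
      by (intro sum_mono mult_left_mono) (auto simp: weights_def)
    finally show ?thesis .
  qed
  then show ?thesis by blast
qed

text \<open>Domination gives a mean \<open>l\<close> on the bounded functions of the weights with
\<open>\<parallel>total x\<parallel> \<le> K l |\<langle>w, x\<rangle>|\<close>. Passing from the first to the second moment makes the right-hand side a
Hilbertian seminorm in \<open>x\<close>, and \<open>q\<close> is its square on the quotient by the kernel of \<open>total\<close>.\<close>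

lemma hilbertian_if_universal_map_summing:
  assumes K: "0 < K"
    and summing: "\<And>(k::nat) x W. (\<And>j. j < k \<Longrightarrow> x j \<in> testfuns) \<Longrightarrow> 0 < W \<Longrightarrow>
      (\<And>w. w \<in> weights \<Longrightarrow> (\<Sum>j<k. norm (pairing w (x j))) \<le> W) \<Longrightarrow> (\<Sum>j<k. nrm E (total (x j))) \<le> K * W"
  shows "\<exists>H :: ('k, 'a) normed_structure. hilbert_space H \<and> isomorphic E H"
proof -
  define V where "V = {f :: ('a \<Rightarrow> 'k) \<Rightarrow> real. \<exists>C. \<forall>w\<in>weights. \<bar>f w\<bar> \<le> C}"
  define g where "g xs w = K * (\<Sum>x\<leftarrow>xs. norm (pairing w x))" for xs and w
  define r where "r xs = (\<Sum>x\<leftarrow>xs. nrm E (total x))" for xs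
  define Q where "Q = {(g xs, r xs) | xs. set xs \<subseteq> testfuns}"
  have zero_w: "(\<lambda>_. 0) \<in> weights" by (simp add: weights_def)
  have V_bound: "(\<lambda>w. norm (pairing w x)) \<in> V" if "x \<in> testfuns" for x
    using pairing_bounded[OF that] by (simp add: V_def)
  have V_add: "(\<lambda>w. f w + h w) \<in> V" if "f \<in> V" "h \<in> V" for f h
  proof -
    obtain C D where "\<forall>w\<in>weights. \<bar>f w\<bar> \<le> C" "\<forall>w\<in>weights. \<bar>h w\<bar> \<le> D" using \<open>f \<in> V\<close> \<open>h \<in> V\<close> by (auto simp: V_def)
    then have "\<forall>w\<in>weights. \<bar>f w + h w\<bar> \<le> C + D" by (meson abs_triangle_ineq add_mono order.trans)
    then show ?thesis by (auto simp: V_def)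
  qed
  have V_mult: "(\<lambda>w. f w * h w) \<in> V" if "f \<in> V" "h \<in> V" for f h
  proof -
    obtain C D where CD: "\<forall>w\<in>weights. \<bar>f w\<bar> \<le> C" "\<forall>w\<in>weights. \<bar>h w\<bar> \<le> D" using \<open>f \<in> V\<close> \<open>h \<in> V\<close> by (auto simp: V_def)
    have "\<forall>w\<in>weights. \<bar>f w * h w\<bar> \<le> C * D"
    proof
      fix w assume w: "w \<in> weights"
      then have "0 \<le> C" using CD(1) abs_ge_zero[of "f w"] by (meson order.trans)
      then show "\<bar>f w * h w\<bar> \<le> C * D" using CD w unfolding abs_mult by (intro mult_mono) auto
    qed
    then show ?thesis by (auto simp: V_def)
  qed
  have V_const: "(\<lambda>w. c) \<in> V" for c by (auto simp: V_def)
  have gV: "g xs \<in> V" if "set xs \<subseteq> testfuns" for xs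
    using that
  proof (induction xs)
    case Nil
    then show ?case using V_const[of 0] by (simp add: g_def[abs_def])
  next
    case (Cons x xs)
    then have "(\<lambda>w. K * norm (pairing w x) + g xs w) \<in> V"
      by (intro V_add V_mult V_const V_bound) auto
    then show ?case by (simp add: g_def[abs_def] distrib_left)
  qed
  have dom: "r xs \<le> M" if xs: "set xs \<subseteq> testfuns" and M: "\<And>w. w \<in> weights \<Longrightarrow> g xs w \<le> M" for xs M
  proof -
    have nth: "(\<Sum>x\<leftarrow>xs. f x) = (\<Sum>j<length xs. f (xs ! j))" for f :: "('a \<Rightarrow> 'k) \<Rightarrow> real"
      by (simp add: sum_list_sum_nth atLeast0LessThan)
    have M0: "0 \<le> M"
    proof -
      have "0 \<le> g xs (\<lambda>_. 0)" using K by (simp add: g_def nth sum_nonneg)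
      then show ?thesis using M[OF zero_w] by linarith
    qed
    have "r xs \<le> M + e" if e: "0 < e" for e
    proof -
      have "(\<Sum>j<length xs. nrm E (total (xs ! j))) \<le> K * ((M + e) / K)"
      proof (rule summing)
        show "xs ! j \<in> testfuns" if "j < length xs" for j using xs that by auto
        show "0 < (M + e) / K" using M0 e K by simp
        show "(\<Sum>j<length xs. norm (pairing w (xs ! j))) \<le> (M + e) / K" if "w \<in> weights" for w
          using M[OF that] e K by (simp add: g_def nth pos_le_divide_eq mult.commute)
      qed
      then show ?thesis using K by (simp add: r_def nth)
    qed
    then show ?thesis by (rule field_le_epsilon)
  qed
  obtain l where l_add: "\<And>f h. f \<in> V \<Longrightarrow> h \<in> V \<Longrightarrow> l (\<lambda>w. f w + h w) = l f + l h"
    and l_mult: "\<And>c f. f \<in> V \<Longrightarrow> l (\<lambda>w. c * f w) = c * l f"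
    and l_le: "\<And>f M. f \<in> V \<Longrightarrow> (\<And>w. w \<in> weights \<Longrightarrow> f w \<le> M) \<Longrightarrow> l f \<le> (M :: real)"
    and l_Q: "\<And>h s. (h, s) \<in> Q \<Longrightarrow> s \<le> l h"
  proof (rule dominating_mean[of Q weights, folded V_def])
    show "((\<lambda>w. 0), 0) \<in> Q"
      unfolding Q_def by (auto intro!: exI[of _ "[]"] simp: g_def[abs_def] r_def)
    show "((\<lambda>w. f w + h w), s + t) \<in> Q" if fs: "(f, s) \<in> Q" and ht: "(h, t) \<in> Q" for f h s t
    proof -
      obtain xs where "f = g xs" "s = r xs" "set xs \<subseteq> testfuns" using fs by (auto simp: Q_def)
      moreover obtain ys where "h = g ys" "t = r ys" "set ys \<subseteq> testfuns" using ht by (auto simp: Q_def)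
      ultimately show ?thesis
        unfolding Q_def by (auto intro!: exI[of _ "xs @ ys"] simp: g_def[abs_def] r_def distrib_left)
    qed
    show "((\<lambda>w. c * h w), c * s) \<in> Q" if c: "c > 0" and "(h, s) \<in> Q" for c h s
    proof -
      obtain xs where xs: "h = g xs" "s = r xs" "set xs \<subseteq> testfuns" using \<open>(h, s) \<in> Q\<close> by (auto simp: Q_def)
      let ?ys = "map (\<lambda>x y. of_real c * x y) xs"
      have "g ?ys w = c * g xs w" for w
      proof -
        have "(\<Sum>x\<leftarrow>xs. norm (pairing w (\<lambda>y. of_real c * x y))) = (\<Sum>x\<leftarrow>xs. c * norm (pairing w x))"
          using xs(3) c by (intro arg_cong[of _ _ sum_list] map_cong refl) (auto simp: testfuns_scale norm_mult)
        then show ?thesis by (simp add: g_def comp_def sum_list_const_mult)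
      qed
      moreover have "r ?ys = c * r xs"
      proof -
        have "(\<Sum>x\<leftarrow>xs. nrm E (total (\<lambda>y. of_real c * x y))) = (\<Sum>x\<leftarrow>xs. c * nrm E (total x))"
          using xs(3) c by (intro arg_cong[of _ _ sum_list] map_cong refl) (auto simp: testfuns_scale nrm_scale total_in)
        then show ?thesis by (simp add: r_def comp_def sum_list_const_mult)
      qed
      moreover have "set ?ys \<subseteq> testfuns" using xs(3) testfuns_scale(1) by auto
      ultimately have "(\<lambda>w. c * g xs w, c * r xs) = (g ?ys, r ?ys)" "set ?ys \<subseteq> testfuns" by auto
      then show ?thesis unfolding Q_def xs by blast
    qed
    show "h \<in> V" if "(h, s) \<in> Q" for h s using that gV by (auto simp: Q_def)
    show "s \<le> M" if "(h, s) \<in> Q" "\<And>w. w \<in> weights \<Longrightarrow> h w \<le> M" for h s M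
      using that dom by (auto simp: Q_def)
  qed blast
  have l_mono: "l f \<le> l h" if f: "f \<in> V" and h: "h \<in> V" and le: "\<And>w. w \<in> weights \<Longrightarrow> f w \<le> h w" for f h
  proof -
    have m: "(\<lambda>w. (-1) * h w) \<in> V" by (rule V_mult[OF V_const h])
    have "l (\<lambda>w. f w + (-1) * h w) \<le> 0" using le by (intro l_le V_add f m) simp
    then show ?thesis using l_add[OF f m] l_mult[OF h, of "-1"] by simp
  qed
  have l_zero: "l (\<lambda>w. 0) = 0" using l_mult[OF V_const[of 0], of 0] by simp
  have sqV: "(\<lambda>w. (norm (pairing w x))\<^sup>2) \<in> V" if "x \<in> testfuns" for x
    unfolding power2_eq_square by (intro V_mult V_bound that)
  define Q2 where "Q2 x = l (\<lambda>w. (norm (pairing w x))\<^sup>2)" for x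
  have Q2_nonneg: "0 \<le> Q2 x" if "x \<in> testfuns" for x
    using l_mono[OF V_const[of 0] sqV[OF that]] l_zero by (simp add: Q2_def)
  have Q2_lower: "(nrm E (total x))\<^sup>2 \<le> K\<^sup>2 * Q2 x" if x: "x \<in> testfuns" for x
  proof -
    define t where "t = l (\<lambda>w. norm (pairing w x))"
    have "nrm E (total x) \<le> l (\<lambda>w. K * norm (pairing w x))"
      using x by (intro l_Q) (auto simp: Q_def g_def[abs_def] r_def intro!: exI[of _ "[x]"])
    then have nt: "nrm E (total x) \<le> K * t" using l_mult[OF V_bound[OF x], of K] by (simp add: t_def)
    have n: "0 \<le> nrm E (total x)" using total_in[OF x] by simp
    have "2 * t * t \<le> Q2 x + t\<^sup>2"
    proof -
      have "2 * t * t = l (\<lambda>w. (2 * t) * norm (pairing w x))" using l_mult[OF V_bound[OF x], of "2 * t"] by (simp add: t_def)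
      also have "\<dots> \<le> l (\<lambda>w. (norm (pairing w x))\<^sup>2 + t\<^sup>2)"
      proof (rule l_mono)
        show "(2 * t) * norm (pairing w x) \<le> (norm (pairing w x))\<^sup>2 + t\<^sup>2" for w
          using sum_squares_bound[of "norm (pairing w x)" t] by (simp add: mult_ac)
      qed (intro V_mult V_const V_bound V_add sqV x)+
      also have "\<dots> = Q2 x + l (\<lambda>w. t\<^sup>2)" using l_add[OF sqV[OF x] V_const] by (simp add: Q2_def)
      also have "l (\<lambda>w. t\<^sup>2) \<le> t\<^sup>2" by (intro l_le V_const) simp
      finally show ?thesis by simp
    qed
    then have "t\<^sup>2 \<le> Q2 x" by (simp add: power2_eq_square)
    then have "K\<^sup>2 * t\<^sup>2 \<le> K\<^sup>2 * Q2 x" by (rule mult_left_mono) simp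
    moreover have "(nrm E (total x))\<^sup>2 \<le> (K * t)\<^sup>2" using nt n by (rule power_mono)
    ultimately show ?thesis by (simp add: power_mult_distrib)
  qed
  have Q2_scale: "Q2 (\<lambda>y. c * x y) = (norm c)\<^sup>2 * Q2 x" if x: "x \<in> testfuns" for c x
    using l_mult[OF sqV[OF x], of "(norm c)\<^sup>2"]
    by (simp add: Q2_def testfuns_scale[OF x] norm_mult power_mult_distrib)
  have parallel: "Q2 (\<lambda>y. 1 * x y + 1 * z y) + Q2 (\<lambda>y. 1 * x y + (-1) * z y) = 2 * Q2 x + 2 * Q2 z"
    if x: "x \<in> testfuns" and z: "z \<in> testfuns" for x z
  proof -
    have id: "(norm (a + b))\<^sup>2 + (norm (a - b))\<^sup>2 = 2 * (norm a)\<^sup>2 + 2 * (norm b)\<^sup>2" for a b :: 'k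
      unfolding norm_scalar_square by (simp add: to_complex_add to_complex_diff power2_sum power2_diff)
    have "Q2 (\<lambda>y. 1 * x y + 1 * z y) + Q2 (\<lambda>y. 1 * x y + (-1) * z y) =
       l (\<lambda>w. (norm (pairing w (\<lambda>y. 1 * x y + 1 * z y)))\<^sup>2 + (norm (pairing w (\<lambda>y. 1 * x y + (-1) * z y)))\<^sup>2)"
      unfolding Q2_def by (intro l_add[symmetric] sqV testfuns_combination x z)
    also have "\<dots> = l (\<lambda>w. 2 * (norm (pairing w x))\<^sup>2 + 2 * (norm (pairing w z))\<^sup>2)"
      unfolding testfuns_combination(3)[OF x z] using id by simp
    also have "\<dots> = l (\<lambda>w. 2 * (norm (pairing w x))\<^sup>2) + l (\<lambda>w. 2 * (norm (pairing w z))\<^sup>2)"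
      by (intro l_add V_mult V_const sqV x z)
    also have "\<dots> = 2 * Q2 x + 2 * Q2 z"
      unfolding Q2_def by (simp only: l_mult sqV x z)
    finally show ?thesis .
  qed
  define q where "q y = Inf (Q2 ` {x \<in> testfuns. total x = y})" for y
  have bdd: "bdd_below (Q2 ` {x \<in> testfuns. total x = y})" for y
    using Q2_nonneg by (intro bdd_belowI[of _ 0]) auto
  have q_le: "q y \<le> Q2 x" if "x \<in> testfuns" "total x = y" for x y
    unfolding q_def by (rule cInf_lower[OF _ bdd]) (use that in auto)
  have q_ge: "m \<le> q y" if "y \<in> points E" "\<And>x. x \<in> testfuns \<Longrightarrow> total x = y \<Longrightarrow> m \<le> Q2 x" for y m
    unfolding q_def using testfuns_delta(1,2)[OF that(1)] that(2) by (intro cInf_greatest) auto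
  have q_nonneg: "0 \<le> q y" if "y \<in> points E" for y
    using Q2_nonneg by (intro q_ge that)
  have q_upper: "q y \<le> 1 * (nrm E y)\<^sup>2" if y: "y \<in> points E" for y
  proof -
    have "q y \<le> Q2 (\<lambda>z. if z = y then 1 else 0)" by (rule q_le[OF testfuns_delta(1,2)[OF y]])
    also have "\<dots> \<le> (nrm E y)\<^sup>2"
      unfolding Q2_def
    proof (rule l_le[OF sqV[OF testfuns_delta(1)[OF y]]])
      show "(norm (pairing w (\<lambda>z. if z = y then 1 else 0)))\<^sup>2 \<le> (nrm E y)\<^sup>2" if "w \<in> weights" for w
        unfolding testfuns_delta(3)[OF y] using that y by (intro power_mono) (auto simp: weights_def)
    qed
    finally show ?thesis by simp
  qed
  have q_lower: "(nrm E y)\<^sup>2 \<le> K\<^sup>2 * q y" if y: "y \<in> points E" for y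
  proof -
    have "(nrm E y)\<^sup>2 / K\<^sup>2 \<le> q y"
      using Q2_lower K by (intro q_ge y) (auto simp: pos_divide_le_eq mult.commute)
    then show ?thesis using K by (simp add: pos_divide_le_eq mult.commute)
  qed
  have q_scale_le: "q (scale E c y) \<le> (norm c)\<^sup>2 * q y" if y: "y \<in> points E" and c: "c \<noteq> 0" for c y
  proof -
    have "q (scale E c y) / (norm c)\<^sup>2 \<le> q y"
    proof (rule q_ge[OF y])
      fix x assume x: "x \<in> testfuns" "total x = y"
      have "q (scale E c y) \<le> Q2 (\<lambda>y. c * x y)" using testfuns_scale[OF x(1), where a = c] x(2) by (intro q_le) auto
      then show "q (scale E c y) / (norm c)\<^sup>2 \<le> Q2 x" using c by (simp add: Q2_scale[OF x(1)] pos_divide_le_eq mult.commute)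
    qed
    then show ?thesis using c by (simp add: pos_divide_le_eq mult.commute)
  qed
  have q_scale: "q (scale E c y) = (norm c)\<^sup>2 * q y" if y: "y \<in> points E" for c y
  proof (cases "c = 0")
    case True
    then show ?thesis using q_upper[of 0] q_nonneg[of 0] by simp
  next
    case False
    have "q (scale E (inverse c) (scale E c y)) \<le> (norm (inverse c))\<^sup>2 * q (scale E c y)"
      using False y by (intro q_scale_le) auto
    then have "q y \<le> q (scale E c y) / (norm c)\<^sup>2"
      using False by (simp add: nonzero_norm_inverse power_inverse divide_inverse mult.commute)
    then have "(norm c)\<^sup>2 * q y \<le> q (scale E c y)"
      using False by (simp add: pos_le_divide_eq mult.commute)
    then show ?thesis using q_scale_le[OF y False] by simp
  qed
  have par_le: "q (x + y) + q (x - y) \<le> 2 * q x + 2 * q y" if x: "x \<in> points E" and y: "y \<in> points E" for x y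
  proof -
    have *: "q (x + y) + q (x - y) \<le> 2 * Q2 u + 2 * Q2 v"
      if u: "u \<in> testfuns" "total u = x" and v: "v \<in> testfuns" "total v = y" for u v
    proof -
      have "q (x + y) \<le> Q2 (\<lambda>y. 1 * u y + 1 * v y)"
        using testfuns_combination[OF u(1) v(1), where a = 1 and b = 1] u(2) v(2) by (intro q_le) auto
      moreover have "q (x - y) \<le> Q2 (\<lambda>y. 1 * u y + (-1) * v y)"
        using testfuns_combination[OF u(1) v(1), where a = 1 and b = "-1"] u(2) v(2) by (intro q_le) auto
      ultimately show ?thesis using parallel[OF u(1) v(1)] by linarith
    qed
    have "(q (x + y) + q (x - y) - 2 * q x) / 2 \<le> q y"
    proof (rule q_ge[OF y])
      fix v assume v: "v \<in> testfuns" "total v = y"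
      have "(q (x + y) + q (x - y) - 2 * Q2 v) / 2 \<le> q x"
        using *[OF _ _ v] by (intro q_ge[OF x]) (simp add: field_simps)
      then show "(q (x + y) + q (x - y) - 2 * q x) / 2 \<le> Q2 v" by (simp add: field_simps)
    qed
    then show ?thesis by (simp add: field_simps)
  qed
  have par: "q (x + y) + q (x - y) = 2 * q x + 2 * q y" if x: "x \<in> points E" and y: "y \<in> points E" for x y
  proof -
    have "q ((x + y) + (x - y)) + q ((x + y) - (x - y)) \<le> 2 * q (x + y) + 2 * q (x - y)"
      using x y by (intro par_le) auto
    moreover have "(x + y) + (x - y) = scale E 2 x" "(x + y) - (x - y) = scale E 2 y"
      using vs.scale_left_distrib[of 1 1] by simp_all
    ultimately have "4 * q x + 4 * q y \<le> 2 * q (x + y) + 2 * q (x - y)"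
      using q_scale[OF x, of 2] q_scale[OF y, of 2] by simp
    then show ?thesis using par_le[OF x y] by simp
  qed
  interpret h: hilbertian E q "K\<^sup>2" 1
    by unfold_locales (use q_upper q_lower q_nonneg q_scale par in auto)
  show ?thesis using h.hilbert_space_hilbert h.isomorphic_hilbert by blast
qed

end

context operators
begin

text \<open>A finite set of points of \<open>Y\<close> is matched with equally many basis vectors outside of the exceptional
block. The operator that sends the normalised basis vectors to the normalised points is bounded by
\<open>C\<close>, and the summing inequality for it is the one needed for \<open>total\<close>.\<close>

lemma isomorphic_hilbert:
  assumes inf: "infinite_dimensional Y" and "infinite B"
  shows "\<exists>H :: ('k, 'b) normed_structure. hilbert_space H \<and> isomorphic Y H"
proof -
  obtain C where C: "0 < C" "\<And>x F. x \<in> points X \<Longrightarrow> finite F \<Longrightarrow> F \<subseteq> B \<Longrightarrow>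
    (\<Sum>b\<in>F. norm (X.coord x b) * nrm X b) \<le> C * nrm X x"
    using ell1_estimate[OF inf] by blast
  obtain K F0 where K: "0 < K" and F0: "finite F0"
    and summing: "\<forall>F y (J :: nat set) x. admissible F y J x \<longrightarrow> F \<inter> F0 = {} \<longrightarrow>
      (\<Sum>j\<in>J. nrm Y (block_op F y (x j))) \<le> K"
    using block_summing by (elim exE conjE)
  show ?thesis
  proof (rule Y.hilbertian_if_universal_map_summing[of "C * K"])
    show "0 < C * K" using C(1) K by simp
    fix k :: nat and x :: "nat \<Rightarrow> 'b \<Rightarrow> 'k" and W :: real
    assume x: "\<And>j. j < k \<Longrightarrow> x j \<in> Y.testfuns" and W: "0 < W"
      and weak: "\<And>w. w \<in> Y.weights \<Longrightarrow> (\<Sum>j<k. norm (Y.pairing w (x j))) \<le> W"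
    define A where "A = (\<Union>j<k. {y. x j y \<noteq> 0})"
    have A: "finite A" "A \<subseteq> points Y" using x Y.testfuns_supportD by (auto simp: A_def)
    have supp: "{y. x j y \<noteq> 0} \<subseteq> A" if "j < k" for j using that by (auto simp: A_def)
    have "infinite (B - F0)" using \<open>infinite B\<close> F0 by simp
    then obtain F where F: "F \<subseteq> B - F0" "finite F" "card F = card A"
      using infinite_arbitrarily_large by blast
    then obtain h where h: "bij_betw h F A" using finite_same_card_bij[OF F(2) A(1)] by blast
    have hA: "h b \<in> A" "h b \<in> points Y" if "b \<in> F" for b using h that A by (auto simp: bij_betw_def)
    have nb: "0 < nrm X b" "b \<in> points X" "b \<in> B" if "b \<in> F" for b
      using that F X.basis_in X.basis_nonzero by auto
    define y where "y b = scale Y (of_real (nrm X b / (C * nrm Y (h b)))) (h b)" for b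
    have y_in: "y b \<in> points Y" if "b \<in> F" for b using hA[OF that] by (simp add: y_def)
    have y_nrm: "nrm Y (y b) \<le> nrm X b / C" if b: "b \<in> F" for b
    proof -
      have "nrm Y (y b) = \<bar>nrm X b / (C * nrm Y (h b))\<bar> * nrm Y (h b)"
        unfolding y_def Y.nrm_scale[OF hA(2)[OF b]] by (simp only: norm_of_real)
      also have "\<dots> \<le> nrm X b / C"
        using nb[OF b] C(1) Y.nrm_nonneg[OF hA(2)[OF b]] by (cases "nrm Y (h b) = 0") (auto simp: field_simps)
      finally show ?thesis .
    qed
    have op_le: "nrm Y (block_op F y z) \<le> nrm X z" if z: "z \<in> points X" for z
    proof -
      have "nrm Y (block_op F y z) \<le> (\<Sum>b\<in>F. nrm Y (scale Y (X.coord z b) (y b)))"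
        unfolding block_op_def using y_in by (intro Y.nrm_sum_le) auto
      also have "\<dots> \<le> (\<Sum>b\<in>F. norm (X.coord z b) * (nrm X b / C))"
      proof (rule sum_mono)
        fix b assume b: "b \<in> F"
        show "nrm Y (scale Y (X.coord z b) (y b)) \<le> norm (X.coord z b) * (nrm X b / C)"
          unfolding Y.nrm_scale[OF y_in[OF b]] by (intro mult_left_mono y_nrm b) simp
      qed
      also have "\<dots> = (\<Sum>b\<in>F. norm (X.coord z b) * nrm X b) / C" by (simp add: sum_divide_distrib)
      also have "\<dots> \<le> nrm X z"
        using C(2)[OF z F(2)] F(1) C(1) by (simp add: pos_divide_le_eq mult.commute subset_iff)
      finally show ?thesis .
    qed
    define c where "c j b = x j (h b) * of_real (nrm Y (h b) / (W * nrm X b))" for j b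
    define t where "t j = X.lincomb (c j) F" for j
    have FB: "F \<subseteq> B" using F by blast
    have t_in: "t j \<in> points X" for j
      unfolding t_def X.lincomb_def using nb by (intro X.sum_in X.scale_in) auto
    have t_coord: "X.coord (t j) = (\<lambda>b. if b \<in> F then c j b else 0)" for j
      unfolding t_def by (rule X.coord_lincomb[OF F(2) FB])
    have "weakly_bounded X {..<k} t 1"
      unfolding weakly_bounded_def
    proof (intro allI impI)
      fix \<psi> :: "'a \<Rightarrow> 'k"
      assume \<psi>: "bounded_operator X scalars \<psi>" "\<forall>z\<in>points X. norm (\<psi> z) \<le> nrm X z"
      interpret \<psi>: bounded_op X scalars \<psi>
        by (rule bounded_opI[OF X.normed normed_space_scalars \<psi>(1)])
      \<comment> \<open>The functional becomes a weight on the points, since the point \<open>h b\<close> is the image of \<open>b\<close> up to normalisation.\<close>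
      define w where "w a = (if a \<in> A then of_real (nrm Y a / nrm X (inv_into F h a)) * \<psi> (inv_into F h a) else 0)" for a
      have w_h: "w (h b) = of_real (nrm Y (h b) / nrm X b) * \<psi> b" if "b \<in> F" for b
        using h that hA(1)[OF that] by (simp add: w_def bij_betw_def)
      have "w \<in> Y.weights"
        unfolding Y.weights_def
      proof (intro CollectI ballI)
        fix a assume a: "a \<in> points Y"
        show "norm (w a) \<le> nrm Y a"
        proof (cases "a \<in> A")
          case True
          then obtain b where b: "b \<in> F" "a = h b" using h by (auto simp: bij_betw_def)
          have "norm (w a) = nrm Y a / nrm X b * norm (\<psi> b)"
            unfolding b(2) w_h[OF b(1)] norm_mult norm_of_real using nb[OF b(1)] hA(2)[OF b(1)] by simp
          also have "\<dots> \<le> nrm Y a / nrm X b * nrm X b"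
            using \<psi>(2) nb[OF b(1)] a by (intro mult_left_mono) auto
          finally show ?thesis using nb(1)[OF b(1)] by simp
        qed (use a in \<open>simp add: w_def\<close>)
      qed
      moreover have "\<psi> (t j) = of_real (1 / W) * Y.pairing w (x j)" if j: "j < k" for j
      proof -
        have "\<psi> (t j) = (\<Sum>b\<in>F. c j b * \<psi> b)"
          unfolding t_def X.lincomb_def using nb by (subst \<psi>.sum) (auto simp: \<psi>.scale)
        also have "\<dots> = (\<Sum>b\<in>F. of_real (1 / W) * (x j (h b) * w (h b)))"
          by (intro sum.cong refl) (simp add: c_def w_h)
        also have "\<dots> = of_real (1 / W) * (\<Sum>a\<in>A. x j a * w a)"
          unfolding sum_distrib_left[symmetric] sum.reindex_bij_betw[OF h, of "\<lambda>a. x j a * w a"] ..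
        finally show ?thesis unfolding Y.pairing_eq[OF A(1) supp[OF j]] .
      qed
      ultimately have "(\<Sum>j<k. norm (\<psi> (t j))) = 1 / W * (\<Sum>j<k. norm (Y.pairing w (x j)))" "(\<Sum>j<k. norm (Y.pairing w (x j))) \<le> W"
        using weak W by (auto simp: norm_mult sum_divide_distrib norm_divide)
      then show "(\<Sum>j<k. norm (\<psi> (t j))) \<le> 1" using W by simp
    qed
    then have "admissible F y {..<k} t"
      unfolding admissible_def using F(2) FB y_in op_le t_in t_coord by simp
    then have "(\<Sum>j<k. nrm Y (block_op F y (t j))) \<le> K" using summing F(1) by blast
    moreover have "block_op F y (t j) = scale Y (of_real (1 / (C * W))) (Y.total (x j))" if j: "j < k" for j
    proof -
      have "block_op F y (t j) = (\<Sum>b\<in>F. scale Y (c j b) (y b))"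
        unfolding block_op_def t_coord by (intro sum.cong) auto
      also have "\<dots> = (\<Sum>b\<in>F. scale Y (of_real (1 / (C * W))) (scale Y (x j (h b)) (h b)))"
      proof (intro sum.cong refl)
        fix b assume b: "b \<in> F"
        show "scale Y (c j b) (y b) = scale Y (of_real (1 / (C * W))) (scale Y (x j (h b)) (h b))"
        proof (cases "h b = 0")
          case False
          then have "nrm Y (h b) \<noteq> 0" using hA(2)[OF b] by simp
          then have "c j b * of_real (nrm X b / (C * nrm Y (h b))) = of_real (1 / (C * W)) * x j (h b)"
            using nb(1)[OF b] W C(1) by (simp add: c_def field_simps)
          then show ?thesis by (simp add: y_def)
        qed (simp add: y_def)
      qed
      also have "\<dots> = scale Y (of_real (1 / (C * W))) (\<Sum>b\<in>F. scale Y (x j (h b)) (h b))"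
        by (simp add: Y.vs.scale_sum_right)
      also have "(\<Sum>b\<in>F. scale Y (x j (h b)) (h b)) = (\<Sum>a\<in>A. scale Y (x j a) a)"
        by (rule sum.reindex_bij_betw[OF h])
      finally show ?thesis unfolding Y.total_eq[OF A(1) supp[OF j]] .
    qed
    moreover have "nrm Y (scale Y (of_real (1 / (C * W))) (Y.total (x j))) = 1 / (C * W) * nrm Y (Y.total (x j))" if "j < k" for j
      unfolding Y.nrm_scale[OF Y.total_in[OF x[OF that]]] norm_of_real using C(1) W by simp
    ultimately have "(\<Sum>j<k. 1 / (C * W) * nrm Y (Y.total (x j))) \<le> K" by simp
    then have "1 / (C * W) * (\<Sum>j<k. nrm Y (Y.total (x j))) \<le> K" unfolding sum_distrib_left .
    then show "(\<Sum>j<k. nrm Y (Y.total (x j))) \<le> C * K * W"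
      using C(1) W by (simp add: field_simps)
  qed
qed

end

section \<open>Grothendieck's inequality\<close>

text \<open>Induction through the Schur complement. If a diagonal entry vanishes, then so does its row, since the
quadratic form would otherwise take negative values.\<close>

lemma cholesky:
  fixes B :: "'g \<Rightarrow> 'g \<Rightarrow> real"
  assumes "finite G" "\<And>a b. a \<in> G \<Longrightarrow> b \<in> G \<Longrightarrow> B a b = B b a"
    "\<And>t. 0 \<le> (\<Sum>a\<in>G. \<Sum>b\<in>G. t a * t b * B a b)"
  shows "\<exists>(d::nat) c. \<forall>a\<in>G. \<forall>b\<in>G. B a b = (\<Sum>k<d. c a k * c b k)"
  using assms
proof (induction G arbitrary: B rule: finite_induct)
  case (insert z G)
  have expand: "(\<Sum>a\<in>insert z G. \<Sum>b\<in>insert z G. t a * t b * B a b) =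
      (t z)^2 * B z z + 2 * t z * (\<Sum>b\<in>G. t b * B z b) + (\<Sum>a\<in>G. \<Sum>b\<in>G. t a * t b * B a b)" for t
  proof -
    have "(\<Sum>a\<in>G. t a * t z * B a z) = t z * (\<Sum>b\<in>G. t b * B z b)"
      using insert.prems(1) by (simp add: sum_distrib_left mult_ac)
    then show ?thesis using insert.hyps
      by (simp add: sum.distrib sum_distrib_left power2_eq_square mult_ac)
  qed
  show ?case
  proof (cases "B z z = 0")
    case True
    have zero: "B z a = 0" if a: "a \<in> G" for a
    proof (rule ccontr)
      assume n: "B z a \<noteq> 0"
      \<comment> \<open>At this vector the quadratic form has the value \<open>-1\<close>.\<close>
      let ?t = "\<lambda>b. if b = a then 1 else if b = z then - (B a a + 1) / (2 * B z a) else 0"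
      have za: "z \<noteq> a" using a insert.hyps by auto
      have "(\<Sum>b\<in>G. ?t b * B z b) = (\<Sum>b\<in>G. if b = a then B z a else 0)"
        using insert.hyps by (intro sum.cong) auto
      moreover have "(\<Sum>x\<in>G. \<Sum>b\<in>G. ?t x * ?t b * B x b) = (\<Sum>x\<in>G. if x = a then B a a else 0)"
      proof (intro sum.cong refl)
        fix x assume x: "x \<in> G"
        have "(\<Sum>b\<in>G. ?t x * ?t b * B x b) = (\<Sum>b\<in>G. if b = a then ?t x * B x a else 0)"
          using insert.hyps by (intro sum.cong) auto
        then show "(\<Sum>b\<in>G. ?t x * ?t b * B x b) = (if x = a then B a a else 0)"
          using x a insert.hyps by auto
      qed
      ultimately have "0 \<le> 2 * ?t z * B z a + B a a"
        using insert.prems(2)[of ?t] expand[of ?t] True a insert.hyps by simp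
      then show False using n za by (simp add: field_simps)
    qed
    have "0 \<le> (\<Sum>a\<in>G. \<Sum>b\<in>G. t a * t b * B a b)" for t
      using insert.prems(2)[of "t"] expand[of t] True zero by simp
    then have "\<exists>(d::nat) c. \<forall>a\<in>G. \<forall>b\<in>G. B a b = (\<Sum>k<d. c a k * c b k)"
      by (intro insert.IH insert.prems(1)) auto
    then obtain d :: nat and c
      where c: "\<forall>a\<in>G. \<forall>b\<in>G. B a b = (\<Sum>k<d. c a k * c b k)" by blast
    have "B a b = (\<Sum>k<d. (c(z := \<lambda>k. 0)) a k * (c(z := \<lambda>k. 0)) b k)" if "a \<in> insert z G" "b \<in> insert z G" for a b
      using that c zero True insert.prems(1)[of a b] insert.hyps by auto
    then show ?thesis by blast
  next
    case False
    have "B z z > 0"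
    proof -
      let ?t = "\<lambda>b. if b = z then 1 else (0::real)"
      have "(\<Sum>b\<in>G. ?t b * B z b) = 0" "(\<Sum>x\<in>G. \<Sum>b\<in>G. ?t x * ?t b * B x b) = 0"
        using insert.hyps by (auto intro!: sum.neutral)
      then show ?thesis using insert.prems(2)[of ?t] expand[of ?t] False by simp
    qed
    define B' where "B' a b = B a b - B z a * B z b / B z z" for a b
    have "0 \<le> (\<Sum>a\<in>G. \<Sum>b\<in>G. t a * t b * B' a b)" for t
    proof -
      let ?s = "\<Sum>b\<in>G. t b * B z b"
      \<comment> \<open>The value at \<open>z\<close> that minimises the quadratic form.\<close>
      let ?t = "t(z := - ?s / B z z)"
      have same: "(\<Sum>b\<in>G. ?t b * B z b) = ?s" "(\<Sum>a\<in>G. \<Sum>b\<in>G. ?t a * ?t b * B a b) = (\<Sum>a\<in>G. \<Sum>b\<in>G. t a * t b * B a b)"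
        using insert.hyps by (auto intro!: sum.cong)
      have "(\<Sum>a\<in>G. \<Sum>b\<in>G. t a * t b * B' a b) =
          (\<Sum>a\<in>G. \<Sum>b\<in>G. t a * t b * B a b) - (\<Sum>a\<in>G. \<Sum>b\<in>G. (t a * B z a) * (t b * B z b)) / B z z"
        unfolding B'_def right_diff_distrib sum_subtractf sum_divide_distrib by (simp add: mult_ac)
      also have "(\<Sum>a\<in>G. \<Sum>b\<in>G. (t a * B z a) * (t b * B z b)) = ?s * ?s"
        by (simp add: sum_product)
      finally have "(\<Sum>a\<in>G. \<Sum>b\<in>G. t a * t b * B' a b) = (\<Sum>a\<in>G. \<Sum>b\<in>G. t a * t b * B a b) - ?s * ?s / B z z" .
      moreover have "0 \<le> (?s / B z z)^2 * B z z + 2 * (- ?s / B z z) * ?s + (\<Sum>a\<in>G. \<Sum>b\<in>G. t a * t b * B a b)"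
        using insert.prems(2)[of ?t] unfolding expand same by simp
      moreover have "(?s / B z z)^2 * B z z + 2 * (- ?s / B z z) * ?s = - (?s * ?s / B z z)"
        using False by (simp add: power2_eq_square field_simps)
      ultimately show ?thesis by linarith
    qed
    moreover have "B' a b = B' b a" if "a \<in> G" "b \<in> G" for a b
      using insert.prems(1)[of a b] that by (simp add: B'_def)
    ultimately have "\<exists>(d::nat) c. \<forall>a\<in>G. \<forall>b\<in>G. B' a b = (\<Sum>k<d. c a k * c b k)"
      by (intro insert.IH) auto
    then obtain d :: nat and c
      where c: "\<forall>a\<in>G. \<forall>b\<in>G. B' a b = (\<Sum>k<d. c a k * c b k)" by blast
    define c' where "c' a k = (if k < d then if a = z then 0 else c a k else B z a / sqrt (B z z))" for a k
    have last: "c' a d * c' b d = B z a * B z b / B z z" for a b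
      using \<open>B z z > 0\<close> by (simp add: c'_def real_sqrt_mult_self)
    have "B a b = (\<Sum>k<Suc d. c' a k * c' b k)" if "a \<in> insert z G" "b \<in> insert z G" for a b
    proof (cases "a = z \<or> b = z")
      case True
      then have "(\<Sum>k<d. c' a k * c' b k) = 0" by (auto simp: c'_def)
      then show ?thesis using True False insert.prems(1)[OF that] by (auto simp: last)
    next
      case nz: False
      then have "(\<Sum>k<d. c' a k * c' b k) = B' a b" using that c by (simp add: c'_def)
      then show ?thesis by (simp add: last B'_def)
    qed
    then show ?thesis by blast
  qed
qed simp

text \<open>A sign sequence is encoded by the set of indices with sign \<open>+1\<close>, so that expectations are averages over
a power set.\<close>

definition rademacher :: "nat \<Rightarrow> (nat \<Rightarrow> real) \<Rightarrow> nat set \<Rightarrow> real" where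
  "rademacher d v A = (\<Sum>k<d. if k \<in> A then v k else - v k)"

definition avg :: "nat \<Rightarrow> (nat set \<Rightarrow> real) \<Rightarrow> real" where
  "avg d f = (\<Sum>A\<in>Pow {..<d}. f A) / 2 ^ d"

lemma avg_mono: "(\<And>A. A \<subseteq> {..<d} \<Longrightarrow> f A \<le> g A) \<Longrightarrow> avg d f \<le> avg d g"
  unfolding avg_def by (intro divide_right_mono sum_mono) auto

lemma avg_add: "avg d (\<lambda>A. f A + g A) = avg d f + avg d g"
  by (simp add: avg_def sum.distrib add_divide_distrib)

lemma avg_cmult: "avg d (\<lambda>A. c * f A) = c * avg d f"
  by (simp add: avg_def sum_distrib_left)

lemma avg_const [simp]: "avg d (\<lambda>A. c) = c"
  by (simp add: avg_def card_Pow)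

lemma avg_sum: "avg d (\<lambda>A. \<Sum>j\<in>J. f j A) = (\<Sum>j\<in>J. avg d (f j))"
  unfolding avg_def by (subst sum.swap) (simp add: sum_divide_distrib)

lemma avg_Suc: "avg (Suc d) f = avg d (\<lambda>A. (f A + f (insert d A)) / 2)"
proof -
  have "(\<Sum>A\<in>Pow {..<Suc d}. f A) = (\<Sum>A\<in>Pow {..<d}. f A) + (\<Sum>A\<in>insert d ` Pow {..<d}. f A)"
    unfolding lessThan_Suc Pow_insert by (intro sum.union_disjoint) auto
  also have "(\<Sum>A\<in>insert d ` Pow {..<d}. f A) = (\<Sum>A\<in>Pow {..<d}. f (insert d A))"
    by (subst sum.reindex) (auto simp: inj_on_def comp_def)
  finally show ?thesis
    by (simp add: avg_def sum.distrib sum_divide_distrib[symmetric])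
qed

lemma rademacher_Suc:
  assumes "A \<subseteq> {..<d}"
  shows "rademacher (Suc d) v A = rademacher d v A - v d"
    "rademacher (Suc d) v (insert d A) = rademacher d v A + v d"
proof -
  have "d \<notin> A" using assms by auto
  moreover have "(\<Sum>k<d. if k \<in> insert d A then v k else - v k) = (\<Sum>k<d. if k \<in> A then v k else - v k)"
    by (intro sum.cong) auto
  ultimately show "rademacher (Suc d) v A = rademacher d v A - v d"
    "rademacher (Suc d) v (insert d A) = rademacher d v A + v d"
    by (auto simp: rademacher_def)
qed

lemma rademacher_second_moment: "avg d (\<lambda>A. (rademacher d v A)^2) = (\<Sum>k<d. (v k)^2)"
proof (induction d)
  case 0
  then show ?case by (simp add: avg_def rademacher_def)
next
  case (Suc d)
  have "avg (Suc d) (\<lambda>A. (rademacher (Suc d) v A)^2) = avg d (\<lambda>A. (rademacher d v A)^2 + (v d)^2)"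
    unfolding avg_Suc
    by (intro antisym avg_mono) (simp_all add: rademacher_Suc, simp_all add: power2_eq_square field_simps)
  then show ?case using Suc by (simp add: avg_add)
qed

lemma rademacher_fourth_moment: "avg d (\<lambda>A. (rademacher d v A)^4) \<le> 3 * (\<Sum>k<d. (v k)^2)^2"
proof (induction d)
  case 0
  then show ?case by (simp add: avg_def rademacher_def)
next
  case (Suc d)
  have id: "((r - x)^4 + (r + x)^4) / 2 = r^4 + ((6 * x^2) * r^2 + x^4)" for r x :: real
    by (simp add: power4_eq_xxxx power2_eq_square) algebra
  have "avg (Suc d) (\<lambda>A. (rademacher (Suc d) v A)^4) =
      avg d (\<lambda>A. (rademacher d v A)^4 + ((6 * (v d)^2) * (rademacher d v A)^2 + (v d)^4))"
    unfolding avg_Suc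
    by (intro antisym avg_mono) (simp_all add: rademacher_Suc id)
  also have "\<dots> \<le> 3 * (\<Sum>k<d. (v k)^2)^2 + (6 * (v d)^2 * (\<Sum>k<d. (v k)^2) + (v d)^4)"
    using Suc by (simp add: avg_add avg_cmult rademacher_second_moment)
  also have "\<dots> \<le> 3 * ((\<Sum>k<d. (v k)^2) + (v d)^2)^2"
  proof -
    have "(v d)^4 = ((v d)^2)^2" by simp
    then show ?thesis by (simp only: power2_sum) (simp add: algebra_simps)
  qed
  finally show ?case by simp
qed

text \<open>From \<open>(u - 2 s)\<^sup>2 (u + 4 s) \<ge> 0\<close> one gets a lower bound of \<open>|r|\<close> by a combination of \<open>r\<^sup>2\<close> and \<open>r\<^sup>4\<close>, and
the second and fourth moments are known.\<close>

lemma khinchine: "L2_set v {..<d} \<le> 2 * avg d (\<lambda>A. \<bar>rademacher d v A\<bar>)"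
proof (cases "L2_set v {..<d} = 0")
  case True
  have "0 \<le> avg d (\<lambda>A. \<bar>rademacher d v A\<bar>)" by (simp add: avg_def sum_nonneg)
  then show ?thesis using True by simp
next
  case False
  define s where "s = L2_set v {..<d}"
  have s: "s > 0" unfolding s_def using False by (metis L2_set_nonneg order_le_less)
  have s2: "(\<Sum>k<d. (v k)^2) = s^2" by (simp add: s_def L2_set_def sum_nonneg)
  have pt: "(12 * s^2) * r^2 + (-1) * r^4 \<le> 16 * s^3 * \<bar>r\<bar>" for r
  proof -
    let ?u = "\<bar>r\<bar>"
    have "0 \<le> ?u * ((?u - 2 * s)^2 * (?u + 4 * s))" using s by simp
    also have "u * ((u - 2 * s)^2 * (u + 4 * s)) = u^4 - 12 * s^2 * u^2 + 16 * s^3 * u" for u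
      by (simp add: power2_eq_square power3_eq_cube power4_eq_xxxx algebra_simps)
    finally show ?thesis by (simp add: power_even_abs)
  qed
  have "12 * s^2 * s^2 - 3 * (s^2)^2 \<le> avg d (\<lambda>A. (12 * s^2) * (rademacher d v A)^2 + (-1) * (rademacher d v A)^4)"
    using rademacher_fourth_moment[of d v] rademacher_second_moment[of d v]
    unfolding avg_add avg_cmult s2 by simp
  also have "\<dots> \<le> avg d (\<lambda>A. 16 * s^3 * \<bar>rademacher d v A\<bar>)" by (intro avg_mono pt)
  finally have "9 * s^4 \<le> 16 * s^3 * avg d (\<lambda>A. \<bar>rademacher d v A\<bar>)"
    by (simp add: avg_cmult power2_eq_square power4_eq_xxxx)
  then have "s^3 * (9 * s) \<le> s^3 * (16 * avg d (\<lambda>A. \<bar>rademacher d v A\<bar>))"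
    by (simp add: power3_eq_cube power4_eq_xxxx mult_ac)
  then have "9 * s \<le> 16 * avg d (\<lambda>A. \<bar>rademacher d v A\<bar>)" using s by simp
  then show ?thesis using s unfolding s_def[symmetric] by linarith
qed

lemma avg_abs_le_sqrt: "avg d (\<lambda>A. \<bar>f A\<bar>) \<le> sqrt (avg d (\<lambda>A. (f A)^2))"
proof -
  define a where "a = avg d (\<lambda>A. \<bar>f A\<bar>)"
  have "0 \<le> avg d (\<lambda>A. (\<bar>f A\<bar> - a)^2)" by (simp add: avg_def sum_nonneg)
  also have "\<dots> = avg d (\<lambda>A. (f A)^2 + ((- 2 * a) * \<bar>f A\<bar> + a^2))"
    by (intro arg_cong[of _ _ "avg d"] ext) (simp add: power2_diff)
  also have "\<dots> = avg d (\<lambda>A. (f A)^2) - a^2"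
    unfolding avg_add avg_cmult avg_const a_def[symmetric] by (simp add: power2_eq_square)
  finally show ?thesis unfolding a_def[symmetric] by (intro real_le_rsqrt) simp
qed

lemma rademacher_combination:
  "rademacher d (\<lambda>k. \<Sum>g\<in>G. x g * c g k) A = (\<Sum>g\<in>G. x g * rademacher d (c g) A)"
  unfolding rademacher_def sum_distrib_left
  by (subst sum.swap, intro sum.cong refl) (simp add: sum_negf)

lemma L2_set_combination_le:
  assumes "finite G" "\<And>g. g \<in> G \<Longrightarrow> L2_set (c g) I \<le> 1"
  shows "L2_set (\<lambda>k. \<Sum>g\<in>G. x g * c g k) I \<le> (\<Sum>g\<in>G. \<bar>x g\<bar>)"
  using assms
proof (induction G rule: finite_induct)
  case empty
  then show ?case by (simp add: L2_set_def)
next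
  case (insert g G)
  have "L2_set (\<lambda>k. x g * c g k + (\<Sum>g\<in>G. x g * c g k)) I \<le>
      L2_set (\<lambda>k. x g * c g k) I + L2_set (\<lambda>k. \<Sum>g\<in>G. x g * c g k) I"
    by (rule L2_set_triangle_ineq)
  also have "L2_set (\<lambda>k. x g * c g k) I = \<bar>x g\<bar> * L2_set (c g) I"
    by (simp add: L2_set_def power_mult_distrib sum_distrib_left[symmetric] real_sqrt_mult)
  also have "\<bar>x g\<bar> * L2_set (c g) I \<le> \<bar>x g\<bar>" using insert.prems by (simp add: mult_left_le)
  finally show ?case using insert by simp
qed

text \<open>Bootstrapping on the best constant \<open>Sup S\<close>, which is finite because the \<open>x j g\<close> are finitely many. By
Khinchine's inequality the vectors \<open>c g\<close> may be replaced by Rademacher sums \<open>R g\<close>. Truncate these at height 8.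
The truncated sums are, for each choice of signs, bounded weights, which costs \<open>8 W\<close>. The remainders
have an \<open>L\<^sub>2\<close> norm of at most 1/4 and are again vectors of a finite-dimensional Euclidean space, which
costs \<open>Sup S / 4\<close>.\<close>

lemma grothendieck_coordinates:
  fixes x :: "'j \<Rightarrow> 'g \<Rightarrow> real"
  assumes "finite G" "finite J"
    and W: "\<And>w. (\<And>g. g \<in> G \<Longrightarrow> \<bar>w g\<bar> \<le> 1) \<Longrightarrow> (\<Sum>j\<in>J. \<bar>\<Sum>g\<in>G. x j g * w g\<bar>) \<le> W"
    and c: "\<And>g. g \<in> G \<Longrightarrow> L2_set (c g) {..<d::nat} \<le> 1"
  shows "(\<Sum>j\<in>J. L2_set (\<lambda>k. \<Sum>g\<in>G. x j g * c g k) {..<d}) \<le> 32 * W"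
proof -
  let ?f = "\<lambda>(d::nat) c. \<Sum>j\<in>J. L2_set (\<lambda>k. \<Sum>g\<in>G. x j g * c g k) {..<d}"
  define S where "S = {?f d c | d c. \<forall>g\<in>G. L2_set (c g) {..<d} \<le> 1}"
  have bdd: "bdd_above S"
  proof (rule bdd_aboveI)
    fix y assume "y \<in> S"
    then show "y \<le> (\<Sum>j\<in>J. \<Sum>g\<in>G. \<bar>x j g\<bar>)"
      unfolding S_def by (auto intro!: sum_mono L2_set_combination_le[OF \<open>finite G\<close>])
  qed
  have S_upper: "?f d c \<le> Sup S" if "\<And>g. g \<in> G \<Longrightarrow> L2_set (c g) {..<d} \<le> 1" for d c
    by (rule cSup_upper[OF _ bdd]) (use that in \<open>auto simp: S_def\<close>)
  have improve: "?f d c \<le> 16 * W + Sup S / 2" if c: "\<And>g. g \<in> G \<Longrightarrow> L2_set (c g) {..<d} \<le> 1" for d c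
  proof -
    define R where "R g A = rademacher d (c g) A" for g A
    define T where "T g A = (if \<bar>R g A\<bar> \<le> 8 then R g A else 0)" for g A
    define T' where "T' g A = R g A - T g A" for g A
    have "(\<Sum>j\<in>J. avg d (\<lambda>A. \<bar>\<Sum>g\<in>G. x j g * T g A\<bar>)) \<le> avg d (\<lambda>A. 8 * W)"
      unfolding avg_sum[symmetric]
    proof (rule avg_mono)
      fix A
      have "(\<Sum>j\<in>J. \<bar>\<Sum>g\<in>G. x j g * (T g A / 8)\<bar>) \<le> W" by (rule W) (simp add: T_def)
      moreover have "(\<Sum>j\<in>J. \<bar>\<Sum>g\<in>G. x j g * (T g A / 8)\<bar>) = (\<Sum>j\<in>J. \<bar>\<Sum>g\<in>G. x j g * T g A\<bar>) / 8"
        by (simp add: sum_divide_distrib[symmetric])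
      ultimately show "(\<Sum>j\<in>J. \<bar>\<Sum>g\<in>G. x j g * T g A\<bar>) \<le> 8 * W" by simp
    qed
    then have main: "(\<Sum>j\<in>J. avg d (\<lambda>A. \<bar>\<Sum>g\<in>G. x j g * T g A\<bar>)) \<le> 8 * W" by simp
    obtain h where h: "bij_betw h {..<card (Pow {..<d})} (Pow {..<d})"
      using ex_bij_betw_nat_finite[of "Pow {..<d}"] by (auto simp: atLeast0LessThan)
    define D where "D = card (Pow {..<d})"
    have avgD: "avg d (\<lambda>A. (f A)^2) = (\<Sum>k<D. (f (h k) / sqrt (2 ^ d))^2)" for f
      unfolding avg_def D_def sum.reindex_bij_betw[OF h, symmetric]
      by (simp add: power_divide sum_divide_distrib)
    \<comment> \<open>The remainders, as vectors indexed by the sign choices and scaled up to norm at most 1.\<close>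
    define c' where "c' g k = 4 * (T' g (h k) / sqrt (2 ^ d))" for g k
    have "L2_set (c' g) {..<D} \<le> 1" if g: "g \<in> G" for g
    proof -
      have "(\<Sum>k<D. (c' g k)^2) = 16 * avg d (\<lambda>A. (T' g A)^2)"
        unfolding avgD c'_def power_mult_distrib sum_distrib_left by simp
      also have "\<dots> \<le> 16 * avg d (\<lambda>A. (1 / 64) * (R g A)^4)"
      proof (intro mult_left_mono avg_mono)
        fix A
        show "(T' g A)^2 \<le> 1 / 64 * (R g A)^4"
        proof (cases "\<bar>R g A\<bar> \<le> 8")
          case False
          then have "8^2 \<le> (R g A)^2" by (intro abs_le_square_iff[THEN iffD1]) simp
          then have "64 * (R g A)^2 \<le> (R g A)^2 * (R g A)^2" by (intro mult_right_mono) auto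
          then show ?thesis using False by (simp add: T'_def T_def power4_eq_xxxx power2_eq_square)
        qed (simp add: T'_def T_def)
      qed simp
      also have "\<dots> \<le> 16 * (1 / 64 * (3 * (\<Sum>k<d. (c g k)^2)^2))"
        unfolding avg_cmult R_def using rademacher_fourth_moment[of d "c g"] by simp
      also have "\<dots> \<le> 1"
      proof -
        have "(\<Sum>k<d. (c g k)^2) \<le> 1" using c[OF g] by (simp add: L2_set_def)
        then have "(\<Sum>k<d. (c g k)^2)^2 \<le> 1" by (intro power_le_one) (auto simp: sum_nonneg)
        then show ?thesis by simp
      qed
      finally show ?thesis by (simp add: L2_set_def)
    qed
    then have "?f D c' \<le> Sup S" by (rule S_upper)
    moreover have "?f D c' = 4 * (\<Sum>j\<in>J. sqrt (avg d (\<lambda>A. (\<Sum>g\<in>G. x j g * T' g A)^2)))"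
    proof -
      have "L2_set (\<lambda>k. \<Sum>g\<in>G. x j g * c' g k) {..<D} = 4 * sqrt (avg d (\<lambda>A. (\<Sum>g\<in>G. x j g * T' g A)^2))" for j
      proof -
        have "(\<Sum>g\<in>G. x j g * c' g k) = 4 * ((\<Sum>g\<in>G. x j g * T' g (h k)) / sqrt (2 ^ d))" for k
          unfolding c'_def by (simp add: sum_distrib_left sum_divide_distrib mult_ac)
        then have "L2_set (\<lambda>k. \<Sum>g\<in>G. x j g * c' g k) {..<D} =
            sqrt (16 * (\<Sum>k<D. ((\<Sum>g\<in>G. x j g * T' g (h k)) / sqrt (2 ^ d))^2))"
          by (simp only: L2_set_def power_mult_distrib sum_distrib_left) simp
        then show ?thesis by (simp add: avgD real_sqrt_mult)
      qed
      then show ?thesis by (simp add: sum_distrib_left)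
    qed
    ultimately have rest: "(\<Sum>j\<in>J. sqrt (avg d (\<lambda>A. (\<Sum>g\<in>G. x j g * T' g A)^2))) \<le> Sup S / 4" by simp
    have "?f d c \<le> (\<Sum>j\<in>J. 2 * avg d (\<lambda>A. \<bar>\<Sum>g\<in>G. x j g * R g A\<bar>))"
      unfolding R_def rademacher_combination[symmetric] by (intro sum_mono khinchine)
    also have "\<dots> \<le> (\<Sum>j\<in>J. 2 * (avg d (\<lambda>A. \<bar>\<Sum>g\<in>G. x j g * T g A\<bar>) + avg d (\<lambda>A. \<bar>\<Sum>g\<in>G. x j g * T' g A\<bar>)))"
    proof (intro sum_mono mult_left_mono)
      fix j
      have "(\<Sum>g\<in>G. x j g * R g A) = (\<Sum>g\<in>G. x j g * T g A) + (\<Sum>g\<in>G. x j g * T' g A)" for A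
        by (simp add: T'_def sum.distrib[symmetric] algebra_simps)
      then show "avg d (\<lambda>A. \<bar>\<Sum>g\<in>G. x j g * R g A\<bar>) \<le>
          avg d (\<lambda>A. \<bar>\<Sum>g\<in>G. x j g * T g A\<bar>) + avg d (\<lambda>A. \<bar>\<Sum>g\<in>G. x j g * T' g A\<bar>)"
        unfolding avg_add[symmetric] by (intro avg_mono) (simp add: abs_triangle_ineq)
    qed simp
    also have "\<dots> \<le> 2 * (\<Sum>j\<in>J. avg d (\<lambda>A. \<bar>\<Sum>g\<in>G. x j g * T g A\<bar>)) +
        2 * (\<Sum>j\<in>J. sqrt (avg d (\<lambda>A. (\<Sum>g\<in>G. x j g * T' g A)^2)))"
      unfolding sum_distrib_left[symmetric] sum.distrib distrib_left
      by (intro add_left_mono mult_left_mono sum_mono avg_abs_le_sqrt) simp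
    also have "\<dots> \<le> 16 * W + Sup S / 2" using main rest by simp
    finally show ?thesis .
  qed
  have "Sup S \<le> 16 * W + Sup S / 2"
  proof (rule cSup_least)
    have "?f 0 (\<lambda>g k. 0) \<in> S" unfolding S_def by (auto intro!: exI[of _ 0] exI[of _ "\<lambda>g k. 0"] simp: L2_set_def)
    then show "S \<noteq> {}" by blast
  qed (use improve in \<open>auto simp: S_def\<close>)
  then have "Sup S \<le> 32 * W" by simp
  then show ?thesis using S_upper[of c d] c by fastforce
qed

lemma grothendieck_gram:
  fixes x :: "'j \<Rightarrow> 'g \<Rightarrow> real" and B :: "'g \<Rightarrow> 'g \<Rightarrow> real"
  assumes "finite G" "finite J"
    and W: "\<And>w. (\<And>g. g \<in> G \<Longrightarrow> \<bar>w g\<bar> \<le> 1) \<Longrightarrow> (\<Sum>j\<in>J. \<bar>\<Sum>g\<in>G. x j g * w g\<bar>) \<le> W"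
    and sym: "\<And>a b. a \<in> G \<Longrightarrow> b \<in> G \<Longrightarrow> B a b = B b a"
    and psd: "\<And>t. 0 \<le> (\<Sum>a\<in>G. \<Sum>b\<in>G. t a * t b * B a b)"
    and diag: "\<And>a. a \<in> G \<Longrightarrow> B a a \<le> 1"
  shows "(\<Sum>j\<in>J. sqrt (\<Sum>a\<in>G. \<Sum>b\<in>G. x j a * x j b * B a b)) \<le> 32 * W"
proof -
  obtain d :: nat and c where c: "\<And>a b. a \<in> G \<Longrightarrow> b \<in> G \<Longrightarrow> B a b = (\<Sum>k<d. c a k * c b k)"
    using cholesky[where G=G and B=B] \<open>finite G\<close> sym psd by blast
  have "(\<Sum>a\<in>G. \<Sum>b\<in>G. x j a * x j b * B a b) = (\<Sum>k<d. (\<Sum>a\<in>G. x j a * c a k)^2)" for j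
  proof -
    have "(\<Sum>a\<in>G. \<Sum>b\<in>G. x j a * x j b * B a b) =
        (\<Sum>a\<in>G. \<Sum>b\<in>G. \<Sum>k<d. (x j a * c a k) * (x j b * c b k))"
      by (intro sum.cong refl) (simp add: c sum_distrib_left mult_ac)
    also have "\<dots> = (\<Sum>a\<in>G. \<Sum>k<d. \<Sum>b\<in>G. (x j a * c a k) * (x j b * c b k))"
      by (intro sum.cong refl) (rule sum.swap)
    also have "\<dots> = (\<Sum>k<d. \<Sum>a\<in>G. \<Sum>b\<in>G. (x j a * c a k) * (x j b * c b k))"
      by (rule sum.swap)
    finally show ?thesis by (simp add: sum_product power2_eq_square)
  qed
  then have "(\<Sum>j\<in>J. sqrt (\<Sum>a\<in>G. \<Sum>b\<in>G. x j a * x j b * B a b)) =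
      (\<Sum>j\<in>J. L2_set (\<lambda>k. \<Sum>g\<in>G. x j g * c g k) {..<d})"
    by (simp add: L2_set_def)
  also have "\<dots> \<le> 32 * W"
    proof -
    have "L2_set (c g) {..<d} \<le> 1" if "g \<in> G" for g
      using diag[OF that] c[OF that that] by (simp add: L2_set_def power2_eq_square)
    then show ?thesis
      using grothendieck_coordinates[OF assms(1,2), where x=x and c=c and d=d and W=W] W by blast
  qed
  finally show ?thesis .
qed

section \<open>From multilinear to linear operators\<close>

locale multilinear_space =
  fixes n :: nat and X :: "nat \<Rightarrow> ('k::real_or_complex, 'a::ab_group_add) normed_structure"
  assumes normed: "\<And>i. i \<in> {1..n} \<Longrightarrow> normed_space (X i)"
begin

lemma factor: "i \<in> {1..n} \<Longrightarrow> nspace (X i)"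
  by (intro nspace.intro normed)

lemma point_in: "u \<in> product_points n X \<Longrightarrow> i \<in> {1..n} \<Longrightarrow> u i \<in> points (X i)"
  by (auto simp: product_points_def)

lemma update_in:
  assumes "u \<in> product_points n X" "i \<in> {1..n}" "x \<in> points (X i)"
  shows "u(i := x) \<in> product_points n X"
  using assms unfolding product_points_def by (auto simp: PiE_def extensional_def)

lemma restrict_in:
  assumes "\<And>i. i \<in> {1..n} \<Longrightarrow> f i \<in> points (X i)"
  shows "restrict f {1..n} \<in> product_points n X"
  using assms by (auto simp: product_points_def)

lemma nrm_point_nonneg: "u \<in> product_points n X \<Longrightarrow> i \<in> {1..n} \<Longrightarrow> 0 \<le> nrm (X i) (u i)"
  using nspace.nrm_nonneg[OF factor point_in] by blast

lemma prod_nrm_nonneg: "u \<in> product_points n X \<Longrightarrow> 0 \<le> (\<Prod>i\<in>{1..n}. nrm (X i) (u i))"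
  by (intro prod_nonneg ballI nrm_point_nonneg)

end

locale multilinear_op = multilinear_space n X + Y: nspace Y
  for n and X :: "nat \<Rightarrow> ('k::real_or_complex, 'a::ab_group_add) normed_structure"
    and Y :: "('k, 'b::ab_group_add) normed_structure" +
  fixes T
  assumes op: "T \<in> multilinear_ops n X Y"
begin

lemma maps [intro]: "u \<in> product_points n X \<Longrightarrow> T u \<in> points Y"
  using op by (auto simp: multilinear_ops_def)

lemma add_at:
  "u \<in> product_points n X \<Longrightarrow> i \<in> {1..n} \<Longrightarrow> x \<in> points (X i) \<Longrightarrow> y \<in> points (X i) \<Longrightarrow>
    T (u(i := x + y)) = T (u(i := x)) + T (u(i := y))"
  using op by (simp add: multilinear_ops_def)

lemma scale_at:
  "u \<in> product_points n X \<Longrightarrow> i \<in> {1..n} \<Longrightarrow> x \<in> points (X i) \<Longrightarrow>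
    T (u(i := scale (X i) c x)) = scale Y c (T (u(i := x)))"
  using op by (simp add: multilinear_ops_def)

lemma bound: "\<exists>C>0. \<forall>u\<in>product_points n X. nrm Y (T u) \<le> C * (\<Prod>i\<in>{1..n}. nrm (X i) (u i))"
proof -
  obtain C where C: "\<forall>u\<in>product_points n X. nrm Y (T u) \<le> C * (\<Prod>i\<in>{1..n}. nrm (X i) (u i))"
    using op by (auto simp: multilinear_ops_def)
  have "nrm Y (T u) \<le> (\<bar>C\<bar> + 1) * (\<Prod>i\<in>{1..n}. nrm (X i) (u i))" if u: "u \<in> product_points n X" for u
  proof -
    have "C * (\<Prod>i\<in>{1..n}. nrm (X i) (u i)) \<le> (\<bar>C\<bar> + 1) * (\<Prod>i\<in>{1..n}. nrm (X i) (u i))"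
      using nrm_point_nonneg[OF u] by (intro mult_right_mono prod_nonneg) auto
    then show ?thesis using C u by fastforce
  qed
  then show ?thesis by (intro exI[of _ "\<bar>C\<bar> + 1"]) auto
qed

lemma zero_at:
  assumes u: "u \<in> product_points n X" and i: "i \<in> {1..n}"
  shows "T (u(i := 0)) = 0"
proof -
  interpret Xi: nspace "X i" by (rule factor[OF i])
  show ?thesis using scale_at[OF u i Xi.zero_in, of 0] by simp
qed

lemma diff_at:
  assumes u: "u \<in> product_points n X" and i: "i \<in> {1..n}" and x: "x \<in> points (X i)" and y: "y \<in> points (X i)"
  shows "T (u(i := x - y)) = T (u(i := x)) - T (u(i := y))"
proof -
  interpret Xi: nspace "X i" by (rule factor[OF i])
  show ?thesis using add_at[OF u i Xi.diff_in[OF x y] y] by simp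
qed

lemma sum_at:
  assumes u: "u \<in> product_points n X" and i: "i \<in> {1..n}" and x: "\<And>a. a \<in> A \<Longrightarrow> x a \<in> points (X i)"
  shows "T (u(i := \<Sum>a\<in>A. x a)) = (\<Sum>a\<in>A. T (u(i := x a)))"
  using x
proof (induction A rule: infinite_finite_induct)
  case (insert a A)
  interpret Xi: nspace "X i" by (rule factor[OF i])
  have "T (u(i := x a + (\<Sum>a\<in>A. x a))) = T (u(i := x a)) + T (u(i := \<Sum>a\<in>A. x a))"
    using insert by (intro add_at u i Xi.sum_in) auto
  moreover have "T (u(i := \<Sum>a\<in>A. x a)) = (\<Sum>a\<in>A. T (u(i := x a)))"
    using insert by (intro insert.IH) auto
  ultimately show ?case by (simp only: sum.insert[OF insert.hyps])
next
  case (infinite A)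
  then show ?case using zero_at[OF u i] by (simp only: sum.infinite[OF infinite(1)])
next
  case empty
  show ?case using zero_at[OF u i] by (simp only: sum.empty)
qed

text \<open>Needed to bring all components of a point to norm 1 at once.\<close>

lemma scale_all:
  assumes w: "w \<in> product_points n X" and "J \<subseteq> {1..n}"
  shows "T (\<lambda>l. if l \<in> J then scale (X l) (c l) (w l) else w l) = scale Y (\<Prod>l\<in>J. c l) (T w)"
proof -
  have "finite J" using assms(2) finite_subset by blast
  then show ?thesis using assms(2)
  proof (induction J rule: finite_induct)
    case (insert j J)
    let ?w = "\<lambda>l. if l \<in> J then scale (X l) (c l) (w l) else w l"
    have j: "j \<in> {1..n}" and J: "J \<subseteq> {1..n}" using insert.prems by auto
    have w': "?w \<in> product_points n X"
    proof -
      have "?w l \<in> points (X l)" if "l \<in> {1..n}" for l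
        using nspace.scale_in[OF factor[OF that] point_in[OF w that]] point_in[OF w that] by simp
      moreover have "?w l = undefined" if "l \<notin> {1..n}" for l
        using that J w by (auto simp: product_points_def PiE_def extensional_def)
      ultimately show ?thesis by (auto simp: product_points_def PiE_def extensional_def)
    qed
    have "(\<lambda>l. if l \<in> insert j J then scale (X l) (c l) (w l) else w l) = ?w(j := scale (X j) (c j) (w j))"
      using insert.hyps by (auto simp: fun_eq_iff)
    moreover have "?w(j := w j) = ?w" using insert.hyps by (auto simp: fun_eq_iff)
    ultimately show ?case
      using scale_at[OF w' j point_in[OF w j], of "c j"] insert by simp
  qed simp
qed

end

lemma multilinear_opI: "multilinear_space n X \<Longrightarrow> normed_space Y \<Longrightarrow> T \<in> multilinear_ops n X Y \<Longrightarrow> multilinear_op n X Y T"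
  by (simp add: multilinear_op.intro nspace.intro multilinear_op_axioms.intro)

context multilinear_space
begin

lemma form_op: "\<phi> \<in> form_ball n X \<Longrightarrow> multilinear_op n X scalars \<phi>"
  by (rule multilinear_opI[OF multilinear_space_axioms normed_space_scalars]) (simp add: form_ball_def)

text \<open>The supremum norm of a form only controls it on the product of the unit balls; elsewhere the components
are normalised first, and a form vanishes if some component is 0.\<close>

lemma form_ball_bound:
  assumes \<phi>: "\<phi> \<in> form_ball n X" and w: "w \<in> product_points n X"
  shows "norm (\<phi> w) \<le> (\<Prod>i\<in>{1..n}. nrm (X i) (w i))"
proof -
  interpret \<phi>: multilinear_op n X scalars \<phi> by (rule form_op[OF \<phi>])
  show ?thesis
  proof (cases "\<exists>i\<in>{1..n}. w i = 0")
    case True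
    then obtain i where i: "i \<in> {1..n}" "w i = 0" by blast
    then have "w(i := 0) = w" by auto
    then have "\<phi> w = 0" using \<phi>.zero_at[OF w i(1)] by simp
    then show ?thesis using prod_nrm_nonneg[OF w] by simp
  next
    case False
    have pos: "0 < nrm (X i) (w i)" if "i \<in> {1..n}" for i
      using False that nspace.nrm_eq_0[OF factor[OF that] point_in[OF w that]] nrm_point_nonneg[OF w that] by fastforce
    let ?c = "\<lambda>l. of_real (inverse (nrm (X l) (w l))) :: 'k"
    let ?w = "\<lambda>l. if l \<in> {1..n} then scale (X l) (?c l) (w l) else w l"
    let ?S = "{u \<in> product_points n X. \<forall>i\<in>{1..n}. nrm (X i) (u i) \<le> 1}"
    have w'_nrm: "nrm (X l) (?w l) \<le> 1" if "l \<in> {1..n}" for l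
    proof -
      have "nrm (X l) (?w l) = norm (?c l) * nrm (X l) (w l)"
        using that nspace.nrm_scale[OF factor[OF that] point_in[OF w that]] by simp
      also have "\<dots> = 1" using pos[OF that] by (simp only: norm_of_real) simp
      finally show ?thesis by simp
    qed
    have w': "?w \<in> product_points n X"
    proof -
      have "?w l \<in> points (X l)" if "l \<in> {1..n}" for l
        using nspace.scale_in[OF factor[OF that] point_in[OF w that]] that by simp
      moreover have "?w l = undefined" if "l \<notin> {1..n}" for l
        using that w by (auto simp: product_points_def PiE_def extensional_def)
      ultimately show ?thesis by (auto simp: product_points_def PiE_def extensional_def)
    qed
    obtain C where C: "0 < C" "\<And>u. u \<in> product_points n X \<Longrightarrow> norm (\<phi> u) \<le> C * (\<Prod>i\<in>{1..n}. nrm (X i) (u i))"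
      using \<phi>.bound by auto
    have "bdd_above ((\<lambda>u. norm (\<phi> u)) ` ?S)"
    proof (rule bdd_aboveI2)
      fix u assume u: "u \<in> ?S"
      then have "(\<Prod>i\<in>{1..n}. nrm (X i) (u i)) \<le> 1"
        using nrm_point_nonneg[of u] by (intro prod_le_1) auto
      then have "C * (\<Prod>i\<in>{1..n}. nrm (X i) (u i)) \<le> C * 1" using C(1) by (intro mult_left_mono) auto
      then show "norm (\<phi> u) \<le> C" using C(2)[of u] u by simp
    qed
    then have "norm (\<phi> ?w) \<le> (SUP u\<in>?S. norm (\<phi> u))"
      using w' w'_nrm by (intro cSUP_upper) auto
    also have "\<dots> \<le> 1" using \<phi> by (simp add: form_ball_def multilinear_norm_def)
    finally have "norm (\<phi> ?w) \<le> 1" .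
    moreover have "\<phi> ?w = (\<Prod>l\<in>{1..n}. ?c l) * \<phi> w"
      using \<phi>.scale_all[OF w order_refl, of ?c] by simp
    moreover have "norm (\<Prod>l\<in>{1..n}. ?c l) = inverse (\<Prod>l\<in>{1..n}. nrm (X l) (w l))"
    proof -
      have "norm (\<Prod>l\<in>{1..n}. ?c l) = (\<Prod>l\<in>{1..n}. norm (?c l))" by (simp add: prod_norm)
      also have "\<dots> = (\<Prod>l\<in>{1..n}. inverse (nrm (X l) (w l)))"
        using pos by (intro prod.cong refl) (simp only: norm_of_real, simp add: abs_of_pos)
      finally show ?thesis by (simp add: prod_inversef[symmetric] comp_def)
    qed
    moreover have "0 < (\<Prod>l\<in>{1..n}. nrm (X l) (w l))" using pos by (intro prod_pos) auto
    ultimately show ?thesis by (simp add: norm_mult field_simps)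
  qed
qed

lemma form_ballI:
  assumes op: "\<phi> \<in> multilinear_ops n X scalars"
    and le: "\<And>u. u \<in> product_points n X \<Longrightarrow> norm (\<phi> u) \<le> (\<Prod>i\<in>{1..n}. nrm (X i) (u i))"
  shows "\<phi> \<in> form_ball n X"
proof -
  let ?S = "{u \<in> product_points n X. \<forall>i\<in>{1..n}. nrm (X i) (u i) \<le> 1}"
  have "restrict (\<lambda>_. 0) {1..n} \<in> product_points n X"
    by (intro restrict_in nspace.zero_in[OF factor])
  then have "restrict (\<lambda>_. 0) {1..n} \<in> ?S" using nspace.nrm_zero[OF factor] by simp
  then have "?S \<noteq> {}" by blast
  moreover have "norm (\<phi> u) \<le> 1" if u: "u \<in> ?S" for u
  proof -
    have "(\<Prod>i\<in>{1..n}. nrm (X i) (u i)) \<le> 1"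
      using nrm_point_nonneg[of u] u by (intro prod_le_1) auto
    then show ?thesis using le[of u] u by simp
  qed
  ultimately have "(SUP u\<in>?S. norm (\<phi> u)) \<le> 1" by (rule cSUP_least)
  then show ?thesis using op by (simp add: form_ball_def multilinear_norm_def)
qed

lemma zero_form: "restrict (\<lambda>_. 0) (product_points n X) \<in> form_ball n X"
proof (rule form_ballI)
  show "restrict (\<lambda>_. 0) (product_points n X) \<in> multilinear_ops n X scalars"
    unfolding multilinear_ops_def
  proof (intro CollectI conjI ballI allI)
    show "\<exists>C. \<forall>u\<in>product_points n X. nrm scalars (restrict (\<lambda>_. 0) (product_points n X) u) \<le> C * (\<Prod>i\<in>{1..n}. nrm (X i) (u i))"
      by (intro exI[of _ 0]) simp
  qed (auto simp: update_in nspace.add_in[OF factor] nspace.scale_in[OF factor])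
  show "norm (restrict (\<lambda>_. 0 :: 'k) (product_points n X) u) \<le> (\<Prod>i\<in>{1..n}. nrm (X i) (u i))"
    if "u \<in> product_points n X" for u
    using that prod_nrm_nonneg[OF that] by simp
qed

lemma lipschitz_summing_1:
  assumes Y: "normed_space Y"
  shows "T \<in> lipschitz_summing 1 n X Y \<longleftrightarrow> T \<in> multilinear_ops n X Y \<and>
     (\<exists>c>0. \<forall>k. \<forall>u v :: nat \<Rightarrow> nat \<Rightarrow> 'a.
       (\<forall>i\<in>{1..k}. u i \<in> product_points n X \<and> v i \<in> product_points n X) \<longrightarrow>
       (\<Sum>i=1..k. nrm Y (T (u i) - T (v i)))
         \<le> c * (SUP \<phi>\<in>form_ball n X. \<Sum>i=1..k. norm (\<phi> (u i) - \<phi> (v i))))"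
proof (cases "T \<in> multilinear_ops n X Y")
  case True
  interpret T: multilinear_op n X Y T by (rule multilinear_opI[OF multilinear_space_axioms Y True])
  have *: "(\<Sum>i=1..k. nrm Y (T (u i) - T (v i)) powr 1) powr (1 / 1) = (\<Sum>i=1..k. nrm Y (T (u i) - T (v i)))"
    if "\<forall>i\<in>{1..k}. u i \<in> product_points n X \<and> v i \<in> product_points n X" for k :: nat and u v :: "nat \<Rightarrow> nat \<Rightarrow> 'a"
  proof -
    have "(\<Sum>i=1..k. nrm Y (T (u i) - T (v i)) powr 1) = (\<Sum>i=1..k. nrm Y (T (u i) - T (v i)))"
    proof (intro sum.cong refl powr_one)
      fix i assume "i \<in> {1..k}"
      then show "0 \<le> nrm Y (T (u i) - T (v i))"
        using that by (intro T.Y.nrm_nonneg T.Y.diff_in T.maps) auto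
    qed
    moreover have "0 \<le> (\<Sum>i=1..k. nrm Y (T (u i) - T (v i)))"
      using that by (intro sum_nonneg T.Y.nrm_nonneg T.Y.diff_in T.maps) auto
    ultimately show ?thesis by simp
  qed
  have **: "(\<Sum>i=1..k. norm (\<phi> (u i) - \<phi> (v i)) powr 1) powr (1 / 1) = (\<Sum>i=1..k. norm (\<phi> (u i) - \<phi> (v i)))"
    for k :: nat and u v :: "nat \<Rightarrow> nat \<Rightarrow> 'a" and \<phi> :: "(nat \<Rightarrow> 'a) \<Rightarrow> 'k"
    by (simp add: sum_nonneg)
  show ?thesis unfolding lipschitz_summing_def ** using True * by auto
qed (simp add: lipschitz_summing_def)

end

text \<open>The pair consists of a basis vector and its coordinate functional, which is bounded by
\<open>projections_bounded\<close>.\<close>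

lemma (in unconditional) norming_pair:
  assumes "points E \<noteq> {0}"
  shows "\<exists>e\<in>points E. \<exists>f. bounded_operator E scalars f \<and> f e = 1"
proof -
  have "B \<noteq> {}"
  proof
    assume B: "B = {}"
    have "x = 0" if x: "x \<in> points E" for x
    proof -
      have "((\<lambda>F. nrm E (proj F x - x)) \<longlongrightarrow> 0) (finite_subsets_at_top {})" using proj_tendsto[OF x] B by simp
      moreover have "\<forall>\<^sub>F F in finite_subsets_at_top {}. nrm E (proj F x - x) = nrm E x"
        unfolding eventually_finite_subsets_at_top using x nrm_minus[OF x] by (auto simp: lincomb_def)
      ultimately have "((\<lambda>F. nrm E x) \<longlongrightarrow> 0) (finite_subsets_at_top ({} :: 'a set))"
        by (rule Lim_transform_eventually)
      then have "nrm E x = 0" by (simp add: tendsto_const_iff)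
      then show ?thesis using x by simp
    qed
    then show False using assms zero_in by auto
  qed
  then obtain b where b: "b \<in> B" by blast
  obtain U where U: "U > 0" "\<And>x F. x \<in> points E \<Longrightarrow> finite F \<Longrightarrow> nrm E (proj F x) \<le> U * nrm E x"
    using projections_bounded by blast
  have "norm (coord x b) \<le> U / nrm E b * nrm E x" if "x \<in> points E" for x
    using U(2)[OF that, of "{b}"] nrm_scale[OF basis_in[OF b]] basis_nonzero[OF b]
    by (simp add: lincomb_def pos_le_divide_eq)
  then have "bounded_operator E scalars (\<lambda>x. coord x b)"
    unfolding bounded_operator_def by (auto simp: coord_add coord_scale intro!: exI[of _ "U / nrm E b"])
  moreover have "coord b b = 1" using coord_basis[OF b] by simp
  ultimately show ?thesis using basis_in[OF b] by blast
qed

text \<open>The operator \<open>u \<mapsto> (\<Prod>l\<noteq>i. f l (u l)) S (u i)\<close> is tested on points whose components other than \<open>i\<close> are the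
fixed vectors \<open>e l\<close> and on the differences of such points with the one whose component \<open>i\<close> is 0. Forms
restricted to these points are functionals on \<open>X i\<close> of norm at most \<open>\<Prod>l\<noteq>i. \<parallel>e l\<parallel>\<close>.\<close>

lemma (in multilinear_space) operators_absolutely_summing:
  assumes Y: "normed_space Y" and all: "lipschitz_summing 1 n X Y = multilinear_ops n X Y"
    and pairs: "\<And>l. l \<in> {1..n} \<Longrightarrow> \<exists>e\<in>points (X l). \<exists>f. bounded_operator (X l) scalars f \<and> f e = 1"
    and i: "i \<in> {1..n}" and S: "bounded_operator (X i) Y S"
  shows "absolutely_summing (X i) Y S"
proof -
  interpret S: bounded_op "X i" Y S by (rule bounded_opI[OF normed[OF i] Y S])
  obtain e f where e: "\<And>l. l \<in> {1..n} \<Longrightarrow> e l \<in> points (X l)"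
    and f: "\<And>l. l \<in> {1..n} \<Longrightarrow> bounded_operator (X l) scalars (f l)" and fe: "\<And>l. l \<in> {1..n} \<Longrightarrow> f l (e l) = 1"
    using pairs by metis
  have f_op: "bounded_op (X l) scalars (f l)" if "l \<in> {1..n}" for l
    by (rule bounded_opI[OF normed[OF that] normed_space_scalars f[OF that]])
  let ?I = "{1..n} - {i}"
  define T where "T = restrict (\<lambda>u. scale Y (\<Prod>l\<in>?I. f l (u l)) (S (u i))) (product_points n X)"
  have T_at: "T u = scale Y (\<Prod>l\<in>?I. f l (u l)) (S (u i))" if "u \<in> product_points n X" for u
    using that by (simp add: T_def)
  have upd_i: "(\<Prod>l\<in>?I. f l ((u(i := x)) l)) = (\<Prod>l\<in>?I. f l (u l))" for u x
    by (intro prod.cong) auto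
  have upd_j: "(\<Prod>l\<in>?I. f l ((u(j := x)) l)) = f j x * (\<Prod>l\<in>?I - {j}. f l (u l))" if "j \<in> ?I" for u x j
    by (subst prod.remove[OF _ that]) auto
  have "T \<in> multilinear_ops n X Y"
    unfolding multilinear_ops_def
  proof (intro CollectI conjI ballI allI)
    show "T \<in> product_points n X \<rightarrow>\<^sub>E points Y"
      unfolding T_def using point_in[OF _ i] by (intro restrict_PiE_iff[THEN iffD2]) auto
    fix u j assume u: "u \<in> product_points n X" and j: "j \<in> {1..n}"
    interpret Xj: nspace "X j" by (rule factor[OF j])
    interpret fj: bounded_op "X j" scalars "f j" by (rule f_op[OF j])
    show "T (u(j := x + y)) = T (u(j := x)) + T (u(j := y))" if x: "x \<in> points (X j)" and y: "y \<in> points (X j)" for x y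
    proof (cases "j = i")
      case True
      have "S (x + y) = S x + S y" using x y True by (intro S.add) auto
      then show ?thesis
        unfolding T_at[OF update_in[OF u j x]] T_at[OF update_in[OF u j y]] T_at[OF update_in[OF u j Xj.add_in[OF x y]]]
        unfolding True upd_i fun_upd_same by (simp only: S.Y.vs.scale_right_distrib)
    next
      case False
      then have jI: "j \<in> ?I" and upd: "(u(j := z)) i = u i" for z using j by auto
      have "f j (x + y) = f j x + f j y" using x y by (rule fj.add)
      then show ?thesis
        unfolding T_at[OF update_in[OF u j x]] T_at[OF update_in[OF u j y]] T_at[OF update_in[OF u j Xj.add_in[OF x y]]]
        unfolding upd_j[OF jI] upd by (simp only: distrib_right S.Y.vs.scale_left_distrib)
    qed
    show "T (u(j := scale (X j) c x)) = scale Y c (T (u(j := x)))" if x: "x \<in> points (X j)" for c x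
    proof (cases "j = i")
      case True
      have "S (scale (X j) c x) = scale Y c (S x)" using x True by (simp add: S.scale)
      then show ?thesis
        unfolding T_at[OF update_in[OF u j x]] T_at[OF update_in[OF u j Xj.scale_in[OF x]]]
        unfolding True upd_i fun_upd_same by (simp add: mult.commute)
    next
      case False
      then have jI: "j \<in> ?I" and upd: "(u(j := z)) i = u i" for z using j by auto
      have "f j (scale (X j) c x) = c * f j x" using fj.scale[OF x] by simp
      then show ?thesis
        unfolding T_at[OF update_in[OF u j x]] T_at[OF update_in[OF u j Xj.scale_in[OF x]]]
        unfolding upd_j[OF jI] upd by (simp add: mult.assoc)
    qed
  next
    obtain C where C: "\<And>l x. l \<in> {1..n} \<Longrightarrow> x \<in> points (X l) \<Longrightarrow> norm (f l x) \<le> C l * nrm (X l) x"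
      and Cpos: "\<And>l. l \<in> {1..n} \<Longrightarrow> C l > 0"
      using bounded_op.bound[OF f_op] unfolding scalars_simps by metis
    obtain D where D: "D > 0" "\<And>x. x \<in> points (X i) \<Longrightarrow> nrm Y (S x) \<le> D * nrm (X i) x" using S.bound by blast
    have "nrm Y (T u) \<le> ((\<Prod>l\<in>?I. C l) * D) * (\<Prod>l\<in>{1..n}. nrm (X l) (u l))" if u: "u \<in> product_points n X" for u
    proof -
      have "nrm Y (T u) = norm (\<Prod>l\<in>?I. f l (u l)) * nrm Y (S (u i))"
        unfolding T_at[OF u] using point_in[OF u i] by (intro S.Y.nrm_scale) auto
      also have "\<dots> \<le> (\<Prod>l\<in>?I. C l * nrm (X l) (u l)) * (D * nrm (X i) (u i))"
      proof (intro mult_mono)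
        show "norm (\<Prod>l\<in>?I. f l (u l)) \<le> (\<Prod>l\<in>?I. C l * nrm (X l) (u l))"
          unfolding prod_norm[symmetric] using C point_in[OF u] by (intro prod_mono) auto
        show "0 \<le> (\<Prod>l\<in>?I. C l * nrm (X l) (u l))"
          using Cpos nrm_point_nonneg[OF u] by (intro prod_nonneg mult_nonneg_nonneg) (auto intro: less_imp_le)
      qed (use D(2) point_in[OF u i] in auto)
      also have "\<dots> = ((\<Prod>l\<in>?I. C l) * D) * (nrm (X i) (u i) * (\<Prod>l\<in>?I. nrm (X l) (u l)))"
        by (simp add: prod.distrib mult_ac)
      also have "nrm (X i) (u i) * (\<Prod>l\<in>?I. nrm (X l) (u l)) = (\<Prod>l\<in>{1..n}. nrm (X l) (u l))"
        using i by (intro prod.remove[symmetric]) auto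
      finally show ?thesis .
    qed
    then show "\<exists>C. \<forall>u\<in>product_points n X. nrm Y (T u) \<le> C * (\<Prod>i\<in>{1..n}. nrm (X i) (u i))" by blast
  qed
  then have "T \<in> lipschitz_summing 1 n X Y" using all by simp
  then obtain c where c: "c > 0" "\<forall>k. \<forall>u v :: nat \<Rightarrow> nat \<Rightarrow> 'a.
       (\<forall>i\<in>{1..k}. u i \<in> product_points n X \<and> v i \<in> product_points n X) \<longrightarrow>
       (\<Sum>i=1..k. nrm Y (T (u i) - T (v i)))
         \<le> c * (SUP \<phi>\<in>form_ball n X. \<Sum>i=1..k. norm (\<phi> (u i) - \<phi> (v i)))"
    unfolding lipschitz_summing_1[OF Y] by (elim conjE exE)
  define E where "E = restrict e {1..n}"
  have E: "E \<in> product_points n X" unfolding E_def using e by (rule restrict_in)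
  have E_upd: "E(i := x) \<in> product_points n X" if "x \<in> points (X i)" for x
    by (rule update_in[OF E i that])
  have T_E: "T (E(i := x)) = S x" if x: "x \<in> points (X i)" for x
  proof -
    have "(\<Prod>l\<in>?I. f l ((E(i := x)) l)) = 1" using fe by (intro prod.neutral) (auto simp: E_def)
    then show ?thesis using T_at[OF E_upd[OF x]] by simp
  qed
  define D where "D = (\<Prod>l\<in>?I. nrm (X l) (e l))"
  have D: "0 < D"
    unfolding D_def
  proof (intro prod_pos ballI)
    fix l assume "l \<in> ?I"
    then have l: "l \<in> {1..n}" by simp
    interpret Xl: nspace "X l" by (rule factor[OF l])
    interpret fl: bounded_op "X l" scalars "f l" by (rule f_op[OF l])
    have "e l \<noteq> 0" using fe[OF l] fl.zero by auto
    then show "0 < nrm (X l) (e l)" using Xl.nrm_eq_0[OF e[OF l]] Xl.nrm_nonneg[OF e[OF l]] by linarith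
  qed
  show ?thesis
    unfolding absolutely_summing_def
  proof (intro exI[of _ "c * D"] allI impI)
    fix k and x :: "nat \<Rightarrow> 'a" and W assume x: "\<forall>j<k. x j \<in> points (X i)" and weak: "weakly_bounded (X i) {..<k} x W"
    \<comment> \<open>The definition of Lipschitz summability counts from 1.\<close>
    define u where "u j = E(i := x (j - 1))" for j
    define v where "v j = E(i := 0)" for j :: nat
    have shift: "(\<Sum>j=1..k. h (j - 1)) = (\<Sum>j<k. h j)" for h :: "nat \<Rightarrow> real"
      by (rule sum.reindex_bij_witness[of _ Suc "\<lambda>j. j - 1"]) auto
    have x': "x (j - 1) \<in> points (X i)" if "j \<in> {1..k}" for j
    proof -
      have "j - 1 < k" using that by auto
      then show ?thesis using x by blast
    qed
    have uv: "\<forall>j\<in>{1..k}. u j \<in> product_points n X \<and> v j \<in> product_points n X"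
      using E_upd x' by (auto simp: u_def v_def)
    have "(\<Sum>j=1..k. nrm Y (T (u j) - T (v j))) = (\<Sum>j=1..k. nrm Y (S (x (j - 1))))"
      using T_E x' by (intro sum.cong refl) (simp add: u_def v_def)
    then have lhs: "(\<Sum>j=1..k. nrm Y (T (u j) - T (v j))) = (\<Sum>j<k. nrm Y (S (x j)))"
      using shift[of "\<lambda>j. nrm Y (S (x j))"] by simp
    have rhs: "(SUP \<phi>\<in>form_ball n X. \<Sum>j=1..k. norm (\<phi> (u j) - \<phi> (v j))) \<le> D * W"
    proof (rule cSUP_least)
      show "form_ball n X \<noteq> {}" using zero_form by blast
      fix \<phi> assume \<phi>: "\<phi> \<in> form_ball n X"
      interpret \<phi>: multilinear_op n X scalars \<phi> by (rule form_op[OF \<phi>])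
      define \<psi> where "\<psi> z = of_real (1 / D) * \<phi> (E(i := z))" for z
      have \<psi>_le: "norm (\<psi> z) \<le> nrm (X i) z" if z: "z \<in> points (X i)" for z
      proof -
        have "norm (\<phi> (E(i := z))) \<le> (\<Prod>l\<in>{1..n}. nrm (X l) ((E(i := z)) l))"
          by (rule form_ball_bound[OF \<phi> E_upd[OF z]])
        also have "\<dots> = nrm (X i) z * (\<Prod>l\<in>?I. nrm (X l) ((E(i := z)) l))"
          using i by (subst prod.remove[of _ i]) auto
        also have "(\<Prod>l\<in>?I. nrm (X l) ((E(i := z)) l)) = D"
          unfolding D_def by (intro prod.cong) (auto simp: E_def)
        finally have "norm (\<phi> (E(i := z))) \<le> nrm (X i) z * D" .
        then show ?thesis using D by (simp add: \<psi>_def norm_mult norm_divide pos_divide_le_eq)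
      qed
      have "bounded_operator (X i) scalars \<psi>"
        unfolding bounded_operator_def
      proof (intro conjI ballI allI)
        show "\<exists>C. \<forall>z\<in>points (X i). nrm scalars (\<psi> z) \<le> C * nrm (X i) z" using \<psi>_le by (intro exI[of _ 1]) simp
      qed (use \<phi>.add_at[OF E i] \<phi>.scale_at[OF E i] in \<open>auto simp: \<psi>_def distrib_left\<close>)
      then have "(\<Sum>j<k. norm (\<psi> (x j))) \<le> W" using weak \<psi>_le unfolding weakly_bounded_def by blast
      moreover have "norm (\<phi> (u j) - \<phi> (v j)) = D * norm (\<psi> (x (j - 1)))" for j
        using D \<phi>.zero_at[OF E i] by (simp add: u_def v_def \<psi>_def norm_mult norm_divide)
      ultimately show "(\<Sum>j=1..k. norm (\<phi> (u j) - \<phi> (v j))) \<le> D * W"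
        using shift[of "\<lambda>j. D * norm (\<psi> (x j))"] D by (simp add: sum_distrib_left[symmetric])
    qed
    have "(\<Sum>j<k. nrm Y (S (x j))) \<le> c * (SUP \<phi>\<in>form_ball n X. \<Sum>j=1..k. norm (\<phi> (u j) - \<phi> (v j)))"
      unfolding lhs[symmetric] by (rule mp[OF spec[OF spec[OF spec[OF c(2)]]] uv])
    also have "\<dots> \<le> c * (D * W)" using rhs c(1) by (intro mult_left_mono) auto
    finally show "(\<Sum>j<k. nrm Y (S (x j))) \<le> c * D * W" by (simp add: mult.assoc)
  qed
qed

section \<open>Operators from \<open>\<ell>\<^sub>1\<close> to Hilbert spaces\<close>

text \<open>The Gram matrix of the vectors \<open>h (y g)\<close> for the real part of the inner product turns the inequality for
matrices into one for operators. Real and imaginary parts of the coefficients are treated separately,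
whence 64 in place of 32.\<close>

lemma grothendieck_operator:
  fixes Y :: "('k::real_or_complex, 'b::ab_group_add) normed_structure" and H :: "('k, 'c::ab_group_add) normed_structure"
    and x :: "'j \<Rightarrow> 'g \<Rightarrow> 'k"
  assumes Y: "normed_space Y" and H: "hilbert_space H" and h: "bounded_operator Y H h"
    and C1: "0 < C1" "\<And>y. y \<in> points Y \<Longrightarrow> nrm H (h y) \<le> C1 * nrm Y y"
    and C2: "0 < C2" "\<And>y. y \<in> points Y \<Longrightarrow> nrm Y y \<le> C2 * nrm H (h y)"
    and fin: "finite G" "finite J" and R: "0 < R"
    and y: "\<And>g. g \<in> G \<Longrightarrow> y g \<in> points Y" "\<And>g. g \<in> G \<Longrightarrow> nrm Y (y g) \<le> R"
    and W: "\<And>w. (\<And>g. g \<in> G \<Longrightarrow> \<bar>w g\<bar> \<le> 1) \<Longrightarrow> (\<Sum>j\<in>J. norm (\<Sum>g\<in>G. x j g * of_real (w g))) \<le> W"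
  shows "(\<Sum>j\<in>J. nrm Y (\<Sum>g\<in>G. scale Y (x j g) (y g))) \<le> 64 * C1 * C2 * R * W"
proof -
  have Hn: "normed_space H" using H by (simp add: hilbert_space_def banach_space_def)
  interpret h: bounded_op Y H h by (rule bounded_opI[OF Y Hn h])
  obtain ip :: "'c \<Rightarrow> 'c \<Rightarrow> 'k" where ip:
      "\<forall>x\<in>points H. \<forall>y\<in>points H. \<forall>z\<in>points H. ip (x + y) z = ip x z + ip y z"
      "\<forall>c. \<forall>x\<in>points H. \<forall>y\<in>points H. ip (scale H c x) y = c * ip x y"
      "\<forall>x\<in>points H. \<forall>y\<in>points H. ip y x = conjugate (ip x y)"
      "\<forall>x\<in>points H. ip x x = of_real ((nrm H x)\<^sup>2)"
    using H unfolding hilbert_space_def by (elim conjE exE)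
  define r where "r a b = kre (ip a b)" for a b
  have r_sym: "r a b = r b a" if "a \<in> points H" "b \<in> points H" for a b
  proof -
    have "ip b a = conjugate (ip a b)" using ip(3) that by blast
    then show ?thesis by (simp add: r_def to_complex_conjugate)
  qed
  have r_self: "r a a = (nrm H a)\<^sup>2" if "a \<in> points H" for a
    using ip(4) that by (simp add: r_def del: of_real_power)
  have r_comb: "r (\<Sum>g\<in>G. scale H (of_real (t g)) (a g)) b = (\<Sum>g\<in>G. t g * r (a g) b)"
    if a: "\<And>g. g \<in> G \<Longrightarrow> a g \<in> points H" and b: "b \<in> points H" for t a b
    using fin(1) a
  proof (induction G rule: finite_induct)
    case empty
    have "ip (scale H 0 0) b = 0 * ip 0 b" using ip(2) b h.Y.zero_in by blast
    then show ?case by (simp add: r_def)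
  next
    case (insert g G)
    let ?s = "\<Sum>g\<in>G. scale H (of_real (t g)) (a g)"
    have s: "?s \<in> points H" using insert.prems by (intro h.Y.sum_in) auto
    have ag: "a g \<in> points H" using insert.prems by simp
    have "ip (scale H (of_real (t g)) (a g) + ?s) b = ip (scale H (of_real (t g)) (a g)) b + ip ?s b"
      using ip(1) s ag b h.Y.scale_in by blast
    also have "ip (scale H (of_real (t g)) (a g)) b = of_real (t g) * ip (a g) b" using ip(2) ag b by blast
    finally have "r (scale H (of_real (t g)) (a g) + ?s) b = t g * r (a g) b + r ?s b"
      by (simp add: r_def to_complex_add to_complex_mult)
    moreover have "r ?s b = (\<Sum>g\<in>G. t g * r (a g) b)" using insert by simp
    ultimately show ?case by (simp only: sum.insert[OF insert.hyps])
  qed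
  define B where "B g g' = r (h (y g)) (h (y g')) / (C1 * R)\<^sup>2" for g g'
  have hy: "h (y g) \<in> points H" if "g \<in> G" for g using y(1)[OF that] by simp
  have gram: "(\<Sum>g\<in>G. \<Sum>g'\<in>G. t g * t g' * B g g') = (nrm H (h (\<Sum>g\<in>G. scale Y (of_real (t g)) (y g))) / (C1 * R))\<^sup>2" for t
  proof -
    let ?v = "\<Sum>g\<in>G. scale H (of_real (t g)) (h (y g))"
    have v: "?v \<in> points H" using hy by (intro h.Y.sum_in) auto
    have "(nrm H ?v)\<^sup>2 = r ?v ?v" using r_self[OF v] by simp
    also have "\<dots> = (\<Sum>g\<in>G. t g * r (h (y g)) ?v)" by (rule r_comb[OF hy v])
    also have "\<dots> = (\<Sum>g\<in>G. t g * (\<Sum>g'\<in>G. t g' * r (h (y g')) (h (y g))))"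
      using r_sym[OF hy v] r_comb[OF hy hy] by simp
    also have "\<dots> = (\<Sum>g\<in>G. \<Sum>g'\<in>G. t g * t g' * r (h (y g)) (h (y g')))"
      unfolding sum_distrib_left using r_sym[OF hy hy] by (intro sum.cong refl) (simp add: mult_ac)
    finally have "(nrm H ?v / (C1 * R))\<^sup>2 = (\<Sum>g\<in>G. \<Sum>g'\<in>G. t g * t g' * B g g')"
      by (simp add: B_def power_divide sum_divide_distrib)
    moreover have "h (\<Sum>g\<in>G. scale Y (of_real (t g)) (y g)) = ?v"
      using y(1) by (subst h.sum) (auto simp: h.scale)
    ultimately show ?thesis by simp
  qed
  have real: "(\<Sum>j\<in>J. nrm Y (\<Sum>g\<in>G. scale Y (of_real (t j g)) (y g))) \<le> C2 * (C1 * R) * (32 * W)"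
    if t: "\<And>w. (\<And>g. g \<in> G \<Longrightarrow> \<bar>w g\<bar> \<le> 1) \<Longrightarrow> (\<Sum>j\<in>J. \<bar>\<Sum>g\<in>G. t j g * w g\<bar>) \<le> W" for t
  proof -
    let ?v = "\<lambda>j. \<Sum>g\<in>G. scale Y (of_real (t j g)) (y g)"
    have v: "?v j \<in> points Y" for j using y(1) by (intro h.X.sum_in) auto
    have "(\<Sum>j\<in>J. sqrt (\<Sum>g\<in>G. \<Sum>g'\<in>G. t j g * t j g' * B g g')) \<le> 32 * W"
    proof (rule grothendieck_gram[OF fin])
      show "(\<Sum>j\<in>J. \<bar>\<Sum>g\<in>G. t j g * w g\<bar>) \<le> W" if "\<And>g. g \<in> G \<Longrightarrow> \<bar>w g\<bar> \<le> 1" for w using t that by blast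
      show "B g g' = B g' g" if "g \<in> G" "g' \<in> G" for g g' using r_sym[OF hy hy] that by (simp add: B_def)
      show "0 \<le> (\<Sum>a\<in>G. \<Sum>b\<in>G. s a * s b * B a b)" for s unfolding gram by simp
      show "B g g \<le> 1" if g: "g \<in> G" for g
      proof -
        have "nrm H (h (y g)) \<le> C1 * nrm Y (y g)" by (rule C1(2)[OF y(1)[OF g]])
        also have "\<dots> \<le> C1 * R" using y(2)[OF g] C1(1) by simp
        finally have "(nrm H (h (y g)))\<^sup>2 \<le> (C1 * R)\<^sup>2" using hy[OF g] by (intro power_mono) auto
        then show ?thesis using C1(1) R r_self[OF hy[OF g]] by (simp add: B_def)
      qed
    qed
    moreover have "nrm Y (?v j) \<le> C2 * (C1 * R) * sqrt (\<Sum>g\<in>G. \<Sum>g'\<in>G. t j g * t j g' * B g g')" for j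
      unfolding gram using C2(2)[OF v[of j]] C1(1) R h.Y.nrm_nonneg[OF h.maps[OF v[of j]]] by simp
    ultimately have "(\<Sum>j\<in>J. nrm Y (?v j)) \<le> C2 * (C1 * R) * (\<Sum>j\<in>J. sqrt (\<Sum>g\<in>G. \<Sum>g'\<in>G. t j g * t j g' * B g g'))"
      unfolding sum_distrib_left by (intro sum_mono)
    also have "\<dots> \<le> C2 * (C1 * R) * (32 * W)"
      using \<open>(\<Sum>j\<in>J. sqrt (\<Sum>g\<in>G. \<Sum>g'\<in>G. t j g * t j g' * B g g')) \<le> 32 * W\<close> C1(1) C2(1) R by (intro mult_left_mono) auto
    finally show ?thesis .
  qed
  let ?r = "\<lambda>j. \<Sum>g\<in>G. scale Y (of_real (kre (x j g))) (y g)" and ?m = "\<lambda>j. \<Sum>g\<in>G. scale Y (of_real (kim (x j g))) (y g)"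
  have re: "(\<Sum>j\<in>J. nrm Y (?r j)) \<le> C2 * (C1 * R) * (32 * W)"
  proof (rule real)
    fix w :: "'g \<Rightarrow> real" assume w: "\<And>g. g \<in> G \<Longrightarrow> \<bar>w g\<bar> \<le> 1"
    have "(\<Sum>j\<in>J. \<bar>\<Sum>g\<in>G. kre (x j g) * w g\<bar>) \<le> (\<Sum>j\<in>J. norm (\<Sum>g\<in>G. x j g * of_real (w g)))"
    proof (rule sum_mono)
      fix j
      have "(\<Sum>g\<in>G. kre (x j g) * w g) = kre (\<Sum>g\<in>G. x j g * of_real (w g))"
        by (simp add: to_complex_sum to_complex_mult)
      then show "\<bar>\<Sum>g\<in>G. kre (x j g) * w g\<bar> \<le> norm (\<Sum>g\<in>G. x j g * of_real (w g))"
        using abs_kre_le[of "\<Sum>g\<in>G. x j g * of_real (w g)"] by simp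
    qed
    then show "(\<Sum>j\<in>J. \<bar>\<Sum>g\<in>G. kre (x j g) * w g\<bar>) \<le> W" using W[of w, OF w] by simp
  qed
  have im: "(\<Sum>j\<in>J. nrm Y (?m j)) \<le> C2 * (C1 * R) * (32 * W)"
  proof (rule real)
    fix w :: "'g \<Rightarrow> real" assume w: "\<And>g. g \<in> G \<Longrightarrow> \<bar>w g\<bar> \<le> 1"
    have "(\<Sum>j\<in>J. \<bar>\<Sum>g\<in>G. kim (x j g) * w g\<bar>) \<le> (\<Sum>j\<in>J. norm (\<Sum>g\<in>G. x j g * of_real (w g)))"
    proof (rule sum_mono)
      fix j
      have "(\<Sum>g\<in>G. kim (x j g) * w g) = kim (\<Sum>g\<in>G. x j g * of_real (w g))"
        by (simp add: to_complex_sum to_complex_mult)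
      then show "\<bar>\<Sum>g\<in>G. kim (x j g) * w g\<bar> \<le> norm (\<Sum>g\<in>G. x j g * of_real (w g))"
        using abs_kim_le[of "\<Sum>g\<in>G. x j g * of_real (w g)"] by simp
    qed
    then show "(\<Sum>j\<in>J. \<bar>\<Sum>g\<in>G. kim (x j g) * w g\<bar>) \<le> W" using W[of w, OF w] by simp
  qed
  have "nrm Y (\<Sum>g\<in>G. scale Y (x j g) (y g)) \<le> nrm Y (?r j) + nrm Y (?m j)" for j
  proof -
    have in': "?r j \<in> points Y" "?m j \<in> points Y" using y(1) by (auto intro!: h.X.sum_in)
    have "(\<Sum>g\<in>G. scale Y (x j g) (y g)) = (\<Sum>g\<in>G. scale Y (of_real (kre (x j g)) + kiota * of_real (kim (x j g))) (y g))"
      by (simp only: scalar_decomposition[symmetric])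
    also have "\<dots> = ?r j + scale Y kiota (?m j)"
      by (simp add: h.X.vs.scale_left_distrib sum.distrib h.X.vs.scale_sum_right)
    finally have "nrm Y (\<Sum>g\<in>G. scale Y (x j g) (y g)) \<le> nrm Y (?r j) + norm (kiota :: 'k) * nrm Y (?m j)"
      using h.X.nrm_triangle[of "?r j" "scale Y kiota (?m j)"] in' by (simp add: h.X.nrm_scale)
    also have "\<dots> \<le> nrm Y (?r j) + 1 * nrm Y (?m j)"
      using norm_kiota_le in' by (intro add_left_mono mult_right_mono) auto
    finally show ?thesis by simp
  qed
  then have "(\<Sum>j\<in>J. nrm Y (\<Sum>g\<in>G. scale Y (x j g) (y g))) \<le> (\<Sum>j\<in>J. nrm Y (?r j)) + (\<Sum>j\<in>J. nrm Y (?m j))"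
    unfolding sum.distrib[symmetric] by (intro sum_mono)
  also have "\<dots> \<le> C2 * (C1 * R) * (32 * W) + C2 * (C1 * R) * (32 * W)" by (intro add_mono re im)
  finally show ?thesis by (simp add: mult_ac)
qed

text \<open>An isomorphism with \<open>\<ell>\<^sub>1(\<Gamma>)\<close> in terms of vectors of the space: \<open>e \<gamma>\<close> corresponds to the unit vectors and
\<open>a x\<close> to the coordinates. In the multilinear argument these are used for each factor separately.\<close>

definition ell1_coordinates ::
    "('k::real_or_complex, 'a::ab_group_add) normed_structure \<Rightarrow> 'g set \<Rightarrow> ('a \<Rightarrow> 'g \<Rightarrow> 'k) \<Rightarrow> ('g \<Rightarrow> 'a) \<Rightarrow> real \<Rightarrow> bool" where
  "ell1_coordinates E \<Gamma> a e A \<longleftrightarrow> 0 < A \<and> (\<forall>\<gamma>\<in>\<Gamma>. e \<gamma> \<in> points E \<and> nrm E (e \<gamma>) \<le> A) \<and>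
     (\<forall>x\<in>points E. \<forall>y\<in>points E. \<forall>\<gamma>. a (x + y) \<gamma> = a x \<gamma> + a y \<gamma>) \<and>
     (\<forall>c. \<forall>x\<in>points E. \<forall>\<gamma>. a (scale E c x) \<gamma> = c * a x \<gamma>) \<and>
     (\<forall>x\<in>points E. \<forall>F. finite F \<longrightarrow> F \<subseteq> \<Gamma> \<longrightarrow> (\<Sum>\<gamma>\<in>F. norm (a x \<gamma>)) \<le> A * nrm E x) \<and>
     (\<forall>x\<in>points E. \<forall>d>0. \<exists>F0. finite F0 \<and> F0 \<subseteq> \<Gamma> \<and>
        (\<forall>F. finite F \<longrightarrow> F0 \<subseteq> F \<longrightarrow> F \<subseteq> \<Gamma> \<longrightarrow> nrm E (x - (\<Sum>\<gamma>\<in>F. scale E (a x \<gamma>) (e \<gamma>))) < d))"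

lemma ell1_coordinatesD:
  assumes "ell1_coordinates E \<Gamma> a e A"
  shows "0 < A" "\<gamma> \<in> \<Gamma> \<Longrightarrow> e \<gamma> \<in> points E" "\<gamma> \<in> \<Gamma> \<Longrightarrow> nrm E (e \<gamma>) \<le> A"
    and "x \<in> points E \<Longrightarrow> y \<in> points E \<Longrightarrow> a (x + y) \<gamma> = a x \<gamma> + a y \<gamma>"
    and "x \<in> points E \<Longrightarrow> a (scale E c x) \<gamma> = c * a x \<gamma>"
    and "x \<in> points E \<Longrightarrow> finite F \<Longrightarrow> F \<subseteq> \<Gamma> \<Longrightarrow> (\<Sum>\<gamma>\<in>F. norm (a x \<gamma>)) \<le> A * nrm E x"
    and "x \<in> points E \<Longrightarrow> 0 < d \<Longrightarrow> \<exists>F0. finite F0 \<and> F0 \<subseteq> \<Gamma> \<and>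
        (\<forall>F. finite F \<longrightarrow> F0 \<subseteq> F \<longrightarrow> F \<subseteq> \<Gamma> \<longrightarrow> nrm E (x - (\<Sum>\<gamma>\<in>F. scale E (a x \<gamma>) (e \<gamma>))) < d)"
  using assms unfolding ell1_coordinates_def by simp_all

lemma isomorphic_ell1_coordinates:
  fixes E :: "('k::real_or_complex, 'a::ab_group_add) normed_structure" and \<Gamma> :: "'g set"
  assumes E: "normed_space E" and iso: "isomorphic E (ell1 \<Gamma> :: ('k, 'g \<Rightarrow> 'k) normed_structure)"
  shows "\<exists>a e A. ell1_coordinates E \<Gamma> a e A"
proof -
  let ?L = "ell1 \<Gamma> :: ('k, 'g \<Rightarrow> 'k) normed_structure"
  obtain f g where f: "bounded_operator E ?L f" and g: "bounded_operator ?L E g" and gf: "\<forall>x\<in>points E. g (f x) = x"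
    using iso unfolding isomorphic_def by blast
  interpret f: bounded_op E ?L f by (rule bounded_opI[OF E normed_space_ell1 f])
  interpret g: bounded_op ?L E g by (rule bounded_opI[OF normed_space_ell1 E g])
  obtain Cf where Cf: "0 < Cf" "\<And>x. x \<in> points E \<Longrightarrow> nrm ?L (f x) \<le> Cf * nrm E x" using f.bound by blast
  obtain Cg where Cg: "0 < Cg" "\<And>x. x \<in> points ?L \<Longrightarrow> nrm E (g x) \<le> Cg * nrm ?L x" using g.bound by blast
  define \<delta> where "\<delta> \<gamma> = (\<lambda>\<beta>. if \<beta> = \<gamma> then 1 else 0 :: 'k)" for \<gamma> :: 'g
  have \<delta>: "\<delta> \<gamma> \<in> points ?L" "nrm ?L (\<delta> \<gamma>) \<le> 1" if "\<gamma> \<in> \<Gamma>" for \<gamma>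
  proof -
    have "(\<Sum>\<beta>\<in>F. norm (\<delta> \<gamma> \<beta>)) \<le> 1" if "finite F" for F
    proof -
      have "(\<Sum>\<beta>\<in>F. norm (\<delta> \<gamma> \<beta>)) = (\<Sum>\<beta>\<in>F. if \<beta> = \<gamma> then 1 else 0)" by (intro sum.cong) (auto simp: \<delta>_def)
      also have "\<dots> \<le> (1 :: real)" using that by simp
      finally show ?thesis .
    qed
    moreover have "\<delta> \<gamma> \<beta> = 0" if "\<beta> \<notin> \<Gamma>" for \<beta> using that \<open>\<gamma> \<in> \<Gamma>\<close> by (auto simp: \<delta>_def)
    ultimately show "\<delta> \<gamma> \<in> points ?L" "nrm ?L (\<delta> \<gamma>) \<le> 1" using ell1_pointsI[of \<Gamma> "\<delta> \<gamma>" 1] by auto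
  qed
  have "\<exists>F0. finite F0 \<and> F0 \<subseteq> \<Gamma> \<and> (\<forall>F. finite F \<longrightarrow> F0 \<subseteq> F \<longrightarrow> F \<subseteq> \<Gamma> \<longrightarrow>
      nrm E (x - (\<Sum>\<gamma>\<in>F. scale E (f x \<gamma>) (g (\<delta> \<gamma>)))) < d)" if x: "x \<in> points E" and d: "d > 0" for x d
  proof -
    have fx: "f x \<in> points ?L" using x by simp
    have "((\<lambda>F. \<Sum>\<gamma>\<in>F. norm (f x \<gamma>)) \<longlongrightarrow> nrm ?L (f x)) (finite_subsets_at_top \<Gamma>)"
      using fx unfolding ell1_simps by (auto dest: has_sum_infsum simp: has_sum_def)
    moreover have "nrm ?L (f x) - d / (2 * Cg) < nrm ?L (f x)" using d Cg(1) by simp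
    ultimately have "\<forall>\<^sub>F F in finite_subsets_at_top \<Gamma>. nrm ?L (f x) - d / (2 * Cg) < (\<Sum>\<gamma>\<in>F. norm (f x \<gamma>))"
      by (rule order_tendstoD(1))
    then obtain F0 where F0: "finite F0" "F0 \<subseteq> \<Gamma>" "nrm ?L (f x) - d / (2 * Cg) < (\<Sum>\<gamma>\<in>F0. norm (f x \<gamma>))"
      unfolding eventually_finite_subsets_at_top by (meson order_refl)
    have "nrm E (x - (\<Sum>\<gamma>\<in>F. scale E (f x \<gamma>) (g (\<delta> \<gamma>)))) < d" if F: "finite F" "F0 \<subseteq> F" "F \<subseteq> \<Gamma>" for F
    proof -
      let ?t = "\<lambda>\<gamma>. if \<gamma> \<in> F then f x \<gamma> else 0"
      have s_in: "(\<Sum>\<gamma>\<in>F. scale ?L (f x \<gamma>) (\<delta> \<gamma>)) \<in> points ?L" using F \<delta> by (intro f.Y.sum_in f.Y.scale_in) auto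
      have s_eq: "(\<Sum>\<gamma>\<in>F. scale ?L (f x \<gamma>) (\<delta> \<gamma>)) \<beta> = ?t \<beta>" for \<beta>
      proof -
        have "(\<Sum>\<gamma>\<in>F. scale ?L (f x \<gamma>) (\<delta> \<gamma>)) \<beta> = (\<Sum>\<gamma>\<in>F. scale ?L (f x \<gamma>) (\<delta> \<gamma>) \<beta>)"
          by (induction F rule: infinite_finite_induct) simp_all
        also have "\<dots> = (\<Sum>\<gamma>\<in>F. if \<gamma> = \<beta> then f x \<beta> else 0)"
          by (intro sum.cong) (auto simp: ell1_simps \<delta>_def)
        finally show ?thesis using F(1) by simp
      qed
      have "(\<Sum>\<gamma>\<in>F. scale E (f x \<gamma>) (g (\<delta> \<gamma>))) = g (\<Sum>\<gamma>\<in>F. scale ?L (f x \<gamma>) (\<delta> \<gamma>))"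
      proof -
        have "g (\<Sum>\<gamma>\<in>F. scale ?L (f x \<gamma>) (\<delta> \<gamma>)) = (\<Sum>\<gamma>\<in>F. g (scale ?L (f x \<gamma>) (\<delta> \<gamma>)))"
          using F \<delta> by (intro g.sum f.Y.scale_in) auto
        also have "\<dots> = (\<Sum>\<gamma>\<in>F. scale E (f x \<gamma>) (g (\<delta> \<gamma>)))"
          using F \<delta> by (intro sum.cong refl g.scale) auto
        finally show ?thesis by simp
      qed
      then have "x - (\<Sum>\<gamma>\<in>F. scale E (f x \<gamma>) (g (\<delta> \<gamma>))) = g (f x - (\<Sum>\<gamma>\<in>F. scale ?L (f x \<gamma>) (\<delta> \<gamma>)))"
        using g.diff[OF fx s_in] gf x by simp
      also have "nrm E \<dots> \<le> Cg * nrm ?L (f x - (\<Sum>\<gamma>\<in>F. scale ?L (f x \<gamma>) (\<delta> \<gamma>)))"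
        by (rule Cg(2)[OF f.Y.diff_in[OF fx s_in]])
      also have "nrm ?L (f x - (\<Sum>\<gamma>\<in>F. scale ?L (f x \<gamma>) (\<delta> \<gamma>))) \<le> d / (2 * Cg)"
      proof (rule ell1_pointsI(2))
        show "(f x - (\<Sum>\<gamma>\<in>F. scale ?L (f x \<gamma>) (\<delta> \<gamma>))) \<gamma> = 0" if "\<gamma> \<notin> \<Gamma>" for \<gamma>
          using f.Y.diff_in[OF fx s_in] that unfolding ell1_simps by blast
        fix K assume K: "finite K" "K \<subseteq> \<Gamma>"
        have "(\<Sum>\<gamma>\<in>K. norm ((f x - (\<Sum>\<gamma>\<in>F. scale ?L (f x \<gamma>) (\<delta> \<gamma>))) \<gamma>)) = (\<Sum>\<gamma>\<in>K. norm (f x \<gamma> - ?t \<gamma>))"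
          by (intro sum.cong refl) (simp only: minus_apply s_eq)
        also have "\<dots> = (\<Sum>\<gamma>\<in>K - F. norm (f x \<gamma>))"
          using K by (intro sum.mono_neutral_cong_right) auto
        also have "\<dots> \<le> nrm ?L (f x) - (\<Sum>\<gamma>\<in>F. norm (f x \<gamma>))"
        proof -
          have "(\<Sum>\<gamma>\<in>K - F. norm (f x \<gamma>)) + (\<Sum>\<gamma>\<in>F. norm (f x \<gamma>)) = (\<Sum>\<gamma>\<in>(K - F) \<union> F. norm (f x \<gamma>))"
            using K F by (intro sum.union_disjoint[symmetric]) auto
          also have "\<dots> \<le> nrm ?L (f x)" using K F by (intro ell1_finite_sum_le[OF fx]) auto
          finally show ?thesis by simp
        qed
        also have "\<dots> \<le> d / (2 * Cg)"
        proof -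
          have "(\<Sum>\<gamma>\<in>F0. norm (f x \<gamma>)) \<le> (\<Sum>\<gamma>\<in>F. norm (f x \<gamma>))" using F by (intro sum_mono2) auto
          then show ?thesis using F0(3) by linarith
        qed
        finally show "(\<Sum>\<gamma>\<in>K. norm ((f x - (\<Sum>\<gamma>\<in>F. scale ?L (f x \<gamma>) (\<delta> \<gamma>))) \<gamma>)) \<le> d / (2 * Cg)" .
      qed
      also have "Cg * (d / (2 * Cg)) < d" using Cg(1) d by simp
      finally show ?thesis using Cg(1) by simp
    qed
    then show ?thesis using F0 by blast
  qed
  moreover have "nrm E (g (\<delta> \<gamma>)) \<le> Cf + Cg" if "\<gamma> \<in> \<Gamma>" for \<gamma>
  proof -
    have "nrm E (g (\<delta> \<gamma>)) \<le> Cg * nrm ?L (\<delta> \<gamma>)" by (rule Cg(2)[OF \<delta>(1)[OF that]])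
    also have "\<dots> \<le> Cg" using \<delta>(2)[OF that] Cg(1) by (simp add: mult_left_le)
    finally show ?thesis using Cf(1) by simp
  qed
  moreover have "(\<Sum>\<gamma>\<in>F. norm (f x \<gamma>)) \<le> (Cf + Cg) * nrm E x" if x: "x \<in> points E" and F: "finite F" "F \<subseteq> \<Gamma>" for x F
  proof -
    have "(\<Sum>\<gamma>\<in>F. norm (f x \<gamma>)) \<le> Cf * nrm E x"
      using ell1_finite_sum_le[OF f.maps[OF x] F] Cf(2)[OF x] by linarith
    also have "\<dots> \<le> (Cf + Cg) * nrm E x" using Cg(1) f.X.nrm_nonneg[OF x] by (intro mult_right_mono) auto
    finally show ?thesis .
  qed
  ultimately have "ell1_coordinates E \<Gamma> f (\<lambda>\<gamma>. g (\<delta> \<gamma>)) (Cf + Cg)"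
    unfolding ell1_coordinates_def using Cf(1) Cg(1) \<delta>(1) by (simp add: f.add f.scale ell1_simps)
  then show ?thesis by blast
qed

lemma sum_PiE_insert:
  assumes "j \<notin> J"
  shows "(\<Sum>\<gamma>\<in>PiE (insert j J) F. f \<gamma>) = (\<Sum>\<beta>\<in>F j. \<Sum>\<gamma>\<in>PiE J F. f (\<gamma>(j := \<beta>)))"
proof -
  have "(\<Sum>\<gamma>\<in>PiE (insert j J) F. f \<gamma>) = (\<Sum>p\<in>F j \<times> PiE J F. f ((snd p)(j := fst p)))"
    unfolding PiE_insert_eq
    by (subst sum.reindex) (use inj_combinator[OF assms] in \<open>auto simp: case_prod_unfold comp_def\<close>)
  then show ?thesis by (simp add: sum.cartesian_product case_prod_unfold)
qed

context multilinear_op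
begin

lemma mixed_in:
  assumes w: "w \<in> product_points n X" and J: "J \<subseteq> {1..n}" and f: "\<And>l. l \<in> J \<Longrightarrow> f l \<in> points (X l)"
  shows "(\<lambda>l. if l \<in> J then f l else w l) \<in> product_points n X"
proof -
  have "(if l \<in> J then f l else w l) \<in> points (X l)" if "l \<in> {1..n}" for l
    using f point_in[OF w that] by simp
  moreover have "(if l \<in> J then f l else w l) = undefined" if "l \<notin> {1..n}" for l
    using that J w by (auto simp: product_points_def PiE_def extensional_def)
  ultimately show ?thesis by (auto simp: product_points_def PiE_def extensional_def)
qed

text \<open>Multilinear expansion in the variables in \<open>J\<close>.\<close>

lemma expand:
  assumes J: "J \<subseteq> {1..n}" and fin: "\<And>l. l \<in> J \<Longrightarrow> finite (F l)"
    and e: "\<And>l \<gamma>. l \<in> J \<Longrightarrow> \<gamma> \<in> F l \<Longrightarrow> e l \<gamma> \<in> points (X l)" and w: "w \<in> product_points n X"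
  shows "T (\<lambda>l. if l \<in> J then \<Sum>\<gamma>\<in>F l. scale (X l) (c l \<gamma>) (e l \<gamma>) else w l) =
    (\<Sum>\<gamma>\<in>PiE J F. scale Y (\<Prod>l\<in>J. c l (\<gamma> l)) (T (\<lambda>l. if l \<in> J then e l (\<gamma> l) else w l)))"
proof -
  have "finite J" using J finite_subset by blast
  then show ?thesis using J fin e w
  proof (induction J arbitrary: w rule: finite_induct)
    case empty
    then show ?case by simp
  next
    case (insert j J)
    have j: "j \<in> {1..n}" and J: "J \<subseteq> {1..n}" using insert.prems(1) by auto
    interpret Xj: nspace "X j" by (rule factor[OF j])
    let ?s = "\<lambda>l. \<Sum>\<gamma>\<in>F l. scale (X l) (c l \<gamma>) (e l \<gamma>)"
    have ej: "e j \<beta> \<in> points (X j)" if "\<beta> \<in> F j" for \<beta> using insert.prems(3) that by auto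
    have sj: "?s j \<in> points (X j)" using ej by (intro Xj.sum_in Xj.scale_in)
    have w': "w(j := ?s j) \<in> product_points n X" by (rule update_in[OF insert.prems(4) j sj])
    have z: "(\<lambda>l. if l \<in> J then e l (\<gamma> l) else w l) \<in> product_points n X" if "\<gamma> \<in> PiE J F" for \<gamma>
      using insert.prems(3) that by (intro mixed_in[OF insert.prems(4) J]) auto
    have upd: "(\<lambda>l. if l \<in> J then f l else (w(j := x)) l) = (\<lambda>l. if l \<in> J then f l else w l)(j := x)" for f :: "nat \<Rightarrow> 'a" and x
      using insert.hyps by (auto simp: fun_eq_iff)
    have "(\<lambda>l. if l \<in> insert j J then ?s l else w l) = (\<lambda>l. if l \<in> J then ?s l else (w(j := ?s j)) l)"
      using insert.hyps by (auto simp: fun_eq_iff)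
    then have "T (\<lambda>l. if l \<in> insert j J then ?s l else w l) =
        (\<Sum>\<gamma>\<in>PiE J F. scale Y (\<Prod>l\<in>J. c l (\<gamma> l)) (T (\<lambda>l. if l \<in> J then e l (\<gamma> l) else (w(j := ?s j)) l)))"
      using insert.IH[OF J _ _ w'] insert.prems by simp
    also have "\<dots> = (\<Sum>\<gamma>\<in>PiE J F. \<Sum>\<beta>\<in>F j. scale Y (\<Prod>l\<in>insert j J. c l ((\<gamma>(j := \<beta>)) l))
        (T (\<lambda>l. if l \<in> insert j J then e l ((\<gamma>(j := \<beta>)) l) else w l)))"
    proof (rule sum.cong[OF refl])
      fix \<gamma> assume \<gamma>: "\<gamma> \<in> PiE J F"
      let ?z = "\<lambda>l. if l \<in> J then e l (\<gamma> l) else w l"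
      have "T (\<lambda>l. if l \<in> J then e l (\<gamma> l) else (w(j := ?s j)) l) = T (?z(j := ?s j))" unfolding upd ..
      also have "\<dots> = (\<Sum>\<beta>\<in>F j. T (?z(j := scale (X j) (c j \<beta>) (e j \<beta>))))"
        using ej by (intro sum_at z \<gamma> j) auto
      also have "\<dots> = (\<Sum>\<beta>\<in>F j. scale Y (c j \<beta>) (T (?z(j := e j \<beta>))))"
        using ej by (intro sum.cong refl scale_at z \<gamma> j)
      finally have "scale Y (\<Prod>l\<in>J. c l (\<gamma> l)) (T (\<lambda>l. if l \<in> J then e l (\<gamma> l) else (w(j := ?s j)) l)) =
          (\<Sum>\<beta>\<in>F j. scale Y (c j \<beta> * (\<Prod>l\<in>J. c l (\<gamma> l))) (T (?z(j := e j \<beta>))))"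
        by (simp only: Y.vs.scale_sum_right Y.vs.scale_scale mult.commute)
      also have "\<dots> = (\<Sum>\<beta>\<in>F j. scale Y (\<Prod>l\<in>insert j J. c l ((\<gamma>(j := \<beta>)) l))
        (T (\<lambda>l. if l \<in> insert j J then e l ((\<gamma>(j := \<beta>)) l) else w l)))"
      proof (rule sum.cong[OF refl])
        fix \<beta>
        have "(\<Prod>l\<in>insert j J. c l ((\<gamma>(j := \<beta>)) l)) = c j \<beta> * (\<Prod>l\<in>J. c l ((\<gamma>(j := \<beta>)) l))"
          using insert.hyps by simp
        also have "(\<Prod>l\<in>J. c l ((\<gamma>(j := \<beta>)) l)) = (\<Prod>l\<in>J. c l (\<gamma> l))"
          using insert.hyps by (intro prod.cong) auto
        finally have "(\<Prod>l\<in>insert j J. c l ((\<gamma>(j := \<beta>)) l)) = c j \<beta> * (\<Prod>l\<in>J. c l (\<gamma> l))" .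
        moreover have "(\<lambda>l. if l \<in> insert j J then e l ((\<gamma>(j := \<beta>)) l) else w l) = ?z(j := e j \<beta>)"
          using insert.hyps by (auto simp: fun_eq_iff)
        ultimately show "scale Y (c j \<beta> * (\<Prod>l\<in>J. c l (\<gamma> l))) (T (?z(j := e j \<beta>))) =
            scale Y (\<Prod>l\<in>insert j J. c l ((\<gamma>(j := \<beta>)) l)) (T (\<lambda>l. if l \<in> insert j J then e l ((\<gamma>(j := \<beta>)) l) else w l))"
          by (simp only:)
      qed
      finally show "scale Y (\<Prod>l\<in>J. c l (\<gamma> l)) (T (\<lambda>l. if l \<in> J then e l (\<gamma> l) else (w(j := ?s j)) l)) =
          (\<Sum>\<beta>\<in>F j. scale Y (\<Prod>l\<in>insert j J. c l ((\<gamma>(j := \<beta>)) l))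
            (T (\<lambda>l. if l \<in> insert j J then e l ((\<gamma>(j := \<beta>)) l) else w l)))" .
    qed
    also have "\<dots> = (\<Sum>\<gamma>\<in>PiE (insert j J) F. scale Y (\<Prod>l\<in>insert j J. c l (\<gamma> l))
        (T (\<lambda>l. if l \<in> insert j J then e l (\<gamma> l) else w l)))"
      unfolding sum_PiE_insert[OF insert.hyps(2)] by (rule sum.swap)
    finally show ?case .
  qed
qed

text \<open>The variables are changed one after the other. Each change is controlled by the difference in one
component, while the other components converge and so stay bounded.\<close>

lemma sequentially_continuous:
  assumes u: "u \<in> product_points n X" and s: "\<And>m. s m \<in> product_points n X"
    and lim: "\<And>l. l \<in> {1..n} \<Longrightarrow> (\<lambda>m. nrm (X l) (s m l - u l)) \<longlonglongrightarrow> 0"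
  shows "(\<lambda>m. nrm Y (T (s m) - T u)) \<longlonglongrightarrow> 0"
proof -
  obtain C where C: "C > 0" "\<And>u. u \<in> product_points n X \<Longrightarrow> nrm Y (T u) \<le> C * (\<Prod>i\<in>{1..n}. nrm (X i) (u i))"
    using bound by blast
  define v where "v J m l = (if l \<in> J then s m l else u l)" for J m and l :: nat
  have v_in: "v J m \<in> product_points n X" if "J \<subseteq> {1..n}" for J m
    unfolding v_def[abs_def] using that point_in[OF s] by (intro mixed_in[OF u that]) auto
  have s_lim: "(\<lambda>m. nrm (X l) (s m l)) \<longlonglongrightarrow> nrm (X l) (u l)" if l: "l \<in> {1..n}" for l
  proof -
    interpret Xl: nspace "X l" by (rule factor[OF l])
    have "(\<lambda>m. \<bar>nrm (X l) (s m l) - nrm (X l) (u l)\<bar>) \<longlonglongrightarrow> 0"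
    proof (rule tendsto_zero_le[OF lim[OF l]])
      fix m
      have sm: "s m l \<in> points (X l)" and ul: "u l \<in> points (X l)" using point_in[OF s l] point_in[OF u l] .
      show "\<bar>nrm (X l) (s m l) - nrm (X l) (u l)\<bar> \<le> nrm (X l) (s m l - u l)"
        using Xl.nrm_triangle[OF Xl.diff_in[OF sm ul] ul] Xl.nrm_triangle[OF Xl.diff_in[OF ul sm] sm]
          Xl.nrm_diff_commute[OF sm ul] by simp
    qed simp
    then show ?thesis by (simp add: tendsto_rabs_zero_iff LIM_zero_iff)
  qed
  have "(\<lambda>m. nrm Y (T (v J m) - T u)) \<longlonglongrightarrow> 0" if "finite J" "J \<subseteq> {1..n}" for J
    using that
  proof (induction J rule: finite_induct)
    case empty
    have "v {} m = u" for m by (simp add: v_def fun_eq_iff)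
    then show ?case by simp
  next
    case (insert j J)
    have j: "j \<in> {1..n}" and J: "J \<subseteq> {1..n}" using insert.prems by auto
    interpret Xj: nspace "X j" by (rule factor[OF j])
    let ?d = "\<lambda>m. (v J m)(j := s m j - u j)"
    have pj: "s m j \<in> points (X j)" "u j \<in> points (X j)" for m using point_in[OF s j] point_in[OF u j] .
    have d_in: "?d m \<in> product_points n X" for m by (intro update_in v_in J j Xj.diff_in pj)
    have step: "T (v (insert j J) m) - T (v J m) = T (?d m)" for m
    proof -
      have "(v J m)(j := s m j) = v (insert j J) m" "(v J m)(j := u j) = v J m"
        using insert.hyps by (auto simp: v_def fun_eq_iff)
      then show ?thesis using diff_at[OF v_in[OF J] j pj(1) pj(2), of m m] by simp
    qed
    have d_lim: "(\<lambda>m. C * (\<Prod>l\<in>{1..n}. nrm (X l) (?d m l))) \<longlonglongrightarrow> C * 0"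
    proof (rule tendsto_mult_left)
      have split: "(\<Prod>l\<in>{1..n}. nrm (X l) (?d m l)) = nrm (X j) (s m j - u j) * (\<Prod>l\<in>{1..n} - {j}. nrm (X l) (v J m l))" for m
      proof -
        have "(\<Prod>l\<in>{1..n} - {j}. nrm (X l) (?d m l)) = (\<Prod>l\<in>{1..n} - {j}. nrm (X l) (v J m l))"
          by (intro prod.cong) auto
        then show ?thesis using j by (subst prod.remove[of _ j]) auto
      qed
      have "(\<lambda>m. \<Prod>l\<in>{1..n} - {j}. nrm (X l) (v J m l)) \<longlonglongrightarrow> (\<Prod>l\<in>{1..n} - {j}. nrm (X l) (u l))"
      proof (rule tendsto_prod)
        fix l assume "l \<in> {1..n} - {j}"
        then show "(\<lambda>m. nrm (X l) (v J m l)) \<longlonglongrightarrow> nrm (X l) (u l)"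
          using s_lim[of l] by (cases "l \<in> J") (auto simp: v_def)
      qed
      from tendsto_mult[OF lim[OF j] this] show "(\<lambda>m. \<Prod>l\<in>{1..n}. nrm (X l) (?d m l)) \<longlonglongrightarrow> 0"
        unfolding split by simp
    qed
    have IH: "(\<lambda>m. nrm Y (T (v J m) - T u)) \<longlonglongrightarrow> 0" by (rule insert.IH[OF J])
    show ?case
    proof (rule tendsto_zero_le)
      show "(\<lambda>m. C * (\<Prod>l\<in>{1..n}. nrm (X l) (?d m l)) + nrm Y (T (v J m) - T u)) \<longlonglongrightarrow> 0"
        using tendsto_add[OF d_lim IH] by simp
      show "nrm Y (T (v (insert j J) m) - T u) \<le> C * (\<Prod>l\<in>{1..n}. nrm (X l) (?d m l)) + nrm Y (T (v J m) - T u)" for m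
        using Y.nrm_diff_triangle[OF maps[OF v_in[OF insert.prems]] maps[OF v_in[OF J]] maps[OF u], of m m]
          C(2)[OF d_in[of m]] unfolding step by linarith
      show "0 \<le> nrm Y (T (v (insert j J) m) - T u)" for m
        by (intro Y.nrm_nonneg Y.diff_in maps v_in[OF insert.prems] u)
    qed
  qed
  from this[of "{1..n}"] have "(\<lambda>m. nrm Y (T (v {1..n} m) - T u)) \<longlonglongrightarrow> 0" by simp
  moreover have "v {1..n} m = s m" for m
  proof
    fix l show "v {1..n} m l = s m l"
      using s[of m] u by (cases "l \<in> {1..n}") (auto simp: v_def product_points_def PiE_def extensional_def)
  qed
  ultimately show ?thesis by simp
qed

end

section \<open>Multilinear operators and the characterisation\<close>

context multilinear_space
begin

text \<open>The sum over all multi-indices factors into a product of \<open>\<ell>\<^sub>1\<close> norms.\<close>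

lemma weighted_form:
  assumes a: "\<And>l. l \<in> {1..n} \<Longrightarrow> ell1_coordinates (X l) (\<Gamma> l) (a l) (e l) (A l)"
    and F: "\<And>l. l \<in> {1..n} \<Longrightarrow> finite (F l)" "\<And>l. l \<in> {1..n} \<Longrightarrow> F l \<subseteq> \<Gamma> l"
    and w: "\<And>\<gamma>. \<gamma> \<in> PiE {1..n} F \<Longrightarrow> \<bar>w \<gamma>\<bar> \<le> 1"
  shows "restrict (\<lambda>u. of_real (1 / (\<Prod>l\<in>{1..n}. A l)) *
      (\<Sum>\<gamma>\<in>PiE {1..n} F. of_real (w \<gamma>) * (\<Prod>l\<in>{1..n}. a l (u l) (\<gamma> l)))) (product_points n X) \<in> form_ball n X"
    (is "restrict ?\<phi> _ \<in> _")
proof (rule form_ballI)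
  let ?I = "{1..n}"
  let ?A = "\<Prod>l\<in>?I. A l"
  have A: "0 < A l" if "l \<in> ?I" for l by (rule ell1_coordinatesD(1)[OF a[OF that]])
  then have A_pos: "0 < ?A" by (intro prod_pos) auto
  have a_add: "a l (x + y) \<gamma> = a l x \<gamma> + a l y \<gamma>" if "l \<in> ?I" "x \<in> points (X l)" "y \<in> points (X l)" for l x y \<gamma>
    using ell1_coordinatesD(4,5)[OF a[OF that(1)]] that by blast
  have a_scale: "a l (scale (X l) c x) \<gamma> = c * a l x \<gamma>" if "l \<in> ?I" "x \<in> points (X l)" for l c x \<gamma>
    using ell1_coordinatesD(4,5)[OF a[OF that(1)]] that by blast
  have upd: "(\<Prod>l\<in>?I. a l ((u(i := x)) l) (\<gamma> l)) = a i x (\<gamma> i) * (\<Prod>l\<in>?I - {i}. a l (u l) (\<gamma> l))"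
    if "i \<in> ?I" for u i x \<gamma>
    by (subst prod.remove[OF _ that]) auto
  have le: "norm (restrict ?\<phi> (product_points n X) u) \<le> (\<Prod>i\<in>{1..n}. nrm (X i) (u i))" if u: "u \<in> product_points n X" for u
  proof -
    have "norm (\<Sum>\<gamma>\<in>PiE ?I F. of_real (w \<gamma>) * (\<Prod>l\<in>?I. a l (u l) (\<gamma> l))) \<le>
        (\<Sum>\<gamma>\<in>PiE ?I F. \<Prod>l\<in>?I. norm (a l (u l) (\<gamma> l)))"
    proof (rule sum_norm_le)
      fix \<gamma> assume "\<gamma> \<in> PiE ?I F"
      have "norm (of_real (w \<gamma>) * (\<Prod>l\<in>?I. a l (u l) (\<gamma> l))) = \<bar>w \<gamma>\<bar> * (\<Prod>l\<in>?I. norm (a l (u l) (\<gamma> l)))"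
        by (simp add: norm_mult prod_norm)
      also have "\<dots> \<le> 1 * (\<Prod>l\<in>?I. norm (a l (u l) (\<gamma> l)))"
        using w[OF \<open>\<gamma> \<in> PiE ?I F\<close>] by (intro mult_right_mono prod_nonneg) auto
      finally show "norm (of_real (w \<gamma>) * (\<Prod>l\<in>?I. a l (u l) (\<gamma> l))) \<le> (\<Prod>l\<in>?I. norm (a l (u l) (\<gamma> l)))" by simp
    qed
    also have "\<dots> = (\<Prod>l\<in>?I. \<Sum>\<gamma>\<in>F l. norm (a l (u l) \<gamma>))"
      using F(1) by (intro prod_sum_PiE[symmetric]) auto
    also have "\<dots> \<le> (\<Prod>l\<in>?I. A l * nrm (X l) (u l))"
    proof (intro prod_mono conjI)
      fix l assume l: "l \<in> ?I"
      show "(\<Sum>\<gamma>\<in>F l. norm (a l (u l) \<gamma>)) \<le> A l * nrm (X l) (u l)"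
        by (rule ell1_coordinatesD(6)[OF a[OF l] point_in[OF u l] F(1)[OF l] F(2)[OF l]])
      show "0 \<le> (\<Sum>\<gamma>\<in>F l. norm (a l (u l) \<gamma>))" by (simp add: sum_nonneg)
    qed
    also have "\<dots> = ?A * (\<Prod>i\<in>{1..n}. nrm (X i) (u i))" by (simp add: prod.distrib)
    finally have "norm (\<Sum>\<gamma>\<in>PiE ?I F. of_real (w \<gamma>) * (\<Prod>l\<in>?I. a l (u l) (\<gamma> l))) \<le> ?A * (\<Prod>i\<in>{1..n}. nrm (X i) (u i))" .
    moreover have "norm (of_real (1 / ?A) :: 'k) = 1 / ?A" using A_pos by (simp only: norm_of_real) simp
    ultimately show ?thesis using u A_pos by (simp add: norm_mult pos_divide_le_eq mult.commute del: of_real_divide)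
  qed
  show "restrict ?\<phi> (product_points n X) \<in> multilinear_ops n X scalars"
    unfolding multilinear_ops_def
  proof (intro CollectI conjI ballI allI)
    show "restrict ?\<phi> (product_points n X) \<in> product_points n X \<rightarrow>\<^sub>E points scalars" by simp
    show "\<exists>C. \<forall>u\<in>product_points n X. nrm scalars (restrict ?\<phi> (product_points n X) u) \<le> C * (\<Prod>i\<in>{1..n}. nrm (X i) (u i))"
      using le by (intro exI[of _ 1]) simp
    fix u i assume u: "u \<in> product_points n X" and i: "i \<in> ?I"
    interpret Xi: nspace "X i" by (rule factor[OF i])
    show "restrict ?\<phi> (product_points n X) (u(i := x + y)) =
        restrict ?\<phi> (product_points n X) (u(i := x)) + restrict ?\<phi> (product_points n X) (u(i := y))"
      if x: "x \<in> points (X i)" and y: "y \<in> points (X i)" for x y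
      unfolding restrict_apply'[OF update_in[OF u i x]] restrict_apply'[OF update_in[OF u i y]]
        restrict_apply'[OF update_in[OF u i Xi.add_in[OF x y]]] upd[OF i] a_add[OF i x y]
      by (simp only: distrib_left distrib_right sum.distrib)
    show "restrict ?\<phi> (product_points n X) (u(i := scale (X i) c x)) =
        scale scalars c (restrict ?\<phi> (product_points n X) (u(i := x)))"
      if x: "x \<in> points (X i)" for c x
      unfolding restrict_apply'[OF update_in[OF u i x]] restrict_apply'[OF update_in[OF u i Xi.scale_in[OF x]]]
        upd[OF i] a_scale[OF i x] by (simp add: sum_distrib_left mult_ac)
  qed
  show "norm (restrict ?\<phi> (product_points n X) u) \<le> (\<Prod>i\<in>{1..n}. nrm (X i) (u i))"
    if "u \<in> product_points n X" for u by (rule le[OF that])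
qed

lemma sum_differences_bdd:
  assumes "\<And>j. j \<in> J \<Longrightarrow> u j \<in> product_points n X" "\<And>j. j \<in> J \<Longrightarrow> v j \<in> product_points n X"
  shows "bdd_above ((\<lambda>\<phi>. \<Sum>j\<in>J. norm (\<phi> (u j) - \<phi> (v j))) ` form_ball n X)"
proof (rule bdd_aboveI2)
  fix \<phi> assume \<phi>: "\<phi> \<in> form_ball n X"
  show "(\<Sum>j\<in>J. norm (\<phi> (u j) - \<phi> (v j))) \<le>
      (\<Sum>j\<in>J. (\<Prod>i\<in>{1..n}. nrm (X i) (u j i)) + (\<Prod>i\<in>{1..n}. nrm (X i) (v j i)))"
    by (intro sum_mono order.trans[OF norm_triangle_ineq4] add_mono form_ball_bound[OF \<phi>] assms)
qed

text \<open>For the truncated points \<open>T\<close> is a finite sum over multi-indices, to which \<open>grothendieck_operator\<close>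
applies; the weights in it are forms evaluated at the original points, since weighted forms over the
truncated index set do not see the truncation. The constant does not depend on the truncation, which
can therefore be removed in the limit.\<close>

lemma multilinear_lipschitz_summing:
  fixes H :: "('k, 'c::ab_group_add) normed_structure" and Y :: "('k, 'b::ab_group_add) normed_structure"
  assumes a: "\<And>l. l \<in> {1..n} \<Longrightarrow> ell1_coordinates (X l) (\<Gamma> l) (a l) (e l) (A l)"
    and Y: "normed_space Y" and H: "hilbert_space H" and iso: "isomorphic Y H"
    and T: "T \<in> multilinear_ops n X Y"
  shows "T \<in> lipschitz_summing 1 n X Y"
proof -
  interpret T: multilinear_op n X Y T by (rule multilinear_opI[OF multilinear_space_axioms Y T])
  let ?I = "{1..n}"
  let ?A = "\<Prod>l\<in>?I. A l"
  have A: "0 < A l" if "l \<in> ?I" for l by (rule ell1_coordinatesD(1)[OF a[OF that]])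
  then have A_pos: "0 < ?A" by (intro prod_pos) auto
  have e: "e l \<gamma> \<in> points (X l)" "nrm (X l) (e l \<gamma>) \<le> A l" if "l \<in> ?I" "\<gamma> \<in> \<Gamma> l" for l \<gamma>
    using ell1_coordinatesD(2,3)[OF a[OF that(1)] that(2)] .
  obtain C where C: "0 < C" "\<And>u. u \<in> product_points n X \<Longrightarrow> nrm Y (T u) \<le> C * (\<Prod>i\<in>{1..n}. nrm (X i) (u i))"
    using T.bound by blast
  have Hn: "normed_space H" using H by (simp add: hilbert_space_def banach_space_def)
  obtain h g where h: "bounded_operator Y H h" and g: "bounded_operator H Y g" and gh: "\<forall>y\<in>points Y. g (h y) = y"
    using iso unfolding isomorphic_def by blast
  interpret h: bounded_op Y H h by (rule bounded_opI[OF Y Hn h])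
  interpret g: bounded_op H Y g by (rule bounded_opI[OF Hn Y g])
  obtain C1 where C1: "0 < C1" "\<And>y. y \<in> points Y \<Longrightarrow> nrm H (h y) \<le> C1 * nrm Y y" using h.bound by blast
  obtain C2 where C2: "0 < C2" "\<And>y. y \<in> points H \<Longrightarrow> nrm Y (g y) \<le> C2 * nrm H y" using g.bound by blast
  have C2': "nrm Y y \<le> C2 * nrm H (h y)" if "y \<in> points Y" for y using C2(2)[OF h.maps[OF that]] gh that by simp
  define R where "R = C * ?A"
  have R: "0 < R" using C(1) A_pos by (simp add: R_def)
  define c where "c = 64 * C1 * C2 * R * ?A"
  have c: "0 < c" using C1(1) C2(1) R A_pos by (simp add: c_def)
  have "(\<Sum>j=1..k. nrm Y (T (u j) - T (v j))) \<le> c * (SUP \<phi>\<in>form_ball n X. \<Sum>j=1..k. norm (\<phi> (u j) - \<phi> (v j)))"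
    if uv: "\<forall>j\<in>{1..k}. u j \<in> product_points n X \<and> v j \<in> product_points n X" for k and u v :: "nat \<Rightarrow> nat \<Rightarrow> 'a"
  proof -
    let ?J = "{1..k}"
    have u: "u j \<in> product_points n X" and v: "v j \<in> product_points n X" if "j \<in> ?J" for j using uv that by auto
    define s where "s = (SUP \<phi>\<in>form_ball n X. \<Sum>j=1..k. norm (\<phi> (u j) - \<phi> (v j)))"
    have s_upper: "(\<Sum>j=1..k. norm (\<phi> (u j) - \<phi> (v j))) \<le> s" if "\<phi> \<in> form_ball n X" for \<phi>
      unfolding s_def by (rule cSUP_upper[OF that sum_differences_bdd]) (use u v in auto)
    define P where "P F u l = (if l \<in> ?I then \<Sum>\<gamma>\<in>F l. scale (X l) (a l (u l) \<gamma>) (e l \<gamma>) else u l)" for F u l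
    have P_in: "P F u \<in> product_points n X"
      if "\<And>l. l \<in> ?I \<Longrightarrow> F l \<subseteq> \<Gamma> l" "u \<in> product_points n X" for F u
      unfolding P_def[abs_def]
    proof (rule T.mixed_in[OF that(2) order_refl])
      fix l assume l: "l \<in> ?I"
      interpret Xl: nspace "X l" by (rule factor[OF l])
      show "(\<Sum>\<gamma>\<in>F l. scale (X l) (a l (u l) \<gamma>) (e l \<gamma>)) \<in> points (X l)"
        using that(1)[OF l] e(1)[OF l] by (intro Xl.sum_in Xl.scale_in) auto
    qed
    have truncated: "(\<Sum>j=1..k. nrm Y (T (P F (u j)) - T (P F (v j)))) \<le> c * s"
      if F: "\<And>l. l \<in> ?I \<Longrightarrow> finite (F l)" "\<And>l. l \<in> ?I \<Longrightarrow> F l \<subseteq> \<Gamma> l" for F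
    proof -
      let ?G = "PiE ?I F"
      define y where "y \<gamma> = T (restrict (\<lambda>l. e l (\<gamma> l)) ?I)" for \<gamma>
      have r_in: "restrict (\<lambda>l. e l (\<gamma> l)) ?I \<in> product_points n X" if "\<gamma> \<in> ?G" for \<gamma>
        using F(2) that by (intro restrict_in e(1)) (auto simp: PiE_def Pi_def)
      have TP: "T (P F u) = (\<Sum>\<gamma>\<in>?G. scale Y (\<Prod>l\<in>?I. a l (u l) (\<gamma> l)) (y \<gamma>))" if u: "u \<in> product_points n X" for u
      proof -
        have "(\<lambda>l. if l \<in> ?I then e l (\<gamma> l) else u l) = restrict (\<lambda>l. e l (\<gamma> l)) ?I" for \<gamma>
          using u by (auto simp: fun_eq_iff product_points_def PiE_def extensional_def)
        moreover have "T (P F u) = (\<Sum>\<gamma>\<in>?G. scale Y (\<Prod>l\<in>?I. a l (u l) (\<gamma> l)) (T (\<lambda>l. if l \<in> ?I then e l (\<gamma> l) else u l)))"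
          unfolding P_def[abs_def]
        proof (rule T.expand[OF order_refl _ _ u])
          show "e l \<gamma> \<in> points (X l)" if "l \<in> ?I" "\<gamma> \<in> F l" for l \<gamma>
            using e(1)[OF that(1)] F(2)[OF that(1)] that(2) by blast
        qed (rule F(1))
        ultimately show ?thesis by (simp only: y_def)
      qed
      define x where "x j \<gamma> = (\<Prod>l\<in>?I. a l (u j l) (\<gamma> l)) - (\<Prod>l\<in>?I. a l (v j l) (\<gamma> l))" for j \<gamma>
      have "(\<Sum>j\<in>?J. nrm Y (\<Sum>\<gamma>\<in>?G. scale Y (x j \<gamma>) (y \<gamma>))) \<le> 64 * C1 * C2 * R * (?A * s)"
      proof (rule grothendieck_operator[OF Y H h C1 C2(1) C2'])
        show "finite ?G" using F(1) by (intro finite_PiE) auto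
        show "0 < R" by (rule R)
        show "y \<gamma> \<in> points Y" if "\<gamma> \<in> ?G" for \<gamma> unfolding y_def by (rule T.maps[OF r_in[OF that]])
        show "nrm Y (y \<gamma>) \<le> R" if \<gamma>: "\<gamma> \<in> ?G" for \<gamma>
        proof -
          have "nrm Y (y \<gamma>) \<le> C * (\<Prod>l\<in>?I. nrm (X l) (restrict (\<lambda>l. e l (\<gamma> l)) ?I l))"
            unfolding y_def by (rule C(2)[OF r_in[OF \<gamma>]])
          also have "\<dots> \<le> C * ?A"
          proof (intro mult_left_mono prod_mono conjI)
            fix l assume l: "l \<in> ?I"
            then have "\<gamma> l \<in> \<Gamma> l" using F(2)[OF l] \<gamma> by auto
            then show "nrm (X l) (restrict (\<lambda>l. e l (\<gamma> l)) ?I l) \<le> A l" using e(2)[OF l] l by simp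
            show "0 \<le> nrm (X l) (restrict (\<lambda>l. e l (\<gamma> l)) ?I l)" by (rule nrm_point_nonneg[OF r_in[OF \<gamma>] l])
          qed (use C(1) in simp)
          finally show ?thesis by (simp add: R_def)
        qed
        fix w :: "(nat \<Rightarrow> 'd) \<Rightarrow> real" assume w: "\<And>\<gamma>. \<gamma> \<in> ?G \<Longrightarrow> \<bar>w \<gamma>\<bar> \<le> 1"
        define \<phi> where "\<phi> = restrict (\<lambda>u. of_real (1 / ?A) *
          (\<Sum>\<gamma>\<in>?G. of_real (w \<gamma>) * (\<Prod>l\<in>?I. a l (u l) (\<gamma> l)))) (product_points n X)"
        have \<phi>: "\<phi> \<in> form_ball n X" unfolding \<phi>_def by (rule weighted_form[OF a F w])
        have "norm (\<Sum>\<gamma>\<in>?G. x j \<gamma> * of_real (w \<gamma>)) = ?A * norm (\<phi> (u j) - \<phi> (v j))" if j: "j \<in> ?J" for j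
        proof -
          have "\<phi> (u j) - \<phi> (v j) = of_real (1 / ?A) * (\<Sum>\<gamma>\<in>?G. x j \<gamma> * of_real (w \<gamma>))"
            unfolding \<phi>_def restrict_apply'[OF u[OF j]] restrict_apply'[OF v[OF j]] x_def
            by (simp only: right_diff_distrib[symmetric] sum_subtractf[symmetric] mult.commute)
          then have "norm (\<phi> (u j) - \<phi> (v j)) = \<bar>1 / ?A\<bar> * norm (\<Sum>\<gamma>\<in>?G. x j \<gamma> * of_real (w \<gamma>))"
            by (simp only: norm_mult norm_of_real)
          moreover have "r * (\<bar>1 / r\<bar> * s) = s" if "0 < r" for r s :: real using that by simp
          ultimately show ?thesis using A_pos by (simp only:)
        qed
        then have "(\<Sum>j\<in>?J. norm (\<Sum>\<gamma>\<in>?G. x j \<gamma> * of_real (w \<gamma>))) = ?A * (\<Sum>j=1..k. norm (\<phi> (u j) - \<phi> (v j)))"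
          by (simp add: sum_distrib_left)
        also have "\<dots> \<le> ?A * s" using s_upper[OF \<phi>] A_pos by (intro mult_left_mono) auto
        finally show "(\<Sum>j\<in>?J. norm (\<Sum>\<gamma>\<in>?G. x j \<gamma> * of_real (w \<gamma>))) \<le> ?A * s" .
      qed auto
      moreover have "T (P F (u j)) - T (P F (v j)) = (\<Sum>\<gamma>\<in>?G. scale Y (x j \<gamma>) (y \<gamma>))" if "j \<in> ?J" for j
        unfolding TP[OF u[OF that]] TP[OF v[OF that]] x_def
        by (simp only: T.Y.vs.scale_left_diff_distrib sum_subtractf)
      ultimately show ?thesis by (simp add: c_def mult.assoc)
    qed
    define good where "good l m F \<longleftrightarrow> finite F \<and> F \<subseteq> \<Gamma> l \<and> (\<forall>j\<in>?J.
        nrm (X l) (u j l - (\<Sum>\<gamma>\<in>F. scale (X l) (a l (u j l) \<gamma>) (e l \<gamma>))) < 1 / real (Suc m) \<and>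
        nrm (X l) (v j l - (\<Sum>\<gamma>\<in>F. scale (X l) (a l (v j l) \<gamma>) (e l \<gamma>))) < 1 / real (Suc m))" for l m F
    have ex: "\<exists>F. good l m F"
      if l: "l \<in> ?I" for l m
    proof -
      let ?near = "\<lambda>x F. nrm (X l) (x - (\<Sum>\<gamma>\<in>F. scale (X l) (a l x \<gamma>) (e l \<gamma>))) < 1 / real (Suc m)"
      have near: "\<exists>F0. finite F0 \<and> F0 \<subseteq> \<Gamma> l \<and> (\<forall>F. finite F \<longrightarrow> F0 \<subseteq> F \<longrightarrow> F \<subseteq> \<Gamma> l \<longrightarrow> ?near x F)"
        if "x \<in> points (X l)" for x
        using ell1_coordinatesD(7)[OF a[OF l] that, of "1 / real (Suc m)"] by simp
      have "\<forall>j. \<exists>F0. j \<in> ?J \<longrightarrow> finite F0 \<and> F0 \<subseteq> \<Gamma> l \<and> (\<forall>F. finite F \<longrightarrow> F0 \<subseteq> F \<longrightarrow> F \<subseteq> \<Gamma> l \<longrightarrow> ?near (u j l) F)"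
        using near[OF point_in[OF u l]] by meson
      then obtain Fu where Fu: "\<And>j. j \<in> ?J \<Longrightarrow> finite (Fu j)" "\<And>j. j \<in> ?J \<Longrightarrow> Fu j \<subseteq> \<Gamma> l"
          "\<And>j F. j \<in> ?J \<Longrightarrow> finite F \<Longrightarrow> Fu j \<subseteq> F \<Longrightarrow> F \<subseteq> \<Gamma> l \<Longrightarrow> ?near (u j l) F" by metis
      have "\<forall>j. \<exists>F0. j \<in> ?J \<longrightarrow> finite F0 \<and> F0 \<subseteq> \<Gamma> l \<and> (\<forall>F. finite F \<longrightarrow> F0 \<subseteq> F \<longrightarrow> F \<subseteq> \<Gamma> l \<longrightarrow> ?near (v j l) F)"
        using near[OF point_in[OF v l]] by meson
      then obtain Fv where Fv: "\<And>j. j \<in> ?J \<Longrightarrow> finite (Fv j)" "\<And>j. j \<in> ?J \<Longrightarrow> Fv j \<subseteq> \<Gamma> l"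
          "\<And>j F. j \<in> ?J \<Longrightarrow> finite F \<Longrightarrow> Fv j \<subseteq> F \<Longrightarrow> F \<subseteq> \<Gamma> l \<Longrightarrow> ?near (v j l) F" by metis
      let ?F = "(\<Union>j\<in>?J. Fu j) \<union> (\<Union>j\<in>?J. Fv j)"
      have F: "finite ?F" "?F \<subseteq> \<Gamma> l"
        using Fu(1) Fv(1) by (simp, intro Un_least UN_least Fu(2) Fv(2))
      moreover have "?near (u j l) ?F \<and> ?near (v j l) ?F" if "j \<in> ?J" for j
        using that F by (intro conjI Fu(3) Fv(3)) auto
      ultimately have "good l m ?F" unfolding good_def by simp
      then show ?thesis by (rule exI)
    qed
    have good: "good l m (SOME F. good l m F)" if "l \<in> ?I" for l m by (rule someI_ex) (rule ex[OF that])
    define F where "F m l = (SOME F. good l m F)" for m l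
    have good': "good l m (F m l)" if "l \<in> ?I" for l m using good[OF that] by (simp only: F_def)
    have F: "\<And>m l. l \<in> ?I \<Longrightarrow> finite (F m l)" "\<And>m l. l \<in> ?I \<Longrightarrow> F m l \<subseteq> \<Gamma> l"
        "\<And>m l j. l \<in> ?I \<Longrightarrow> j \<in> ?J \<Longrightarrow>
          nrm (X l) (u j l - (\<Sum>\<gamma>\<in>F m l. scale (X l) (a l (u j l) \<gamma>) (e l \<gamma>))) < 1 / real (Suc m)"
        "\<And>m l j. l \<in> ?I \<Longrightarrow> j \<in> ?J \<Longrightarrow>
          nrm (X l) (v j l - (\<Sum>\<gamma>\<in>F m l. scale (X l) (a l (v j l) \<gamma>) (e l \<gamma>))) < 1 / real (Suc m)"
      using good' unfolding good_def by blast+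
    have lim: "(\<lambda>m. nrm Y (T (P (F m) z) - T z)) \<longlonglongrightarrow> 0"
      if z: "z \<in> product_points n X"
        and near: "\<And>m l. l \<in> ?I \<Longrightarrow> nrm (X l) (z l - (\<Sum>\<gamma>\<in>F m l. scale (X l) (a l (z l) \<gamma>) (e l \<gamma>))) < 1 / real (Suc m)" for z
    proof (rule T.sequentially_continuous[OF z])
      show P: "P (F m) z \<in> product_points n X" for m using F(2) z by (intro P_in)
      fix l assume l: "l \<in> ?I"
      interpret Xl: nspace "X l" by (rule factor[OF l])
      have "P (F m) z l \<in> points (X l)" for m by (rule point_in[OF P l])
      moreover have "z l \<in> points (X l)" by (rule point_in[OF z l])
      ultimately have "nrm (X l) (P (F m) z l - z l) \<le> 1 / real (Suc m)" "0 \<le> nrm (X l) (P (F m) z l - z l)" for m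
        using near[OF l, of m] Xl.nrm_diff_commute[of "P (F m) z l" "z l"] l by (simp_all add: P_def less_imp_le)
      then show "(\<lambda>m. nrm (X l) (P (F m) z l - z l)) \<longlonglongrightarrow> 0"
        by (intro tendsto_zero_le[OF LIMSEQ_Suc[OF lim_1_over_n]])
    qed
    have "(\<Sum>j=1..k. nrm Y (T (u j) - T (v j))) \<le>
        c * s + (\<Sum>j=1..k. nrm Y (T (P (F m) (u j)) - T (u j)) + nrm Y (T (P (F m) (v j)) - T (v j)))" for m
    proof -
      have "(\<Sum>j=1..k. nrm Y (T (u j) - T (v j))) \<le>
        (\<Sum>j=1..k. nrm Y (T (P (F m) (u j)) - T (P (F m) (v j))) +
          (nrm Y (T (P (F m) (u j)) - T (u j)) + nrm Y (T (P (F m) (v j)) - T (v j))))"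
      proof (rule sum_mono)
        fix j assume j: "j \<in> ?J"
        have in': "T (u j) \<in> points Y" "T (v j) \<in> points Y" "T (P (F m) (u j)) \<in> points Y" "T (P (F m) (v j)) \<in> points Y"
          by (intro P_in T.maps u v j F(2); assumption)+
        show "nrm Y (T (u j) - T (v j)) \<le> nrm Y (T (P (F m) (u j)) - T (P (F m) (v j))) +
          (nrm Y (T (P (F m) (u j)) - T (u j)) + nrm Y (T (P (F m) (v j)) - T (v j)))"
          using T.Y.nrm_diff_triangle[OF in'(1,3,2)] T.Y.nrm_diff_triangle[OF in'(3,4,2)]
            T.Y.nrm_diff_commute[OF in'(1,3)] by linarith
      qed
      then show ?thesis using truncated[of "F m"] F(1,2) by (simp add: sum.distrib)
    qed
    moreover have "(\<lambda>m. c * s + (\<Sum>j=1..k. nrm Y (T (P (F m) (u j)) - T (u j)) + nrm Y (T (P (F m) (v j)) - T (v j))))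
        \<longlonglongrightarrow> c * s + (\<Sum>j=1..k. 0 + 0)"
      using u v F(3,4) by (intro tendsto_add tendsto_const tendsto_sum lim) auto
    ultimately have "(\<Sum>j=1..k. nrm Y (T (u j) - T (v j))) \<le> c * s + (\<Sum>j=1..k. 0 + 0)"
      by (intro LIMSEQ_le_const) auto
    then show ?thesis by (simp add: s_def)
  qed
  then show ?thesis unfolding lipschitz_summing_1[OF Y] using T c by blast
qed

end

lemma (in unconditional) infinite_basis:
  assumes inf: "infinite_dimensional E"
  shows "infinite B"
proof
  assume B: "finite B"
  have "x \<in> vs.span B" if x: "x \<in> points E" for x
  proof -
    have "\<forall>\<^sub>F F in finite_subsets_at_top B. nrm E (proj F x - x) = nrm E (proj B x - x)"
      unfolding eventually_finite_subsets_at_top using B by (intro exI[of _ B]) auto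
    then have "((\<lambda>F. nrm E (proj B x - x)) \<longlongrightarrow> 0) (finite_subsets_at_top B)"
      by (rule Lim_transform_eventually[OF proj_tendsto[OF x]])
    then have "nrm E (proj B x - x) = 0" by (simp add: tendsto_const_iff)
    then have "x = proj B x" using x nrm_eq_0[of "proj B x - x"] by simp
    also have "\<dots> \<in> vs.span B" unfolding lincomb_def by (intro vs.span_sum vs.span_scale vs.span_base)
    finally show ?thesis .
  qed
  moreover have "vs.span B \<subseteq> points E" by (rule vs.span_minimal[OF _ subspace]) (use basis_in in blast)
  ultimately have "points E = vs.span B" by blast
  then show False using inf B unfolding infinite_dimensional_def by blast
qed

theorem corollary3p13:
  fixes n :: nat
    and X :: "nat \<Rightarrow> ('k::real_or_complex, 'a::ab_group_add) normed_structure"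
    and Y :: "('k, 'b::ab_group_add) normed_structure"
  assumes "n \<ge> 1"
    and "\<And>i. i \<in> {1..n} \<Longrightarrow> banach_space (X i)"
    and "\<And>i. i \<in> {1..n} \<Longrightarrow> has_unconditional_basis (X i)"
    and "banach_space Y"
    and "\<And>i. i \<in> {1..n} \<Longrightarrow> points (X i) \<noteq> {0}"
    and "\<exists>i\<in>{1..n}. infinite_dimensional (X i)"
    and "infinite_dimensional Y"
  shows "((\<forall>i\<in>{1..n}. \<exists>\<Gamma> :: 'a set. isomorphic (X i) (ell1 \<Gamma>)) \<and>
          (\<exists>H :: ('k, 'b) normed_structure. hilbert_space H \<and> isomorphic Y H))
         \<longleftrightarrow> lipschitz_summing 1 n X Y = multilinear_ops n X Y"
    (is "?spaces \<longleftrightarrow> ?all")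
proof
  have Y: "normed_space Y" using assms(4) by (simp add: banach_space_def)
  interpret M: multilinear_space n X
    by unfold_locales (use assms(2) in \<open>auto simp: banach_space_def\<close>)
  {
    assume ?spaces
    then obtain H :: "('k, 'b) normed_structure" where H: "hilbert_space H" "isomorphic Y H"
      and ell1: "\<forall>i\<in>{1..n}. \<exists>\<Gamma> :: 'a set. isomorphic (X i) (ell1 \<Gamma>)" by blast
    have "\<forall>l. \<exists>\<Gamma> :: 'a set. \<exists>a e A. l \<in> {1..n} \<longrightarrow> ell1_coordinates (X l) \<Gamma> a e A"
      using ell1 isomorphic_ell1_coordinates[OF M.normed] by meson
    then obtain \<Gamma> :: "nat \<Rightarrow> 'a set" and a e A
      where a: "\<And>l. l \<in> {1..n} \<Longrightarrow> ell1_coordinates (X l) (\<Gamma> l) (a l) (e l) (A l)" by metis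
    have "T \<in> lipschitz_summing 1 n X Y" if "T \<in> multilinear_ops n X Y" for T
      by (rule M.multilinear_lipschitz_summing[OF a Y H that])
    then show ?all by (auto simp: lipschitz_summing_def)
  next
    assume all: ?all
    obtain B where B: "\<And>i. i \<in> {1..n} \<Longrightarrow> unconditional_basis (X i) (B i)"
      using assms(3) unfolding has_unconditional_basis_def by metis
    have unc: "unconditional (X i) (B i)" if "i \<in> {1..n}" for i
      by (intro unconditional.intro bspaceI assms(2)[OF that] unconditional_axioms.intro B[OF that])
    have pairs: "\<exists>e\<in>points (X l). \<exists>f. bounded_operator (X l) scalars f \<and> f e = 1" if "l \<in> {1..n}" for l
      by (rule unconditional.norming_pair[OF unc[OF that] assms(5)[OF that]])
    have ops: "operators (X i) (B i) Y" if "i \<in> {1..n}" for i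
      by (intro operators.intro unc[OF that] bspaceI[OF assms(4)] operators_axioms.intro
          M.operators_absolutely_summing[OF Y all pairs that])
    have "isomorphic (X i) (ell1 (B i))" if i: "i \<in> {1..n}" for i
    proof -
      interpret operators "X i" "B i" Y by (rule ops[OF i])
      obtain C where "\<And>x F. x \<in> points (X i) \<Longrightarrow> finite F \<Longrightarrow> F \<subseteq> B i \<Longrightarrow>
          (\<Sum>b\<in>F. norm (X.coord x b) * nrm (X i) b) \<le> C * nrm (X i) x"
        using ell1_estimate[OF assms(7)] by blast
      then show ?thesis by (rule X.isomorphic_ell1)
    qed
    moreover obtain i where i: "i \<in> {1..n}" "infinite_dimensional (X i)" using assms(6) by blast
    have "\<exists>H :: ('k, 'b) normed_structure. hilbert_space H \<and> isomorphic Y H"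
      by (rule operators.isomorphic_hilbert[OF ops[OF i(1)] assms(7) unconditional.infinite_basis[OF unc[OF i(1)] i(2)]])
    ultimately show ?spaces by blast
  }
qed

end
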